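(* Let $(\mathcal{E},\mathcal{F})$ be a regular and irreducible Dirichlet form on $L^2(E,m)$, $\mu$ a non-zero positive Radon measure charging no $\mathcal{E}$-polar sets, $F=\mathrm{qsupp}[\mu]$, $G=E\setminus F$, and let $\kappa=\kappa^+-\kappa^-$ with $\kappa^\pm$ positive smooth measures, $\kappa^+\perp\kappa^-$, $\kappa^-\neq0$. Assume that $\mathcal{F}^\kappa_{\mathrm e}=\mathcal{F}^{\kappa,G}_{\mathrm e}\oplus\mathcal{H}^\kappa_F$, i.e. for any $u\in\mathcal{F}^\kappa_{\mathrm e}$ there is a unique pair $(u_1,u_2)\in\mathcal{F}^{\kappa,G}_{\mathrm e}\times\mathcal{H}^\kappa_F$ with $u=u_1+u_2$. Assume also that $\kappa^-$ is $\mathcal{E}^{\kappa^+}$-form bounded on trace, i.e. there exist constants $0<\delta_0<1$ and $C_{\delta_0}>0$ such that $$\int_E u^2\,d\kappa^-\le\delta_0\,\mathcal{E}^{\kappa^+}(u,u)+C_{\delta_0}\int_F(u|_F)^2\,d\mu,\qquad\forall u\in\mathcal{H}^\kappa_F.$$ Then the DN operator $\mathcal{N}_\kappa$ for $(\mathcal{E}^\kappa,\mathcal{F}^\kappa)$ on $L^2(F,\mu)$ is lower semi-bounded and self-adjoint on $L^2(F,\mu)$.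
   Context: $E$ is a locally compact separable metric space, $m$ a fully supported Radon measure on $E$; Dirichlet forms are symmetric. $\mathcal{F}_{\mathrm e}$ is the extended Dirichlet space of $(\mathcal{E},\mathcal{F})$, whose elements are represented by $\mathcal{E}$-quasi-continuous $m$-versions. The quasi support $\mathrm{qsupp}[\mu]$ is the smallest (up to $\mathcal{E}$-polar sets) quasi closed set whose complement is $\mu$-null (taken nearly Borel and finely closed). Smooth measures are with respect to $\mathcal{E}$. $|\kappa|:=\kappa^++\kappa^-$. Perturbation: $\mathcal{F}^\kappa:=\mathcal{F}\cap L^2(E,|\kappa|)$, $\mathcal{E}^\kappa(u,v):=\mathcal{E}(u,v)+\int_E uv\,d\kappa^+-\int_E uv\,d\kappa^-$; $\mathcal{F}^\kappa_{\mathrm e}:=\mathcal{F}_{\mathrm e}\cap L^2(E,|\kappa|)$, on which $\mathcal{E}^\kappa$ is given by the same formula. $\mathcal{E}^{\kappa^+}(u,u):=\mathcal{E}(u,u)+\int_E u^2\,d\kappa^+$. $\mathcal{F}^{\kappa,G}_{\mathrm e}:=\{u\in\mathcal{F}^\kappa_{\mathrm e}:u=0\ \mathcal{E}\text{-q.e. on }F\}$, $\mathcal{H}^\kappa_F:=\{u\in\mathcal{F}^\kappa_{\mathrm e}:\mathcal{E}^\kappa(u,v)=0\ \forall v\in\mathcal{F}^{\kappa,G}_{\mathrm e}\}$. DN operator (well defined when $\mathcal{F}^{\kappa,G}_{\mathrm e}\cap\mathcal{H}^\kappa_F=\{0\}$): $\mathcal{D}(\mathcal{N}_\kappa)$ is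 the set of $\varphi\in L^2(F,\mu)$ for which there exist $u\in\mathcal{H}^\kappa_F$ and $f\in L^2(F,\mu)$ with $u|_F=\varphi$ and $\mathcal{E}^\kappa(u,v)=\int_F f\,v|_F\,d\mu$ for every $v\in\mathcal{F}^\kappa_{\mathrm e}$ with $v|_F\in L^2(F,\mu)$; and $\mathcal{N}_\kappa\varphi:=f$. *)

theory Defs
  imports "HOL-Analysis.Analysis"
begin

text \<open>
  Throughout, elements of an $L^2$ space are represented by functions and the corresponding
  domains are closed under almost everywhere equality.  Quasi-continuous functions and quasi-closed
  sets are Borel only up to a polar set, so all integrals are taken with respect to the completions
  of the Borel measures involved.
\<close>
definition L2 :: "'a measure \<Rightarrow> ('a \<Rightarrow> real) set" where
  "L2 M = {f \<in> borel_measurable M. integrable M (\<lambda>x. (f x)\<^sup>2)}"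

definition L2_inner :: "'a measure \<Rightarrow> ('a \<Rightarrow> real) \<Rightarrow> ('a \<Rightarrow> real) \<Rightarrow> real" where
  "L2_inner M f g = (\<integral>x. f x * g x \<partial>M)"

definition L2_dist2 :: "'a measure \<Rightarrow> ('a \<Rightarrow> real) \<Rightarrow> ('a \<Rightarrow> real) \<Rightarrow> real" where
  "L2_dist2 M f g = (\<integral>x. (f x - g x)\<^sup>2 \<partial>M)"

definition L2_dense :: "'a measure \<Rightarrow> ('a \<Rightarrow> real) set \<Rightarrow> bool" where
  "L2_dense M D \<longleftrightarrow> (\<forall>f\<in>L2 M. \<forall>e>0. \<exists>g\<in>D. L2_dist2 M f g < e)"

text \<open>An unbounded operator is given by its graph, saturated under almost everywhere equality.\<close>

definition L2_operator :: "'a measure \<Rightarrow> (('a \<Rightarrow> real) \<times> ('a \<Rightarrow> real)) set \<Rightarrow> bool" where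
  "L2_operator M A \<longleftrightarrow>
     A \<subseteq> L2 M \<times> L2 M \<and>
     (\<lambda>x. 0, \<lambda>x. 0) \<in> A \<and>
     (\<forall>(u, f)\<in>A. \<forall>(v, g)\<in>A. \<forall>a b. (\<lambda>x. a * u x + b * v x, \<lambda>x. a * f x + b * g x) \<in> A) \<and>
     (\<forall>(u, f)\<in>A. \<forall>(v, g)\<in>A. (AE x in M. u x = v x) \<longrightarrow> (AE x in M. f x = g x))"

definition adjoint_graph ::
    "'a measure \<Rightarrow> (('a \<Rightarrow> real) \<times> ('a \<Rightarrow> real)) set \<Rightarrow> (('a \<Rightarrow> real) \<times> ('a \<Rightarrow> real)) set" where
  "adjoint_graph M A =
     {(v, g). v \<in> L2 M \<and> g \<in> L2 M \<and> (\<forall>(u, f)\<in>A. L2_inner M f v = L2_inner M u g)}"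

definition self_adjoint :: "'a measure \<Rightarrow> (('a \<Rightarrow> real) \<times> ('a \<Rightarrow> real)) set \<Rightarrow> bool" where
  "self_adjoint M A \<longleftrightarrow> L2_operator M A \<and> L2_dense M (fst ` A) \<and> A = adjoint_graph M A"

definition lower_semibounded :: "'a measure \<Rightarrow> (('a \<Rightarrow> real) \<times> ('a \<Rightarrow> real)) set \<Rightarrow> bool" where
  "lower_semibounded M A \<longleftrightarrow> (\<exists>c. \<forall>(u, f)\<in>A. c * L2_inner M u u \<le> L2_inner M f u)"

definition radon_measure :: "'a::metric_space measure \<Rightarrow> bool" where
  "radon_measure M \<longleftrightarrow> sets M = sets borel \<and> (\<forall>K. compact K \<longrightarrow> emeasure M K < \<infinity>)"

definition full_support :: "'a::metric_space measure \<Rightarrow> bool" where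
  "full_support M \<longleftrightarrow> (\<forall>U. open U \<and> U \<noteq> {} \<longrightarrow> emeasure M U > 0)"

definition mutually_singular :: "'a measure \<Rightarrow> 'a measure \<Rightarrow> bool" where
  "mutually_singular M N \<longleftrightarrow> (\<exists>A\<in>sets M. emeasure M A = 0 \<and> emeasure N (space N - A) = 0)"

definition sum_measure :: "'a measure \<Rightarrow> 'a measure \<Rightarrow> 'a measure" where
  "sum_measure M N = measure_of (space M) (sets M) (\<lambda>A. emeasure M A + emeasure N A)"

lemma emeasure_sum_measure:
  assumes "sets M = sets N" "A \<in> sets M"
  shows "emeasure (sum_measure M N) A = emeasure M A + emeasure N A"
proof (rule emeasure_measure_of[OF sum_measure_def sets.space_closed])
  have sets_eq: "sets (sum_measure M N) = sets M"
    by (simp add: sum_measure_def)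
  show "countably_additive (sets (sum_measure M N)) (\<lambda>A. emeasure M A + emeasure N A)"
  proof (rule countably_additiveI)
    fix B :: "nat \<Rightarrow> 'a set"
    assume B: "range B \<subseteq> sets (sum_measure M N)" and d: "disjoint_family B"
    from B have "range B \<subseteq> sets M" "range B \<subseteq> sets N"
      using assms(1) sets_eq by auto
    with d show "(\<Sum>i. emeasure M (B i) + emeasure N (B i)) =
        emeasure M (\<Union>i. B i) + emeasure N (\<Union>i. B i)"
      by (simp add: suminf_add[symmetric] suminf_emeasure)
  qed
qed (insert assms(2), simp_all add: positive_def sum_measure_def)

type_synonym 'a form = "('a \<Rightarrow> real) \<Rightarrow> ('a \<Rightarrow> real) \<Rightarrow> real"

definition form1 :: "'a measure \<Rightarrow> 'a form \<Rightarrow> 'a form" where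
  "form1 m \<E> u v = \<E> u v + L2_inner (completion m) u v"

definition form_dist2 :: "'a form \<Rightarrow> ('a \<Rightarrow> real) \<Rightarrow> ('a \<Rightarrow> real) \<Rightarrow> real" where
  "form_dist2 \<E> u v = \<E> (\<lambda>x. u x - v x) (\<lambda>x. u x - v x)"

definition form_cauchy :: "'a form \<Rightarrow> (nat \<Rightarrow> 'a \<Rightarrow> real) \<Rightarrow> bool" where
  "form_cauchy \<E> U \<longleftrightarrow> (\<forall>e>0. \<exists>N. \<forall>i\<ge>N. \<forall>j\<ge>N. form_dist2 \<E> (U i) (U j) < e)"

text \<open>
  The first four clauses make the form a densely defined object on $m$-equivalence classes
  (compatibility of the form with equality a.e. follows by Cauchy-Schwarz from the condition
  on functions vanishing a.e.).
\<close>

definition dirichlet_form :: "'a measure \<Rightarrow> 'a form \<Rightarrow> ('a \<Rightarrow> real) set \<Rightarrow> bool" where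
  "dirichlet_form m \<E> \<F> \<longleftrightarrow>
     \<F> \<subseteq> L2 (completion m) \<and> L2_dense (completion m) \<F> \<and>
     (\<forall>u\<in>\<F>. \<forall>v\<in>borel_measurable (completion m). (AE x in m. u x = v x) \<longrightarrow> v \<in> \<F>) \<and>
     (\<forall>u\<in>\<F>. (AE x in m. u x = 0) \<longrightarrow> \<E> u u = 0) \<and>
     (\<forall>u\<in>\<F>. \<forall>v\<in>\<F>. \<forall>a b. (\<lambda>x. a * u x + b * v x) \<in> \<F>) \<and>
     (\<forall>u\<in>\<F>. \<forall>v\<in>\<F>. \<forall>w\<in>\<F>. \<forall>a b. \<E> (\<lambda>x. a * u x + b * v x) w = a * \<E> u w + b * \<E> v w) \<and>
     (\<forall>u\<in>\<F>. \<forall>v\<in>\<F>. \<E> u v = \<E> v u) \<and>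
     (\<forall>u\<in>\<F>. 0 \<le> \<E> u u) \<and>
     (\<forall>U. (\<forall>n. U n \<in> \<F>) \<and> form_cauchy (form1 m \<E>) U \<longrightarrow>
        (\<exists>u\<in>\<F>. (\<lambda>n. form_dist2 (form1 m \<E>) (U n) u) \<longlonglongrightarrow> 0)) \<and>
     (\<forall>u\<in>\<F>. (\<lambda>x. min (max 0 (u x)) 1) \<in> \<F> \<and>
        \<E> (\<lambda>x. min (max 0 (u x)) 1) (\<lambda>x. min (max 0 (u x)) 1) \<le> \<E> u u)"

definition Cc :: "('a::topological_space \<Rightarrow> real) set" where
  "Cc = {f. continuous_on UNIV f \<and> (\<exists>K. compact K \<and> (\<forall>x. x \<notin> K \<longrightarrow> f x = 0))}"

definition regular_form :: "'a::metric_space measure \<Rightarrow> 'a form \<Rightarrow> ('a \<Rightarrow> real) set \<Rightarrow> bool" where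
  "regular_form m \<E> \<F> \<longleftrightarrow>
     (\<forall>u\<in>\<F>. \<forall>e>0. \<exists>f\<in>\<F> \<inter> Cc. form_dist2 (form1 m \<E>) u f < e) \<and>
     (\<forall>g\<in>Cc. \<forall>e>0. \<exists>f\<in>\<F> \<inter> Cc. \<forall>x. \<bar>g x - f x\<bar> < e)"

definition L2_semigroup :: "'a measure \<Rightarrow> (real \<Rightarrow> ('a \<Rightarrow> real) \<Rightarrow> ('a \<Rightarrow> real)) \<Rightarrow> bool" where
  "L2_semigroup M T \<longleftrightarrow>
     (\<forall>t>0. \<forall>f\<in>L2 M. T t f \<in> L2 M \<and> L2_inner M (T t f) (T t f) \<le> L2_inner M f f) \<and>
     (\<forall>t>0. \<forall>f\<in>L2 M. \<forall>g\<in>L2 M. \<forall>a b.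
        AE x in M. T t (\<lambda>y. a * f y + b * g y) x = a * T t f x + b * T t g x) \<and>
     (\<forall>t>0. \<forall>f\<in>L2 M. \<forall>g\<in>L2 M. L2_inner M (T t f) g = L2_inner M f (T t g)) \<and>
     (\<forall>s>0. \<forall>t>0. \<forall>f\<in>L2 M. AE x in M. T (s + t) f x = T s (T t f) x) \<and>
     (\<forall>f\<in>L2 M. ((\<lambda>t. L2_dist2 M (T t f) f) \<longlongrightarrow> 0) (at_right 0))"

text \<open>
  For a closed form the associated semigroup exists and is unique up to equality a.e.
  The quotients $(u - T_t u, u)/t$ are monotone in $t$, so having a real limit means that the
  limit in $[0,\infty]$ is finite.
\<close>

definition semigroup_of_form :: "'a measure \<Rightarrow> 'a form \<Rightarrow> ('a \<Rightarrow> real) set \<Rightarrow>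
    (real \<Rightarrow> ('a \<Rightarrow> real) \<Rightarrow> ('a \<Rightarrow> real)) \<Rightarrow> bool" where
  "semigroup_of_form m \<E> \<F> T \<longleftrightarrow>
     L2_semigroup (completion m) T \<and>
     \<F> = {u \<in> L2 (completion m). \<exists>l.
            ((\<lambda>t. L2_inner (completion m) (\<lambda>x. u x - T t u x) u / t) \<longlongrightarrow> l) (at_right 0)} \<and>
     (\<forall>u\<in>\<F>. \<forall>v\<in>\<F>.
        ((\<lambda>t. L2_inner (completion m) (\<lambda>x. u x - T t u x) v / t) \<longlongrightarrow> \<E> u v) (at_right 0))"

definition invariant_set ::
    "'a measure \<Rightarrow> (real \<Rightarrow> ('a \<Rightarrow> real) \<Rightarrow> ('a \<Rightarrow> real)) \<Rightarrow> 'a set \<Rightarrow> bool" where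
  "invariant_set m T A \<longleftrightarrow> A \<in> sets (completion m) \<and>
     (\<forall>t>0. \<forall>f\<in>L2 (completion m).
        AE x in m. T t (\<lambda>y. indicator A y * f y) x = indicator A x * T t f x)"

definition irreducible_form :: "'a measure \<Rightarrow> 'a form \<Rightarrow> ('a \<Rightarrow> real) set \<Rightarrow> bool" where
  "irreducible_form m \<E> \<F> \<longleftrightarrow>
     (\<exists>T. semigroup_of_form m \<E> \<F> T \<and>
        (\<forall>A. invariant_set m T A \<longrightarrow>
           A \<in> null_sets (completion m) \<or> space m - A \<in> null_sets (completion m)))"

definition nest ::
    "'a::metric_space measure \<Rightarrow> 'a form \<Rightarrow> ('a \<Rightarrow> real) set \<Rightarrow> (nat \<Rightarrow> 'a set) \<Rightarrow> bool" where
  "nest m \<E> \<F> K \<longleftrightarrow> (\<forall>k. closed (K k)) \<and> (\<forall>k. K k \<subseteq> K (Suc k)) \<and>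
     (\<forall>u\<in>\<F>. \<forall>e>0. \<exists>k. \<exists>v\<in>\<F>. (AE x in m. x \<notin> K k \<longrightarrow> v x = 0) \<and>
        form_dist2 (form1 m \<E>) u v < e)"

definition polar :: "'a::metric_space measure \<Rightarrow> 'a form \<Rightarrow> ('a \<Rightarrow> real) set \<Rightarrow> 'a set \<Rightarrow> bool" where
  "polar m \<E> \<F> N \<longleftrightarrow> (\<exists>K. nest m \<E> \<F> K \<and> N \<subseteq> (\<Inter>k. - K k))"

definition qe ::
    "'a::metric_space measure \<Rightarrow> 'a form \<Rightarrow> ('a \<Rightarrow> real) set \<Rightarrow> ('a \<Rightarrow> bool) \<Rightarrow> bool" where
  "qe m \<E> \<F> P \<longleftrightarrow> polar m \<E> \<F> {x. \<not> P x}"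

definition quasi_closed ::
    "'a::metric_space measure \<Rightarrow> 'a form \<Rightarrow> ('a \<Rightarrow> real) set \<Rightarrow> 'a set \<Rightarrow> bool" where
  "quasi_closed m \<E> \<F> A \<longleftrightarrow> (\<exists>K. nest m \<E> \<F> K \<and> (\<forall>k. closed (A \<inter> K k)))"

definition quasi_continuous ::
    "'a::metric_space measure \<Rightarrow> 'a form \<Rightarrow> ('a \<Rightarrow> real) set \<Rightarrow> ('a \<Rightarrow> real) \<Rightarrow> bool" where
  "quasi_continuous m \<E> \<F> u \<longleftrightarrow> (\<exists>K. nest m \<E> \<F> K \<and> (\<forall>k. continuous_on (K k) u))"

text \<open>A polar set is contained in a Borel polar set, so testing Borel sets is enough here.\<close>

definition charges_no_polar ::
    "'a::metric_space measure \<Rightarrow> 'a form \<Rightarrow> ('a \<Rightarrow> real) set \<Rightarrow> 'a measure \<Rightarrow> bool" where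
  "charges_no_polar m \<E> \<F> \<nu> \<longleftrightarrow> (\<forall>N\<in>sets borel. polar m \<E> \<F> N \<longrightarrow> emeasure \<nu> N = 0)"

definition smooth_measure ::
    "'a::metric_space measure \<Rightarrow> 'a form \<Rightarrow> ('a \<Rightarrow> real) set \<Rightarrow> 'a measure \<Rightarrow> bool" where
  "smooth_measure m \<E> \<F> \<nu> \<longleftrightarrow> sets \<nu> = sets borel \<and> charges_no_polar m \<E> \<F> \<nu> \<and>
     (\<exists>K. nest m \<E> \<F> K \<and> (\<forall>k. emeasure \<nu> (K k) < \<infinity>))"

text \<open>
  The quasi support is determined only up to a polar set; the predicate holds for every version.
\<close>

definition is_qsupp ::
    "'a::metric_space measure \<Rightarrow> 'a form \<Rightarrow> ('a \<Rightarrow> real) set \<Rightarrow> 'a measure \<Rightarrow> 'a set \<Rightarrow> bool" where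
  "is_qsupp m \<E> \<F> \<mu> F \<longleftrightarrow>
     quasi_closed m \<E> \<F> F \<and> - F \<in> null_sets (completion \<mu>) \<and>
     (\<forall>F'. quasi_closed m \<E> \<F> F' \<and> - F' \<in> null_sets (completion \<mu>) \<longrightarrow> polar m \<E> \<F> (F - F'))"

definition approx_seq :: "'a measure \<Rightarrow> 'a form \<Rightarrow> ('a \<Rightarrow> real) set \<Rightarrow>
    (nat \<Rightarrow> 'a \<Rightarrow> real) \<Rightarrow> ('a \<Rightarrow> real) \<Rightarrow> bool" where
  "approx_seq m \<E> \<F> U u \<longleftrightarrow>
     (\<forall>n. U n \<in> \<F>) \<and> form_cauchy \<E> U \<and> (AE x in m. (\<lambda>n. U n x) \<longlonglongrightarrow> u x)"

text \<open>Members of the extended Dirichlet space are quasi-continuous versions.\<close>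

definition ext_space ::
    "'a::metric_space measure \<Rightarrow> 'a form \<Rightarrow> ('a \<Rightarrow> real) set \<Rightarrow> ('a \<Rightarrow> real) set" where
  "ext_space m \<E> \<F> =
     {u \<in> borel_measurable (completion m). (\<exists>U. approx_seq m \<E> \<F> U u) \<and> quasi_continuous m \<E> \<F> u}"

text \<open>For a Dirichlet form the limit does not depend on the approximating sequences.\<close>

definition ext_form :: "'a measure \<Rightarrow> 'a form \<Rightarrow> ('a \<Rightarrow> real) set \<Rightarrow> 'a form" where
  "ext_form m \<E> \<F> u v = (THE l. \<forall>U V. approx_seq m \<E> \<F> U u \<and> approx_seq m \<E> \<F> V v \<longrightarrow>
      (\<lambda>n. \<E> (U n) (V n)) \<longlonglongrightarrow> l)"

definition pert_space :: "'a::metric_space measure \<Rightarrow> 'a form \<Rightarrow> ('a \<Rightarrow> real) set \<Rightarrow>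
    'a measure \<Rightarrow> 'a measure \<Rightarrow> ('a \<Rightarrow> real) set" where
  "pert_space m \<E> \<F> \<kappa>p \<kappa>m = ext_space m \<E> \<F> \<inter> L2 (completion (sum_measure \<kappa>p \<kappa>m))"

definition pert_form_plus ::
    "'a measure \<Rightarrow> 'a form \<Rightarrow> ('a \<Rightarrow> real) set \<Rightarrow> 'a measure \<Rightarrow> 'a form" where
  "pert_form_plus m \<E> \<F> \<kappa>p u v = ext_form m \<E> \<F> u v + (\<integral>x. u x * v x \<partial>completion \<kappa>p)"

definition pert_form ::
    "'a measure \<Rightarrow> 'a form \<Rightarrow> ('a \<Rightarrow> real) set \<Rightarrow> 'a measure \<Rightarrow> 'a measure \<Rightarrow> 'a form" where
  "pert_form m \<E> \<F> \<kappa>p \<kappa>m u v = ext_form m \<E> \<F> u v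
     + (\<integral>x. u x * v x \<partial>completion \<kappa>p) - (\<integral>x. u x * v x \<partial>completion \<kappa>m)"

definition pert_space_part :: "'a::metric_space measure \<Rightarrow> 'a form \<Rightarrow> ('a \<Rightarrow> real) set \<Rightarrow>
    'a measure \<Rightarrow> 'a measure \<Rightarrow> 'a set \<Rightarrow> ('a \<Rightarrow> real) set" where
  "pert_space_part m \<E> \<F> \<kappa>p \<kappa>m F =
     {u \<in> pert_space m \<E> \<F> \<kappa>p \<kappa>m. qe m \<E> \<F> (\<lambda>x. x \<in> F \<longrightarrow> u x = 0)}"

definition harmonic_space :: "'a::metric_space measure \<Rightarrow> 'a form \<Rightarrow> ('a \<Rightarrow> real) set \<Rightarrow>
    'a measure \<Rightarrow> 'a measure \<Rightarrow> 'a set \<Rightarrow> ('a \<Rightarrow> real) set" where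
  "harmonic_space m \<E> \<F> \<kappa>p \<kappa>m F =
     {u \<in> pert_space m \<E> \<F> \<kappa>p \<kappa>m.
        \<forall>v\<in>pert_space_part m \<E> \<F> \<kappa>p \<kappa>m F. pert_form m \<E> \<F> \<kappa>p \<kappa>m u v = 0}"

text \<open>Uniqueness is equality of elements of the extended Dirichlet space, that is, equality q.e.\<close>

definition unique_decomposition :: "'a::metric_space measure \<Rightarrow> 'a form \<Rightarrow> ('a \<Rightarrow> real) set \<Rightarrow>
    'a measure \<Rightarrow> 'a measure \<Rightarrow> 'a set \<Rightarrow> bool" where
  "unique_decomposition m \<E> \<F> \<kappa>p \<kappa>m F \<longleftrightarrow>
     (\<forall>u\<in>pert_space m \<E> \<F> \<kappa>p \<kappa>m.
        \<exists>u1\<in>pert_space_part m \<E> \<F> \<kappa>p \<kappa>m F. \<exists>u2\<in>harmonic_space m \<E> \<F> \<kappa>p \<kappa>m F.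
          qe m \<E> \<F> (\<lambda>x. u x = u1 x + u2 x) \<and>
          (\<forall>w1\<in>pert_space_part m \<E> \<F> \<kappa>p \<kappa>m F. \<forall>w2\<in>harmonic_space m \<E> \<F> \<kappa>p \<kappa>m F.
             qe m \<E> \<F> (\<lambda>x. u x = w1 x + w2 x) \<longrightarrow>
             qe m \<E> \<F> (\<lambda>x. w1 x = u1 x) \<and> qe m \<E> \<F> (\<lambda>x. w2 x = u2 x)))"

text \<open>
  A quasi support is measurable for the completion only, hence the order of the two operations.
  Functions on \<open>F\<close> are functions on the whole space whose values off \<open>F\<close> are irrelevant.
\<close>

definition measure_on :: "'a measure \<Rightarrow> 'a set \<Rightarrow> 'a measure" where
  "measure_on \<mu> F = restrict_space (completion \<mu>) F"

text \<open>
  Lebesgue integrals in \<open>[0,\<infinity>]\<close> are used because the trace of a function in the harmonic space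
  need not be square integrable, in which case the condition is void.
\<close>

definition form_bounded_on_trace :: "'a::metric_space measure \<Rightarrow> 'a form \<Rightarrow> ('a \<Rightarrow> real) set \<Rightarrow>
    'a measure \<Rightarrow> 'a measure \<Rightarrow> 'a measure \<Rightarrow> 'a set \<Rightarrow> bool" where
  "form_bounded_on_trace m \<E> \<F> \<kappa>p \<kappa>m \<mu> F \<longleftrightarrow>
     (\<exists>\<delta> C :: real. 0 < \<delta> \<and> \<delta> < 1 \<and> 0 < C \<and>
        (\<forall>u\<in>harmonic_space m \<E> \<F> \<kappa>p \<kappa>m F.
           (\<integral>\<^sup>+x. ennreal ((u x)\<^sup>2) \<partial>completion \<kappa>m)
             \<le> ennreal (\<delta> * pert_form_plus m \<E> \<F> \<kappa>p u u)
               + ennreal C * (\<integral>\<^sup>+x. ennreal ((u x)\<^sup>2) \<partial>measure_on \<mu> F)))"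

definition DN_operator :: "'a::metric_space measure \<Rightarrow> 'a form \<Rightarrow> ('a \<Rightarrow> real) set \<Rightarrow>
    'a measure \<Rightarrow> 'a measure \<Rightarrow> 'a measure \<Rightarrow> 'a set \<Rightarrow> (('a \<Rightarrow> real) \<times> ('a \<Rightarrow> real)) set" where
  "DN_operator m \<E> \<F> \<kappa>p \<kappa>m \<mu> F =
     {(\<phi>, f). \<phi> \<in> L2 (measure_on \<mu> F) \<and> f \<in> L2 (measure_on \<mu> F) \<and>
        (\<exists>u\<in>harmonic_space m \<E> \<F> \<kappa>p \<kappa>m F.
           (AE x in measure_on \<mu> F. u x = \<phi> x) \<and>
           (\<forall>v\<in>pert_space m \<E> \<F> \<kappa>p \<kappa>m. v \<in> L2 (measure_on \<mu> F) \<longrightarrow>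
              pert_form m \<E> \<F> \<kappa>p \<kappa>m u v = (\<integral>x. f x * v x \<partial>measure_on \<mu> F)))}"

end

theory Submission
  imports Defs
begin

text \<open>
  Let \<open>V\<close> consist of the functions in the domain of the perturbed form \<open>a\<close> with trace in \<open>L2 \<nu>\<close>, where
  \<open>\<nu>\<close> is \<open>\<mu>\<close> restricted to the quasi support, and let \<open>W\<close> be its harmonic part.  The form bound gives
  \<open>a u u + \<Lambda> * I\<nu> u u \<ge> (1 - \<delta>) * a_plus u u + (\<Lambda> - C) * I\<nu> u u\<close> on \<open>W\<close>, so for \<open>\<Lambda> > C\<close> the shifted
  form is an inner product.  If \<open>W\<close> is complete for it, the Riesz representation theorem solves
  \<open>a u v + \<Lambda> * I\<nu> u v = I\<nu> f v\<close> for every \<open>f\<close>, that is, the DN operator shifted by \<open>\<Lambda>\<close> is onto.  The DN operator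
  is symmetric, and it is densely defined because the traces of \<open>V\<close> are dense; a densely defined symmetric
  operator with such a surjective shift is self-adjoint.

  Completeness is the analytic core.  A sequence that is Cauchy for the shifted form is Cauchy for \<open>E\<close> and for \<open>\<nu>\<close>, and
  it has to converge quasi-everywhere along a subsequence.  This follows once \<open>E (g n) (g n) \<longlonglongrightarrow> 0\<close>
  and \<open>I\<nu> (g n) (g n) \<longlonglongrightarrow> 0\<close> force the truncations \<open>min \<bar>g n\<bar> \<psi>\<close> by a strictly positive \<open>\<psi>\<close> in the
  domain to tend to 0 for the form \<open>E1\<close>.  Otherwise convex combinations of truncations converge to a
  nonzero function of zero energy.  Its level sets are invariant, so by irreducibility it is a positive constant, and it
  vanishes almost everywhere for the nonzero measure \<open>\<nu>\<close>, a contradiction.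
\<close>

section \<open>Forms on spaces of functions\<close>

text \<open>Energy alone does not fix a pointwise limit: for a recurrent form the constants lie in
  the extended space and have zero energy, so a Cauchy sequence may drift by constants, and only the
  trace norm stops the drift. Capacity is available for \<open>E1\<close> on \<open>F\<close>, while
  differences in the extended space need not be square integrable; truncation by
  \<open>\<psi>\<close> brings them back to \<open>F\<close>, and a bound strictly below
  \<open>\<psi>\<close> on the truncation is a bound on the function itself, even after the n-th
  difference has been multiplied by \<open>2 ^ n\<close>. Irreducibility speaks of the semigroup,
  energy arguments speak of the form; convexity of t -> (T_t u, u) bridges the two in place of the
  spectral theorem. Elements are functions and not classes, so every form is only semi-definite, and
  weak compactness is replaced by minimising norms over convex hulls of tails. The form bound
  controls the negative part of the perturbation on harmonic functions only; hence Riesz is applied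
  on \<open>W\<close>, and the decomposition carries the equation over to test functions in
  \<open>V\<close>.\<close>

locale bilinear_on =
  fixes V :: "('a \<Rightarrow> real) set" and B :: "'a form"
  assumes lin: "\<And>u v a b. u \<in> V \<Longrightarrow> v \<in> V \<Longrightarrow> (\<lambda>x. a * u x + b * v x) \<in> V"
    and nonempty: "V \<noteq> {}"
    and left: "\<And>u v w a b. u \<in> V \<Longrightarrow> v \<in> V \<Longrightarrow> w \<in> V \<Longrightarrow>
      B (\<lambda>x. a * u x + b * v x) w = a * B u w + b * B v w"
    and sym: "\<And>u v. u \<in> V \<Longrightarrow> v \<in> V \<Longrightarrow> B u v = B v u"
begin

lemma zero_in: "(\<lambda>x. 0) \<in> V"
proof -
  obtain u where "u \<in> V" using nonempty by blast
  from lin[OF this this, of 0 0] show ?thesis by simp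
qed

lemma add_in: "u \<in> V \<Longrightarrow> v \<in> V \<Longrightarrow> (\<lambda>x. u x + v x) \<in> V"
  using lin[of u v 1 1] by simp

lemma diff_in: "u \<in> V \<Longrightarrow> v \<in> V \<Longrightarrow> (\<lambda>x. u x - v x) \<in> V"
  using lin[of u v 1 "-1"] by simp

lemma scale_in: "u \<in> V \<Longrightarrow> (\<lambda>x. a * u x) \<in> V"
  using lin[of u u a 0] by simp

lemma minus_in: "u \<in> V \<Longrightarrow> (\<lambda>x. - u x) \<in> V"
  using lin[of u u "-1" 0] by simp

lemma sum_in: "(\<And>i. i \<in> I \<Longrightarrow> u i \<in> V) \<Longrightarrow> (\<lambda>x. \<Sum>i\<in>I. u i x) \<in> V"
  by (induction I rule: infinite_finite_induct) (auto intro: zero_in add_in)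

lemmas ins = zero_in add_in diff_in scale_in minus_in sum_in

lemma add_left: "u \<in> V \<Longrightarrow> v \<in> V \<Longrightarrow> w \<in> V \<Longrightarrow> B (\<lambda>x. u x + v x) w = B u w + B v w"
  using left[of u v w 1 1] by simp

lemma diff_left: "u \<in> V \<Longrightarrow> v \<in> V \<Longrightarrow> w \<in> V \<Longrightarrow> B (\<lambda>x. u x - v x) w = B u w - B v w"
  using left[of u v w 1 "-1"] by simp

lemma scale_left: "u \<in> V \<Longrightarrow> w \<in> V \<Longrightarrow> B (\<lambda>x. a * u x) w = a * B u w"
  using left[of u u w a 0] by simp

lemma minus_left: "u \<in> V \<Longrightarrow> w \<in> V \<Longrightarrow> B (\<lambda>x. - u x) w = - B u w"
  using left[of u u w "-1" 0] by simp

lemma zero_left: "w \<in> V \<Longrightarrow> B (\<lambda>x. 0) w = 0"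
  using scale_left[of w w 0] by simp

lemma add_right: "u \<in> V \<Longrightarrow> v \<in> V \<Longrightarrow> w \<in> V \<Longrightarrow> B w (\<lambda>x. u x + v x) = B w u + B w v"
  by (simp add: sym[of w] add_left add_in)

lemma diff_right: "u \<in> V \<Longrightarrow> v \<in> V \<Longrightarrow> w \<in> V \<Longrightarrow> B w (\<lambda>x. u x - v x) = B w u - B w v"
  by (simp add: sym[of w] diff_left diff_in)

lemma scale_right: "u \<in> V \<Longrightarrow> w \<in> V \<Longrightarrow> B w (\<lambda>x. a * u x) = a * B w u"
  by (simp add: sym[of w] scale_left scale_in)

lemma minus_right: "u \<in> V \<Longrightarrow> w \<in> V \<Longrightarrow> B w (\<lambda>x. - u x) = - B w u"
  by (simp add: sym[of w] minus_left minus_in)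

lemma zero_right: "w \<in> V \<Longrightarrow> B w (\<lambda>x. 0) = 0"
  by (simp add: sym[of w] zero_left zero_in)

lemmas lefts = add_left diff_left scale_left minus_left zero_left
lemmas rights = add_right diff_right scale_right minus_right zero_right

lemma subspace:
  assumes "W \<subseteq> V" "W \<noteq> {}"
    and "\<And>u v a b. u \<in> W \<Longrightarrow> v \<in> W \<Longrightarrow> (\<lambda>x. a * u x + b * v x) \<in> W"
  shows "bilinear_on W B"
  using assms by unfold_locales (auto intro: left sym)

end

lemma bilinear_on_combine:
  assumes "bilinear_on V B1" "bilinear_on V B2"
  shows "bilinear_on V (\<lambda>u v. B1 u v + c * B2 u v)"
proof -
  interpret b1: bilinear_on V B1 by fact
  interpret b2: bilinear_on V B2 by fact
  show ?thesis
    by unfold_locales (auto intro: b1.lin b1.zero_in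
        simp: b1.left b2.left b1.sym b2.sym algebra_simps)
qed

locale semi_inner = bilinear_on +
  assumes nonneg: "\<And>u. u \<in> V \<Longrightarrow> 0 \<le> B u u"
begin

lemma expand_add: "u \<in> V \<Longrightarrow> v \<in> V \<Longrightarrow>
    B (\<lambda>x. u x + v x) (\<lambda>x. u x + v x) = B u u + 2 * B u v + B v v"
  by (simp add: lefts rights ins sym[of v u])

lemma expand_diff: "u \<in> V \<Longrightarrow> v \<in> V \<Longrightarrow>
    B (\<lambda>x. u x - v x) (\<lambda>x. u x - v x) = B u u - 2 * B u v + B v v"
  by (simp add: lefts rights ins sym[of v u])

lemma expand_scale: "u \<in> V \<Longrightarrow> B (\<lambda>x. a * u x) (\<lambda>x. a * u x) = a\<^sup>2 * B u u"
  by (simp add: lefts rights ins power2_eq_square)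

lemma expand_comb: "u \<in> V \<Longrightarrow> v \<in> V \<Longrightarrow>
    B (\<lambda>x. u x + t * v x) (\<lambda>x. u x + t * v x) = B u u + 2 * t * B u v + t\<^sup>2 * B v v"
  by (simp add: expand_add scale_right ins expand_scale[of v t] scale_left power2_eq_square)

lemma expand_lin: "u \<in> V \<Longrightarrow> v \<in> V \<Longrightarrow>
    B (\<lambda>x. a * u x + b * v x) (\<lambda>x. a * u x + b * v x) = a\<^sup>2 * B u u + 2 * (a * b) * B u v + b\<^sup>2 * B v v"
  by (simp add: left lin sym[of _ "\<lambda>x. a * u x + b * v x"] sym[of v u] power2_eq_square algebra_simps)

lemma Cauchy_Schwarz: 
  assumes u: "u \<in> V" and v: "v \<in> V"
  shows "(B u v)\<^sup>2 \<le> B u u * B v v"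
proof -
  have q: "0 \<le> B u u + 2 * t * B u v + t\<^sup>2 * B v v" for t
    using nonneg[of "\<lambda>x. u x + t * v x"] expand_comb[OF u v, of t] u v by (simp add: ins)
  show ?thesis
  proof (cases "B v v = 0")
    case True
    have "B u v = 0"
    proof (rule ccontr)
      assume ne: "B u v \<noteq> 0"
      \<comment> \<open>Where \<open>B v v = 0\<close> the quadratic is affine in \<open>t\<close>;
        this \<open>t\<close> gives it the value -1.\<close>
      have "2 * (- (B u u + 1) / (2 * B u v)) * B u v = - (B u u + 1)"
        using ne by simp
      with q[of "- (B u u + 1) / (2 * B u v)"] True show False by simp
    qed
    then show ?thesis using True by simp
  next
    case False
    then have pos: "B v v > 0" using nonneg[OF v] by simp
    have "B u u + 2 * (- B u v / B v v) * B u v + (- B u v / B v v)\<^sup>2 * B v v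
        = B u u - (B u v)\<^sup>2 / B v v"
      using pos by (simp add: field_simps power2_eq_square)
    with q[of "- B u v / B v v"] have "(B u v)\<^sup>2 / B v v \<le> B u u" by simp
    then show ?thesis using pos by (simp add: field_simps)
  qed
qed

lemma abs_le: "u \<in> V \<Longrightarrow> v \<in> V \<Longrightarrow> \<bar>B u v\<bar> \<le> sqrt (B u u) * sqrt (B v v)"
  using Cauchy_Schwarz[of u v] by (metis real_sqrt_abs real_sqrt_le_mono real_sqrt_mult)

lemma null_left: "u \<in> V \<Longrightarrow> v \<in> V \<Longrightarrow> B u u = 0 \<Longrightarrow> B u v = 0"
  using abs_le[of u v] by simp

lemma triangle:
  assumes u: "u \<in> V" and v: "v \<in> V"
  shows "sqrt (B (\<lambda>x. u x + v x) (\<lambda>x. u x + v x)) \<le> sqrt (B u u) + sqrt (B v v)"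
proof (rule real_le_lsqrt)
  show "B (\<lambda>x. u x + v x) (\<lambda>x. u x + v x) \<le> (sqrt (B u u) + sqrt (B v v))\<^sup>2"
    using abs_le[OF u v] nonneg[OF u] nonneg[OF v]
    by (simp add: expand_add u v power2_sum)
qed (simp add: nonneg u v)

lemma triangle_diff: "u \<in> V \<Longrightarrow> v \<in> V \<Longrightarrow>
  sqrt (B (\<lambda>x. u x - v x) (\<lambda>x. u x - v x)) \<le> sqrt (B u u) + sqrt (B v v)"
  using triangle[of u "\<lambda>x. - v x"] by (simp add: ins lefts rights)

lemma sq_add_le: "u \<in> V \<Longrightarrow> v \<in> V \<Longrightarrow>
    B (\<lambda>x. u x + v x) (\<lambda>x. u x + v x) \<le> 2 * B u u + 2 * B v v"
  using nonneg[of "\<lambda>x. u x - v x"] by (simp add: expand_add expand_diff ins)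

lemma sq_diff_le: "u \<in> V \<Longrightarrow> v \<in> V \<Longrightarrow>
    B (\<lambda>x. u x - v x) (\<lambda>x. u x - v x) \<le> 2 * B u u + 2 * B v v"
  using nonneg[of "\<lambda>x. u x + v x"] by (simp add: expand_add expand_diff ins)

text \<open>The midpoint carries the weights \<open>1 - 1/2\<close> and \<open>1/2\<close> so that
  it literally matches the convex step of \<open>tail_hull\<close>. Near-minimisers on a convex set
  are Cauchy by this identity.\<close>

lemma parallelogram: "u \<in> V \<Longrightarrow> v \<in> V \<Longrightarrow>
    B (\<lambda>x. u x - v x) (\<lambda>x. u x - v x)
     = 2 * B u u + 2 * B v v - 4 * B (\<lambda>x. (1 - 1/2) * u x + 1/2 * v x) (\<lambda>x. (1 - 1/2) * u x + 1/2 * v x)"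
  unfolding expand_lin expand_diff by (simp add: power2_eq_square algebra_simps)

lemma dist2_triangle:
  assumes "u \<in> V" "v \<in> V" "w \<in> V"
  shows "form_dist2 B u w \<le> 2 * form_dist2 B u v + 2 * form_dist2 B v w"
  using sq_add_le[of "\<lambda>x. u x - v x" "\<lambda>x. v x - w x"] assms
  by (simp add: form_dist2_def ins)

lemma dist2_sym: "u \<in> V \<Longrightarrow> v \<in> V \<Longrightarrow> form_dist2 B u v = form_dist2 B v u"
  by (simp add: form_dist2_def expand_diff sym[of v u])

lemma dist2_nonneg: "u \<in> V \<Longrightarrow> v \<in> V \<Longrightarrow> 0 \<le> form_dist2 B u v"
  by (simp add: form_dist2_def nonneg ins)

lemma convergent_imp_cauchy:
  assumes U: "\<And>n. U n \<in> V" and u: "u \<in> V" and lim: "(\<lambda>n. form_dist2 B (U n) u) \<longlonglongrightarrow> 0"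
  shows "form_cauchy B U"
  unfolding form_cauchy_def
proof (intro allI impI)
  fix e :: real assume e: "e > 0"
  then obtain N where N: "\<And>n. n \<ge> N \<Longrightarrow> form_dist2 B (U n) u < e / 4"
    using order_tendstoD(2)[OF lim, of "e/4"] by (auto simp: eventually_sequentially)
  show "\<exists>N. \<forall>i\<ge>N. \<forall>j\<ge>N. form_dist2 B (U i) (U j) < e"
  proof (intro exI allI impI)
    fix i j assume "N \<le> i" "N \<le> j"
    then show "form_dist2 B (U i) (U j) < e"
      using N[of i] N[of j] dist2_triangle[OF U u U, of i j] dist2_sym[OF U u, of j] by simp
  qed
qed

lemma cauchy_bounded:
  assumes U: "\<And>n. U n \<in> V" and c: "form_cauchy B U"
  obtains C where "\<And>n. B (U n) (U n) \<le> C" "C \<ge> 0"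
proof -
  obtain N where N: "\<And>i j. i \<ge> N \<Longrightarrow> j \<ge> N \<Longrightarrow> form_dist2 B (U i) (U j) < 1"
    using c unfolding form_cauchy_def by (meson zero_less_one)
  \<comment> \<open>The sum bounds the terms up to \<open>N\<close>; the rest bounds the later ones
    through their squared distance below 1 from \<open>U N\<close>.\<close>
  define C where "C = (\<Sum>i\<le>N. B (U i) (U i)) + 2 + 2 * B (U N) (U N)"
  have "B (U n) (U n) \<le> C" for n
  proof (cases "n \<le> N")
    case True
    then have "B (U n) (U n) \<le> (\<Sum>i\<le>N. B (U i) (U i))"
      by (intro member_le_sum) (auto intro: nonneg U)
    then show ?thesis unfolding C_def using nonneg[OF U, of N] by simp
  next
    case False
    have "B (U n) (U n) \<le> 2 * form_dist2 B (U n) (U N) + 2 * B (U N) (U N)"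
      using sq_add_le[of "\<lambda>x. U n x - U N x" "U N"] U by (simp add: form_dist2_def ins)
    then show ?thesis unfolding C_def using N[of n N] False
      by (smt (verit) U nonneg sum_nonneg nle_le)
  qed
  moreover have "C \<ge> 0" unfolding C_def using U nonneg by (simp add: sum_nonneg)
  ultimately show ?thesis using that by blast
qed

lemma tendsto_left:
  assumes U: "\<And>n. U n \<in> V" and u: "u \<in> V" and lim: "(\<lambda>n. form_dist2 B (U n) u) \<longlonglongrightarrow> 0" and w: "w \<in> V"
  shows "(\<lambda>n. B (U n) w) \<longlonglongrightarrow> B u w"
proof (rule LIM_zero_cancel, rule tendsto_rabs_zero_cancel, rule Lim_null_comparison)
  show "\<forall>\<^sub>F n in sequentially. norm \<bar>B (U n) w - B u w\<bar> \<le> sqrt (form_dist2 B (U n) u) * sqrt (B w w)"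
    using abs_le[OF diff_in[OF U u] w] U u w by (simp add: form_dist2_def lefts)
  show "(\<lambda>n. sqrt (form_dist2 B (U n) u) * sqrt (B w w)) \<longlonglongrightarrow> 0"
    using tendsto_mult_right[OF tendsto_real_sqrt[OF lim], of "sqrt (B w w)"] by simp
qed

lemma tendsto_self:
  assumes U: "\<And>n. U n \<in> V" and u: "u \<in> V" and lim: "(\<lambda>n. form_dist2 B (U n) u) \<longlonglongrightarrow> 0"
  shows "(\<lambda>n. B (U n) (U n)) \<longlonglongrightarrow> B u u"
proof -
  have eq: "B (U n) (U n) = form_dist2 B (U n) u + 2 * B (U n) u - B u u" for n
    using U u by (simp add: form_dist2_def expand_diff)
  have "(\<lambda>n. form_dist2 B (U n) u + 2 * B (U n) u - B u u) \<longlonglongrightarrow> 0 + 2 * B u u - B u u"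
    by (intro tendsto_intros lim tendsto_left U u)
  then show ?thesis by (simp add: eq)
qed

lemma cauchy_lin:
  assumes U: "\<And>n. U n \<in> V" and U': "\<And>n. U' n \<in> V" and c: "form_cauchy B U" "form_cauchy B U'"
  shows "form_cauchy B (\<lambda>n x. a * U n x + b * U' n x)"
  unfolding form_cauchy_def
proof (intro allI impI)
  fix e :: real assume e: "e > 0"
  \<comment> \<open>The summand 1 keeps the denominator positive for \<open>a = b = 0\<close> and
    leaves a margin \<open>d\<close>, which makes the final estimate strict.\<close>
  define d where "d = e / (2 * a\<^sup>2 + 2 * b\<^sup>2 + 1)"
  have pos: "2 * a\<^sup>2 + 2 * b\<^sup>2 + 1 > 0"
    using zero_le_power2[of a] zero_le_power2[of b] by linarith
  have d: "d > 0" using e pos by (simp add: d_def)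
  obtain N where N: "\<And>i j. i \<ge> N \<Longrightarrow> j \<ge> N \<Longrightarrow> form_dist2 B (U i) (U j) < d"
    using c(1) d unfolding form_cauchy_def by blast
  obtain N' where N': "\<And>i j. i \<ge> N' \<Longrightarrow> j \<ge> N' \<Longrightarrow> form_dist2 B (U' i) (U' j) < d"
    using c(2) d unfolding form_cauchy_def by blast
  show "\<exists>N. \<forall>i\<ge>N. \<forall>j\<ge>N. form_dist2 B (\<lambda>x. a * U i x + b * U' i x) (\<lambda>x. a * U j x + b * U' j x) < e"
  proof (intro exI allI impI)
    fix i j assume ij: "max N N' \<le> i" "max N N' \<le> j"
    let ?D = "\<lambda>x. U i x - U j x" and ?D' = "\<lambda>x. U' i x - U' j x"
    have D: "?D \<in> V" "?D' \<in> V" using U U' by (auto intro: diff_in)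
    have "form_dist2 B (\<lambda>x. a * U i x + b * U' i x) (\<lambda>x. a * U j x + b * U' j x)
        = B (\<lambda>x. a * ?D x + b * ?D' x) (\<lambda>x. a * ?D x + b * ?D' x)"
      unfolding form_dist2_def by (simp add: algebra_simps)
    also have "\<dots> \<le> 2 * B (\<lambda>x. a * ?D x) (\<lambda>x. a * ?D x) + 2 * B (\<lambda>x. b * ?D' x) (\<lambda>x. b * ?D' x)"
      by (rule sq_add_le) (intro scale_in D)+
    also have "\<dots> = 2 * (a\<^sup>2 * form_dist2 B (U i) (U j)) + 2 * (b\<^sup>2 * form_dist2 B (U' i) (U' j))"
      unfolding expand_scale[OF D(1)] expand_scale[OF D(2)] form_dist2_def by simp
    also have "\<dots> \<le> 2 * (a\<^sup>2 * d) + 2 * (b\<^sup>2 * d)"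
      using N[of i j] N'[of i j] ij by (intro add_mono mult_left_mono) auto
    also have "\<dots> = d * (2 * a\<^sup>2 + 2 * b\<^sup>2 + 1) - d" by (simp add: algebra_simps)
    also have "\<dots> = e - d" using pos by (simp add: d_def)
    finally show "form_dist2 B (\<lambda>x. a * U i x + b * U' i x) (\<lambda>x. a * U j x + b * U' j x) < e"
      using d by simp
  qed
qed

lemma semi_subspace:
  assumes "W \<subseteq> V" "W \<noteq> {}"
    and "\<And>u v a b. u \<in> W \<Longrightarrow> v \<in> W \<Longrightarrow> (\<lambda>x. a * u x + b * v x) \<in> W"
  shows "semi_inner W B"
proof -
  interpret w: bilinear_on W B by (rule subspace[OF assms])
  show ?thesis using assms(1) by unfold_locales (blast intro: nonneg)
qed

end

section \<open>Convex hulls of tails, Mazur's lemma and Riesz representation\<close>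

inductive_set tail_hull :: "(nat \<Rightarrow> 'a \<Rightarrow> real) \<Rightarrow> nat \<Rightarrow> ('a \<Rightarrow> real) set" for U N where
  base: "N \<le> i \<Longrightarrow> U i \<in> tail_hull U N"
| step: "u \<in> tail_hull U N \<Longrightarrow> v \<in> tail_hull U N \<Longrightarrow> 0 \<le> t \<Longrightarrow> t \<le> 1 \<Longrightarrow>
    (\<lambda>x. (1 - t) * u x + t * v x) \<in> tail_hull U N"

lemma tail_hull_mono: "w \<in> tail_hull U N \<Longrightarrow> M \<le> N \<Longrightarrow> w \<in> tail_hull U M"
  by (induction rule: tail_hull.induct) (auto intro: tail_hull.intros)

lemma convex_le: "0 \<le> t \<Longrightarrow> t \<le> 1 \<Longrightarrow> a \<le> c \<Longrightarrow> b \<le> c \<Longrightarrow> (1 - t) * a + t * b \<le> (c::real)"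
  using convex_bound_le[of a c b "1 - t" t] by simp

lemma tail_hull_le:
  assumes "w \<in> tail_hull U N" and "\<And>i. i \<ge> N \<Longrightarrow> U i x \<le> c"
  shows "w x \<le> c"
  using assms by (induction rule: tail_hull.induct) (auto intro: convex_le)

lemma tail_hull_ge:
  assumes "w \<in> tail_hull U N" and "\<And>i. i \<ge> N \<Longrightarrow> c \<le> U i x"
  shows "c \<le> w x"
  using assms
proof (induction rule: tail_hull.induct)
  case (step u v t)
  then show ?case using convex_le[of t "- u x" "- c" "- v x"] by simp
qed auto

text \<open>An interval around the limit that contains a whole tail is convex, hence contains every
  combination of that tail.\<close>

lemma tail_hull_tendsto:
  assumes "\<And>N. W N \<in> tail_hull U N" "(\<lambda>n. U n x) \<longlonglongrightarrow> l"
  shows "(\<lambda>n. W n x) \<longlonglongrightarrow> l"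
proof (rule tendstoI)
  fix e :: real assume "e > 0"
  then have "e / 2 > 0" by simp
  from tendstoD[OF assms(2) this] obtain N where N: "\<And>i. i \<ge> N \<Longrightarrow> dist (U i x) l < e / 2"
    by (auto simp: eventually_sequentially)
  have "dist (W n x) l < e" if "n \<ge> N" for n
  proof -
    have "\<And>i. i \<ge> n \<Longrightarrow> U i x \<le> l + e / 2 \<and> l - e / 2 \<le> U i x"
      using N that by (smt (verit, best) dist_real_def order_trans)
    then have "W n x \<le> l + e / 2" "l - e / 2 \<le> W n x"
      by (auto intro: tail_hull_le[OF assms(1)] tail_hull_ge[OF assms(1)])
    then show ?thesis using \<open>e > 0\<close> by (simp add: dist_real_def abs_le_iff abs_less_iff)
  qed
  then show "\<forall>\<^sub>F n in sequentially. dist (W n x) l < e" by (auto simp: eventually_sequentially)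
qed

context bilinear_on begin

lemma tail_hull_in: "w \<in> tail_hull U N \<Longrightarrow> (\<And>n. U n \<in> V) \<Longrightarrow> w \<in> V"
  by (induction rule: tail_hull.induct) (auto intro: lin)

text \<open>Half-spaces are convex. A positive lower bound on a functional thus survives the passage
  to combinations, where it contradicts strong convergence to zero.\<close>

lemma tail_hull_ge_left:
  assumes "w \<in> tail_hull U N" "\<And>n. U n \<in> V" "v \<in> V" "\<And>i. i \<ge> N \<Longrightarrow> c \<le> B (U i) v"
  shows "c \<le> B w v"
  using assms
proof (induction rule: tail_hull.induct)
  case (step u w t)
  then have "B (\<lambda>x. (1 - t) * u x + t * w x) v = (1 - t) * B u v + t * B w v"
    using left[OF tail_hull_in[OF step.hyps(1)] tail_hull_in[OF step.hyps(2)], of v "1 - t" t] by blast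
  then show ?case using step convex_le[of t "- B u v" "- c" "- B w v"] by simp
qed auto

end

context semi_inner begin

lemma tail_hull_norm_le:
  assumes "w \<in> tail_hull U N" "\<And>n. U n \<in> V" "\<And>i. i \<ge> N \<Longrightarrow> B (U i) (U i) \<le> c"
  shows "B w w \<le> c"
  using assms
proof (induction rule: tail_hull.induct)
  case (step u v t)
  have u: "u \<in> V" and v: "v \<in> V" using step tail_hull_in by blast+
  \<comment> \<open>Convexity of the square norm with its exact deficit, which is nonnegative and
    dropped.\<close>
  have "B (\<lambda>x. (1 - t) * u x + t * v x) (\<lambda>x. (1 - t) * u x + t * v x)
      = (1 - t) * B u u + t * B v v - t * (1 - t) * B (\<lambda>x. u x - v x) (\<lambda>x. u x - v x)"
    using u v by (simp add: lefts rights ins sym[of v u] algebra_simps)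
  also have "\<dots> \<le> (1 - t) * B u u + t * B v v"
    using step.hyps nonneg[OF diff_in[OF u v]] by simp
  also have "\<dots> \<le> c" using step by (intro convex_le) auto
  finally show ?case .
qed auto

text \<open>Near-minimisers of the norm over the tail hulls. The infima increase with the tail and
  stay below \<open>C\<close>, so they converge, and the parallelogram identity turns closeness to
  the infimum into a Cauchy estimate. No limit point is required, so this serves in incomplete
  spaces.\<close>

lemma mazur:
  assumes U: "\<And>n. U n \<in> V" and bd: "\<And>n. B (U n) (U n) \<le> C"
  obtains W where "\<And>N. W N \<in> tail_hull U N" "form_cauchy B W"
proof -
  define S where "S N = (\<lambda>w. B w w) ` tail_hull U N" for N
  define a where "a N = Inf (S N)" for N
  have bb: "bdd_below (S N)" for N
    unfolding S_def by (rule bdd_belowI[of _ 0]) (auto intro: nonneg tail_hull_in U)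
  have ne: "S N \<noteq> {}" for N unfolding S_def using tail_hull.base[of N N U] by auto
  have "incseq a"
    unfolding incseq_def a_def
    by (intro allI impI cInf_superset_mono ne bb) (auto simp: S_def intro: tail_hull_mono)
  moreover have aC: "a N \<le> C" for N
    unfolding a_def by (rule cInf_lower2[OF _ bd bb, of N]) (auto simp: S_def intro: tail_hull.base)
  ultimately obtain L where L: "a \<longlonglongrightarrow> L" "\<And>N. a N \<le> L"
    using incseq_convergent[of a C] by blast
  have "\<exists>w\<in>tail_hull U N. B w w < a N + inverse (real (Suc N))" for N
  proof -
    have "Inf (S N) < a N + inverse (real (Suc N))" by (simp add: a_def)
    from cInf_lessD[OF ne this] show ?thesis by (auto simp: S_def)
  qed
  then obtain W where W: "\<And>N. W N \<in> tail_hull U N" "\<And>N. B (W N) (W N) < a N + inverse (real (Suc N))"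
    by metis
  have WV: "W N \<in> V" for N using tail_hull_in[OF W(1) U] .
  have key: "form_dist2 B (W i) (W j) \<le> 4 * (L - a N) + 4 * inverse (real (Suc N))" if "i \<ge> N" "j \<ge> N" for i j N
  proof -
    have h: "W i \<in> tail_hull U N" "W j \<in> tail_hull U N" using W(1) that tail_hull_mono by blast+
    have "a N \<le> B (\<lambda>x. (1 - 1/2) * W i x + 1/2 * W j x) (\<lambda>x. (1 - 1/2) * W i x + 1/2 * W j x)"
      unfolding a_def S_def
      by (rule cInf_lower[OF _ bb[unfolded S_def]]) (rule imageI, rule tail_hull.step[OF h], simp_all)
    moreover have "inverse (real (Suc i)) \<le> inverse (real (Suc N))" "inverse (real (Suc j)) \<le> inverse (real (Suc N))"
      using that by auto
    \<comment> \<open>Both norms are below \<open>L + inverse (Suc N)\<close> and the midpoint,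
      again in the hull, has norm at least \<open>a N\<close>.\<close>
    ultimately show ?thesis unfolding form_dist2_def parallelogram[OF WV WV]
      using W(2)[of i] W(2)[of j] L(2)[of i] L(2)[of j] by argo
  qed
  have "(\<lambda>N. 4 * (L - a N) + 4 * inverse (real (Suc N))) \<longlonglongrightarrow> 4 * (L - L) + 4 * 0"
    by (intro tendsto_intros L LIMSEQ_inverse_real_of_nat)
  then have lim: "(\<lambda>N. 4 * (L - a N) + 4 * inverse (real (Suc N))) \<longlonglongrightarrow> 0" by simp
  have "form_cauchy B W"
    unfolding form_cauchy_def
  proof (intro allI impI)
    fix e :: real assume "e > 0"
    then obtain N where "4 * (L - a N) + 4 * inverse (real (Suc N)) < e"
      using order_tendstoD(2)[OF lim] by (auto simp: eventually_sequentially)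
    then show "\<exists>N. \<forall>i\<ge>N. \<forall>j\<ge>N. form_dist2 B (W i) (W j) < e"
      using key by (intro exI[of _ N]) (meson order.strict_trans1)
  qed
  with W(1) that show ?thesis by blast
qed

text \<open>The representing element minimises \<open>B v v - 2 * l v\<close>. Minimising sequences
  are Cauchy by the parallelogram identity, and the equation is the vanishing of the first
  variation.\<close>

lemma riesz:
  assumes complete: "\<And>U. (\<And>n. U n \<in> V) \<Longrightarrow> form_cauchy B U \<Longrightarrow> \<exists>u\<in>V. (\<lambda>n. form_dist2 B (U n) u) \<longlonglongrightarrow> 0"
    and lin_l: "\<And>u v a b. u \<in> V \<Longrightarrow> v \<in> V \<Longrightarrow> l (\<lambda>x. a * u x + b * v x) = a * l u + b * l v"
    and bd: "\<And>v. v \<in> V \<Longrightarrow> \<bar>l v\<bar> \<le> K * sqrt (B v v)"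
  obtains u where "u \<in> V" "\<And>v. v \<in> V \<Longrightarrow> B u v = l v"
proof -
  define J where "J v = B v v - 2 * l v" for v
  have J_low: "- (K\<^sup>2) \<le> J v" if "v \<in> V" for v
  proof -
    \<comment> \<open>Completing the square: \<open>J v\<close> is at least
      \<open>B v v - 2 * K * sqrt (B v v)\<close>.\<close>
    have "0 \<le> (sqrt (B v v) - K)\<^sup>2" by simp
    then show ?thesis using bd[OF that] nonneg[OF that] unfolding J_def
      by (simp add: power2_diff mult.commute)
  qed
  define a where "a = Inf (J ` V)"
  have bb: "bdd_below (J ` V)" using J_low by (intro bdd_belowI[of _ "- (K\<^sup>2)"]) auto
  have "\<exists>w\<in>V. J w < a + inverse (real (Suc n))" for n
  proof -
    have "Inf (J ` V) < a + inverse (real (Suc n))" by (simp add: a_def)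
    from cInf_lessD[OF _ this] show ?thesis using zero_in by blast
  qed
  then obtain U where U: "\<And>n. U n \<in> V" "\<And>n. J (U n) < a + inverse (real (Suc n))" by metis
  have a_le: "a \<le> J v" if "v \<in> V" for v unfolding a_def using bb that by (intro cInf_lower) auto
  have key: "form_dist2 B (U i) (U j) \<le> 4 * inverse (real (Suc N))" if "i \<ge> N" "j \<ge> N" for i j N
  proof -
    let ?m = "\<lambda>x. (1 - 1/2) * U i x + 1/2 * U j x"
    have "?m \<in> V" using U by (intro lin) auto
    from a_le[OF this] have "a \<le> B ?m ?m - 2 * ((1 - 1/2) * l (U i) + 1/2 * l (U j))"
      unfolding J_def using lin_l[OF U(1) U(1), of "1 - 1/2" i "1/2" j] by simp
    moreover have "inverse (real (Suc i)) \<le> inverse (real (Suc N))" "inverse (real (Suc j)) \<le> inverse (real (Suc N))"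
      using that by auto
    ultimately show ?thesis unfolding form_dist2_def parallelogram[OF U(1) U(1)]
      using U(2)[of i] U(2)[of j] unfolding J_def by argo
  qed
  have "form_cauchy B U"
    unfolding form_cauchy_def
  proof (intro allI impI)
    fix e :: real assume "e > 0"
    then have "0 < e / 4" by simp
    then obtain N where "inverse (real (Suc N)) < e / 4" using reals_Archimedean by blast
    then have "4 * inverse (real (Suc N)) < e" by simp
    then show "\<exists>N. \<forall>i\<ge>N. \<forall>j\<ge>N. form_dist2 B (U i) (U j) < e"
      using key by (intro exI[of _ N]) (meson order.strict_trans1)
  qed
  from complete[OF U(1) this] obtain u where u: "u \<in> V" and lim: "(\<lambda>n. form_dist2 B (U n) u) \<longlonglongrightarrow> 0" by blast
  have ldiff: "l (\<lambda>x. U n x - u x) = l (U n) - l u" for n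
    using lin_l[OF U(1) u, of 1 n "-1"] by simp
  have "(\<lambda>n. l (U n) - l u) \<longlonglongrightarrow> 0"
  proof (rule tendsto_rabs_zero_cancel, rule Lim_null_comparison)
    show "\<forall>\<^sub>F n in sequentially. norm \<bar>l (U n) - l u\<bar> \<le> K * sqrt (form_dist2 B (U n) u)"
      using bd[OF diff_in[OF U(1) u]] by (simp add: form_dist2_def ldiff)
    show "(\<lambda>n. K * sqrt (form_dist2 B (U n) u)) \<longlonglongrightarrow> 0"
      using tendsto_mult_left[OF tendsto_real_sqrt[OF lim], of K] by simp
  qed
  then have "(\<lambda>n. J (U n)) \<longlonglongrightarrow> J u"
    unfolding J_def by (intro tendsto_intros tendsto_self[OF U(1) u lim]) (simp add: LIM_zero_iff)
  moreover have "(\<lambda>n. a + inverse (real (Suc n))) \<longlonglongrightarrow> a"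
    using tendsto_add[OF tendsto_const[of a] LIMSEQ_inverse_real_of_nat] by simp
  ultimately have "J u \<le> a"
    using U(2) by (intro LIMSEQ_le) (auto intro!: exI[of _ 0] less_imp_le)
  have "B u v = l v" if v: "v \<in> V" for v
  proof -
    have q: "0 \<le> 2 * t * (B u v - l v) + t\<^sup>2 * B v v" for t
    proof -
      have "(\<lambda>x. u x + t * v x) \<in> V" using u v by (simp add: ins)
      from a_le[OF this] have "J u \<le> J (\<lambda>x. u x + t * v x)" using \<open>J u \<le> a\<close> by simp
      then show ?thesis unfolding J_def expand_comb[OF u v]
        using lin_l[OF u v, of 1 t] by (simp add: algebra_simps)
    qed
    define d where "d = B u v - l v"
    show ?thesis
    proof (rule ccontr)
      assume "B u v \<noteq> l v"
      then have d: "d \<noteq> 0" by (simp add: d_def)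
      \<comment> \<open>Enlarging \<open>B v v\<close> makes the choice \<open>t = - d / b\<close>
        possible for null vectors too; the variation is then negative, unlike what minimality
        demands.\<close>
      define b where "b = B v v + 1"
      have b: "b > 0" "B v v < b" using nonneg[OF v] by (auto simp: b_def)
      have "0 \<le> 2 * (- d / b) * d + (- d / b)\<^sup>2 * B v v" using q[of "- d / b"] by (simp add: d_def)
      also have "\<dots> \<le> 2 * (- d / b) * d + (- d / b)\<^sup>2 * b" using b by (intro add_left_mono mult_left_mono) auto
      also have "\<dots> = - (d\<^sup>2 / b)" using b by (simp add: field_simps power2_eq_square)
      also have "\<dots> < 0" using b d by simp
      finally show False by simp
    qed
  qed
  with u that show ?thesis by blast
qed

end

section \<open>Lattice operations for forms contracted by the absolute value\<close>

locale lattice_form = semi_inner +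
  assumes abs_in: "u \<in> V \<Longrightarrow> (\<lambda>x. \<bar>u x\<bar>) \<in> V"
    and abs_contr: "u \<in> V \<Longrightarrow> B (\<lambda>x. \<bar>u x\<bar>) (\<lambda>x. \<bar>u x\<bar>) \<le> B u u"
begin

lemma pos_in:
  assumes "u \<in> V"
  shows "(\<lambda>x. max 0 (u x)) \<in> V"
proof -
  have "(\<lambda>x. max 0 (u x)) = (\<lambda>x. 1/2 * u x + 1/2 * \<bar>u x\<bar>)" by (auto simp: max_def)
  then show ?thesis using lin[OF assms abs_in[OF assms]] by metis
qed

lemma neg_in: "u \<in> V \<Longrightarrow> (\<lambda>x. max 0 (- u x)) \<in> V"
  using pos_in[OF minus_in] .

text \<open>Writing the absolute value as \<open>p + n\<close> and \<open>u\<close> as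
  \<open>p - n\<close>, the two energies differ by \<open>4 * B p n\<close>, so contraction means
  that the mixed term is nonpositive.\<close>

lemma pos_neg_le:
  assumes u: "u \<in> V"
  shows "B (\<lambda>x. max 0 (u x)) (\<lambda>x. max 0 (- u x)) \<le> 0"
    and pos_contr: "B (\<lambda>x. max 0 (u x)) (\<lambda>x. max 0 (u x)) \<le> B u u"
    and neg_contr: "B (\<lambda>x. max 0 (- u x)) (\<lambda>x. max 0 (- u x)) \<le> B u u"
proof -
  let ?p = "\<lambda>x. max 0 (u x)" and ?n = "\<lambda>x. max 0 (- u x)"
  have p: "?p \<in> V" and n: "?n \<in> V" using u pos_in neg_in by auto
  have "(\<lambda>x. \<bar>u x\<bar>) = (\<lambda>x. ?p x + ?n x)" by auto
  then have "B (\<lambda>x. \<bar>u x\<bar>) (\<lambda>x. \<bar>u x\<bar>) = B ?p ?p + 2 * B ?p ?n + B ?n ?n"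
    using expand_add[OF p n] by simp
  moreover have "u = (\<lambda>x. ?p x - ?n x)" by auto
  then have "B u u = B ?p ?p - 2 * B ?p ?n + B ?n ?n"
    using expand_diff[OF p n] by simp
  ultimately show "B ?p ?n \<le> 0" "B ?p ?p \<le> B u u" "B ?n ?n \<le> B u u"
    using abs_contr[OF u] nonneg[OF p] nonneg[OF n] by linarith+
qed

lemma min_in:
  assumes "u \<in> V" "v \<in> V"
  shows "(\<lambda>x. min (u x) (v x)) \<in> V"
proof -
  have "(\<lambda>x. min (u x) (v x)) = (\<lambda>x. u x - max 0 (u x - v x))" by (auto simp: min_def max_def)
  then show ?thesis using diff_in[OF assms(1) pos_in[OF diff_in[OF assms]]] by simp
qed

lemma max_in:
  assumes "u \<in> V" "v \<in> V"
  shows "(\<lambda>x. max (u x) (v x)) \<in> V"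
proof -
  have "(\<lambda>x. max (u x) (v x)) = (\<lambda>x. v x + max 0 (u x - v x))" by (auto simp: min_def max_def)
  then show ?thesis using add_in[OF assms(2) pos_in[OF diff_in[OF assms]]] by simp
qed

text \<open>The inequality behind the cut-off estimates below: cutting two functions at their
  minimum leaves excesses of nonpositive mutual energy.\<close>

lemma excess_le:
  assumes "u \<in> V" "v \<in> V"
  shows "B (\<lambda>x. u x - min (u x) (v x)) (\<lambda>x. v x - min (u x) (v x)) \<le> 0"
proof -
  have "(\<lambda>x. u x - min (u x) (v x)) = (\<lambda>x. max 0 (u x - v x))"
    "(\<lambda>x. v x - min (u x) (v x)) = (\<lambda>x. max 0 (- (u x - v x)))" by auto
  then show ?thesis using pos_neg_le(1)[OF diff_in[OF assms]] by simp
qed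

text \<open>Strong subadditivity. The energy of the maximum is kept because it can be computed
  exactly when one of the functions has zero energy.\<close>

lemma min_max_le:
  assumes u: "u \<in> V" and v: "v \<in> V"
  shows "B (\<lambda>x. min (u x) (v x)) (\<lambda>x. min (u x) (v x)) + B (\<lambda>x. max (u x) (v x)) (\<lambda>x. max (u x) (v x))
    \<le> B u u + B v v"
proof -
  define p where "p = (\<lambda>x. min (u x) (v x))"
  have p: "p \<in> V" unfolding p_def using u v by (rule min_in)
  have "(\<lambda>x. max (u x) (v x)) = (\<lambda>x. (u x + v x) - p x)" by (auto simp: p_def)
  then have "B (\<lambda>x. max (u x) (v x)) (\<lambda>x. max (u x) (v x))
      = B u u + 2 * B u v + B v v - 2 * (B u p + B v p) + B p p"
    using u v p by (simp add: expand_diff expand_add add_in add_left)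
  moreover have "B (\<lambda>x. u x - p x) (\<lambda>x. v x - p x) \<le> 0"
    using excess_le[OF u v] by (simp add: p_def)
  then have "B u v - B u p - B v p + B p p \<le> 0"
    using u v p by (simp add: diff_left diff_right diff_in sym[of p v])
  ultimately show ?thesis unfolding p_def[symmetric] by (simp add: algebra_simps)
qed

lemma min_contr: "u \<in> V \<Longrightarrow> v \<in> V \<Longrightarrow>
    B (\<lambda>x. min (u x) (v x)) (\<lambda>x. min (u x) (v x)) \<le> B u u + B v v"
  using min_max_le[of u v] nonneg[OF max_in, of u v] by simp

end

section \<open>Square integrable functions\<close>

lemma L2_meas: "u \<in> L2 M \<Longrightarrow> u \<in> borel_measurable M"
  by (simp add: L2_def)

lemma L2_sq_integrable: "u \<in> L2 M \<Longrightarrow> integrable M (\<lambda>x. (u x)\<^sup>2)"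
  by (simp add: L2_def)

lemma abs_mult_le_sq: "\<bar>a * b\<bar> \<le> a\<^sup>2 + (b::real)\<^sup>2"
proof -
  have "2 * (\<bar>a\<bar> * \<bar>b\<bar>) \<le> a\<^sup>2 + b\<^sup>2" using sum_squares_bound[of "\<bar>a\<bar>" "\<bar>b\<bar>"] by (simp add: mult.assoc)
  moreover have "0 \<le> a\<^sup>2 + b\<^sup>2" by simp
  ultimately show ?thesis unfolding abs_mult by linarith
qed

lemma L2_mult_integrable:
  assumes "u \<in> L2 M" "v \<in> L2 M"
  shows "integrable M (\<lambda>x. u x * v x)"
proof (rule Bochner_Integration.integrable_bound)
  show "integrable M (\<lambda>x. (u x)\<^sup>2 + (v x)\<^sup>2)" using assms by (simp add: L2_def)
  show "(\<lambda>x. u x * v x) \<in> borel_measurable M"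
    using assms by (intro borel_measurable_times L2_meas)
  show "AE x in M. norm (u x * v x) \<le> norm ((u x)\<^sup>2 + (v x)\<^sup>2)"
    using abs_mult_le_sq by (auto simp: abs_of_nonneg)
qed

lemma L2_bound:
  assumes "u \<in> borel_measurable M" "v \<in> L2 M" "AE x in M. \<bar>u x\<bar> \<le> \<bar>v x\<bar>"
  shows "u \<in> L2 M"
proof -
  have "integrable M (\<lambda>x. (u x)\<^sup>2)"
    by (rule Bochner_Integration.integrable_bound[OF L2_sq_integrable[OF assms(2)]])
      (use assms in \<open>auto simp: abs_le_square_iff elim!: eventually_mono\<close>)
  then show ?thesis using assms(1) by (simp add: L2_def)
qed

lemma L2_lin:
  assumes "u \<in> L2 M" "v \<in> L2 M"
  shows "(\<lambda>x. a * u x + b * v x) \<in> L2 M"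
proof -
  have "integrable M (\<lambda>x. a\<^sup>2 * (u x)\<^sup>2 + 2 * a * b * (u x * v x) + b\<^sup>2 * (v x)\<^sup>2)"
    by (intro Bochner_Integration.integrable_add integrable_mult_right L2_mult_integrable L2_sq_integrable assms)
  also have "(\<lambda>x. a\<^sup>2 * (u x)\<^sup>2 + 2 * a * b * (u x * v x) + b\<^sup>2 * (v x)\<^sup>2) = (\<lambda>x. (a * u x + b * v x)\<^sup>2)"
    by (auto simp: power2_eq_square algebra_simps)
  finally show ?thesis using L2_meas[OF assms(1)] L2_meas[OF assms(2)] by (simp add: L2_def)
qed

lemma semi_inner_L2: "semi_inner (L2 M) (L2_inner M)"
proof unfold_locales
  show "L2 M \<noteq> {}" by (auto simp: L2_def intro!: exI[of _ "\<lambda>x. 0"])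
  fix u v w :: "'a \<Rightarrow> real" and a b
  assume "u \<in> L2 M" "v \<in> L2 M" "w \<in> L2 M"
  then show "L2_inner M (\<lambda>x. a * u x + b * v x) w = a * L2_inner M u w + b * L2_inner M v w"
    by (simp add: L2_inner_def ring_distribs mult.assoc L2_mult_integrable)
qed (auto simp: L2_lin L2_inner_def mult.commute)

interpretation L2: semi_inner "L2 M" "L2_inner M" for M
  by (rule semi_inner_L2)

lemma L2_dist2_form_dist2: "L2_dist2 M u v = form_dist2 (L2_inner M) u v"
  by (simp add: L2_dist2_def form_dist2_def L2_inner_def power2_eq_square)

lemma L2_inner_self: "L2_inner M u u = (\<integral>x. (u x)\<^sup>2 \<partial>M)"
  by (simp add: L2_inner_def power2_eq_square)

lemma L2_AE_eq:
  assumes "u \<in> L2 M" "v \<in> borel_measurable M" "AE x in M. u x = v x"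
  shows "v \<in> L2 M"
  using assms(2,1) by (rule L2_bound) (use assms(3) in \<open>auto elim!: eventually_mono\<close>)

lemma L2_inner_cong_AE:
  assumes "u \<in> borel_measurable M" "u' \<in> borel_measurable M" "v \<in> borel_measurable M" "v' \<in> borel_measurable M"
    "AE x in M. u x = u' x" "AE x in M. v x = v' x"
  shows "L2_inner M u v = L2_inner M u' v'"
  unfolding L2_inner_def by (rule integral_cong_AE) (use assms in auto)

lemma L2_null:
  assumes "u \<in> L2 M" "L2_inner M u u \<le> 0"
  shows "AE x in M. u x = 0"
proof -
  have "(\<integral>x. (u x)\<^sup>2 \<partial>M) = 0"
    using assms(2) by (simp add: L2_inner_self antisym)
  then have "AE x in M. (u x)\<^sup>2 = 0"
    using integral_nonneg_eq_0_iff_AE[OF L2_sq_integrable[OF assms(1)]] by simp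
  then show ?thesis by simp
qed

lemma L2_AE_subseq:
  assumes U: "\<And>n. U n \<in> L2 M" and u: "u \<in> L2 M" and lim: "(\<lambda>n. L2_dist2 M (U n) u) \<longlonglongrightarrow> 0"
  obtains r :: "nat \<Rightarrow> nat" where "strict_mono r" "AE x in M. (\<lambda>n. U (r n) x) \<longlonglongrightarrow> u x"
proof -
  have "\<exists>r::nat\<Rightarrow>nat. strict_mono r \<and> (AE x in M. (\<lambda>n. (U (r n) x - u x)\<^sup>2) \<longlonglongrightarrow> 0)"
  proof (rule tendsto_L1_AE_subseq[where u="\<lambda>n x. (U n x - u x)\<^sup>2"])
    show "integrable M (\<lambda>x. (U n x - u x)\<^sup>2)" for n
      using L2_sq_integrable[OF L2.diff_in[OF U u]] .
  qed (use lim in \<open>simp add: L2_dist2_def\<close>)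
  then obtain r :: "nat \<Rightarrow> nat" where r: "strict_mono r" "AE x in M. (\<lambda>n. (U (r n) x - u x)\<^sup>2) \<longlonglongrightarrow> 0"
    by blast
  from r(2) have "AE x in M. (\<lambda>n. U (r n) x) \<longlonglongrightarrow> u x"
    by eventually_elim (auto intro: LIM_zero_cancel)
  with r(1) that show ?thesis by blast
qed

lemma L2_dominated:
  assumes U: "\<And>n. U n \<in> borel_measurable M" and u: "u \<in> borel_measurable M" and g: "g \<in> L2 M"
    and bd: "\<And>n. AE x in M. \<bar>U n x\<bar> \<le> g x"
    and lim: "AE x in M. (\<lambda>n. U n x) \<longlonglongrightarrow> u x"
  shows "u \<in> L2 M" "(\<lambda>n. L2_dist2 M (U n) u) \<longlonglongrightarrow> 0"
proof -
  from bd have "AE x in M. \<forall>n. \<bar>U n x\<bar> \<le> g x" by (simp add: AE_all_countable)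
  with lim have ub: "AE x in M. \<bar>u x\<bar> \<le> g x"
  proof eventually_elim
    case (elim x)
    have "(\<lambda>n. \<bar>U n x\<bar>) \<longlonglongrightarrow> \<bar>u x\<bar>" using elim(1) by (intro tendsto_intros)
    then show ?case by (rule LIMSEQ_le_const2) (use elim(2) in auto)
  qed
  then have "AE x in M. \<bar>u x\<bar> \<le> \<bar>g x\<bar>" by eventually_elim simp
  with u g show "u \<in> L2 M" by (intro L2_bound[of u M g]) auto
  have "(\<lambda>n. \<integral>x. (U n x - u x)\<^sup>2 \<partial>M) \<longlonglongrightarrow> (\<integral>x. 0 \<partial>M)"
  proof (rule integral_dominated_convergence)
    show "integrable M (\<lambda>x. 4 * (g x)\<^sup>2)" using g by (simp add: L2_def)
    show "AE x in M. (\<lambda>n. (U n x - u x)\<^sup>2) \<longlonglongrightarrow> 0"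
      using lim
    proof eventually_elim
      case (elim x)
      then have "(\<lambda>n. (U n x - u x)\<^sup>2) \<longlonglongrightarrow> (u x - u x)\<^sup>2" by (intro tendsto_intros)
      then show ?case by simp
    qed
    show "AE x in M. norm ((U n x - u x)\<^sup>2) \<le> 4 * (g x)\<^sup>2" for n
      using bd[of n] ub
    proof eventually_elim
      case (elim x)
      then have "\<bar>U n x - u x\<bar> \<le> \<bar>2 * g x\<bar>" by simp
      then have "(U n x - u x)\<^sup>2 \<le> (2 * g x)\<^sup>2" by (simp only: abs_le_square_iff)
      then show ?case by (simp add: power_mult_distrib)
    qed
  qed (use U u in auto)
  then show "(\<lambda>n. L2_dist2 M (U n) u) \<longlonglongrightarrow> 0" by (simp add: L2_dist2_def)
qed

text \<open>Fatou's lemma applied to \<open>U i - U (r n)\<close> with \<open>i\<close> fixed. The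
  candidate \<open>u\<close> is only known to be measurable; the Cauchy property puts it into L2 and
  gives convergence of the full sequence.\<close>

lemma L2_cauchy_limit:
  assumes U: "\<And>n. U n \<in> L2 M" and c: "form_cauchy (L2_inner M) U"
    and r: "strict_mono (r :: nat \<Rightarrow> nat)"
    and u: "u \<in> borel_measurable M" and lim: "AE x in M. (\<lambda>n. U (r n) x) \<longlonglongrightarrow> u x"
  shows "u \<in> L2 M" "(\<lambda>n. L2_dist2 M (U n) u) \<longlonglongrightarrow> 0"
proof -
  have fatou: "(\<integral>\<^sup>+x. ennreal ((U i x - u x)\<^sup>2) \<partial>M) \<le> ennreal e"
    if N: "\<And>j. j \<ge> N \<Longrightarrow> form_dist2 (L2_inner M) (U i) (U j) < e" for i N e
  proof -
    have e: "e \<ge> 0" using N[of N] L2.dist2_nonneg[OF U U, of i N] by simp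
    have "(\<integral>\<^sup>+x. ennreal ((U i x - u x)\<^sup>2) \<partial>M)
        = (\<integral>\<^sup>+x. liminf (\<lambda>n. ennreal ((U i x - U (r n) x)\<^sup>2)) \<partial>M)"
      using lim
    proof (intro nn_integral_cong_AE, eventually_elim)
      case (elim x)
      then have "(\<lambda>n. ennreal ((U i x - U (r n) x)\<^sup>2)) \<longlonglongrightarrow> ennreal ((U i x - u x)\<^sup>2)"
        by (intro tendsto_ennrealI tendsto_intros)
      from lim_imp_Liminf[OF sequentially_bot this] show ?case by simp
    qed
    also have "\<dots> \<le> liminf (\<lambda>n. \<integral>\<^sup>+x. ennreal ((U i x - U (r n) x)\<^sup>2) \<partial>M)"
      using L2_meas[OF U] by (intro nn_integral_liminf) simp
    also have "\<dots> \<le> ennreal e"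
    proof (rule Liminf_le[OF sequentially_bot])
      show "\<forall>\<^sub>F n in sequentially. (\<integral>\<^sup>+x. ennreal ((U i x - U (r n) x)\<^sup>2) \<partial>M) \<le> ennreal e"
        using eventually_ge_at_top[of N]
      proof eventually_elim
        case (elim n)
        then have "r n \<ge> N" using seq_suble[OF r, of n] by simp
        have "(\<integral>\<^sup>+x. ennreal ((U i x - U (r n) x)\<^sup>2) \<partial>M) = ennreal (\<integral>x. (U i x - U (r n) x)\<^sup>2 \<partial>M)"
          by (intro nn_integral_eq_integral L2_sq_integrable[OF L2.diff_in] U) auto
        also have "\<dots> \<le> ennreal e"
          using N[OF \<open>r n \<ge> N\<close>] by (simp add: form_dist2_def L2_inner_self ennreal_leI)
        finally show ?case .
      qed
    qed
    finally show ?thesis .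
  qed
  have main: "\<exists>N. \<forall>i\<ge>N. (\<lambda>x. U i x - u x) \<in> L2 M \<and> L2_dist2 M (U i) u \<le> e" if e: "e > 0" for e
  proof -
    from c e obtain N where N: "\<And>i j. i \<ge> N \<Longrightarrow> j \<ge> N \<Longrightarrow> form_dist2 (L2_inner M) (U i) (U j) < e"
      unfolding form_cauchy_def by blast
    have "(\<lambda>x. U i x - u x) \<in> L2 M \<and> L2_dist2 M (U i) u \<le> e" if "i \<ge> N" for i
    proof -
      have le: "(\<integral>\<^sup>+x. ennreal ((U i x - u x)\<^sup>2) \<partial>M) \<le> ennreal e" by (rule fatou[of N]) (use N that in auto)
      have m: "(\<lambda>x. U i x - u x) \<in> borel_measurable M" using L2_meas[OF U] u by simp
      have int: "integrable M (\<lambda>x. (U i x - u x)\<^sup>2)"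
        using m le by (intro integrableI_bounded) (auto simp: le_less_trans[OF le])
      with m have "(\<lambda>x. U i x - u x) \<in> L2 M" by (simp add: L2_def)
      moreover have "ennreal (L2_dist2 M (U i) u) \<le> ennreal e"
        unfolding L2_dist2_def using le nn_integral_eq_integral[OF int] by simp
      ultimately show ?thesis using e by simp
    qed
    then show ?thesis by blast
  qed
  from main[of 1] obtain N where "(\<lambda>x. U N x - u x) \<in> L2 M" by auto
  from L2.diff_in[OF U[of N] this] show uL2: "u \<in> L2 M" by simp
  show "(\<lambda>n. L2_dist2 M (U n) u) \<longlonglongrightarrow> 0"
  proof (rule LIMSEQ_I)
    fix e :: real assume "e > 0"
    with main[of "e/2"] obtain N where N: "\<And>i. i \<ge> N \<Longrightarrow> L2_dist2 M (U i) u \<le> e / 2" by auto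
    have "L2_dist2 M (U i) u \<ge> 0" for i by (simp add: L2_dist2_def)
    moreover have "L2_dist2 M (U i) u < e" if "i \<ge> N" for i using N[OF that] \<open>e > 0\<close> by simp
    ultimately show "\<exists>no. \<forall>n\<ge>no. norm (L2_dist2 M (U n) u - 0) < e" by auto
  qed
qed

text \<open>Convergence a.e. has no metric to diagonalise with. A weighted L1 distance that it
  controls is made small for each \<open>n\<close>, and a subsequence then converges a.e. The
  predicate \<open>P\<close> carries further requirements on the chosen index.\<close>

lemma (in sigma_finite_measure) AE_diagonal:
  fixes f :: "nat \<Rightarrow> nat \<Rightarrow> 'a \<Rightarrow> real"
  assumes f: "\<And>n k. f n k \<in> borel_measurable M" and g: "\<And>n. g n \<in> borel_measurable M"
    and lim: "\<And>n. AE x in M. (\<lambda>k. f n k x) \<longlonglongrightarrow> g n x"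
    and P: "\<And>n. eventually (P n) sequentially"
  obtains r k :: "nat \<Rightarrow> nat" where "strict_mono r" "\<And>n. P (r n) (k n)"
    "AE x in M. (\<lambda>n. f (r n) (k n) x - g (r n) x) \<longlonglongrightarrow> 0"
proof -
  obtain \<rho> :: "'a \<Rightarrow> real" where \<rho>: "\<rho> \<in> borel_measurable M" "\<And>x. \<rho> x > 0" "integrable M \<rho>"
    using obtain_positive_integrable_function by metis
  \<comment> \<open>The distance truncated at 1 is dominated by the integrable weight. Eventually
    the truncation is inactive, since the limit is 0.\<close>
  define d where "d n k x = \<rho> x * min 1 \<bar>f n k x - g n x\<bar>" for n k x
  have d_meas: "d n k \<in> borel_measurable M" for n k
    unfolding d_def using f g \<rho> by measurable
  have d_bd: "norm (d n k x) \<le> \<rho> x" for n k x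
    unfolding d_def using \<rho>(2)[of x] by (simp add: abs_mult mult_left_le)
  have int: "integrable M (d n k)" for n k
    by (rule Bochner_Integration.integrable_bound[OF \<rho>(3) d_meas])
      (use d_bd \<rho>(2) in \<open>auto simp: less_imp_le\<close>)
  have "(\<lambda>k. \<integral>x. norm (d n k x) \<partial>M) \<longlonglongrightarrow> (\<integral>x. 0 \<partial>M)" for n
  proof (rule integral_dominated_convergence[OF _ _ \<rho>(3)])
    show "AE x in M. (\<lambda>k. norm (d n k x)) \<longlonglongrightarrow> 0"
      using lim[of n]
    proof eventually_elim
      case (elim x)
      have "(\<lambda>k. norm (d n k x)) \<longlonglongrightarrow> norm (\<rho> x * min 1 \<bar>g n x - g n x\<bar>)"
        unfolding d_def by (intro tendsto_intros elim)
      then show ?case by simp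
    qed
  qed (use d_meas d_bd in auto)
  then have ev: "\<forall>\<^sub>F k in sequentially. (\<integral>x. norm (d n k x) \<partial>M) < inverse (real (Suc n))" for n
    by (intro order_tendstoD(2)[of _ 0]) auto
  have "\<exists>k. P n k \<and> (\<integral>x. norm (d n k x) \<partial>M) < inverse (real (Suc n))" for n
    using eventually_happens[OF eventually_conj[OF P ev]] by auto
  then obtain K where K: "\<And>n. P n (K n)" "\<And>n. (\<integral>x. norm (d n (K n) x) \<partial>M) < inverse (real (Suc n))"
    by metis
  have "(\<lambda>n. \<integral>x. norm (d n (K n) x) \<partial>M) \<longlonglongrightarrow> 0"
    by (rule Lim_null_comparison[OF _ LIMSEQ_inverse_real_of_nat]) (use K(2) in \<open>auto intro!: always_eventually less_imp_le\<close>)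
  from tendsto_L1_AE_subseq[OF int this] obtain r :: "nat \<Rightarrow> nat" where r: "strict_mono r"
    "AE x in M. (\<lambda>n. d (r n) (K (r n)) x) \<longlonglongrightarrow> 0" by blast
  have "AE x in M. (\<lambda>n. f (r n) (K (r n)) x - g (r n) x) \<longlonglongrightarrow> 0"
    using r(2)
  proof eventually_elim
    case (elim x)
    have "(\<lambda>n. inverse (\<rho> x) * d (r n) (K (r n)) x) \<longlonglongrightarrow> inverse (\<rho> x) * 0"
      by (intro tendsto_intros elim)
    then have m: "(\<lambda>n. min 1 \<bar>f (r n) (K (r n)) x - g (r n) x\<bar>) \<longlonglongrightarrow> 0"
      using \<rho>(2)[of x] by (simp add: d_def field_simps)
    have "\<forall>\<^sub>F n in sequentially. min 1 \<bar>f (r n) (K (r n)) x - g (r n) x\<bar> < 1"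
      using order_tendstoD(2)[OF m, of 1] by simp
    then have "\<forall>\<^sub>F n in sequentially. min 1 \<bar>f (r n) (K (r n)) x - g (r n) x\<bar> = \<bar>f (r n) (K (r n)) x - g (r n) x\<bar>"
      by eventually_elim auto
    from tendsto_cong[THEN iffD1, OF this m] show ?case by (rule tendsto_rabs_zero_cancel)
  qed
  with r(1) K(1) that[of r "\<lambda>n. K (r n)"] show ?thesis by simp
qed

lemma sigma_finite_completion:
  assumes "sigma_finite_measure N"
  shows "sigma_finite_measure (completion N)"
proof -
  interpret sigma_finite_measure N by fact
  obtain A where "countable A" "A \<subseteq> sets N" "\<Union>A = space N" "\<forall>a\<in>A. emeasure N a \<noteq> \<infinity>"
    using sigma_finite_countable by blast
  then show ?thesis
    by unfold_locales (auto intro!: exI[of _ A] dest: subsetD)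
qed

lemma subseq_of_frequently:
  assumes "\<not> eventually P sequentially"
  obtains r :: "nat \<Rightarrow> nat" where "strict_mono r" "\<And>n. \<not> P (r n)"
proof -
  have inf: "infinite {n. \<not> P n}"
    using assms unfolding infinite_nat_iff_unbounded_le eventually_sequentially by blast
  show ?thesis
    by (rule that[of "enumerate {n. \<not> P n}"])
      (use inf enumerate_in_set[OF inf] in \<open>auto simp: strict_mono_enumerate\<close>)
qed

lemma LIMSEQ_comp_mono: "X \<longlonglongrightarrow> L \<Longrightarrow> strict_mono r \<Longrightarrow> (\<lambda>n. X (r n)) \<longlonglongrightarrow> L"
  using LIMSEQ_subseq_LIMSEQ[of X L r] by (simp add: comp_def)

lemma LIMSEQ_bounded_above:
  assumes "a \<longlonglongrightarrow> (l::real)" shows "\<exists>D. \<forall>n. a n \<le> D"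
proof -
  have "Bseq a" using convergentI[OF assms] by (rule convergent_imp_Bseq)
  then obtain D where "\<forall>n. norm (a n) \<le> D" by (rule BseqE)
  then have "a n \<le> D" for n by (simp add: abs_le_iff)
  then show ?thesis by blast
qed

lemma geometric_null: "(\<lambda>n. C * (1/2::real) ^ n) \<longlonglongrightarrow> 0"
  using tendsto_mult_left[OF LIMSEQ_power_zero[of "1/2::real"], of C] by simp

section \<open>Dirichlet forms and the extended form\<close>

locale dirichlet =
  fixes m :: "'a measure" and E :: "'a form" and F :: "('a \<Rightarrow> real) set"
  assumes dform: "dirichlet_form m E F" and sigma_fin: "sigma_finite_measure m"
    and space_eq: "space m = UNIV"
begin

abbreviation "M \<equiv> completion m"
abbreviation "E1 \<equiv> form1 m E"

lemma F_L2: "u \<in> F \<Longrightarrow> u \<in> L2 M"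
  using dform unfolding dirichlet_form_def by blast

lemma F_dense: "L2_dense M F"
  using dform unfolding dirichlet_form_def by blast

lemma F_meas: "u \<in> F \<Longrightarrow> u \<in> borel_measurable M"
  using F_L2 L2_meas by blast

lemma F_AE_eq: "u \<in> F \<Longrightarrow> v \<in> borel_measurable M \<Longrightarrow> AE x in m. u x = v x \<Longrightarrow> v \<in> F"
  using dform unfolding dirichlet_form_def by blast

lemma E_null_AE: "u \<in> F \<Longrightarrow> AE x in m. u x = 0 \<Longrightarrow> E u u = 0"
  using dform unfolding dirichlet_form_def by blast

lemma F_complete: "(\<And>n. U n \<in> F) \<Longrightarrow> form_cauchy E1 U \<Longrightarrow> \<exists>u\<in>F. (\<lambda>n. form_dist2 E1 (U n) u) \<longlonglongrightarrow> 0"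
  using dform unfolding dirichlet_form_def by blast

lemma F_unit: "u \<in> F \<Longrightarrow> (\<lambda>x. min (max 0 (u x)) 1) \<in> F"
  "u \<in> F \<Longrightarrow> E (\<lambda>x. min (max 0 (u x)) 1) (\<lambda>x. min (max 0 (u x)) 1) \<le> E u u"
  using dform unfolding dirichlet_form_def by blast+

sublocale E: semi_inner F E
proof unfold_locales
  have "(\<lambda>x. 0) \<in> L2 M" by (simp add: L2_def)
  then show "F \<noteq> {}" using F_dense unfolding L2_dense_def by (metis empty_iff zero_less_one)
qed (use dform in \<open>unfold dirichlet_form_def, blast+\<close>)

lemma semi_inner_L2_F: "semi_inner F (L2_inner M)"
  by (rule L2.semi_subspace) (use F_L2 E.nonempty E.lin in auto)

sublocale E1: semi_inner F E1
proof -
  interpret f: semi_inner F "L2_inner M" by (rule semi_inner_L2_F)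
  interpret g: bilinear_on F E1
    using bilinear_on_combine[OF E.bilinear_on_axioms f.bilinear_on_axioms, of 1]
    by (simp add: form1_def[abs_def])
  show "semi_inner F E1"
    by unfold_locales (simp add: form1_def E.nonneg f.nonneg)
qed

lemma E1_eq: "E1 u v = E u v + L2_inner M u v"
  by (simp add: form1_def)

lemma dist2_E1: "form_dist2 E1 u v = form_dist2 E u v + L2_dist2 M u v"
  by (simp add: L2_dist2_form_dist2 form_dist2_def E1_eq)

lemma E_cong:
  assumes "u \<in> F" "v \<in> F" "AE x in m. u x = v x"
  shows "w \<in> F \<Longrightarrow> E u w = E v w" "E u u = E v v"
proof -
  have d: "(\<lambda>x. u x - v x) \<in> F" by (intro E.ins assms)
  have "AE x in m. u x - v x = 0" using assms(3) by eventually_elim simp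
  then have z: "E (\<lambda>x. u x - v x) (\<lambda>x. u x - v x) = 0" using d E_null_AE by blast
  show *: "E u w = E v w" if "w \<in> F" for w
    using E.null_left[OF d that z] assms that by (simp add: E.lefts)
  show "E u u = E v v" using *[of u] *[of v] assms E.sym[of u v] by simp
qed

lemma dist2_E1_tendsto_iff:
  assumes "\<And>n. U n \<in> F" "u \<in> F"
  shows "(\<lambda>n. form_dist2 E1 (U n) u) \<longlonglongrightarrow> 0 \<longleftrightarrow>
    (\<lambda>n. form_dist2 E (U n) u) \<longlonglongrightarrow> 0 \<and> (\<lambda>n. L2_dist2 M (U n) u) \<longlonglongrightarrow> 0" (is "?l \<longleftrightarrow> ?r")
proof
  have nn: "form_dist2 E (U n) u \<ge> 0" "L2_dist2 M (U n) u \<ge> 0" for n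
    using assms by (auto simp: E.dist2_nonneg L2_dist2_def)
  show ?r if ?l
    using that nn by (auto intro!: Lim_null_comparison[OF _ that] simp: dist2_E1)
  show ?l if ?r
    using that tendsto_add[of "\<lambda>n. form_dist2 E (U n) u" 0 _ "\<lambda>n. L2_dist2 M (U n) u" 0] by (simp add: dist2_E1)
qed

text \<open>Completeness yields some limit; a subsequence identifies it a.e. with \<open>v\<close>,
  and \<open>F\<close> is saturated under equality a.e.\<close>

lemma F_closed_AE:
  assumes W: "\<And>n. W n \<in> F" and c: "form_cauchy E1 W"
    and lim: "AE x in m. (\<lambda>n. W n x) \<longlonglongrightarrow> v x" and v: "v \<in> borel_measurable M"
  shows "v \<in> F" "(\<lambda>n. form_dist2 E1 (W n) v) \<longlonglongrightarrow> 0"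
proof -
  obtain w where w: "w \<in> F" and wl: "(\<lambda>n. form_dist2 E1 (W n) w) \<longlonglongrightarrow> 0"
    using F_complete[OF W c] by blast
  then have "(\<lambda>n. L2_dist2 M (W n) w) \<longlonglongrightarrow> 0" using dist2_E1_tendsto_iff W by blast
  then obtain r :: "nat \<Rightarrow> nat" where r: "strict_mono r" "AE x in M. (\<lambda>n. W (r n) x) \<longlonglongrightarrow> w x"
    using L2_AE_subseq[of W M w] W w F_L2 by blast
  from r(2) have "AE x in m. (\<lambda>n. W (r n) x) \<longlonglongrightarrow> w x" by (simp add: AE_completion_iff)
  with lim have eq: "AE x in m. w x = v x"
  proof eventually_elim
    case (elim x)
    from LIMSEQ_unique[OF elim(2) LIMSEQ_comp_mono[OF elim(1) r(1)]] show ?case .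
  qed
  show vF: "v \<in> F" using F_AE_eq[OF w v eq] .
  have "form_dist2 E1 (W n) w = form_dist2 E1 (W n) v" for n
  proof -
    have d: "(\<lambda>x. W n x - w x) \<in> F" "(\<lambda>x. W n x - v x) \<in> F" using W w vF by (auto intro: E.ins)
    have ae: "AE x in m. W n x - w x = W n x - v x" using eq by eventually_elim simp
    have "L2_inner M (\<lambda>x. W n x - w x) (\<lambda>x. W n x - w x) = L2_inner M (\<lambda>x. W n x - v x) (\<lambda>x. W n x - v x)"
      by (intro L2_inner_cong_AE F_meas d) (use ae in \<open>simp_all add: AE_completion_iff\<close>)
    then show ?thesis unfolding form_dist2_def E1_eq using E_cong(2)[OF d ae] by simp
  qed
  with wl show "(\<lambda>n. form_dist2 E1 (W n) v) \<longlonglongrightarrow> 0" by simp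
qed

text \<open>Lower semicontinuity without weak topologies: Mazur combinations of a subsequence
  converge for \<open>E1\<close> and keep the energy bound.\<close>

lemma F_weak_closed:
  assumes V: "\<And>n. V n \<in> F" and bd: "\<And>n. E (V n) (V n) \<le> C"
    and v: "v \<in> L2 M" and lim: "(\<lambda>n. L2_dist2 M (V n) v) \<longlonglongrightarrow> 0"
  shows "v \<in> F" "E v v \<le> C"
proof -
  obtain r :: "nat \<Rightarrow> nat" where r: "strict_mono r" "AE x in M. (\<lambda>n. V (r n) x) \<longlonglongrightarrow> v x"
    using L2_AE_subseq[OF _ v lim] V F_L2 by blast
  have "form_cauchy (L2_inner M) V"
    by (rule L2.convergent_imp_cauchy[OF _ v]) (use V F_L2 lim in \<open>auto simp: L2_dist2_form_dist2\<close>)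
  then obtain D where D: "\<And>n. L2_inner M (V n) (V n) \<le> D"
    using L2.cauchy_bounded[of V M] V F_L2 by metis
  have "E1 (V (r n)) (V (r n)) \<le> C + D" for n using bd[of "r n"] D[of "r n"] by (simp add: E1_eq)
  then obtain W where W: "\<And>N. W N \<in> tail_hull (\<lambda>n. V (r n)) N" "form_cauchy E1 W"
    using E1.mazur[of "\<lambda>n. V (r n)"] V by metis
  have WF: "W N \<in> F" for N using E.tail_hull_in[OF W(1) V] .
  have "AE x in m. (\<lambda>n. W n x) \<longlonglongrightarrow> v x"
    using r(2) unfolding AE_completion_iff by eventually_elim (rule tail_hull_tendsto[OF W(1)])
  note cl = F_closed_AE[OF WF W(2) this L2_meas[OF v]]
  show "v \<in> F" by (rule cl)
  have "(\<lambda>n. E (W n) (W n)) \<longlonglongrightarrow> E v v"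
    using cl(2) by (intro E.tendsto_self WF cl(1)) (simp add: dist2_E1_tendsto_iff WF cl(1))
  then show "E v v \<le> C"
    by (rule LIMSEQ_le_const2) (auto intro!: E.tail_hull_norm_le[OF W(1)] V bd)
qed

text \<open>A failure along a subsequence would, by \<open>F_weak_closed\<close>, give
  \<open>E v v\<close> at most \<open>E v v - e\<close>.\<close>

lemma F_lsc:
  assumes V: "\<And>n. V n \<in> F" and v: "v \<in> F" and lim: "(\<lambda>n. L2_dist2 M (V n) v) \<longlonglongrightarrow> 0" and e: "e > 0"
  shows "\<forall>\<^sub>F n in sequentially. E v v \<le> E (V n) (V n) + e"
proof (rule ccontr)
  assume "\<not> ?thesis"
  then obtain r :: "nat \<Rightarrow> nat" where r: "strict_mono r" "\<And>n. \<not> E v v \<le> E (V (r n)) (V (r n)) + e"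
    by (rule subseq_of_frequently) blast
  have "E (V (r n)) (V (r n)) \<le> E v v - e" for n using r(2)[of n] by linarith
  then have "E v v \<le> E v v - e"
    by (rule F_weak_closed(2)[of "\<lambda>n. V (r n)", OF V _ F_L2[OF v] LIMSEQ_comp_mono[OF lim r(1)]])
  with e show False by simp
qed

text \<open>Semicontinuity of the energy of \<open>V n + s * w\<close> bounds
  \<open>s * (E v w - E (V n) w)\<close> by a constant; large \<open>s\<close> of both signs then
  squeeze the difference.\<close>

lemma F_weak_tendsto:
  assumes V: "\<And>n. V n \<in> F" and bd: "\<And>n. E (V n) (V n) \<le> C"
    and v: "v \<in> F" and lim: "(\<lambda>n. L2_dist2 M (V n) v) \<longlonglongrightarrow> 0" and w: "w \<in> F"
  shows "(\<lambda>n. E (V n) w) \<longlonglongrightarrow> E v w"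
proof (rule LIMSEQ_I)
  fix e :: real assume e: "e > 0"
  have C: "C \<ge> 0" using bd[of 0] E.nonneg[OF V, of 0] by simp
  \<comment> \<open>Chosen with \<open>S * e = C + 1\<close>, twice the bound that the two one-sided
    estimates leave for \<open>S\<close> times the difference.\<close>
  define S where "S = (C + 1) / e"
  have S: "S > 0" using C e by (simp add: S_def)
  have ev: "\<forall>\<^sub>F n in sequentially. 2 * s * (E v w - E (V n) w) \<le> C + 1" for s
  proof -
    have "\<forall>\<^sub>F n in sequentially. E (\<lambda>x. v x + s * w x) (\<lambda>x. v x + s * w x)
        \<le> E (\<lambda>x. V n x + s * w x) (\<lambda>x. V n x + s * w x) + 1"
      using lim by (intro F_lsc E.ins V v w) (simp_all add: L2_dist2_def)
    then show ?thesis
    proof eventually_elim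
      case (elim n)
      then show ?case
        using E.expand_comb[OF v w, of s] E.expand_comb[OF V w, of n s] bd[of n] E.nonneg[OF v]
        by (simp add: algebra_simps)
    qed
  qed
  have "\<forall>\<^sub>F n in sequentially. norm (E (V n) w - E v w) < e"
    using ev[of S] ev[of "-S"]
  proof eventually_elim
    case (elim n)
    have "S * \<bar>E (V n) w - E v w\<bar> \<le> (C + 1) / 2" using elim S by (simp add: abs_if algebra_simps)
    also have "\<dots> < S * e" using C e by (simp add: S_def)
    finally show ?case using S by simp
  qed
  then show "\<exists>no. \<forall>n\<ge>no. norm (E (V n) w - E v w) < e" by (simp add: eventually_sequentially)
qed

text \<open>As in a Hilbert space: weak convergence and no loss of norm give strong
  convergence.\<close>

lemma F_strong:
  assumes V: "\<And>n. V n \<in> F" and bd: "\<And>n. E (V n) (V n) \<le> C"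
    and v: "v \<in> F" and lim: "(\<lambda>n. L2_dist2 M (V n) v) \<longlonglongrightarrow> 0"
    and up: "\<And>e. e > 0 \<Longrightarrow> \<forall>\<^sub>F n in sequentially. E (V n) (V n) \<le> E v v + e"
  shows "(\<lambda>n. form_dist2 E1 (V n) v) \<longlonglongrightarrow> 0"
proof -
  have "(\<lambda>n. form_dist2 E (V n) v) \<longlonglongrightarrow> 0"
  proof (rule LIMSEQ_I)
    fix e :: real assume e: "e > 0"
    have "\<forall>\<^sub>F n in sequentially. dist (E (V n) v) (E v v) < e / 4"
      using F_weak_tendsto[OF V bd v lim v] e by (intro tendstoD) auto
    moreover have "\<forall>\<^sub>F n in sequentially. E (V n) (V n) \<le> E v v + e / 4" using up e by simp
    ultimately have "\<forall>\<^sub>F n in sequentially. norm (form_dist2 E (V n) v - 0) < e"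
    proof eventually_elim
      case (elim n)
      have "E v v - e / 4 < E (V n) v" using elim(1) abs_ge_minus_self[of "E (V n) v - E v v"] by (simp add: dist_real_def)
      then have "form_dist2 E (V n) v < e" unfolding form_dist2_def E.expand_diff[OF V v]
        using elim(2) e by linarith
      then show ?case using E.dist2_nonneg[OF V v, of n] by simp
    qed
    then show "\<exists>no. \<forall>n\<ge>no. norm (form_dist2 E (V n) v - 0) < e" by (simp add: eventually_sequentially)
  qed
  with lim show ?thesis by (simp add: dist2_E1_tendsto_iff V v)
qed

lemma F_clip:
  assumes u: "u \<in> F" and c: "c > 0"
  shows "(\<lambda>x. min (max 0 (u x)) c) \<in> F"
    "E (\<lambda>x. min (max 0 (u x)) c) (\<lambda>x. min (max 0 (u x)) c) \<le> E u u"
proof -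
  let ?v = "\<lambda>x. (1/c) * u x" and ?w = "\<lambda>x. min (max 0 (1/c * u x)) 1"
  have v: "?v \<in> F" using u by (rule E.scale_in)
  have eq: "(\<lambda>x. min (max 0 (u x)) c) = (\<lambda>x. c * ?w x)"
    using c by (auto simp: min_def max_def field_simps)
  show "(\<lambda>x. min (max 0 (u x)) c) \<in> F" unfolding eq by (intro E.scale_in F_unit v)
  have "E (\<lambda>x. c * ?w x) (\<lambda>x. c * ?w x) = c\<^sup>2 * E ?w ?w" by (intro E.expand_scale F_unit v)
  also have "\<dots> \<le> c\<^sup>2 * E ?v ?v" by (intro mult_left_mono F_unit v) auto
  also have "\<dots> = E u u" unfolding E.expand_scale[OF u] using c by (simp add: field_simps)
  finally show "E (\<lambda>x. min (max 0 (u x)) c) (\<lambda>x. min (max 0 (u x)) c) \<le> E u u" unfolding eq .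
qed

text \<open>Only the unit contraction is postulated. Scaling gives cuts at every height, and the
  cuts at heights n + 1 converge in L2 with bounded energy.\<close>

lemma F_pos:
  assumes u: "u \<in> F"
  shows "(\<lambda>x. max 0 (u x)) \<in> F" "E (\<lambda>x. max 0 (u x)) (\<lambda>x. max 0 (u x)) \<le> E u u"
proof -
  let ?V = "\<lambda>n x. min (max 0 (u x)) (real (Suc n))"
  have V: "?V n \<in> F" "E (?V n) (?V n) \<le> E u u" for n using F_clip[OF u, of "real (Suc n)"] by auto
  have pt: "(\<lambda>n. ?V n x) \<longlonglongrightarrow> max 0 (u x)" for x
  proof (rule tendsto_eventually)
    obtain N where N: "\<bar>u x\<bar> \<le> real N" using real_arch_simple by blast
    show "\<forall>\<^sub>F n in sequentially. min (max 0 (u x)) (real (Suc n)) = max 0 (u x)"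
      using eventually_ge_at_top[of N] by eventually_elim (use N in auto)
  qed
  have ab: "(\<lambda>x. \<bar>u x\<bar>) \<in> L2 M" using L2_bound[of "\<lambda>x. \<bar>u x\<bar>" M u] F_L2[OF u] F_meas[OF u] by auto
  have "(\<lambda>x. max 0 (u x)) \<in> L2 M \<and> (\<lambda>n. L2_dist2 M (?V n) (\<lambda>x. max 0 (u x))) \<longlonglongrightarrow> 0"
    by (intro conjI L2_dominated[of ?V M, OF F_meas[OF V(1)] _ ab])
      (use pt F_meas[OF u] in \<open>auto intro!: borel_measurable_max\<close>)
  with F_weak_closed[of ?V, OF V] show "(\<lambda>x. max 0 (u x)) \<in> F" "E (\<lambda>x. max 0 (u x)) (\<lambda>x. max 0 (u x)) \<le> E u u"
    by blast+
qed

text \<open>The positive part of \<open>p - t * n\<close> is again \<open>p\<close>, so subtracting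
  \<open>t * n\<close> cannot lower the energy of \<open>p\<close>; small \<open>t\<close> shows
  that the mixed term is nonpositive.\<close>

lemma E_pos_neg:
  assumes u: "u \<in> F"
  shows "E (\<lambda>x. max 0 (u x)) (\<lambda>x. max 0 (- u x)) \<le> 0"
proof -
  define p where "p = (\<lambda>x. max 0 (u x))"
  define n where "n = (\<lambda>x. max 0 (- u x))"
  have p: "p \<in> F" and n: "n \<in> F" unfolding p_def n_def using F_pos(1)[OF u] F_pos(1)[OF E.minus_in[OF u]] by auto
  have le: "2 * t * E p n \<le> t\<^sup>2 * E n n" if t: "t > 0" for t
  proof -
    have w: "(\<lambda>x. p x - t * n x) \<in> F" using p n by (intro E.ins)
    have "max 0 (p x - t * n x) = p x" for x
      using t mult_nonneg_nonpos[of t "u x"] by (cases "u x \<ge> 0") (auto simp: p_def n_def max_def)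
    then have "E p p \<le> E (\<lambda>x. p x - t * n x) (\<lambda>x. p x - t * n x)" using F_pos(2)[OF w] by simp
    also have "\<dots> = E p p - 2 * t * E p n + t\<^sup>2 * E n n"
      using E.expand_comb[OF p n, of "-t"] by simp
    finally show ?thesis by simp
  qed
  show ?thesis
  proof (rule ccontr)
    assume "\<not> ?thesis"
    then have pos: "E p n > 0" by (simp add: p_def n_def)
    define b where "b = E n n + 1"
    have b: "b > 0" "E n n < b" using E.nonneg[OF n] by (auto simp: b_def)
    \<comment> \<open>The value \<open>t = E p n / b\<close> makes the quadratic term at most half
      of the linear one.\<close>
    have "2 * (E p n / b) * E p n \<le> (E p n / b)\<^sup>2 * E n n" using le[of "E p n / b"] pos b by simp
    also have "\<dots> \<le> (E p n / b)\<^sup>2 * b" using b by (intro mult_left_mono) auto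
    also have "\<dots> = (E p n / b) * E p n" using b by (simp add: power2_eq_square)
    finally have "(E p n / b) * E p n \<le> 0" by simp
    moreover have "(E p n / b) * E p n > 0" using pos b by simp
    ultimately show False by simp
  qed
qed

sublocale E: lattice_form F E
proof unfold_locales
  fix u assume u: "u \<in> F"
  have p: "(\<lambda>x. max 0 (u x)) \<in> F" and n: "(\<lambda>x. max 0 (- u x)) \<in> F"
    using F_pos(1)[OF u] F_pos(1)[OF E.minus_in[OF u]] by auto
  have a: "(\<lambda>x. \<bar>u x\<bar>) = (\<lambda>x. max 0 (u x) + max 0 (- u x))" by auto
  show "(\<lambda>x. \<bar>u x\<bar>) \<in> F" unfolding a using p n by (rule E.add_in)
  have "u = (\<lambda>x. max 0 (u x) - max 0 (- u x))" by auto
  then have "E u u = E (\<lambda>x. max 0 (u x)) (\<lambda>x. max 0 (u x)) - 2 * E (\<lambda>x. max 0 (u x)) (\<lambda>x. max 0 (- u x))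
      + E (\<lambda>x. max 0 (- u x)) (\<lambda>x. max 0 (- u x))" using E.expand_diff[OF p n] by simp
  then show "E (\<lambda>x. \<bar>u x\<bar>) (\<lambda>x. \<bar>u x\<bar>) \<le> E u u"
    unfolding a E.expand_add[OF p n] using E_pos_neg[OF u] by simp
qed

sublocale E1: lattice_form F E1
proof unfold_locales
  fix u assume u: "u \<in> F"
  show "(\<lambda>x. \<bar>u x\<bar>) \<in> F" using u by (rule E.abs_in)
  show "E1 (\<lambda>x. \<bar>u x\<bar>) (\<lambda>x. \<bar>u x\<bar>) \<le> E1 u u"
    using E.abs_contr[OF u] by (simp add: E1_eq L2_inner_self)
qed

end

section \<open>Closability under convergence almost everywhere\<close>

context dirichlet begin

lemma L2_null_dominated:
  assumes V: "\<And>n. V n \<in> F" and g: "g \<in> F" and bd: "\<And>n x. \<bar>V n x\<bar> \<le> g x"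
    and lim: "AE x in m. (\<lambda>n. V n x) \<longlonglongrightarrow> 0"
  shows "(\<lambda>n. L2_dist2 M (V n) (\<lambda>x. 0)) \<longlonglongrightarrow> 0"
  by (rule L2_dominated(2)[OF _ _ F_L2[OF g]]) (use F_meas V bd lim in \<open>auto simp: AE_completion_iff\<close>)

text \<open>
  The key step towards closability in the extended sense: compare \<open>W n\<close> with \<open>k \<psi>\<close>.  The cut-off
  \<open>min (W n) (k \<psi>)\<close> tends to 0 weakly, and the two excesses over it have nonpositive mutual energy,
  so that \<open>k E (W n) \<psi>\<close> is at most \<open>E (W n) (W n) / 4 + o(1)\<close>.
\<close>

lemma weak_null_upper:
  assumes W: "\<And>n. W n \<in> F" and nn: "\<And>n x. 0 \<le> W n x" and bd: "\<And>n. E (W n) (W n) \<le> C"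
    and lim: "AE x in m. (\<lambda>n. W n x) \<longlonglongrightarrow> 0"
    and \<psi>: "\<psi> \<in> F" and \<psi>0: "\<And>x. 0 \<le> \<psi> x" and e: "e > 0"
  shows "\<forall>\<^sub>F n in sequentially. E (W n) \<psi> < e"
proof -
  have C: "C \<ge> 0" using bd[of 0] E.nonneg[OF W, of 0] by simp
  \<comment> \<open>With \<open>k * e = C + 1\<close> the bound \<open>C / 4 + k * e / 2\<close>
    stays below \<open>k * e\<close>.\<close>
  define k where "k = (C + 1) / e"
  have k: "k > 0" using C e by (simp add: k_def)
  define g where "g = (\<lambda>x. k * \<psi> x)"
  have g: "g \<in> F" unfolding g_def using \<psi> by (rule E.scale_in)
  have g0: "g x \<ge> 0" for x using k \<psi>0 by (simp add: g_def)
  define v where "v n = (\<lambda>x. min (W n x) (g x))" for n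
  have v: "v n \<in> F" for n unfolding v_def using W g by (rule E.min_in)
  have lim_v: "(\<lambda>n. L2_dist2 M (v n) (\<lambda>x. 0)) \<longlonglongrightarrow> 0"
  proof (rule L2_null_dominated[OF v g])
    show "\<bar>v n x\<bar> \<le> g x" for n x using nn[of n x] g0[of x] by (simp add: v_def)
    show "AE x in m. (\<lambda>n. v n x) \<longlonglongrightarrow> 0"
      using lim
    proof eventually_elim
      case (elim x)
      have "(\<lambda>n. v n x) \<longlonglongrightarrow> min 0 (g x)" unfolding v_def by (intro tendsto_intros elim)
      then show ?case using g0[of x] by simp
    qed
  qed
  have bd_v: "E (v n) (v n) \<le> C + E g g" for n
    using E.min_contr[OF W g, of n] bd[of n] by (simp add: v_def)
  have "(\<lambda>n. E (v n) \<psi>) \<longlonglongrightarrow> E (\<lambda>x. 0) \<psi>"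
    by (rule F_weak_tendsto[OF v bd_v E.zero_in lim_v \<psi>])
  then have "(\<lambda>n. E (v n) \<psi>) \<longlonglongrightarrow> 0" using E.zero_left[OF \<psi>] by simp
  then have "\<forall>\<^sub>F n in sequentially. E (v n) \<psi> < e / 2" by (rule order_tendstoD) (use e in simp)
  then show ?thesis
  proof eventually_elim
    case (elim n)
    have "E (\<lambda>x. W n x - v n x) (\<lambda>x. g x - v n x) \<le> 0"
      using E.excess_le[OF W g, of n] by (simp add: v_def)
    then have 1: "E (W n) g - E (W n) (v n) - E (v n) g + E (v n) (v n) \<le> 0"
      using W v g by (simp add: E.diff_left E.diff_right E.diff_in)
    \<comment> \<open>The square of \<open>v n - W n / 2\<close> is the source of the
      quarter.\<close>
    have "0 \<le> E (\<lambda>x. v n x + (- 1/2) * W n x) (\<lambda>x. v n x + (- 1/2) * W n x)"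
      using W v by (intro E.nonneg E.ins)
    then have 2: "E (W n) (v n) - E (v n) (v n) \<le> E (W n) (W n) / 4"
      unfolding E.expand_comb[OF v W] using E.sym[OF W v, of n n] by (simp add: power2_eq_square)
    have g_eq: "E w g = k * E w \<psi>" if "w \<in> F" for w
      unfolding g_def using \<psi> that by (rule E.scale_right)
    have "k * E (W n) \<psi> \<le> C / 4 + k * E (v n) \<psi>"
      using 1 2 bd[of n] by (simp add: g_eq W v)
    also have "\<dots> \<le> C / 4 + k * (e / 2)" using elim k by simp
    also have "\<dots> < k * e"
    proof -
      have "k * e = C + 1" using e by (simp add: k_def)
      then have "k * (e / 2) = (C + 1) / 2" by simp
      with \<open>k * e = C + 1\<close> show ?thesis using C by argo
    qed
    finally show ?case using k by simp
  qed
qed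

text \<open>Split \<open>E (U k) (U k)\<close> into the pairings of \<open>U k\<close> with
  \<open>U k - U n\<close> and with \<open>U n\<close>: the first is small by Cauchy-Schwarz, the
  second for late \<open>n\<close> by hypothesis. An upper bound on the pairing suffices because the
  energy is nonnegative.\<close>

lemma cauchy_weak_null:
  assumes U: "\<And>n. U n \<in> F" and c: "form_cauchy E U"
    and weak: "\<And>k e. e > 0 \<Longrightarrow> \<forall>\<^sub>F n in sequentially. E (U n) (U k) < e"
  shows "(\<lambda>n. E (U n) (U n)) \<longlonglongrightarrow> 0"
proof (rule LIMSEQ_I)
  fix e :: real assume e: "e > 0"
  obtain C where C: "\<And>n. E (U n) (U n) \<le> C" "C \<ge> 0" using E.cauchy_bounded[OF U c] by blast
  \<comment> \<open>Makes \<open>d * C\<close> smaller than the square of \<open>e / 2\<close>, also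
    for \<open>C = 0\<close>.\<close>
  define d where "d = e\<^sup>2 / (4 * (C + 1))"
  have d: "d > 0" using e C by (simp add: d_def)
  then obtain N where N: "\<And>i j. i \<ge> N \<Longrightarrow> j \<ge> N \<Longrightarrow> form_dist2 E (U i) (U j) < d"
    using c unfolding form_cauchy_def by blast
  have "E (U k) (U k) < e" if k: "k \<ge> N" for k
  proof -
    have "\<forall>\<^sub>F n in sequentially. E (U n) (U k) < e / 2"
      using e by (intro weak) simp
    then have "\<forall>\<^sub>F n in sequentially. E (U n) (U k) < e / 2 \<and> n \<ge> N"
      using eventually_ge_at_top[of N] by eventually_elim simp
    then obtain n where n: "E (U n) (U k) < e / 2" "n \<ge> N" using eventually_happens by fastforce
    let ?D = "\<lambda>x. U k x - U n x"
    have D: "?D \<in> F" using U by (intro E.ins)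
    have "(E ?D (U k))\<^sup>2 \<le> E ?D ?D * E (U k) (U k)" by (rule E.Cauchy_Schwarz[OF D U])
    also have "\<dots> \<le> d * C" using N[OF k n(2)] C d E.nonneg[OF U]
      by (intro mult_mono) (auto simp: form_dist2_def)
    also have "\<dots> < (e / 2)\<^sup>2" using e C by (simp add: d_def field_simps power2_eq_square)
    finally have "E ?D (U k) < e / 2" using e by (intro power2_less_imp_less[of _ "e / 2"]) auto
    then show ?thesis using n(1) U by (simp add: E.diff_left)
  qed
  then show "\<exists>no. \<forall>n\<ge>no. norm (E (U n) (U n) - 0) < e"
    using E.nonneg[OF U] by (intro exI[of _ N]) simp
qed

lemma null_nonneg_cauchy:
  assumes W: "\<And>n. W n \<in> F" and nn: "\<And>n x. 0 \<le> W n x" and c: "form_cauchy E W"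
    and lim: "AE x in m. (\<lambda>n. W n x) \<longlonglongrightarrow> 0"
  shows "(\<lambda>n. E (W n) (W n)) \<longlonglongrightarrow> 0"
proof -
  obtain C where C: "\<And>n. E (W n) (W n) \<le> C" using E.cauchy_bounded[OF W c] by blast
  show ?thesis by (rule cauchy_weak_null[OF W c weak_null_upper[OF W nn C lim W nn]])
qed

text \<open>\<open>weak_null_upper\<close> needs a nonnegative test function. For general
  \<open>w\<close>, a subsequence violating the bound has Mazur combinations that are Cauchy, so
  their energy tends to 0 by \<open>null_nonneg_cauchy\<close>, while the pairing stays at least
  \<open>e\<close>.\<close>

lemma weak_null_nonneg:
  assumes W: "\<And>n. W n \<in> F" and nn: "\<And>n x. 0 \<le> W n x" and bd: "\<And>n. E (W n) (W n) \<le> C"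
    and lim: "AE x in m. (\<lambda>n. W n x) \<longlonglongrightarrow> 0" and w: "w \<in> F"
  shows "(\<lambda>n. E (W n) w) \<longlonglongrightarrow> 0"
proof -
  have upper: "\<forall>\<^sub>F n in sequentially. E (W n) w < e" if w: "w \<in> F" and e: "e > 0" for w e
  proof (rule ccontr)
    assume "\<not> ?thesis"
    then obtain r :: "nat \<Rightarrow> nat" where r: "strict_mono r" "\<And>n. \<not> E (W (r n)) w < e"
      by (rule subseq_of_frequently) blast
    obtain P where P: "\<And>N. P N \<in> tail_hull (\<lambda>n. W (r n)) N" "form_cauchy E P"
      using E.mazur[of "\<lambda>n. W (r n)" C] W bd by blast
    have PF: "P N \<in> F" for N using E.tail_hull_in[OF P(1) W] .
    have "AE x in m. (\<lambda>n. P n x) \<longlonglongrightarrow> 0"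
      using lim by eventually_elim (rule tail_hull_tendsto[OF P(1)], rule LIMSEQ_comp_mono[OF _ r(1)])
    then have "(\<lambda>n. E (P n) (P n)) \<longlonglongrightarrow> 0"
      by (intro null_nonneg_cauchy[OF PF _ P(2)] tail_hull_ge[OF P(1)] nn)
    then have "(\<lambda>n. E (P n) w) \<longlonglongrightarrow> E (\<lambda>x. 0) w"
      by (intro E.tendsto_left[OF PF E.zero_in _ w]) (simp add: form_dist2_def)
    then have "(\<lambda>n. E (P n) w) \<longlonglongrightarrow> 0" by (simp add: E.zero_left w)
    moreover have "E (P n) w \<ge> e" for n
      by (rule E.tail_hull_ge_left[OF P(1) W w]) (use r(2) in \<open>simp add: not_less\<close>)
    ultimately have "e \<le> 0" by (intro LIMSEQ_le_const) auto
    with e show False by simp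
  qed
  show ?thesis
  proof (rule LIMSEQ_I)
    fix e :: real assume "e > 0"
    then have "\<forall>\<^sub>F n in sequentially. norm (E (W n) w - 0) < e"
      using upper[OF w, of e] upper[OF E.minus_in[OF w], of e]
      by (auto simp: E.minus_right W w abs_less_iff elim: eventually_elim2)
    then show "\<exists>no. \<forall>n\<ge>no. norm (E (W n) w - 0) < e" by (simp add: eventually_sequentially)
  qed
qed

lemma weak_null:
  assumes U: "\<And>n. U n \<in> F" and bd: "\<And>n. E (U n) (U n) \<le> C"
    and lim: "AE x in m. (\<lambda>n. U n x) \<longlonglongrightarrow> 0" and w: "w \<in> F"
  shows "(\<lambda>n. E (U n) w) \<longlonglongrightarrow> 0"
proof -
  let ?p = "\<lambda>n x. max 0 (U n x)" and ?q = "\<lambda>n x. max 0 (- U n x)"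
  have p: "?p n \<in> F" and q: "?q n \<in> F" for n using E.pos_in[OF U] E.neg_in[OF U] by auto
  have "AE x in m. (\<lambda>n. ?p n x) \<longlonglongrightarrow> 0"
    using lim
  proof eventually_elim
    case (elim x)
    have "(\<lambda>n. ?p n x) \<longlonglongrightarrow> max 0 0" by (intro tendsto_intros elim)
    then show ?case by simp
  qed
  then have 1: "(\<lambda>n. E (?p n) w) \<longlonglongrightarrow> 0"
    using E.pos_contr[OF U] bd by (intro weak_null_nonneg[OF p, where C=C] w) (auto intro: order_trans)
  have "AE x in m. (\<lambda>n. ?q n x) \<longlonglongrightarrow> 0"
    using lim
  proof eventually_elim
    case (elim x)
    have "(\<lambda>n. ?q n x) \<longlonglongrightarrow> max 0 (- 0)" by (intro tendsto_intros elim)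
    then show ?case by simp
  qed
  then have 2: "(\<lambda>n. E (?q n) w) \<longlonglongrightarrow> 0"
    using E.neg_contr[OF U] bd by (intro weak_null_nonneg[OF q, where C=C] w) (auto intro: order_trans)
  have "E (U n) w = E (?p n) w - E (?q n) w" for n
  proof -
    have "U n = (\<lambda>x. ?p n x - ?q n x)" by auto
    then show ?thesis using E.diff_left[OF p q w, of n n] by simp
  qed
  then show ?thesis using tendsto_diff[OF 1 2] by simp
qed

text \<open>Convergence a.e. replaces convergence in L2. This makes the extended form independent of
  the approximating sequences.\<close>

lemma closable:
  assumes U: "\<And>n. U n \<in> F" and c: "form_cauchy E U" and lim: "AE x in m. (\<lambda>n. U n x) \<longlonglongrightarrow> 0"
  shows "(\<lambda>n. E (U n) (U n)) \<longlonglongrightarrow> 0"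
proof -
  obtain C where C: "\<And>n. E (U n) (U n) \<le> C" using E.cauchy_bounded[OF U c] by blast
  show ?thesis by (rule cauchy_weak_null[OF U c order_tendstoD(2)[OF weak_null[OF U C lim U]]])
qed

section \<open>The extended Dirichlet form\<close>

abbreviation "approx \<equiv> approx_seq m E F"
abbreviation "ext \<equiv> ext_form m E F"

text \<open>The extended space before the choice of quasi-continuous versions, so that the energy
  calculus can precede capacities.\<close>

definition X :: "('a \<Rightarrow> real) set" where
  "X = {u \<in> borel_measurable M. \<exists>U. approx U u}"

lemma approxD: "approx U u \<Longrightarrow> U n \<in> F" "approx U u \<Longrightarrow> form_cauchy E U"
  "approx U u \<Longrightarrow> AE x in m. (\<lambda>n. U n x) \<longlonglongrightarrow> u x"
  by (auto simp: approx_seq_def)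

lemma approx_lin:
  assumes "approx U u" "approx V v"
  shows "approx (\<lambda>n x. a * U n x + b * V n x) (\<lambda>x. a * u x + b * v x)"
  unfolding approx_seq_def
proof (intro conjI allI)
  show "(\<lambda>x. a * U n x + b * V n x) \<in> F" for n using assms by (intro E.lin approxD)
  show "form_cauchy E (\<lambda>n x. a * U n x + b * V n x)" by (intro E.cauchy_lin approxD[OF assms(1)] approxD[OF assms(2)])
  show "AE x in m. (\<lambda>n. a * U n x + b * V n x) \<longlonglongrightarrow> a * u x + b * v x"
    using approxD(3)[OF assms(1)] approxD(3)[OF assms(2)]
    by eventually_elim (intro tendsto_intros)
qed

lemma approx_product_null:
  assumes P: "approx P (\<lambda>x. 0)" and V: "approx V v"
  shows "(\<lambda>n. E (P n) (V n)) \<longlonglongrightarrow> 0"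
proof -
  obtain C where C: "\<And>n. E (V n) (V n) \<le> C" "C \<ge> 0" using E.cauchy_bounded approxD[OF V] by metis
  show ?thesis
  proof (rule Lim_null_comparison)
  show "\<forall>\<^sub>F n in sequentially. norm (E (P n) (V n)) \<le> sqrt (E (P n) (P n)) * sqrt C"
  proof (rule always_eventually, rule allI)
    fix n
    have "norm (E (P n) (V n)) \<le> sqrt (E (P n) (P n)) * sqrt (E (V n) (V n))"
      using E.abs_le approxD(1)[OF P] approxD(1)[OF V] by simp
    also have "\<dots> \<le> sqrt (E (P n) (P n)) * sqrt C"
      using C E.nonneg approxD(1)[OF P] by (intro mult_left_mono) auto
    finally show "norm (E (P n) (V n)) \<le> sqrt (E (P n) (P n)) * sqrt C" .
  qed
  show "(\<lambda>n. sqrt (E (P n) (P n)) * sqrt C) \<longlonglongrightarrow> 0"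
    using tendsto_mult_right[OF tendsto_real_sqrt[OF closable[OF approxD[OF P]]], of "sqrt C"] by simp
  qed
qed

lemma approx_converges:
  assumes U: "approx U u" and V: "approx V v"
  shows "convergent (\<lambda>n. E (U n) (V n))"
proof -
  obtain C where C: "\<And>n. E (U n) (U n) \<le> C" "C \<ge> 0" using E.cauchy_bounded approxD[OF U] by metis
  obtain D where D: "\<And>n. E (V n) (V n) \<le> D" "D \<ge> 0" using E.cauchy_bounded approxD[OF V] by metis
  note UF = approxD(1)[OF U] and VF = approxD(1)[OF V]
  have "Cauchy (\<lambda>n. E (U n) (V n))"
  proof (rule CauchyI)
    fix e :: real assume e: "e > 0"
    define S where "S = sqrt C + sqrt D + 1"
    define d where "d = (e / (4 * S))\<^sup>2"
    have S: "S > 0" using C D by (simp add: S_def add_nonneg_pos)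
    then have d: "d > 0" using e by (simp add: d_def)
    obtain N where N: "\<And>i j. i \<ge> N \<Longrightarrow> j \<ge> N \<Longrightarrow> form_dist2 E (U i) (U j) < d"
      using approxD(2)[OF U] d unfolding form_cauchy_def by blast
    obtain N' where N': "\<And>i j. i \<ge> N' \<Longrightarrow> j \<ge> N' \<Longrightarrow> form_dist2 E (V i) (V j) < d"
      using approxD(2)[OF V] d unfolding form_cauchy_def by blast
 have sd: "sqrt d = e / (4 * S)" using e S by (simp add: d_def)
    have "norm (E (U i) (V i) - E (U j) (V j)) < e" if ij: "i \<ge> max N N'" "j \<ge> max N N'" for i j
    proof -
      let ?D = "\<lambda>x. U i x - U j x" and ?D' = "\<lambda>x. V i x - V j x"
      have DF: "?D \<in> F" "?D' \<in> F" using UF VF by (auto intro: E.diff_in)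
      have "E (U i) (V i) - E (U j) (V j) = E ?D (V i) + E (U j) ?D'"
        using UF VF by (simp add: E.diff_left E.diff_right)
      moreover have "\<bar>E ?D (V i)\<bar> \<le> sqrt d * sqrt D"
      proof (rule order_trans[OF E.abs_le[OF DF(1) VF]], rule mult_mono)
        show "sqrt (E ?D ?D) \<le> sqrt d" using N[of i j] ij by (simp add: form_dist2_def)
        show "sqrt (E (V i) (V i)) \<le> sqrt D" using D by simp
      qed (use E.nonneg VF d in auto)
      moreover have "\<bar>E (U j) ?D'\<bar> \<le> sqrt C * sqrt d"
      proof (rule order_trans[OF E.abs_le[OF UF DF(2)]], rule mult_mono)
        show "sqrt (E ?D' ?D') \<le> sqrt d" using N'[of i j] ij by (simp add: form_dist2_def)
        show "sqrt (E (U j) (U j)) \<le> sqrt C" using C by simp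
      qed (use E.nonneg[OF DF(2)] C in auto)
      ultimately have "\<bar>E (U i) (V i) - E (U j) (V j)\<bar> \<le> sqrt d * (sqrt C + sqrt D)"
        by (simp add: algebra_simps)
      also have "\<dots> \<le> sqrt d * S" using d by (simp add: S_def)
      also have "\<dots> = e / 4" using S by (simp add: sd)
      also have "\<dots> < e" using e by simp
      finally show ?thesis by simp
    qed
    then show "\<exists>M. \<forall>m\<ge>M. \<forall>n\<ge>M. norm (E (U m) (V m) - E (U n) (V n)) < e" by blast
  qed
  then show ?thesis by (simp add: Cauchy_convergent_iff)
qed

lemma approx_same_limit:
  assumes U: "approx U u" "approx U' u" and V: "approx V v" "approx V' v"
    and l: "(\<lambda>n. E (U n) (V n)) \<longlonglongrightarrow> l"
  shows "(\<lambda>n. E (U' n) (V' n)) \<longlonglongrightarrow> l"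
proof -
  have P: "approx (\<lambda>n x. U n x - U' n x) (\<lambda>x. 0)" "approx (\<lambda>n x. V n x - V' n x) (\<lambda>x. 0)"
    using approx_lin[OF U, of 1 "-1"] approx_lin[OF V, of 1 "-1"] by simp_all
  \<comment> \<open>Each correction pairs a sequence approximating 0 with an energy-bounded
    one.\<close>
  have "(\<lambda>n. E (U n) (V n) - E (\<lambda>x. U n x - U' n x) (V n) - E (\<lambda>x. V n x - V' n x) (U' n)) \<longlonglongrightarrow> l - 0 - 0"
    by (intro tendsto_diff l approx_product_null[OF P(1) V(1)] approx_product_null[OF P(2) U(2)])
  moreover have "E (U n) (V n) - E (\<lambda>x. U n x - U' n x) (V n) - E (\<lambda>x. V n x - V' n x) (U' n) = E (U' n) (V' n)" for n
    using approxD(1)[OF U(1), of n] approxD(1)[OF U(2), of n] approxD(1)[OF V(1), of n] approxD(1)[OF V(2), of n]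
    by (simp add: E.diff_left E.sym[of _ "U' n"])
  ultimately show ?thesis by simp
qed

lemma ext_tendsto:
  assumes U: "approx U u" and V: "approx V v"
  shows "(\<lambda>n. E (U n) (V n)) \<longlonglongrightarrow> ext u v"
proof -
  obtain l where l: "(\<lambda>n. E (U n) (V n)) \<longlonglongrightarrow> l" using approx_converges[OF U V] by (auto simp: convergent_def)
  have "ext u v = l"
    unfolding ext_form_def
  proof (rule the_equality)
    show "\<forall>U V. approx U u \<and> approx V v \<longrightarrow> (\<lambda>n. E (U n) (V n)) \<longlonglongrightarrow> l"
      using approx_same_limit[OF U _ V _ l] by blast
    show "l' = l" if "\<forall>U V. approx U u \<and> approx V v \<longrightarrow> (\<lambda>n. E (U n) (V n)) \<longlonglongrightarrow> l'" for l'
      using that U V l LIMSEQ_unique by blast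
  qed
  with l show ?thesis by simp
qed

lemma X_obtain:
  assumes "u \<in> X" obtains U where "approx U u"
  using assms by (auto simp: X_def)

lemma X_ex: "u \<in> X \<Longrightarrow> \<exists>U. approx U u"
  by (simp add: X_def)

lemma X_meas: "u \<in> X \<Longrightarrow> u \<in> borel_measurable M"
  by (simp add: X_def)

lemma approx_const: "u \<in> F \<Longrightarrow> approx (\<lambda>n. u) u"
  by (simp add: approx_seq_def form_cauchy_def form_dist2_def E.zero_left[OF E.zero_in])

lemma F_subset_X: "u \<in> F \<Longrightarrow> u \<in> X"
  using approx_const F_meas by (auto simp: X_def)

lemma ext_eq_E: "u \<in> F \<Longrightarrow> v \<in> F \<Longrightarrow> ext u v = E u v"
  using LIMSEQ_unique[OF ext_tendsto[OF approx_const approx_const], of u v "E u v"] by simp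

sublocale ext: semi_inner X ext
proof unfold_locales
  show "X \<noteq> {}" using F_subset_X[OF E.zero_in] by blast
  fix u v w :: "'a \<Rightarrow> real" and a b
  assume u: "u \<in> X" and v: "v \<in> X" and w: "w \<in> X"
  obtain U V W where *: "approx U u" "approx V v" "approx W w" using u v w X_ex by metis
  have "(\<lambda>n. a * E (U n) (W n) + b * E (V n) (W n)) \<longlonglongrightarrow> a * ext u w + b * ext v w"
    by (intro tendsto_intros ext_tendsto *)
  then have "(\<lambda>n. E (\<lambda>x. a * U n x + b * V n x) (W n)) \<longlonglongrightarrow> a * ext u w + b * ext v w"
    using approxD(1)[OF *(1)] approxD(1)[OF *(2)] approxD(1)[OF *(3)] by (simp add: E.left)
  with ext_tendsto[OF approx_lin[OF *(1,2)] *(3)]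
  show "ext (\<lambda>x. a * u x + b * v x) w = a * ext u w + b * ext v w" by (rule LIMSEQ_unique)
next
  fix u v :: "'a \<Rightarrow> real" and a b
  assume u: "u \<in> X" and v: "v \<in> X"
  obtain U V where *: "approx U u" "approx V v" using u v X_ex by metis
  show "(\<lambda>x. a * u x + b * v x) \<in> X"
    using approx_lin[OF *, of a b] X_meas[OF u] X_meas[OF v] unfolding X_def by auto
  have "E (U n) (V n) = E (V n) (U n)" for n using approxD(1)[OF *(1)] approxD(1)[OF *(2)] by (rule E.sym)
  then show "ext u v = ext v u"
    using ext_tendsto[OF *] ext_tendsto[OF *(2,1)] LIMSEQ_unique by simp
next
  fix u assume "u \<in> X"
  then obtain U where *: "approx U u" using X_obtain by blast
  show "0 \<le> ext u u"
    by (rule LIMSEQ_le_const[OF ext_tendsto[OF * *]]) (use E.nonneg approxD(1)[OF *] in auto)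
qed

lemma X_AE_eq:
  assumes u: "u \<in> X" and v: "v \<in> borel_measurable M" and eq: "AE x in m. u x = v x"
  shows "v \<in> X" "w \<in> X \<Longrightarrow> ext u w = ext v w" "ext u u = ext v v"
proof -
  obtain U where U: "approx U u" using X_obtain[OF u] .
  have V: "approx U v"
    unfolding approx_seq_def using approxD[OF U] eq by (auto elim: eventually_elim2)
  then show "v \<in> X" using v by (auto simp: X_def)
  show "ext u u = ext v v" using ext_tendsto[OF U U] ext_tendsto[OF V V] by (rule LIMSEQ_unique)
  show "ext u w = ext v w" if w: "w \<in> X"
  proof -
    obtain W where W: "approx W w" using X_ex[OF w] by blast
    show ?thesis using ext_tendsto[OF U W] ext_tendsto[OF V W] by (rule LIMSEQ_unique)
  qed
qed

text \<open>Fatou property of the extended form. A diagonal sequence in \<open>F\<close> converges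
  a.e. to \<open>v\<close> with bounded energy, and its Mazur combinations form an approximating
  sequence.\<close>

lemma X_weak_closed:
  assumes u: "\<And>n. u n \<in> X" and bd: "\<And>n. ext (u n) (u n) \<le> C"
    and lim: "AE x in m. (\<lambda>n. u n x) \<longlonglongrightarrow> v x" and v: "v \<in> borel_measurable M"
  shows "v \<in> X" "ext v v \<le> C"
proof -
  obtain f where f: "\<And>n. approx (f n) (u n)" using X_ex[OF u] by metis
  interpret c: sigma_finite_measure M
    by (rule sigma_finite_completion[OF sigma_fin])
  \<comment> \<open>The energy slack is made to vanish along the diagonal; otherwise only a bound
    worse than \<open>C\<close> would survive.\<close>
  define P where "P n k \<longleftrightarrow> E (f n k) (f n k) < C + inverse (real (Suc n))" for n k
  obtain r k :: "nat \<Rightarrow> nat" where r: "strict_mono r" and Pr: "\<And>n. P (r n) (k n)"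
    and rl: "AE x in M. (\<lambda>n. f (r n) (k n) x - u (r n) x) \<longlonglongrightarrow> 0"
  proof (rule c.AE_diagonal[of f u P])
    show "\<forall>\<^sub>F k in sequentially. P n k" for n
      unfolding P_def by (rule order_tendstoD[OF ext_tendsto[OF f f]])
        (rule order_le_less_trans[OF bd], simp)
  qed (use approxD[OF f] F_meas X_meas u in \<open>auto simp: AE_completion_iff\<close>)
  let ?V = "\<lambda>n. f (r n) (k n)"
  have VF: "?V n \<in> F" for n using approxD(1)[OF f] .
  have bdV: "E (?V n) (?V n) \<le> C + inverse (real (Suc n))" for n
  proof -
    have "inverse (real (Suc (r n))) \<le> inverse (real (Suc n))" using seq_suble[OF r, of n] by simp
    then show ?thesis using Pr[of n] unfolding P_def by linarith
  qed
  have limV: "AE x in m. (\<lambda>n. ?V n x) \<longlonglongrightarrow> v x"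
    using rl lim unfolding AE_completion_iff
  proof eventually_elim
    case (elim x)
    from tendsto_add[OF elim(1) LIMSEQ_comp_mono[OF elim(2) r]] show ?case by simp
  qed
  have "E (?V n) (?V n) \<le> C + 1" for n using bdV[of n] inverse_le_1_iff[of "real (Suc n)"] by simp
  then obtain W where W: "\<And>N. W N \<in> tail_hull ?V N" "form_cauchy E W"
    using E.mazur[of ?V "C + 1"] VF by blast
  have "AE x in m. (\<lambda>n. W n x) \<longlonglongrightarrow> v x"
    using limV by eventually_elim (rule tail_hull_tendsto[OF W(1)])
  then have ap: "approx W v"
    using W(2) E.tail_hull_in[OF W(1) VF] by (simp add: approx_seq_def)
  then show "v \<in> X" using v by (auto simp: X_def)
  have "E (W n) (W n) \<le> C + inverse (real (Suc n))" for n
  proof (rule E.tail_hull_norm_le[OF W(1) VF])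
    fix i assume "i \<ge> n"
    then have "inverse (real (Suc i)) \<le> inverse (real (Suc n))" by simp
    then show "E (?V i) (?V i) \<le> C + inverse (real (Suc n))" using bdV[of i] by linarith
  qed
  moreover have "(\<lambda>n. C + inverse (real (Suc n))) \<longlonglongrightarrow> C"
    using tendsto_add[OF tendsto_const[of C] LIMSEQ_inverse_real_of_nat] by simp
  ultimately show "ext v v \<le> C" by (intro LIMSEQ_le[OF ext_tendsto[OF ap ap]]) auto
qed

text \<open>The Fatou argument for L2 repeated for the energy: with \<open>i\<close> fixed,
  semicontinuity is applied to the differences from \<open>u i\<close>.\<close>

lemma X_cauchy_limit:
  assumes u: "\<And>n. u n \<in> X" and c: "form_cauchy ext u" and r: "strict_mono (r :: nat \<Rightarrow> nat)"
    and lim: "AE x in m. (\<lambda>n. u (r n) x) \<longlonglongrightarrow> v x" and v: "v \<in> borel_measurable M"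
  shows "v \<in> X" "(\<lambda>n. form_dist2 ext (u n) v) \<longlonglongrightarrow> 0"
proof -
  obtain C where C: "\<And>n. ext (u n) (u n) \<le> C" using ext.cauchy_bounded[OF u c] by blast
  show vX: "v \<in> X" by (rule X_weak_closed(1)[of "\<lambda>n. u (r n)", OF u C lim v])
  show "(\<lambda>n. form_dist2 ext (u n) v) \<longlonglongrightarrow> 0"
  proof (rule LIMSEQ_I)
    fix e :: real assume "e > 0"
    then have "e / 2 > 0" by simp
    then obtain N where N: "\<And>i j. i \<ge> N \<Longrightarrow> j \<ge> N \<Longrightarrow> form_dist2 ext (u i) (u j) < e / 2"
      using c unfolding form_cauchy_def by meson
    have "form_dist2 ext (u i) v < e" if i: "i \<ge> N" for i
    proof -
      let ?w = "\<lambda>n x. u i x - u (r (n + N)) x"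
      have "form_dist2 ext (u i) v \<le> e / 2"
        unfolding form_dist2_def
      proof (rule X_weak_closed(2)[of ?w])
        show "?w n \<in> X" for n using u by (intro ext.diff_in)
        show "ext (?w n) (?w n) \<le> e / 2" for n
          using N[OF i, of "r (n + N)"] seq_suble[OF r, of "n + N"] by (simp add: form_dist2_def)
        show "AE x in m. (\<lambda>n. ?w n x) \<longlonglongrightarrow> u i x - v x"
          using lim
        proof eventually_elim
          case (elim x)
          show ?case by (intro tendsto_intros LIMSEQ_ignore_initial_segment elim)
        qed
        show "(\<lambda>x. u i x - v x) \<in> borel_measurable M" using X_meas[OF u] v by simp
      qed
      with \<open>e > 0\<close> show ?thesis by simp
    qed
    then show "\<exists>no. \<forall>n\<ge>no. norm (form_dist2 ext (u n) v - 0) < e"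
      using ext.dist2_nonneg[OF u vX] by (intro exI[of _ N]) simp
  qed
qed

text \<open>The contraction acts on a tail of an approximating sequence, where the energies exceed
  the limit by at most \<open>e\<close>; the images need not be Cauchy, so
  \<open>X_weak_closed\<close> takes the limit.\<close>

lemma X_contraction:
  assumes cont: "continuous_on UNIV (\<Phi> :: real \<Rightarrow> real)"
    and F: "\<And>w. w \<in> F \<Longrightarrow> (\<lambda>x. \<Phi> (w x)) \<in> F" "\<And>w. w \<in> F \<Longrightarrow> E (\<lambda>x. \<Phi> (w x)) (\<lambda>x. \<Phi> (w x)) \<le> E w w"
    and u: "u \<in> X"
  shows "(\<lambda>x. \<Phi> (u x)) \<in> X" "ext (\<lambda>x. \<Phi> (u x)) (\<lambda>x. \<Phi> (u x)) \<le> ext u u"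
proof -
  obtain U where U: "approx U u" using X_obtain[OF u] .
  have "(\<lambda>x. \<Phi> (u x)) \<in> X \<and> ext (\<lambda>x. \<Phi> (u x)) (\<lambda>x. \<Phi> (u x)) \<le> ext u u + e" if e: "e > 0" for e
  proof -
    obtain N where N: "\<And>n. n \<ge> N \<Longrightarrow> E (U n) (U n) < ext u u + e"
      using order_tendstoD(2)[OF ext_tendsto[OF U U], of "ext u u + e"] e by (auto simp: eventually_sequentially)
    let ?V = "\<lambda>n x. \<Phi> (U (n + N) x)"
    have V: "?V n \<in> F" for n by (intro F approxD[OF U])
    have bd: "ext (?V n) (?V n) \<le> ext u u + e" for n
      unfolding ext_eq_E[OF V V] using F(2)[OF approxD(1)[OF U], of "n + N"] N[of "n + N"] by simp
    have lim: "AE x in m. (\<lambda>n. ?V n x) \<longlonglongrightarrow> \<Phi> (u x)"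
      using approxD(3)[OF U]
    proof eventually_elim
      case (elim x)
      show ?case
        by (rule isCont_tendsto_compose[OF _ LIMSEQ_ignore_initial_segment[OF elim]])
          (use cont in \<open>simp add: continuous_on_eq_continuous_at\<close>)
    qed
    have "(\<lambda>x. \<Phi> (u x)) \<in> borel_measurable M"
      using measurable_compose[OF X_meas[OF u] borel_measurable_continuous_onI[OF cont]] .
    with X_weak_closed[OF F_subset_X[OF V] bd lim] show ?thesis by blast
  qed
  from this[OF zero_less_one] this show "(\<lambda>x. \<Phi> (u x)) \<in> X" "ext (\<lambda>x. \<Phi> (u x)) (\<lambda>x. \<Phi> (u x)) \<le> ext u u"
    by (auto intro: field_le_epsilon)
qed

sublocale ext: lattice_form X ext
proof unfold_locales
  have c: "continuous_on UNIV (abs :: real \<Rightarrow> real)" by (intro continuous_intros)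
  fix u assume u: "u \<in> X"
  show "(\<lambda>x. \<bar>u x\<bar>) \<in> X" by (rule X_contraction(1)[OF c E.abs_in E.abs_contr u])
  show "ext (\<lambda>x. \<bar>u x\<bar>) (\<lambda>x. \<bar>u x\<bar>) \<le> ext u u" by (rule X_contraction(2)[OF c E.abs_in E.abs_contr u])
qed

lemma X_clip:
  assumes u: "u \<in> X" and c: "c > 0"
  shows "(\<lambda>x. min (max 0 (u x)) c) \<in> X" "ext (\<lambda>x. min (max 0 (u x)) c) (\<lambda>x. min (max 0 (u x)) c) \<le> ext u u"
proof -
  have "continuous_on UNIV (\<lambda>t::real. min (max 0 t) c)" by (intro continuous_intros)
  note X_contraction[OF this F_clip(1)[OF _ c] F_clip(2)[OF _ c] u]
  then show "(\<lambda>x. min (max 0 (u x)) c) \<in> X" "ext (\<lambda>x. min (max 0 (u x)) c) (\<lambda>x. min (max 0 (u x)) c) \<le> ext u u"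
    by blast+
qed

text \<open>The return from the extended space to \<open>F\<close>: cutting an approximating
  sequence at \<open>g\<close> supplies the L2 convergence that membership in the extended space
  lacks.\<close>

lemma X_dominated_in_F:
  assumes u: "u \<in> X" and g: "g \<in> F" and bd: "\<And>x. 0 \<le> u x" "\<And>x. u x \<le> g x"
  shows "u \<in> F"
proof -
  obtain U where U: "approx U u" using X_obtain[OF u] .
  obtain C where C: "\<And>n. E (U n) (U n) \<le> C" using E.cauchy_bounded approxD[OF U] by metis
  let ?V = "\<lambda>n x. min (max 0 (U n x)) (g x)"
  have V: "?V n \<in> F" for n by (intro E.min_in E.pos_in approxD[OF U] g)
  have bdV: "E (?V n) (?V n) \<le> C + E g g" for n
    using E.min_contr[OF E.pos_in[OF approxD(1)[OF U]] g, of n] E.pos_contr[OF approxD(1)[OF U], of n] C[of n]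
    by simp
  have g0: "0 \<le> g x" for x using bd[of x] by linarith
  have "u \<in> L2 M \<and> (\<lambda>n. L2_dist2 M (?V n) u) \<longlonglongrightarrow> 0"
  proof (intro conjI L2_dominated[of ?V M, OF F_meas[OF V] X_meas[OF u] F_L2[OF g]])
    show "AE x in M. \<bar>?V n x\<bar> \<le> g x" for n using g0 by (auto simp: min_def max_def)
    then show "AE x in M. \<bar>?V n x\<bar> \<le> g x" for n .
    show "AE x in M. (\<lambda>n. ?V n x) \<longlonglongrightarrow> u x"
      unfolding AE_completion_iff using approxD(3)[OF U]
    proof eventually_elim
      case (elim x)
      have "(\<lambda>n. ?V n x) \<longlonglongrightarrow> min (max 0 (u x)) (g x)" by (intro tendsto_intros elim)
      then show ?case using bd[of x] by simp
    qed
    then show "AE x in M. (\<lambda>n. ?V n x) \<longlonglongrightarrow> u x" .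
  qed
  with F_weak_closed(1)[of ?V, OF V bdV] show ?thesis by blast
qed

end

section \<open>Functions of zero energy\<close>

lemma L2_dense_orthogonal:
  assumes D: "L2_dense N D" "D \<subseteq> L2 N" and w: "w \<in> L2 N" and o: "\<And>g. g \<in> D \<Longrightarrow> L2_inner N w g = 0"
  shows "AE x in N. w x = 0"
proof -
  have "L2_inner N w w \<le> e" if e: "e > 0" for e
  proof -
    obtain g where g: "g \<in> D" "L2_dist2 N w g < e" using D(1) w e unfolding L2_dense_def by blast
    have "L2_dist2 N w g = L2_inner N w w - 2 * L2_inner N w g + L2_inner N g g"
      unfolding L2_dist2_form_dist2 form_dist2_def by (rule L2.expand_diff[OF w subsetD[OF D(2) g(1)]])
    moreover have "0 \<le> L2_inner N g g" by (rule L2.nonneg[OF subsetD[OF D(2) g(1)]])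
    ultimately show ?thesis using g o[OF g(1)] by simp
  qed
  then have "L2_inner N w w \<le> 0" by (rule field_le_epsilon) simp
  with w show ?thesis by (rule L2_null)
qed

text \<open>If convexity failed, \<open>f\<close> minus a chord would have a positive interior
  maximum, which the midpoint inequality forbids at a suitably chosen maximiser.\<close>

lemma midpoint_convex_on:
  fixes f :: "real \<Rightarrow> real"
  assumes cont: "continuous_on {a..} f"
    and mid: "\<And>s t. s \<ge> a \<Longrightarrow> t \<ge> a \<Longrightarrow> f ((s + t) / 2) \<le> (f s + f t) / 2"
  shows "convex_on {a..} f"
proof (rule convex_onI)
  show "convex {a..}" by simp
  have main: "f ((1 - t) * x + t * y) \<le> (1 - t) * f x + t * f y"
    if t: "0 < t" "t < 1" and xy: "a \<le> x" "x < y" for t x y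
  proof (rule ccontr)
    assume neg: "\<not> ?thesis"
    define g where "g z = f z - f x - (z - x) * ((f y - f x) / (y - x))" for z
    have g0: "g x = 0" "g y = 0" using xy by (auto simp: g_def)
    have cg: "continuous_on {x..y} g"
      unfolding g_def by (intro continuous_intros continuous_on_subset[OF cont]) (use xy in auto)
    obtain z where z: "z \<in> {x..y}" "\<And>w. w \<in> {x..y} \<Longrightarrow> g w \<le> g z"
      using continuous_attains_sup[OF compact_Icc _ cg] xy by auto
    let ?z = "(1 - t) * x + t * y"
    have zt: "?z = x + t * (y - x)" by (simp add: algebra_simps)
    have "0 \<le> t * (y - x)" "t * (y - x) \<le> 1 * (y - x)" using t xy by (simp, intro mult_right_mono) auto
    then have "?z \<in> {x..y}" unfolding zt by simp
    moreover have "g ?z > 0"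
    proof -
      have "g ?z = f ?z - f x - t * (f y - f x)" using xy unfolding g_def zt by simp
      then show ?thesis using neg by (simp add: algebra_simps)
    qed
    ultimately have pos: "g z > 0" using z(2) by force
    define S where "S = {w \<in> {x..y}. g w = g z}"
    have "closed ({x..y} \<inter> g -` {g z})" using cg by (intro continuous_closed_preimage) auto
    moreover have "{x..y} \<inter> g -` {g z} = S" by (auto simp: S_def)
    ultimately have "closed S" by simp
    moreover have "bounded S" by (rule bounded_subset[of "{x..y}"]) (auto simp: S_def)
    ultimately have "compact S" by (simp add: compact_eq_bounded_closed)
    moreover have "S \<noteq> {}" using z by (auto simp: S_def)
    \<comment> \<open>The leftmost maximiser: to its left the values are strictly smaller, so the
      average over two symmetric points falls below the maximum.\<close>
    ultimately obtain w where w: "w \<in> S" "\<And>v. v \<in> S \<Longrightarrow> w \<le> v" using compact_attains_inf[of S] by metis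
    have gw: "g w = g z" "x \<le> w" "w \<le> y" using w(1) by (auto simp: S_def)
    have "w \<noteq> x" "w \<noteq> y" using gw(1) g0 pos by auto
    with gw have w': "x < w" "w < y" "g w = g z" by auto
    define d where "d = min (w - x) (y - w)"
    have d: "d > 0" "w - d \<in> {x..y}" "w + d \<in> {x..y}" using w' by (auto simp: d_def)
    have "w - d \<notin> S" using w(2)[of "w - d"] d by auto
    then have "g (w - d) < g z" using d z(2)[of "w - d"] by (auto simp: S_def order_le_less)
    moreover have "g (w + d) \<le> g z" using z(2) d by blast
    moreover have "g w \<le> (g (w - d) + g (w + d)) / 2"
    proof -
      have "f w \<le> (f (w - d) + f (w + d)) / 2" using mid[of "w - d" "w + d"] d xy by simp
      moreover define s where "s = (f y - f x) / (y - x)"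
      ultimately show ?thesis unfolding g_def s_def[symmetric] by (simp add: field_simps)
    qed
    ultimately show False using w' by simp
  qed
  fix t x y :: real
  assume t: "0 < t" "t < 1" and x: "x \<in> {a..}" and y: "y \<in> {a..}"
  show "f ((1 - t) *\<^sub>R x + t *\<^sub>R y) \<le> (1 - t) * f x + t * f y"
  proof (cases x y rule: linorder_cases)
    case less
    then show ?thesis using main[of t x y] t x by simp
  next
    case equal
    then show ?thesis by (simp add: algebra_simps)
  next
    case greater
    then show ?thesis using main[of "1 - t" y x] t y by (simp add: algebra_simps)
  qed
qed

lemma antimono_bounded_at_right:
  fixes q :: "real \<Rightarrow> real"
  assumes mono: "\<And>s t. 0 < t \<Longrightarrow> t \<le> s \<Longrightarrow> q s \<le> q t" and bd: "\<And>t. t > 0 \<Longrightarrow> q t \<le> K"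
  shows "\<exists>l. (q \<longlongrightarrow> l) (at_right 0)"
proof -
  define l where "l = Sup (q ` {0<..})"
  have bb: "bdd_above (q ` {0<..})" using bd by (intro bdd_aboveI[of _ K]) auto
  have "(q \<longlongrightarrow> l) (at_right 0)"
  proof (rule order_tendstoI)
    fix a assume "a < l"
    then obtain t where t: "t > 0" "a < q t" unfolding l_def using less_cSup_iff[OF _ bb] by auto
    then show "\<forall>\<^sub>F x in at_right 0. a < q x"
      unfolding eventually_at_right_field using mono by (intro exI[of _ t]) (force intro: order_less_le_trans)
  next
    fix a assume "l < a"
    then show "\<forall>\<^sub>F x in at_right 0. q x < a"
      unfolding eventually_at_right_field
      by (intro exI[of _ 1]) (auto simp: l_def intro!: order_le_less_trans[OF cSup_upper[OF _ bb]])
  qed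
  then show ?thesis by blast
qed

context dirichlet begin

section \<open>Level sets of a function of zero energy\<close>

context
  fixes h :: "'a \<Rightarrow> real" and c :: real and A :: "'a set"
  assumes h: "h \<in> X" and h0: "\<And>x. 0 \<le> h x" and ext_h: "ext h h = 0" and c: "c > 0"
    and A_def: "A = {x. c < h x}"
begin

lemma level_set_sets: "A \<in> sets M"
  unfolding A_def using X_meas[OF h] space_eq
  by (simp add: borel_measurable_iff_greater)

text \<open>The functions \<open>g n\<close> are n times the positive part of \<open>h - c\<close>.
  They have zero energy and grow without bound exactly on \<open>A\<close>, so cutting
  \<open>u\<close> at \<open>g n\<close> produces the restriction of \<open>u\<close> to
  \<open>A\<close>. The limit gives one sign of the mixed energy, disjointness of the two pieces
  gives the other.\<close>

lemma level_set_split_nonneg: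
  assumes u: "u \<in> F" and u0: "\<And>x. 0 \<le> u x"
  shows "(\<lambda>x. indicator A x * u x) \<in> F"
    "E (\<lambda>x. indicator A x * u x) (\<lambda>x. u x - indicator A x * u x) = 0"
proof -
  let ?a = "\<lambda>x. indicator A x * u x"
  define g where "g n = (\<lambda>x. real n * (h x - min (max 0 (h x)) c))" for n
  define v where "v n = (\<lambda>x. min (u x) (g n x))" for n
  have dX: "(\<lambda>x. h x - min (max 0 (h x)) c) \<in> X" using h X_clip(1)[OF h c] by (rule ext.diff_in)
  have "ext (\<lambda>x. min (max 0 (h x)) c) (\<lambda>x. min (max 0 (h x)) c) \<le> 0" using X_clip(2)[OF h c] ext_h by simp
  then have d0: "ext (\<lambda>x. h x - min (max 0 (h x)) c) (\<lambda>x. h x - min (max 0 (h x)) c) \<le> 0"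
    using ext.sq_diff_le[OF h X_clip(1)[OF h c]] ext_h by simp
  then have d0: "ext (\<lambda>x. h x - min (max 0 (h x)) c) (\<lambda>x. h x - min (max 0 (h x)) c) = 0"
    using ext.nonneg[OF dX] by simp
  have gX: "g n \<in> X" for n unfolding g_def using dX by (rule ext.scale_in)
  have g0: "ext (g n) (g n) = 0" for n unfolding g_def ext.expand_scale[OF dX] d0 by simp
  have gpos: "g n x \<ge> 0" for n x using h0[of x] unfolding g_def by (intro mult_nonneg_nonneg) auto
  have uX: "u \<in> X" using u by (rule F_subset_X)
  have vX: "v n \<in> X" for n unfolding v_def using uX gX by (rule ext.min_in)
  have vF: "v n \<in> F" for n
    by (rule X_dominated_in_F[OF vX u]) (use u0 gpos in \<open>auto simp: v_def\<close>)
  \<comment> \<open>The maximum is \<open>(u - v n) + g n\<close>, and the summand of zero energy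
    does not contribute; hence \<open>v n\<close> and \<open>u - v n\<close> together have at most
    the energy of \<open>u\<close>.\<close>
  have v_le: "E (v n) (v n) \<le> E (v n) u" for n
  proof -
    have "ext (v n) (v n) + ext (\<lambda>x. max (u x) (g n x)) (\<lambda>x. max (u x) (g n x)) \<le> ext u u"
      using ext.min_max_le[OF uX gX, of n] by (simp add: v_def g0)
    moreover have "(\<lambda>x. max (u x) (g n x)) = (\<lambda>x. (u x - v n x) + g n x)" by (auto simp: v_def)
    moreover have "ext (\<lambda>x. (u x - v n x) + g n x) (\<lambda>x. (u x - v n x) + g n x)
        = ext (\<lambda>x. u x - v n x) (\<lambda>x. u x - v n x)"
      using ext.expand_add[OF ext.diff_in[OF uX vX] gX, of n n] g0
        ext.null_left[OF gX ext.diff_in[OF uX vX], of n n] ext.sym[OF gX ext.diff_in[OF uX vX], of n n] by simp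
    ultimately have "ext (v n) (v n) \<le> ext (v n) u"
      using ext.expand_diff[OF uX vX, of n] ext.sym[OF uX vX, of n] by simp
    then show ?thesis by (simp add: ext_eq_E vF u)
  qed
  have bd: "E (v n) (v n) \<le> E u u" for n
  proof -
    have "0 \<le> E (\<lambda>x. v n x - u x) (\<lambda>x. v n x - u x)" by (intro E.nonneg E.diff_in vF u)
    then show ?thesis using v_le[of n] unfolding E.expand_diff[OF vF u] by simp
  qed
  have "A \<in> sets M" by (rule level_set_sets)
  then have ameas: "?a \<in> borel_measurable M" using F_meas[OF u] by simp
  have pt: "(\<lambda>n. v n x) \<longlonglongrightarrow> ?a x" for x
  proof (cases "c < h x")
    case True
    then have pos: "h x - min (max 0 (h x)) c > 0" by auto
    then obtain N where N: "real N * (h x - min (max 0 (h x)) c) > u x" using ex_less_of_nat_mult by blast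
    have "\<forall>\<^sub>F n in sequentially. v n x = ?a x"
      using eventually_ge_at_top[of N]
    proof eventually_elim
      case (elim n)
      have "real N * (h x - min (max 0 (h x)) c) \<le> g n x"
        unfolding g_def using elim pos by (intro mult_right_mono) auto
      then show ?case using N True by (simp add: v_def A_def)
    qed
    then show ?thesis by (rule tendsto_eventually)
  next
    case False
    then have "v n x = ?a x" for n using h0[of x] u0[of x] by (simp add: v_def g_def A_def)
    then show ?thesis by simp
  qed
  have "\<bar>v n x\<bar> \<le> u x" for n x using u0[of x] gpos[of n x] by (simp add: v_def)
  then have L2: "?a \<in> L2 M" "(\<lambda>n. L2_dist2 M (v n) ?a) \<longlonglongrightarrow> 0"
    by (auto intro!: L2_dominated[OF F_meas[OF vF] ameas F_L2[OF u]] pt)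
  show a: "?a \<in> F" by (rule F_weak_closed(1)[OF vF bd L2])
  have wk: "(\<lambda>n. E (v n) u) \<longlonglongrightarrow> E ?a u" by (rule F_weak_tendsto[OF vF bd a L2(2) u])
  have "E ?a ?a \<le> E ?a u"
  proof (rule field_le_epsilon)
    fix e :: real assume e: "e > 0"
    have "\<forall>\<^sub>F n in sequentially. E ?a ?a \<le> E (v n) u + e"
      using F_lsc[OF vF a L2(2) e] by eventually_elim (use v_le in \<open>meson add_right_mono order_trans\<close>)
    moreover have "(\<lambda>n. E (v n) u + e) \<longlonglongrightarrow> E ?a u + e" by (intro tendsto_intros wk)
    ultimately show "E ?a ?a \<le> E ?a u + e" by (intro tendsto_lowerbound) auto
  qed
  then have ge: "E ?a (\<lambda>x. u x - ?a x) \<ge> 0" using a u by (simp add: E.diff_right)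
  \<comment> \<open>The pieces live on disjoint sets, so they are the positive and negative part of
    their difference.\<close>
  have f: "(\<lambda>x. ?a x - (u x - ?a x)) \<in> F" using a u by (intro E.diff_in)
  have "(\<lambda>x. max 0 (?a x - (u x - ?a x))) = ?a" "(\<lambda>x. max 0 (- (?a x - (u x - ?a x)))) = (\<lambda>x. u x - ?a x)"
    using u0 by (auto simp: indicator_def max_def fun_eq_iff intro: antisym)
  with E.pos_neg_le(1)[OF f] have "E ?a (\<lambda>x. u x - ?a x) \<le> 0" by simp
  with ge show "E ?a (\<lambda>x. u x - ?a x) = 0" by simp
qed

lemma level_set_restrict_in:
  assumes u: "u \<in> F"
  shows "(\<lambda>x. indicator A x * u x) \<in> F"
proof -
  have eq: "(\<lambda>x. indicator A x * u x) = (\<lambda>x. indicator A x * max 0 (u x) - indicator A x * max 0 (- u x))"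
    by (auto simp: indicator_def fun_eq_iff)
  show ?thesis unfolding eq
    by (intro E.diff_in level_set_split_nonneg(1) E.pos_in E.neg_in u) auto
qed

text \<open>Polarisation at \<open>u + v\<close>: the two cross terms are nonpositive and add up to
  0.\<close>

lemma level_set_split_nonneg2:
  assumes u: "u \<in> F" "\<And>x. 0 \<le> u x" and v: "v \<in> F" "\<And>x. 0 \<le> v x"
  shows "E (\<lambda>x. indicator A x * u x) (\<lambda>x. v x - indicator A x * v x) = 0"
proof -
  let ?a = "\<lambda>u x. indicator A x * u x :: real"
  have le: "E (?a u) (\<lambda>x. v x - ?a v x) \<le> 0" if "u \<in> F" "\<And>x. 0 \<le> u x" "v \<in> F" "\<And>x. 0 \<le> v x" for u v
  proof -
    have f: "(\<lambda>x. ?a u x - (v x - ?a v x)) \<in> F" using that by (intro E.diff_in level_set_restrict_in)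
    have "(\<lambda>x. max 0 (?a u x - (v x - ?a v x))) = ?a u" "(\<lambda>x. max 0 (- (?a u x - (v x - ?a v x)))) = (\<lambda>x. v x - ?a v x)"
      using that by (auto simp: indicator_def max_def fun_eq_iff intro: antisym)
    with E.pos_neg_le(1)[OF f] show ?thesis by simp
  qed
  have F: "?a u \<in> F" "?a v \<in> F" "(\<lambda>x. u x - ?a u x) \<in> F" "(\<lambda>x. v x - ?a v x) \<in> F"
    using u v by (auto intro!: E.diff_in level_set_restrict_in)
  have "E (?a (\<lambda>x. u x + v x)) (\<lambda>x. (u x + v x) - ?a (\<lambda>x. u x + v x) x) = 0"
    using u v by (intro level_set_split_nonneg(2) E.add_in) auto
  moreover have "?a (\<lambda>x. u x + v x) = (\<lambda>x. ?a u x + ?a v x)"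
    "(\<lambda>x. (u x + v x) - ?a (\<lambda>x. u x + v x) x) = (\<lambda>x. (u x - ?a u x) + (v x - ?a v x))"
    by (auto simp: algebra_simps)
  ultimately have "E (\<lambda>x. ?a u x + ?a v x) (\<lambda>x. (u x - ?a u x) + (v x - ?a v x)) = 0" by simp
  then have "E (?a u) (\<lambda>x. v x - ?a v x) + E (?a v) (\<lambda>x. u x - ?a u x) = 0"
    using level_set_split_nonneg(2)[OF u] level_set_split_nonneg(2)[OF v] F
    by (simp only: E.add_left E.add_right E.add_in)
  with le[OF u v] le[OF v u] show ?thesis by linarith
qed

lemma level_set_split:
  assumes u: "u \<in> F" and v: "v \<in> F"
  shows "E (\<lambda>x. indicator A x * u x) (\<lambda>x. v x - indicator A x * v x) = 0"
proof -
  let ?a = "\<lambda>u x. indicator A x * u x :: real" and ?p = "\<lambda>u x. max 0 (u x) :: real" and ?n = "\<lambda>u x. max 0 (- u x) :: real"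
  have eqs: "?a u = (\<lambda>x. ?a (?p u) x - ?a (?n u) x)"
    "(\<lambda>x. v x - ?a v x) = (\<lambda>x. (?p v x - ?a (?p v) x) - (?n v x - ?a (?n v) x))"
    by (auto simp: indicator_def fun_eq_iff)
  have pn: "?p w \<in> F \<and> ?n w \<in> F" if "w \<in> F" for w using that E.pos_in E.neg_in by auto
  have r: "?a (?p w) \<in> F" "?a (?n w) \<in> F" "(\<lambda>x. ?p w x - ?a (?p w) x) \<in> F" "(\<lambda>x. ?n w x - ?a (?n w) x) \<in> F"
    if "w \<in> F" for w
    using pn[OF that] by (auto intro!: E.diff_in level_set_restrict_in)
  have z: "E (?a (?p u)) (\<lambda>x. ?p v x - ?a (?p v) x) = 0" "E (?a (?p u)) (\<lambda>x. ?n v x - ?a (?n v) x) = 0"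
    "E (?a (?n u)) (\<lambda>x. ?p v x - ?a (?p v) x) = 0" "E (?a (?n u)) (\<lambda>x. ?n v x - ?a (?n v) x) = 0"
    using pn[OF u] pn[OF v] by (auto intro!: level_set_split_nonneg2)
  show ?thesis unfolding eqs
    using r[OF u] r[OF v] z by (simp only: E.diff_left E.diff_right E.diff_in)
qed

text \<open>Orthogonality of the two pieces, restated as symmetry and contractivity of the
  restriction to \<open>A\<close>; the semigroup argument needs it in this shape.\<close>

lemma level_set_sym:
  assumes u: "u \<in> F" and v: "v \<in> F"
  shows "E (\<lambda>x. indicator A x * u x) v = E u (\<lambda>x. indicator A x * v x)"
    and "E (\<lambda>x. indicator A x * u x) (\<lambda>x. indicator A x * u x) \<le> E u u"
proof -
  let ?a = "\<lambda>u x. indicator A x * u x :: real"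
  note a = level_set_restrict_in[OF u] level_set_restrict_in[OF v]
  have 1: "E (?a u) v = E (?a u) (?a v)" using level_set_split[OF u v] a v by (simp add: E.diff_right)
  have 2: "E (?a v) u = E (?a v) (?a u)" using level_set_split[OF v u] a u by (simp add: E.diff_right)
  show "E (?a u) v = E u (?a v)" using 1 2 a u E.sym by metis
  have "E (?a u) u = E (?a u) (?a u)" using level_set_split[OF u u] a u by (simp add: E.diff_right)
  moreover have "0 \<le> E (\<lambda>x. ?a u x - u x) (\<lambda>x. ?a u x - u x)" using a u by (intro E.nonneg E.diff_in)
  ultimately show "E (?a u) (?a u) \<le> E u u" using E.expand_diff[OF a(1) u] by simp
qed

end

end

context dirichlet begin

section \<open>The semigroup and its approximating forms\<close>

context
  fixes T assumes T: "semigroup_of_form m E F T"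
begin

abbreviation "I \<equiv> L2_inner M"

text \<open>The semigroup is constrained for positive times only; time 0 is filled in by the
  identity.\<close>

definition "Sg t f = (if t = 0 then f else T t f)" for t :: real and f

lemma T_semigroup: "L2_semigroup M T"
  using T by (simp add: semigroup_of_form_def)

lemma T_props:
  "t > 0 \<Longrightarrow> f \<in> L2 M \<Longrightarrow> T t f \<in> L2 M"
  "t > 0 \<Longrightarrow> f \<in> L2 M \<Longrightarrow> I (T t f) (T t f) \<le> I f f"
  "t > 0 \<Longrightarrow> f \<in> L2 M \<Longrightarrow> g \<in> L2 M \<Longrightarrow> AE x in M. T t (\<lambda>y. a * f y + b * g y) x = a * T t f x + b * T t g x"
  "t > 0 \<Longrightarrow> f \<in> L2 M \<Longrightarrow> g \<in> L2 M \<Longrightarrow> I (T t f) g = I f (T t g)"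
  "s > 0 \<Longrightarrow> t > 0 \<Longrightarrow> f \<in> L2 M \<Longrightarrow> AE x in M. T (s + t) f x = T s (T t f) x"
  using T_semigroup unfolding L2_semigroup_def by blast+

lemma S_L2: "t \<ge> 0 \<Longrightarrow> f \<in> L2 M \<Longrightarrow> Sg t f \<in> L2 M"
  by (simp add: Sg_def T_props(1))

lemma S_contr: "t \<ge> 0 \<Longrightarrow> f \<in> L2 M \<Longrightarrow> I (Sg t f) (Sg t f) \<le> I f f"
  using T_props(2)[of t f] by (simp add: Sg_def)

lemma S_lin:
  assumes "t \<ge> 0" "f \<in> L2 M" "g \<in> L2 M" "w \<in> L2 M"
  shows "I (Sg t (\<lambda>x. a * f x + b * g x)) w = a * I (Sg t f) w + b * I (Sg t g) w"
proof -
  have ae: "AE x in M. Sg t (\<lambda>y. a * f y + b * g y) x = a * Sg t f x + b * Sg t g x"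
    using assms T_props(3)[of t f g a b] by (simp add: Sg_def)
  have "I (Sg t (\<lambda>x. a * f x + b * g x)) w = I (\<lambda>x. a * Sg t f x + b * Sg t g x) w"
    by (rule L2_inner_cong_AE) (use ae assms in \<open>auto intro!: L2_meas S_L2 L2_lin\<close>)
  also have "\<dots> = a * I (Sg t f) w + b * I (Sg t g) w" using assms by (intro L2.left S_L2)
  finally show ?thesis .
qed

lemma S_diff:
  "t \<ge> 0 \<Longrightarrow> f \<in> L2 M \<Longrightarrow> g \<in> L2 M \<Longrightarrow> w \<in> L2 M \<Longrightarrow> I (Sg t (\<lambda>x. f x - g x)) w = I (Sg t f) w - I (Sg t g) w"
  using S_lin[of t f g w 1 "-1"] by simp

lemma S_sym: "t \<ge> 0 \<Longrightarrow> f \<in> L2 M \<Longrightarrow> g \<in> L2 M \<Longrightarrow> I (Sg t f) g = I f (Sg t g)"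
  using T_props(4)[of t f g] by (simp add: Sg_def)

text \<open>The semigroup law in weak form, with one factor moved to the other argument, so that no
  null sets have to be tracked.\<close>

lemma S_add:
  assumes "s \<ge> 0" "t \<ge> 0" "f \<in> L2 M" "w \<in> L2 M"
  shows "I (Sg (s + t) f) w = I (Sg t f) (Sg s w)"
proof -
  have ae: "AE x in M. Sg (s + t) f x = Sg s (Sg t f) x"
    using assms T_props(5)[of s t f] by (simp add: Sg_def)
  have "I (Sg (s + t) f) w = I (Sg s (Sg t f)) w"
    by (rule L2_inner_cong_AE) (use ae assms in \<open>auto intro!: L2_meas S_L2\<close>)
  then show ?thesis using S_sym[OF assms(1) S_L2[OF assms(2,3)] assms(4)] by simp
qed

lemma S_zero: "Sg 0 f = f"
  by (simp add: Sg_def)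

lemma S_tendsto: "f \<in> L2 M \<Longrightarrow> ((\<lambda>t. L2_dist2 M (Sg t f) f) \<longlongrightarrow> 0) (at_right 0)"
proof -
  assume f: "f \<in> L2 M"
  have "\<forall>\<^sub>F t in at_right 0. L2_dist2 M (T t f) f = L2_dist2 M (Sg t f) f"
    by (auto simp: Sg_def eventually_at_right_field intro!: exI[of _ 1])
  moreover have "((\<lambda>t. L2_dist2 M (T t f) f) \<longlongrightarrow> 0) (at_right 0)"
    using T_semigroup f unfolding L2_semigroup_def by blast
  ultimately show ?thesis by (rule tendsto_cong[THEN iffD1])
qed

text \<open>In spectral terms the Laplace transform of the spectral measure of \<open>u\<close>. Its
  convexity, obtained from the semigroup law, stands in for the spectral theorem.\<close>

definition "corr u t = I (Sg t u) u"

text \<open>The three values are the inner products of the vectors at times \<open>s/2\<close> and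
  \<open>t/2\<close>, and the inequality is the square of their difference.\<close>

lemma corr_midpoint:
  assumes u: "u \<in> L2 M" and st: "s \<ge> 0" "t \<ge> 0"
  shows "corr u ((s + t) / 2) \<le> (corr u s + corr u t) / 2"
proof -
  have half: "corr u r = I (Sg (r/2) u) (Sg (r/2) u)" if "r \<ge> 0" for r
    using S_add[of "r/2" "r/2" u u] that u by (simp add: corr_def)
  have "corr u ((s + t) / 2) = I (Sg (t/2) u) (Sg (s/2) u)"
    using S_add[of "s/2" "t/2" u u] st u by (simp add: corr_def add_divide_distrib)
  moreover have "0 \<le> I (\<lambda>x. Sg (t/2) u x - Sg (s/2) u x) (\<lambda>x. Sg (t/2) u x - Sg (s/2) u x)"
    using st u by (intro L2.nonneg L2.diff_in S_L2) auto
  ultimately show ?thesis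
    using L2.expand_diff[OF S_L2[of "t/2", OF _ u] S_L2[of "s/2", OF _ u]] st half[of s] half[of t] by simp
qed

text \<open>Strong continuity at time 0 is transported to all times: the increment between
  \<open>t\<close> and \<open>s\<close> is controlled by the one over \<open>s - t\<close>.\<close>

lemma corr_continuous:
  assumes u: "u \<in> L2 M"
  shows "continuous_on {0..} (corr u)"
proof -
  define d where "d t = sqrt (L2_dist2 M (Sg t u) u) * sqrt (I u u)" for t
  have d0: "(d \<longlongrightarrow> 0) (at_right 0)"
    unfolding d_def using tendsto_mult_right[OF tendsto_real_sqrt[OF S_tendsto[OF u]], of "sqrt (I u u)"] by simp
  have est: "\<bar>corr u s - corr u t\<bar> \<le> d (s - t)" if "0 \<le> t" "t < s" for s t
  proof -
    have Sg: "Sg (s - t) u \<in> L2 M" "Sg t u \<in> L2 M" using that u by (auto intro: S_L2)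
    have "corr u s - corr u t = I (\<lambda>x. Sg (s - t) u x - u x) (Sg t u)"
      using S_add[of t "s - t" u u] S_sym[of t u u] that u Sg by (simp add: corr_def L2.diff_left)
    then have "\<bar>corr u s - corr u t\<bar> \<le> sqrt (L2_dist2 M (Sg (s - t) u) u) * sqrt (I (Sg t u) (Sg t u))"
      using L2.abs_le[OF L2.diff_in[OF Sg(1) u] Sg(2)] by (simp add: L2_dist2_form_dist2 form_dist2_def)
    also have "\<dots> \<le> d (s - t)"
      unfolding d_def using S_contr[OF that(1) u] by (intro mult_left_mono) (auto simp: L2_dist2_def)
    finally show ?thesis .
  qed
  show ?thesis
    unfolding continuous_on_iff
  proof (intro ballI allI impI)
    fix x e :: real assume x: "x \<in> {0..}" and e: "e > 0"
    have "\<forall>\<^sub>F t in at_right 0. d t < e" using d0 e by (rule order_tendstoD)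
    then obtain b where b: "b > 0" "\<And>t. 0 < t \<Longrightarrow> t < b \<Longrightarrow> d t < e"
      unfolding eventually_at_right_field by blast
    show "\<exists>d>0. \<forall>x'\<in>{0..}. dist x' x < d \<longrightarrow> dist (corr u x') (corr u x) < e"
    proof (intro exI conjI ballI impI)
      fix y assume y: "y \<in> {0..}" and dy: "dist y x < b"
      show "dist (corr u y) (corr u x) < e"
      proof (cases x y rule: linorder_cases)
        case less
        then show ?thesis using est[of x y] b(2)[of "y - x"] x dy by (simp add: dist_real_def)
      next
        case greater
        then show ?thesis using est[of y x] b(2)[of "x - y"] y dy by (simp add: dist_real_def)
      qed (use e in simp)
    qed (rule b)
  qed
qed

lemma corr_convex:
  assumes u: "u \<in> L2 M"
  shows "convex_on {0..} (corr u)"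
  by (rule midpoint_convex_on[OF corr_continuous[OF u] corr_midpoint[OF u]])

text \<open>Chord slopes from 0 of a convex function; this is the monotonicity of the approximating
  forms.\<close>

lemma corr_slope:
  assumes u: "u \<in> L2 M" and t: "0 < t" "t \<le> s"
  shows "(corr u 0 - corr u s) / s \<le> (corr u 0 - corr u t) / t"
proof -
  have "corr u ((1 - t/s) *\<^sub>R 0 + (t/s) *\<^sub>R s) \<le> (1 - t/s) * corr u 0 + (t/s) * corr u s"
    using t by (intro convex_onD[OF corr_convex[OF u]]) auto
  then have "corr u t \<le> (1 - t/s) * corr u 0 + (t/s) * corr u s" using t by simp
  then have "t / s * (corr u 0 - corr u s) \<le> corr u 0 - corr u t" by (simp add: algebra_simps)
  then show ?thesis using t by (simp add: field_simps)
qed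

text \<open>Both inner points are convex combinations of 0 and \<open>\<tau> + h\<close> with
  complementary weights; adding the two convexity inequalities gives the claim.\<close>

lemma corr_decrement:
  assumes u: "u \<in> L2 M" and t: "0 \<le> \<tau>" "0 < h"
  shows "corr u \<tau> - corr u (\<tau> + h) \<le> corr u 0 - corr u h"
proof -
  define a where "a = \<tau> / (\<tau> + h)"
  have a: "0 \<le> a" "a \<le> 1" "a * (\<tau> + h) = \<tau>" "(1 - a) * (\<tau> + h) = h"
    using t by (auto simp: a_def field_simps)
  have 1: "corr u ((1 - a) *\<^sub>R 0 + a *\<^sub>R (\<tau> + h)) \<le> (1 - a) * corr u 0 + a * corr u (\<tau> + h)"
    using t a by (intro convex_onD[OF corr_convex[OF u]]) auto
  have 2: "corr u ((1 - (1 - a)) *\<^sub>R 0 + (1 - a) *\<^sub>R (\<tau> + h)) \<le> (1 - (1 - a)) * corr u 0 + (1 - a) * corr u (\<tau> + h)"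
    using t a by (intro convex_onD[OF corr_convex[OF u]]) auto
  show ?thesis using 1 2 unfolding scaleR_zero_right real_scaleR_def a(3,4) add_0 by (simp add: algebra_simps)
qed

text \<open>The approximating form (u - T_h u, v) / h.\<close>

definition "quot h u v = (1 / h) * I (\<lambda>x. u x - Sg h u x) v"

lemma quot_diag: "u \<in> L2 M \<Longrightarrow> h > 0 \<Longrightarrow> quot h u u = (corr u 0 - corr u h) / h"
  by (simp add: quot_def corr_def S_zero L2.diff_left S_L2)

lemma quot_mult: "h > 0 \<Longrightarrow> u \<in> L2 M \<Longrightarrow> v \<in> L2 M \<Longrightarrow> h * quot h u v = I u v - I (Sg h u) v"
  by (simp add: quot_def L2.diff_left S_L2)

lemma bilinear_quot: "h > 0 \<Longrightarrow> bilinear_on (L2 M) (quot h)"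
proof unfold_locales
  assume h: "h > 0"
  show "L2 M \<noteq> {}" by (rule L2.nonempty)
  fix u v w :: "'a \<Rightarrow> real" and a b
  assume u: "u \<in> L2 M" and v: "v \<in> L2 M"
  show "(\<lambda>x. a * u x + b * v x) \<in> L2 M" using u v by (rule L2.lin)
  show "quot h u v = quot h v u" unfolding quot_def
    using u v h S_sym[of h u v] L2.sym[of "Sg h v" M u] L2.sym[OF u v] by (simp add: L2.diff_left S_L2)
  assume w: "w \<in> L2 M"
  have "I (\<lambda>x. (a * u x + b * v x) - Sg h (\<lambda>x. a * u x + b * v x) x) w
      = I (\<lambda>x. a * u x + b * v x) w - I (Sg h (\<lambda>x. a * u x + b * v x)) w"
    using u v w h by (intro L2.diff_left S_L2 L2.lin) auto
  also have "\<dots> = a * I (\<lambda>x. u x - Sg h u x) w + b * I (\<lambda>x. v x - Sg h v x) w"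
    using u v w h S_lin[of h u v w a b] by (simp add: L2.left L2.diff_left S_L2 algebra_simps)
  finally show "quot h (\<lambda>x. a * u x + b * v x) w = a * quot h u w + b * quot h v w"
    by (simp add: quot_def algebra_simps)
qed

lemma quot_nonneg:
  assumes u: "u \<in> L2 M" and h: "h > 0"
  shows "0 \<le> quot h u u"
proof -
  have "(I (Sg h u) u)\<^sup>2 \<le> I (Sg h u) (Sg h u) * I u u" using u h by (intro L2.Cauchy_Schwarz S_L2) auto
  also have "\<dots> \<le> I u u * I u u" using S_contr[of h u] u h by (intro mult_right_mono L2.nonneg) auto
  finally have "(I (Sg h u) u)\<^sup>2 \<le> (I u u)\<^sup>2" by (simp add: power2_eq_square)
  then have "I (Sg h u) u \<le> I u u" using L2.nonneg[OF u] by (rule power2_le_imp_le)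
  then show ?thesis using h u by (simp add: quot_diag corr_def S_zero)
qed

lemma F_iff: "u \<in> F \<longleftrightarrow> u \<in> L2 M \<and> (\<exists>l. ((\<lambda>t. quot t u u) \<longlongrightarrow> l) (at_right 0))"
  and quot_tendsto: "u \<in> F \<Longrightarrow> v \<in> F \<Longrightarrow> ((\<lambda>t. quot t u v) \<longlongrightarrow> E u v) (at_right 0)"
proof -
  have ev: "\<forall>\<^sub>F t in at_right 0. I (\<lambda>x. u x - T t u x) v / t = quot t u v" for u v
    by (auto simp: Sg_def quot_def eventually_at_right_field intro!: exI[of _ 1])
  have "F = {u \<in> L2 M. \<exists>l. ((\<lambda>t. I (\<lambda>x. u x - T t u x) u / t) \<longlongrightarrow> l) (at_right 0)}"
    using T by (simp add: semigroup_of_form_def)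
  then show "u \<in> F \<longleftrightarrow> u \<in> L2 M \<and> (\<exists>l. ((\<lambda>t. quot t u u) \<longlongrightarrow> l) (at_right 0))"
    using tendsto_cong[OF ev[of u u]] by auto
  show "u \<in> F \<Longrightarrow> v \<in> F \<Longrightarrow> ((\<lambda>t. quot t u v) \<longlongrightarrow> E u v) (at_right 0)"
  proof -
    assume "u \<in> F" "v \<in> F"
    then have "((\<lambda>t. I (\<lambda>x. u x - T t u x) v / t) \<longlongrightarrow> E u v) (at_right 0)"
      using T unfolding semigroup_of_form_def by blast
    then show "((\<lambda>t. quot t u v) \<longlongrightarrow> E u v) (at_right 0)" by (rule tendsto_cong[OF ev, THEN iffD1])
  qed
qed

lemma quot_mono: "u \<in> L2 M \<Longrightarrow> 0 < t \<Longrightarrow> t \<le> s \<Longrightarrow> quot s u u \<le> quot t u u"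
  using corr_slope by (simp add: quot_diag)

lemma quot_le:
  assumes u: "u \<in> F" and h: "h > 0"
  shows "quot h u u \<le> E u u"
  by (rule tendsto_lowerbound[OF quot_tendsto[OF u u]])
    (use h F_L2[OF u] in \<open>auto simp: eventually_at_right_field intro!: exI[of _ h] quot_mono\<close>)

lemma corr_S:
  assumes u: "u \<in> L2 M" and "\<tau> \<ge> 0" "h \<ge> 0"
  shows "corr (Sg \<tau> u) h = corr u (2 * \<tau> + h)"
proof -
  have "corr (Sg \<tau> u) h = I (Sg (h + \<tau>) u) (Sg \<tau> u)"
    using S_add[of h \<tau> u "Sg \<tau> u"] S_sym[of h "Sg \<tau> u" "Sg \<tau> u"] assms by (simp add: corr_def S_L2)
  also have "\<dots> = corr u (2 * \<tau> + h)"
    using S_add[of \<tau> "h + \<tau>" u u] assms by (simp add: corr_def algebra_simps)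
  finally show ?thesis .
qed

lemma quot_S_le:
  assumes u: "u \<in> L2 M" and "\<tau> \<ge> 0" "h > 0"
  shows "quot h (Sg \<tau> u) (Sg \<tau> u) \<le> quot h u u"
  using corr_decrement[OF u, of "2 * \<tau>" h] assms
  by (simp add: quot_diag S_L2 corr_S divide_right_mono)

text \<open>Decrements of a convex function shrink to the right, so the approximating forms of
  \<open>Sg \<tau> u\<close> lie below those of \<open>u\<close>; a bounded monotone family has a
  limit.\<close>

lemma S_F:
  assumes u: "u \<in> F" and t: "\<tau> \<ge> 0"
  shows "Sg \<tau> u \<in> F" "E (Sg \<tau> u) (Sg \<tau> u) \<le> E u u"
proof -
  have uL: "u \<in> L2 M" using u by (rule F_L2)
  have SL: "Sg \<tau> u \<in> L2 M" using t uL by (rule S_L2)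
  have le: "quot h (Sg \<tau> u) (Sg \<tau> u) \<le> E u u" if "h > 0" for h
    using quot_S_le[OF uL t that] quot_le[OF u that] by simp
  show *: "Sg \<tau> u \<in> F"
    unfolding F_iff using SL le quot_mono[OF SL] by (intro conjI antimono_bounded_at_right) auto
  show "E (Sg \<tau> u) (Sg \<tau> u) \<le> E u u"
    by (rule tendsto_upperbound[OF quot_tendsto[OF * *]])
      (use le in \<open>auto simp: eventually_at_right_field intro!: exI[of _ 1]\<close>)
qed

text \<open>Halving the step raises the approximating form by a square. The defect against the limit
  is then a sum of squares, to each of which contractivity applies.\<close>

lemma quot_halve:
  assumes u: "u \<in> L2 M" and h: "h > 0"
  shows "quot (h/2) u u - quot h u u = I (\<lambda>x. u x - Sg (h/2) u x) (\<lambda>x. u x - Sg (h/2) u x) / h"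
proof -
  have "corr u h = I (Sg (h/2) u) (Sg (h/2) u)"
    using S_add[of "h/2" "h/2" u u] h u by (simp add: corr_def)
  then have "I (\<lambda>x. u x - Sg (h/2) u x) (\<lambda>x. u x - Sg (h/2) u x) = corr u 0 - 2 * corr u (h/2) + corr u h"
    using h L2.sym[OF u S_L2[OF _ u], of "h/2"] L2.expand_diff[OF u S_L2[OF _ u], of "h/2"]
    by (simp add: corr_def S_zero)
  moreover have "quot (h/2) u u - quot h u u = (corr u 0 - 2 * corr u (h/2) + corr u h) / h"
    using h quot_diag[OF u, of h] quot_diag[OF u, of "h/2"] by (simp add: diff_divide_distrib add_divide_distrib)
  ultimately show ?thesis by simp
qed

text \<open>The error of the approximating form. Being nonnegative it has its own Cauchy-Schwarz
  inequality, so smallness in one argument is enough. The factor -1 fits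
  \<open>bilinear_on_combine\<close>.\<close>

definition "defect h u v = E u v + (- 1) * quot h u v"

lemma semi_inner_defect:
  assumes h: "h > 0"
  shows "semi_inner F (defect h)"
proof -
  interpret q: bilinear_on "L2 M" "quot h" by (rule bilinear_quot[OF h])
  interpret qF: bilinear_on F "quot h"
    by (rule q.subspace) (use F_L2 E.nonempty E.lin in auto)
  interpret d: bilinear_on F "defect h"
    unfolding defect_def by (rule bilinear_on_combine) unfold_locales
  show ?thesis by unfold_locales (simp add: defect_def quot_le h)
qed

text \<open>The errors at step \<open>h\<close> are sums over successive halvings; the semigroup
  commutes with the increments and contracts each of them.\<close>

lemma defect_S_le:
  assumes u: "u \<in> F" and t: "\<tau> \<ge> 0" and h: "h > 0"
  shows "defect h (Sg \<tau> u) (Sg \<tau> u) \<le> defect h u u"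
proof -
  let ?w = "Sg \<tau> u"
  have uL: "u \<in> L2 M" using u by (rule F_L2)
  have wF: "?w \<in> F" and wL: "?w \<in> L2 M" using S_F[OF u t] S_L2[OF t uL] by auto
  have half: "quot (h/2) ?w ?w - quot h ?w ?w \<le> quot (h/2) u u - quot h u u" if h: "h > 0" for h
  proof -
    let ?d = "\<lambda>x. u x - Sg (h/2) u x"
    have dL: "?d \<in> L2 M" using uL h by (intro L2.diff_in S_L2) auto
    \<comment> \<open>For \<open>Sg \<tau> u\<close> the halving increment is the square of
      \<open>Sg \<tau>\<close> applied to the increment of \<open>u\<close>.\<close>
    have "corr ?d (2 * \<tau>) = I (Sg \<tau> ?d) (Sg \<tau> ?d)" using S_add[of \<tau> \<tau> ?d ?d] t dL by (simp add: corr_def)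
    also have "\<dots> \<le> I ?d ?d" using t dL by (rule S_contr)
    finally have le: "corr ?d (2 * \<tau>) \<le> I ?d ?d" .
    have S2: "Sg (2 * \<tau>) u \<in> L2 M" "Sg (h/2) u \<in> L2 M" "Sg (2 * \<tau>) (Sg (h/2) u) \<in> L2 M"
      using t h uL by (auto intro!: S_L2)
    have "corr ?d (2 * \<tau>) = I (Sg (2 * \<tau>) u) ?d - I (Sg (2 * \<tau>) (Sg (h/2) u)) ?d"
      unfolding corr_def using t uL dL S2 by (intro S_diff) auto
    also have "\<dots> = I (Sg (2 * \<tau>) u) u - I (Sg (2 * \<tau>) u) (Sg (h/2) u)
        - I (Sg (2 * \<tau>) (Sg (h/2) u)) u + I (Sg (2 * \<tau>) (Sg (h/2) u)) (Sg (h/2) u)"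
      using S2 uL by (simp add: L2.diff_right)
    also have "I (Sg (2 * \<tau>) u) (Sg (h/2) u) = corr u (2 * \<tau> + h/2)"
      using S_add[of "h/2" "2 * \<tau>" u u] t h uL by (simp add: corr_def add.commute)
    also have "I (Sg (2 * \<tau>) (Sg (h/2) u)) u = corr u (2 * \<tau> + h/2)"
      using S_add[of "2 * \<tau>" "h/2" u u] S_sym[of "2 * \<tau>" "Sg (h/2) u" u] t h uL S2 by (simp add: corr_def)
    also have "I (Sg (2 * \<tau>) (Sg (h/2) u)) (Sg (h/2) u) = corr u (2 * \<tau> + h)"
      using corr_S[of u "h/2" "2 * \<tau>"] t h uL by (simp add: corr_def add.commute)
    also have "I (Sg (2 * \<tau>) u) u = corr u (2 * \<tau>)" by (simp add: corr_def)
    finally have "corr u (2 * \<tau>) - 2 * corr u (2 * \<tau> + h/2) + corr u (2 * \<tau> + h) \<le> I ?d ?d" using le by simp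
    moreover have "quot (h/2) ?w ?w - quot h ?w ?w
        = (corr u (2 * \<tau>) - 2 * corr u (2 * \<tau> + h/2) + corr u (2 * \<tau> + h)) / h"
      using h t wL uL by (simp add: quot_diag corr_S field_simps)
    ultimately show ?thesis unfolding quot_halve[OF uL h] using h by (simp add: divide_right_mono)
  qed
  \<comment> \<open>Telescoping; as \<open>n\<close> grows the steps tend to 0 and the left-hand
    terms become the full energies.\<close>
  have step: "quot (h / 2 ^ n) ?w ?w - quot h ?w ?w \<le> quot (h / 2 ^ n) u u - quot h u u" for n
  proof (induction n)
    case (Suc n)
    have eq: "h / 2 ^ Suc n = (h / 2 ^ n) / 2" by simp
    have "h / 2 ^ n > 0" using h by simp
    from half[OF this] Suc.IH show ?case unfolding eq by linarith
  qed simp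
  have "(\<lambda>n. h * inverse (2 ^ n)) \<longlonglongrightarrow> h * 0"
    by (intro tendsto_intros LIMSEQ_inverse_realpow_zero) simp
  then have fl: "filterlim (\<lambda>n. h / 2 ^ n) (at_right 0) sequentially"
    using h by (auto simp: filterlim_at divide_inverse)
  have lim: "(\<lambda>n. quot (h / 2 ^ n) v v) \<longlonglongrightarrow> E v v" if "v \<in> F" for v
    using filterlim_compose[OF quot_tendsto[OF that that] fl] .
  have "E ?w ?w - quot h ?w ?w \<le> E u u - quot h u u"
    by (rule LIMSEQ_le[OF tendsto_diff[OF lim[OF wF] tendsto_const] tendsto_diff[OF lim[OF u] tendsto_const]])
      (use step in auto)
  then show ?thesis by (simp add: defect_def)
qed

lemma defect_tendsto: "u \<in> F \<Longrightarrow> ((\<lambda>h. defect h u u) \<longlongrightarrow> 0) (at_right 0)"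
  unfolding defect_def using tendsto_diff[OF tendsto_const quot_tendsto, of u u "E u u"] by simp

lemma defect_le:
  assumes "p \<in> F" "q \<in> F" "h > 0" "defect h p p \<le> d" "E q q \<le> C"
  shows "\<bar>defect h p q\<bar> \<le> sqrt d * sqrt C"
proof -
  interpret d: semi_inner F "defect h" by (rule semi_inner_defect[OF assms(3)])
  have "defect h q q \<le> C" using quot_nonneg[OF F_L2[OF assms(2)] assms(3)] assms(5) by (simp add: defect_def)
  moreover have "0 \<le> d" using d.nonneg[OF assms(1)] assms(4) by simp
  ultimately show ?thesis
    using assms d.nonneg[OF assms(2)] by (intro order_trans[OF d.abs_le[OF assms(1,2)]] mult_mono) auto
qed

section \<open>Invariance of a set under the semigroup from symmetry of the restriction\<close>

context
  fixes A :: "'a set"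
  assumes A: "A \<in> sets M"
    and restr: "\<And>u. u \<in> F \<Longrightarrow> (\<lambda>x. indicator A x * u x) \<in> F"
    and E_sym: "\<And>u v. u \<in> F \<Longrightarrow> v \<in> F \<Longrightarrow> E (\<lambda>x. indicator A x * u x) v = E u (\<lambda>x. indicator A x * v x)"
    and E_le: "\<And>u. u \<in> F \<Longrightarrow> E (\<lambda>x. indicator A x * u x) (\<lambda>x. indicator A x * u x) \<le> E u u"
begin

abbreviation "pr u \<equiv> (\<lambda>x. indicator A x * u x :: real)"

lemma pr_L2: "u \<in> L2 M \<Longrightarrow> pr u \<in> L2 M"
  by (rule L2_bound[of _ M u]) (use A L2_meas[of u M] in \<open>auto intro!: borel_measurable_times borel_measurable_indicator simp: indicator_def\<close>)

lemma pr_sym: "I (pr u) v = I u (pr v)"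
  unfolding L2_inner_def by (simp add: mult_ac)

text \<open>
  Telescoping \<open>s \<mapsto> (pr (Sg s f), Sg (t - s) g)\<close> over a partition of mesh \<open>\<eta>\<close>: each step costs \<open>\<eta>\<close> times
  the defect of the approximating form at \<open>\<eta>\<close>, which does not increase along the semigroup.
\<close>

lemma commute_F:
  assumes f: "f \<in> F" and g: "g \<in> F" and t: "t > 0"
  shows "I (pr (Sg t f)) g = I (pr f) (Sg t g)"
proof -
  have fL: "f \<in> L2 M" and gL: "g \<in> L2 M" using f g F_L2 by auto
  define \<Phi> where "\<Phi> s = I (pr (Sg s f)) (Sg (t - s) g)" for s
  define err where "err \<eta> = sqrt (defect \<eta> f f) * sqrt (E g g) + sqrt (defect \<eta> g g) * sqrt (E f f)" for \<eta>
  have step: "\<bar>\<Phi> (s + \<eta>) - \<Phi> s\<bar> \<le> \<eta> * err \<eta>" if s: "0 \<le> s" "s + \<eta> \<le> t" and h: "\<eta> > 0" for s \<eta>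
  proof -
    let ?p = "Sg s f" and ?q = "Sg (t - (s + \<eta>)) g"
    have p: "?p \<in> F" "E ?p ?p \<le> E f f" and q: "?q \<in> F" "E ?q ?q \<le> E g g"
      using S_F[OF f, of s] S_F[OF g, of "t - (s + \<eta>)"] s by auto
    have pL: "?p \<in> L2 M" and qL: "?q \<in> L2 M" using p q F_L2 by auto
    have 1: "\<Phi> (s + \<eta>) = I (Sg \<eta> ?p) (pr ?q)"
    proof -
      have "\<Phi> (s + \<eta>) = I (Sg (s + \<eta>) f) (pr ?q)" unfolding \<Phi>_def by (rule pr_sym)
      also have "\<dots> = I (Sg s f) (Sg \<eta> (pr ?q))" using S_add[of \<eta> s f "pr ?q"] s h fL qL pr_L2 by (simp add: add.commute)
      also have "\<dots> = I (Sg \<eta> ?p) (pr ?q)" using S_sym[of \<eta> ?p "pr ?q"] h pL qL pr_L2 by simp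
      finally show ?thesis .
    qed
    have 2: "\<Phi> s = I (Sg \<eta> ?q) (pr ?p)"
    proof -
      have "\<Phi> s = I (Sg (\<eta> + (t - (s + \<eta>))) g) (pr ?p)"
        unfolding \<Phi>_def using s h fL gL pr_L2 pL by (simp add: L2.sym S_L2)
      also have "\<dots> = I ?q (Sg \<eta> (pr ?p))" using s h gL pr_L2 pL by (intro S_add) auto
      also have "\<dots> = I (Sg \<eta> ?q) (pr ?p)" using S_sym[of \<eta> ?q "pr ?p"] h pL qL pr_L2 by simp
      finally show ?thesis .
    qed
    have 3: "I ?p (pr ?q) = I ?q (pr ?p)" using pr_sym[of ?p ?q] L2.sym[of "pr ?p" M ?q] pL qL pr_L2 by simp
    have "\<Phi> (s + \<eta>) - \<Phi> s = \<eta> * (quot \<eta> ?q (pr ?p) - quot \<eta> ?p (pr ?q))"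
      unfolding 1 2 right_diff_distrib quot_mult[OF h qL pr_L2[OF pL]] quot_mult[OF h pL pr_L2[OF qL]] 3 by simp
    \<comment> \<open>The exact energies cancel by symmetry of the restriction; only the errors
      remain.\<close>
    also have "quot \<eta> ?q (pr ?p) - quot \<eta> ?p (pr ?q) = defect \<eta> ?p (pr ?q) - defect \<eta> ?q (pr ?p)"
      using E_sym[OF p(1) q(1)] E.sym[OF restr[OF p(1)] q(1)] by (simp add: defect_def)
    finally have eq: "\<Phi> (s + \<eta>) - \<Phi> s = \<eta> * (defect \<eta> ?p (pr ?q) - defect \<eta> ?q (pr ?p))" .
    have "\<bar>defect \<eta> ?p (pr ?q)\<bar> \<le> sqrt (defect \<eta> f f) * sqrt (E g g)"
      using s h by (intro defect_le p restr q defect_S_le f order_trans[OF E_le q(2)]) auto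
    moreover have "\<bar>defect \<eta> ?q (pr ?p)\<bar> \<le> sqrt (defect \<eta> g g) * sqrt (E f f)"
      using s h by (intro defect_le p restr q defect_S_le g order_trans[OF E_le p(2)]) auto
    ultimately have "\<bar>defect \<eta> ?p (pr ?q) - defect \<eta> ?q (pr ?p)\<bar> \<le> err \<eta>" unfolding err_def by linarith
    then show ?thesis unfolding eq abs_mult using h by simp
  qed
  have sum: "\<bar>\<Phi> (real k * \<eta>) - \<Phi> 0\<bar> \<le> real k * (\<eta> * err \<eta>)" if h: "\<eta> > 0" and "real k * \<eta> \<le> t" for k \<eta>
    using that(2)
  proof (induction k)
    case (Suc k)
    have e: "real (Suc k) * \<eta> = real k * \<eta> + \<eta>" by (simp add: algebra_simps)
    have "\<bar>\<Phi> (real k * \<eta> + \<eta>) - \<Phi> (real k * \<eta>)\<bar> \<le> \<eta> * err \<eta>"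
      using Suc.prems h unfolding e by (intro step) auto
    moreover have "\<bar>\<Phi> (real k * \<eta>) - \<Phi> 0\<bar> \<le> real k * (\<eta> * err \<eta>)" using Suc h unfolding e by simp
    ultimately show ?case unfolding e by (simp add: algebra_simps)
  qed simp
  have le: "\<bar>\<Phi> t - \<Phi> 0\<bar> \<le> t * err (t / real (Suc n))" for n
    using sum[of "t / real (Suc n)" "Suc n"] t by simp
  have "(\<lambda>n. t * inverse (real (Suc n))) \<longlonglongrightarrow> t * 0"
    by (intro tendsto_intros LIMSEQ_inverse_real_of_nat)
  then have fl: "filterlim (\<lambda>n. t / real (Suc n)) (at_right 0) sequentially"
    using t by (auto simp: filterlim_at divide_inverse)
  have "((\<lambda>\<eta>. t * err \<eta>) \<longlongrightarrow> t * (sqrt 0 * sqrt (E g g) + sqrt 0 * sqrt (E f f))) (at_right 0)"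
    unfolding err_def by (intro tendsto_intros defect_tendsto f g)
  then have "((\<lambda>\<eta>. t * err \<eta>) \<longlongrightarrow> 0) (at_right 0)" by simp
  from filterlim_compose[OF this fl] have "(\<lambda>n. t * err (t / real (Suc n))) \<longlonglongrightarrow> 0" .
  then have "\<bar>\<Phi> t - \<Phi> 0\<bar> \<le> 0" using le by (intro LIMSEQ_le_const) auto
  then show ?thesis by (simp add: \<Phi>_def S_zero)
qed

text \<open>Commutation is known between elements of \<open>F\<close> only. Two density arguments
  extend it, one for each argument.\<close>

lemma invariant: "invariant_set m T A"
  unfolding invariant_set_def
proof (intro conjI allI impI ballI)
  show "A \<in> sets M" by (rule A)
  fix t :: real and f assume t: "t > 0" and f: "f \<in> L2 M"
  have St: "Sg t = T t" using t by (simp add: Sg_def fun_eq_iff)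
  have FL2: "F \<subseteq> L2 M" using F_L2 by blast
  let ?w = "\<lambda>f x. T t (pr f) x - pr (T t f) x"
  have TL: "T t f \<in> L2 M" if "f \<in> L2 M" for f using S_L2[of t f] t that by (simp add: St)
  have wL: "?w f \<in> L2 M" if "f \<in> L2 M" for f using that by (intro L2.diff_in TL pr_L2)
  have I_w: "I (?w f) g = I (pr f) (T t g) - I (pr (T t f)) g" if "f \<in> L2 M" "g \<in> L2 M" for f g
    using that S_sym[of t "pr f" g] t by (simp add: L2.diff_left TL pr_L2 St)
  have orth: "I (?w f) g = 0" if g: "g \<in> F" for g
  proof -
    \<comment> \<open>The commutator transferred to \<open>g\<close>. It vanishes because it is
      orthogonal to the dense set \<open>F\<close>, and only then may \<open>f\<close> be
      arbitrary.\<close>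
    define z where "z x = pr (T t g) x - T t (pr g) x" for x
    have zL: "z \<in> L2 M" unfolding z_def using F_L2[OF g] by (intro L2.diff_in TL pr_L2)
    have Iz: "I f' z = I (?w f') g" if f': "f' \<in> L2 M" for f'
    proof -
      have "I f' z = I f' (pr (T t g)) - I f' (T t (pr g))"
        unfolding z_def using f' F_L2[OF g] by (intro L2.diff_right TL pr_L2)
      also have "I f' (T t (pr g)) = I (T t f') (pr g)"
        using S_sym[of t f' "pr g"] t f' F_L2[OF g] pr_L2 by (simp add: St)
      finally show ?thesis unfolding I_w[OF f' F_L2[OF g]] by (simp add: pr_sym)
    qed
    have "I z k = 0" if k: "k \<in> F" for k
    proof -
      have "I z k = I k z" using zL F_L2[OF k] by (rule L2.sym)
      also have "\<dots> = I (?w k) g" using F_L2[OF k] by (rule Iz)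
      also have "\<dots> = 0" unfolding I_w[OF F_L2[OF k] F_L2[OF g]] using commute_F[OF k g t] by (simp add: St)
      finally show ?thesis .
    qed
    then have z0: "AE x in M. z x = 0" by (rule L2_dense_orthogonal[OF F_dense FL2 zL])
    have "I f z = I f (\<lambda>x. 0)" by (rule L2_inner_cong_AE) (use z0 f zL L2_meas in auto)
    then show ?thesis using Iz[OF f] L2.zero_right[OF f] by simp
  qed
  have "AE x in M. ?w f x = 0"
    by (rule L2_dense_orthogonal[OF F_dense FL2 wL[OF f] orth])
  then show "AE x in m. T t (pr f) x = pr (T t f) x"
    unfolding AE_completion_iff by eventually_elim simp
qed

end
end

text \<open>Every positive level leaves \<open>h\<close> a.e. on one of its sides. The constant is
  the supremum of the levels below \<open>h\<close>.\<close>

lemma null_energy_constant: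
  assumes irr: "irreducible_form m E F" and h: "h \<in> X" and h0: "\<And>x. 0 \<le> h x" and h1: "\<And>x. h x \<le> 1"
    and z: "ext h h = 0"
  shows "\<exists>c. AE x in m. h x = c"
proof -
  obtain T where T: "semigroup_of_form m E F T"
    and triv: "\<And>A. invariant_set m T A \<Longrightarrow> A \<in> null_sets M \<or> space m - A \<in> null_sets M"
    using irr unfolding irreducible_form_def by blast
  have level: "(AE x in m. h x \<le> c) \<or> (AE x in m. c \<le> h x)" if c: "c > 0" for c
  proof -
    define A where "A = {x. c < h x}"
    note * = level_set_sets[OF h h0 z c A_def] level_set_restrict_in[OF h h0 z c A_def]
      level_set_sym[OF h h0 z c A_def]
    have "invariant_set m T A" by (rule invariant[OF T *(1)]) (use * in auto)
    from triv[OF this] show ?thesis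
    proof
      assume "A \<in> null_sets M"
      then have "AE x in M. x \<notin> A" by (rule AE_not_in)
      then have "AE x in m. h x \<le> c" unfolding AE_completion_iff A_def by (auto elim!: eventually_mono)
      then show ?thesis ..
    next
      assume "space m - A \<in> null_sets M"
      then have "AE x in M. x \<notin> space m - A" by (rule AE_not_in)
      then have "AE x in m. c \<le> h x" unfolding AE_completion_iff A_def space_eq by (auto elim!: eventually_mono)
      then show ?thesis ..
    qed
  qed
  define Q where "Q = {c. 0 \<le> c \<and> c \<le> 1 \<and> (AE x in m. c \<le> h x)}"
  have Q0: "0 \<in> Q" using h0 by (simp add: Q_def)
  have bQ: "bdd_above Q" by (rule bdd_aboveI[of _ 1]) (simp add: Q_def)
  define k where "k = Sup Q"
  have k0: "0 \<le> k" unfolding k_def using Q0 bQ by (rule cSup_upper)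
  have lower: "AE x in m. k - inverse (real (Suc n)) \<le> h x" for n
  proof -
    have "k - inverse (real (Suc n)) < k" by simp
    then obtain c where "c \<in> Q" "k - inverse (real (Suc n)) < c"
      unfolding k_def using less_cSup_iff[OF _ bQ] Q0 by blast
    then show ?thesis unfolding Q_def by (auto elim!: eventually_mono)
  qed
  have upper: "AE x in m. h x \<le> k + inverse (real (Suc n))" for n
  proof (rule ccontr)
    let ?c = "k + inverse (real (Suc n))"
    assume neg: "\<not> ?thesis"
    have c: "?c > 0" using k0 by (simp add: add_nonneg_pos)
    then have 1: "AE x in m. ?c \<le> h x" using level[OF c] neg by blast
    \<comment> \<open>A level above 1 would dominate \<open>h\<close> outright, so \<open>?c\<close>
      is admissible in the supremum.\<close>
    have "?c \<le> 1"
    proof (rule ccontr)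
      assume "\<not> ?c \<le> 1"
      then have "AE x in m. h x \<le> ?c" using h1 by (intro always_eventually allI) (meson le_cases order_trans)
      with neg show False by blast
    qed
    with 1 c have "?c \<in> Q" by (simp add: Q_def)
    then have "?c \<le> k" unfolding k_def using bQ by (rule cSup_upper)
    then show False by simp
  qed
  have "AE x in m. h x = k"
  proof -
    have "AE x in m. \<forall>n. \<bar>h x - k\<bar> \<le> inverse (real (Suc n))"
      unfolding AE_all_countable
    proof
      fix n show "AE x in m. \<bar>h x - k\<bar> \<le> inverse (real (Suc n))"
        using lower[of n] upper[of n] by eventually_elim (simp add: abs_le_iff)
    qed
    then show ?thesis
    proof eventually_elim
      case (elim x)
      then have "\<bar>h x - k\<bar> \<le> 0" by (intro LIMSEQ_le_const[OF LIMSEQ_inverse_real_of_nat]) auto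
      then show ?case by simp
    qed
  qed
  then show ?thesis by blast
qed

end

section \<open>Small open sets and quasi-continuity\<close>

lemma borel_measurable_completion_AE:
  assumes g: "g \<in> borel_measurable N" and eq: "AE x in N. g x = f x"
  shows "f \<in> borel_measurable (completion N)"
proof (rule measurableI)
  fix B :: "'b set" assume B: "B \<in> sets borel"
  have meas: "g -` B \<inter> space N \<in> sets (completion N)" using measurable_sets[OF g B] by simp
  have ae: "AE x in completion N. x \<in> g -` B \<inter> space N \<longleftrightarrow> x \<in> f -` B \<inter> space N"
    unfolding AE_completion_iff using eq by eventually_elim simp
  have "f -` B \<inter> space N \<in> sets (completion N)"
    by (rule completion.in_sets_AE[OF ae meas]) simp
  then show "f -` B \<inter> space (completion N) \<in> sets (completion N)" by simp
qed simp

lemma (in semi_inner) norm_sum_le: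
  assumes "finite J" "\<And>n. w n \<in> V" "\<And>n. sqrt (B (w n) (w n)) \<le> e n"
  shows "sqrt (B (\<lambda>x. \<Sum>n\<in>J. w n x) (\<lambda>x. \<Sum>n\<in>J. w n x)) \<le> sum e J"
  using assms(1)
proof (induction J rule: finite_induct)
  case empty
  then show ?case using zero_left[OF zero_in] by simp
next
  case (insert n J)
  have "sqrt (B (\<lambda>x. w n x + (\<Sum>n\<in>J. w n x)) (\<lambda>x. w n x + (\<Sum>n\<in>J. w n x)))
      \<le> sqrt (B (w n) (w n)) + sqrt (B (\<lambda>x. \<Sum>n\<in>J. w n x) (\<lambda>x. \<Sum>n\<in>J. w n x))"
    using assms by (intro triangle sum_in) auto
  then show ?case using insert assms(3)[of n] by simp
qed

lemma (in semi_inner) partial_sums_cauchy: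
  assumes w: "\<And>n. w n \<in> V" and le: "\<And>n. sqrt (B (w n) (w n)) \<le> e n" and sum: "summable e"
  shows "form_cauchy B (\<lambda>N x. \<Sum>n<N. w n x)"
  unfolding form_cauchy_def
proof (intro allI impI)
  fix d :: real assume d: "d > 0"
  then have "sqrt d > 0" by simp
  then obtain N where N: "\<And>m n. m \<ge> N \<Longrightarrow> norm (sum e {m..<n}) < sqrt d"
    using sum unfolding summable_Cauchy by meson
  have P: "(\<lambda>x. \<Sum>n<i. w n x) \<in> V" for i using w by (intro sum_in)
  have *: "form_dist2 B (\<lambda>x. \<Sum>n<j. w n x) (\<lambda>x. \<Sum>n<i. w n x) < d" if "N \<le> i" "i \<le> j" for i j
  proof -
    have eq: "(\<lambda>x. (\<Sum>n<j. w n x) - (\<Sum>n<i. w n x)) = (\<lambda>x. \<Sum>n\<in>{i..<j}. w n x)"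
      using that by (intro ext) (simp add: lessThan_atLeast0 sum_diff_nat_ivl)
    have "sqrt (B (\<lambda>x. \<Sum>n\<in>{i..<j}. w n x) (\<lambda>x. \<Sum>n\<in>{i..<j}. w n x)) \<le> sum e {i..<j}"
      by (rule norm_sum_le[OF _ w le]) simp
    moreover have "sum e {i..<j} < sqrt d" using N[OF that(1), of j] by (simp add: abs_less_iff)
    ultimately have "sqrt (B (\<lambda>x. \<Sum>n\<in>{i..<j}. w n x) (\<lambda>x. \<Sum>n\<in>{i..<j}. w n x)) < sqrt d"
      by (rule order_le_less_trans)
    with eq show ?thesis by (simp add: form_dist2_def)
  qed
  show "\<exists>N. \<forall>i\<ge>N. \<forall>j\<ge>N. form_dist2 B (\<lambda>x. \<Sum>n<i. w n x) (\<lambda>x. \<Sum>n<j. w n x) < d"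
  proof (intro exI allI impI)
    fix i j assume "N \<le> i" "N \<le> j"
    then show "form_dist2 B (\<lambda>x. \<Sum>n<i. w n x) (\<lambda>x. \<Sum>n<j. w n x) < d"
      using *[of i j] *[of j i] dist2_sym[OF P P, of i j] by (cases "i \<le> j") auto
  qed
qed

text \<open>The halved balls still cover. The gap leaves room for a compactly supported bump that is
  bounded below on the smaller ball.\<close>

lemma compact_ball_cover:
  assumes "locally compact (UNIV :: 'a::{metric_space, second_countable_topology} set)"
  shows "\<exists>(c :: nat \<Rightarrow> 'a) r. (\<forall>n. r n > 0 \<and> compact (cball (c n) (r n))) \<and> (\<Union>n. ball (c n) (r n / 2)) = UNIV"
proof -
  have "\<exists>r>0. compact (cball x r)" for x :: 'a
  proof -
    obtain u v where uv: "open u" "compact v" "x \<in> u" "u \<subseteq> v"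
      using assms unfolding locally_def by (metis UNIV_I subtopology_UNIV open_openin open_UNIV)
    obtain e where e: "e > 0" "ball x e \<subseteq> u" using uv openE by blast
    have "cball x (e / 2) \<subseteq> ball x e" using e by auto
    then have "cball x (e / 2) \<subseteq> v" using e uv by blast
    then have "compact (cball x (e / 2))" using uv(2) by (metis closed_cball compact_Int_closed inf.absorb_iff2)
    then show ?thesis using e by (intro exI[of _ "e / 2"]) simp
  qed
  then obtain \<rho> where \<rho>: "\<And>x :: 'a. \<rho> x > 0" "\<And>x. compact (cball x (\<rho> x))" by metis
  obtain \<F>' where F': "\<F>' \<subseteq> range (\<lambda>x. ball x (\<rho> x / 2))" "countable \<F>'" "\<Union>\<F>' = (\<Union>x. ball x (\<rho> x / 2))"
    using Lindelof[of "range (\<lambda>x. ball x (\<rho> x / 2))"] by auto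
  then obtain C where C: "countable C" "\<F>' = (\<lambda>x. ball x (\<rho> x / 2)) ` C"
    using countable_subset_image[of \<F>' "\<lambda>x. ball x (\<rho> x / 2)" UNIV] by auto
  have "x \<in> (\<Union>x. ball x (\<rho> x / 2))" for x using \<rho>(1)[of x] by (intro UN_I[of x]) auto
  then have cov: "(\<Union>x\<in>C. ball x (\<rho> x / 2)) = UNIV" using F'(3) C(2) by auto
  then have ne: "C \<noteq> {}" by auto
  have "(\<Union>n. ball (from_nat_into C n) (\<rho> (from_nat_into C n) / 2)) = (\<Union>x\<in>range (from_nat_into C). ball x (\<rho> x / 2))"
    by blast
  then have "(\<Union>n. ball (from_nat_into C n) (\<rho> (from_nat_into C n) / 2)) = UNIV"
    using cov range_from_nat_into[OF ne C(1)] by simp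
  then show ?thesis
    using \<rho> by (intro exI[of _ "from_nat_into C"] exI[of _ "\<lambda>n. \<rho> (from_nat_into C n)"]) blast
qed

lemma radon_sigma_finite:
  fixes N :: "'a::{metric_space, second_countable_topology} measure"
  assumes "locally compact (UNIV :: 'a::{metric_space, second_countable_topology} set)" "radon_measure N"
  shows "sigma_finite_measure N"
proof -
  obtain c :: "nat \<Rightarrow> 'a" and r where "(\<forall>n. r n > 0 \<and> compact (cball (c n) (r n))) \<and> (\<Union>n. ball (c n) (r n / 2)) = UNIV"
    using compact_ball_cover[OF assms(1)] by blast
  then have cr: "\<And>n. r n > 0" "\<And>n. compact (cball (c n) (r n))" "(\<Union>n. ball (c n) (r n / 2)) = UNIV"
    by auto
  have sN: "sets N = sets borel" and fin: "\<And>K. compact K \<Longrightarrow> emeasure N K < \<infinity>"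
    using assms(2) by (auto simp: radon_measure_def)
  have "space N = UNIV" using sets_eq_imp_space_eq[OF sN] by simp
  moreover have "x \<in> (\<Union>n. cball (c n) (r n))" for x
  proof -
    have "x \<in> (\<Union>n. ball (c n) (r n / 2))" using cr(3) by simp
    then obtain n where "dist (c n) x < r n / 2" by auto
    then show ?thesis using cr(1)[of n] by (intro UN_I[of n]) auto
  qed
  ultimately show ?thesis
    using fin cr(2) by unfold_locales (auto intro!: exI[of _ "range (\<lambda>n. cball (c n) (r n))"] simp: sN less_top[symmetric])
qed

lemma CcD: "f \<in> Cc \<Longrightarrow> continuous_on S f"
  by (auto simp: Cc_def intro: continuous_on_subset)

lemma Cc_comp2:
  assumes f: "f \<in> Cc" and g: "continuous_on UNIV g" and h: "\<And>S. continuous_on S f \<Longrightarrow> continuous_on S g \<Longrightarrow> continuous_on S (\<lambda>x. h (f x) (g x))"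
    and z: "\<And>x. f x = 0 \<Longrightarrow> h 0 (g x) = 0"
  shows "(\<lambda>x. h (f x) (g x)) \<in> Cc"
proof -
  obtain K where "compact K" "\<And>x. x \<notin> K \<Longrightarrow> f x = 0" using f by (auto simp: Cc_def)
  then show ?thesis using h[of UNIV] f g z unfolding Cc_def by auto
qed

lemma Cc_pos: "f \<in> Cc \<Longrightarrow> (\<lambda>x. max 0 (f x)) \<in> Cc"
  by (rule Cc_comp2[of f "\<lambda>x. 0" "\<lambda>a b. max b a"]) (auto intro!: continuous_intros)

locale regular_dirichlet = dirichlet m E F
  for m :: "'a::{metric_space, second_countable_topology} measure" and E F +
  assumes regular: "regular_form m E F" and loc_compact: "locally compact (UNIV :: 'a::{metric_space, second_countable_topology} set)"
    and radon: "radon_measure m"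
begin

lemma sets_m: "sets m = sets borel"
  using radon by (simp add: radon_measure_def)

lemma Cc_dense: "u \<in> F \<Longrightarrow> e > 0 \<Longrightarrow> \<exists>f\<in>F \<inter> Cc. form_dist2 E1 u f < e"
  using regular unfolding regular_form_def by blast

lemma Cc_uniform: "g \<in> Cc \<Longrightarrow> e > 0 \<Longrightarrow> \<exists>f\<in>F \<inter> Cc. \<forall>x. \<bar>g x - f x\<bar> < e"
  using regular unfolding regular_form_def by blast

text \<open>Countably many bumps in \<open>F\<close> cover the space; small weights make their sum
  converge uniformly and for \<open>E1\<close> at once.\<close>

lemma reference_exists: "\<exists>\<psi>\<in>F. continuous_on UNIV \<psi> \<and> (\<forall>x. 0 < \<psi> x \<and> \<psi> x \<le> 1)"
proof -
  obtain c :: "nat \<Rightarrow> 'a" and r where "(\<forall>n. r n > 0 \<and> compact (cball (c n) (r n))) \<and> (\<Union>n. ball (c n) (r n / 2)) = UNIV"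
    using compact_ball_cover[OF loc_compact] by blast
  then have cr: "\<And>n. r n > 0" "\<And>n. compact (cball (c n) (r n))" "(\<Union>n. ball (c n) (r n / 2)) = UNIV"
    by auto
  have "\<exists>p\<in>F \<inter> Cc. (\<forall>x. 0 \<le> p x) \<and> (\<forall>x\<in>ball (c n) (r n / 2). 0 < p x)" for n
  proof -
    define g where "g y = max 0 (r n - dist (c n) y)" for y
    have "g \<in> Cc"
      unfolding Cc_def g_def using cr(2)[of n]
      by (auto intro!: continuous_intros exI[of _ "cball (c n) (r n)"])
    \<comment> \<open>The bump exceeds \<open>r n / 2\<close> on the halved ball, so this tolerance
      keeps \<open>f\<close> above \<open>r n / 4\<close> there.\<close>
    then obtain f where f: "f \<in> F \<inter> Cc" "\<And>x. \<bar>g x - f x\<bar> < r n / 4" using Cc_uniform[of g "r n / 4"] cr(1)[of n] by auto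
    have "(\<lambda>x. max 0 (f x)) \<in> F \<inter> Cc"
      using f(1) by (auto intro: E.pos_in Cc_pos)
    moreover have "0 < max 0 (f x)" if "x \<in> ball (c n) (r n / 2)" for x
    proof -
      have "g x > r n / 2" using that by (simp add: g_def less_max_iff_disj)
      then have "f x > r n / 4" using f(2)[of x] by linarith
      then show ?thesis using cr(1)[of n] by simp
    qed
    ultimately show ?thesis by (intro bexI[of _ "\<lambda>x. max 0 (f x)"]) auto
  qed
  then obtain p where p: "\<And>n. p n \<in> F" "\<And>n. p n \<in> Cc" "\<And>n x. 0 \<le> p n x" "\<And>n x. x \<in> ball (c n) (r n / 2) \<Longrightarrow> 0 < p n x"
    by (metis IntD1 IntD2)
  have "\<exists>b\<ge>0. \<forall>x. p n x \<le> b" for n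
  proof -
    obtain K where K: "compact K" "\<And>x. x \<notin> K \<Longrightarrow> p n x = 0" using p(2)[of n] by (auto simp: Cc_def)
    have "compact (p n ` K)" using K(1) CcD[OF p(2)] by (intro compact_continuous_image)
    then obtain b where b: "\<And>x. x \<in> K \<Longrightarrow> \<bar>p n x\<bar> \<le> b"
      using compact_imp_bounded[of "p n ` K"] by (auto simp: bounded_iff)
    have "p n x \<le> max 0 b" for x using K(2)[of x] b[of x] by (cases "x \<in> K") auto
    then show ?thesis by (intro exI[of _ "max 0 b"]) auto
  qed
  then obtain b where b: "\<And>n. b n \<ge> 0" "\<And>n x. p n x \<le> b n" by metis
  \<comment> \<open>Normalises the supremum and the \<open>E1\<close> norm together. The weights sum
    to 1, which gives the upper bound 1 on the series.\<close>
  define D where "D n = 1 + b n + sqrt (E1 (p n) (p n))" for n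
  have D: "D n > 0" for n using b(1)[of n] E1.nonneg[OF p(1), of n] by (simp add: D_def add_pos_nonneg)
  define w where "w n = (\<lambda>x. ((1/2) ^ Suc n / D n) * p n x)" for n
  have w: "w n \<in> F" for n unfolding w_def using p(1) by (rule E.scale_in)
  have w0: "0 \<le> w n x" for n x using p(3) D[of n] by (simp add: w_def)
  have wle: "w n x \<le> (1/2) ^ Suc n" for n x
  proof -
    have "p n x \<le> D n" using b[of n] E1.nonneg[OF p(1), of n] by (simp add: D_def add_increasing2 b(2) order_trans[OF b(2)])
    then have "(1/2) ^ Suc n / D n * p n x \<le> (1/2) ^ Suc n / D n * D n" using D[of n] by (intro mult_left_mono) auto
    then show ?thesis using D[of n] by (simp add: w_def)
  qed
  have wn: "sqrt (E1 (w n) (w n)) \<le> (1/2) ^ Suc n" for n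
  proof -
    have "sqrt (E1 (w n) (w n)) = ((1/2) ^ Suc n / D n) * sqrt (E1 (p n) (p n))"
      unfolding w_def E1.expand_scale[OF p(1)] using D[of n] by (simp add: real_sqrt_mult)
    also have "\<dots> \<le> ((1/2) ^ Suc n / D n) * D n"
      using D[of n] b(1)[of n] by (intro mult_left_mono) (auto simp: D_def)
    finally show ?thesis using D[of n] by simp
  qed
  have geo: "(\<lambda>n. (1/2::real) ^ Suc n) sums 1" using power_half_series by simp
  define \<psi> where "\<psi> x = (\<Sum>n. w n x)" for x
  have summ: "summable (\<lambda>n. w n x)" for x
    by (rule summable_comparison_test'[OF sums_summable[OF geo], of 0]) (use w0 wle in auto)
  have unif: "uniform_limit UNIV (\<lambda>N x. \<Sum>n<N. w n x) \<psi> sequentially"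
    unfolding \<psi>_def by (rule Weierstrass_m_test[OF _ sums_summable[OF geo]]) (use w0 wle in auto)
  have cw: "continuous_on UNIV (w n)" for n
    unfolding w_def using CcD[OF p(2)] by (intro continuous_intros)
  have cont: "continuous_on UNIV \<psi>"
    by (rule uniform_limit_theorem[OF _ unif]) (use cw in \<open>auto intro!: always_eventually continuous_on_sum\<close>)
  have "\<psi> x > 0" for x
  proof -
    have "x \<in> (\<Union>n. ball (c n) (r n / 2))" using cr(3) by simp
    then obtain n where "x \<in> ball (c n) (r n / 2)" by blast
    then have "0 < w n x" using p(4) D[of n] by (simp add: w_def)
    then show ?thesis unfolding \<psi>_def by (intro suminf_pos2[OF summ w0])
  qed
  moreover have "\<psi> x \<le> 1" for x
    unfolding \<psi>_def using suminf_le[OF wle summ sums_summable[OF geo]] sums_unique[OF geo] by simp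
  moreover have "\<psi> \<in> F"
  proof (rule F_closed_AE(1))
    show "(\<lambda>x. \<Sum>n<N. w n x) \<in> F" for N using w by (intro E.sum_in)
    show "form_cauchy E1 (\<lambda>N x. \<Sum>n<N. w n x)" by (rule E1.partial_sums_cauchy[OF w wn sums_summable[OF geo]])
    show "AE x in m. (\<lambda>N. \<Sum>n<N. w n x) \<longlonglongrightarrow> \<psi> x"
      unfolding \<psi>_def using summable_LIMSEQ[OF summ] by simp
    have "\<psi> \<in> borel_measurable m"
      using borel_measurable_continuous_onI[OF cont] measurable_cong_sets[OF sets_m refl] by auto
    then show "\<psi> \<in> borel_measurable M" by (rule measurable_completion)
  qed
  ultimately show ?thesis using cont by blast
qed

definition \<psi> :: "'a \<Rightarrow> real" where
  "\<psi> = (SOME \<psi>. \<psi> \<in> F \<and> continuous_on UNIV \<psi> \<and> (\<forall>x. 0 < \<psi> x \<and> \<psi> x \<le> 1))"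

lemma \<psi>: "\<psi> \<in> F" "continuous_on S \<psi>" "0 < \<psi> x" "\<psi> x \<le> 1"
proof -
  have *: "\<psi> \<in> F \<and> continuous_on UNIV \<psi> \<and> (\<forall>x. 0 < \<psi> x \<and> \<psi> x \<le> 1)"
    unfolding \<psi>_def using reference_exists by (intro someI_ex[of "\<lambda>\<psi>. \<psi> \<in> F \<and> continuous_on UNIV \<psi> \<and> (\<forall>x. 0 < \<psi> x \<and> \<psi> x \<le> 1)"]) blast
  then show "\<psi> \<in> F" "0 < \<psi> x" "\<psi> x \<le> 1" by auto
  show "continuous_on S \<psi>" using * continuous_on_subset by blast
qed

lemma Cc_le_ref:
  assumes f: "f \<in> Cc"
  obtains M where "M \<ge> 0" "\<And>x. \<bar>f x\<bar> \<le> M * \<psi> x"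
proof -
  obtain K where K: "compact K" "\<And>x. x \<notin> K \<Longrightarrow> f x = 0" using f by (auto simp: Cc_def)
  have "compact ((\<lambda>x. f x / \<psi> x) ` K)"
    using K(1) CcD[OF f] \<psi>(2,3) by (intro compact_continuous_image continuous_intros) (auto simp: less_le)
  then obtain b where b: "\<And>x. x \<in> K \<Longrightarrow> \<bar>f x / \<psi> x\<bar> \<le> b"
    using compact_imp_bounded by (fastforce simp: bounded_iff)
  have "\<bar>f x\<bar> \<le> max 0 b * \<psi> x" for x
  proof (cases "x \<in> K")
    case True
    then have "\<bar>f x\<bar> / \<psi> x \<le> b" using b[of x] \<psi>(3)[of x] by (simp add: abs_divide)
    then have "\<bar>f x\<bar> \<le> b * \<psi> x" using \<psi>(3)[of x] by (simp add: field_simps)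
    also have "\<dots> \<le> max 0 b * \<psi> x" using \<psi>(3)[of x] by (intro mult_right_mono) auto
    finally show ?thesis .
  qed (use K(2)[of x] \<psi>(3)[of x] in auto)
  then show ?thesis using that[of "max 0 b"] by simp
qed

text \<open>
  Capacity with the weight \<open>\<psi>\<close> in place of the constant 1.  As \<open>\<psi>\<close> belongs to \<open>F\<close>, approximating it along a
  nest shows that the complements of the nest are small; as \<open>\<psi>\<close> is bounded below on compact sets, subtracting
  multiples of \<open>v\<close> cuts functions of \<open>F\<close> with compact support off on a small set.
\<close>

definition small :: "real \<Rightarrow> 'a set \<Rightarrow> bool" where
  "small e U \<longleftrightarrow> open U \<and> (\<exists>v\<in>F. sqrt (E1 v v) \<le> e \<and> (AE x in m. x \<in> U \<longrightarrow> \<psi> x \<le> v x))"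

lemma E1_abs_le: "v \<in> F \<Longrightarrow> sqrt (E1 (\<lambda>x. \<bar>v x\<bar>) (\<lambda>x. \<bar>v x\<bar>)) \<le> sqrt (E1 v v)"
  using E1.abs_contr by simp

lemma smallE:
  assumes "small e U"
  obtains v where "v \<in> F" "sqrt (E1 v v) \<le> e" "\<And>x. 0 \<le> v x" "AE x in m. x \<in> U \<longrightarrow> \<psi> x \<le> v x"
proof -
  obtain v where v: "v \<in> F" "sqrt (E1 v v) \<le> e" "AE x in m. x \<in> U \<longrightarrow> \<psi> x \<le> v x"
    using assms by (auto simp: small_def)
  show ?thesis
    by (rule that[of "\<lambda>x. \<bar>v x\<bar>"]) (use v E.abs_in order_trans[OF E1_abs_le[OF v(1)] v(2)] in \<open>auto elim!: eventually_mono\<close>)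
qed

lemma small_open: "small e U \<Longrightarrow> open U"
  by (simp add: small_def)

lemma small_mono: "small e U \<Longrightarrow> e \<le> e' \<Longrightarrow> small e' U"
  unfolding small_def by (meson order_trans)

lemma small_Un:
  assumes "small a U" "small b V"
  shows "small (a + b) (U \<union> V)"
proof -
  obtain v where v: "v \<in> F" "sqrt (E1 v v) \<le> a" "\<And>x. 0 \<le> v x" "AE x in m. x \<in> U \<longrightarrow> \<psi> x \<le> v x" using smallE[OF assms(1)] by blast
  obtain w where w: "w \<in> F" "sqrt (E1 w w) \<le> b" "\<And>x. 0 \<le> w x" "AE x in m. x \<in> V \<longrightarrow> \<psi> x \<le> w x" using smallE[OF assms(2)] by blast
  have "AE x in m. x \<in> U \<union> V \<longrightarrow> \<psi> x \<le> v x + w x"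
    using v(4) w(4)
  proof eventually_elim
    case (elim x)
    then show ?case using v(3)[of x] w(3)[of x] by auto
  qed
  moreover have "sqrt (E1 (\<lambda>x. v x + w x) (\<lambda>x. v x + w x)) \<le> a + b"
    using E1.triangle[OF v(1) w(1)] v(2) w(2) by linarith
  ultimately show ?thesis using assms E.add_in[OF v(1) w(1)] unfolding small_def by blast
qed

text \<open>Countable subadditivity: the partial sums of dominating functions are Cauchy for
  \<open>E1\<close>, and their limit dominates each summand a.e.\<close>

lemma small_UN:
  assumes O: "\<And>n. small (e n) (U n)" and sum: "summable e"
  shows "small (suminf e) (\<Union>n. U n)"
proof -
  have "\<forall>n. \<exists>v. v \<in> F \<and> sqrt (E1 v v) \<le> e n \<and> (\<forall>x. 0 \<le> v x) \<and> (AE x in m. x \<in> U n \<longrightarrow> \<psi> x \<le> v x)"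
    by (intro allI, rule smallE[OF O]) blast
  from choice[OF this] obtain v where "\<forall>n. v n \<in> F \<and> sqrt (E1 (v n) (v n)) \<le> e n \<and> (\<forall>x. 0 \<le> v n x) \<and> (AE x in m. x \<in> U n \<longrightarrow> \<psi> x \<le> v n x)" by blast
  then have v: "\<And>n. v n \<in> F" "\<And>n. sqrt (E1 (v n) (v n)) \<le> e n" "\<And>n x. 0 \<le> v n x"
    "\<And>n. AE x in m. x \<in> U n \<longrightarrow> \<psi> x \<le> v n x" by auto
  have e0: "0 \<le> e n" for n using v(2)[of n] real_sqrt_ge_zero[OF E1.nonneg[OF v(1)], of n] by linarith
  let ?P = "\<lambda>N x. \<Sum>n<N. v n x"
  have PF: "?P N \<in> F" for N using v(1) by (intro E.sum_in)
  obtain u where u: "u \<in> F" "(\<lambda>N. form_dist2 E1 (?P N) u) \<longlonglongrightarrow> 0"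
    using F_complete[OF PF E1.partial_sums_cauchy[OF v(1,2) sum]] by blast
  have "(\<lambda>n. L2_dist2 M (?P n) u) \<longlonglongrightarrow> 0" using u(2) unfolding dist2_E1_tendsto_iff[of ?P, OF PF u(1)] by blast
  then obtain r :: "nat \<Rightarrow> nat" where r: "strict_mono r" "AE x in M. (\<lambda>n. ?P (r n) x) \<longlonglongrightarrow> u x"
    using L2_AE_subseq[of ?P M u] F_L2[OF PF] F_L2[OF u(1)] by blast
  have "AE x in m. \<forall>n. v n x \<le> u x"
    using r(2) unfolding AE_completion_iff
  proof eventually_elim
    case (elim x)
    show ?case
    proof
      fix n
      have "v n x \<le> ?P (r k) x" if "k \<ge> Suc n" for k
        using that seq_suble[OF r(1), of k] by (intro member_le_sum) (auto simp: v(3))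
      then show "v n x \<le> u x" by (intro LIMSEQ_le_const[OF elim]) blast
    qed
  qed
  moreover have "AE x in m. \<forall>n. x \<in> U n \<longrightarrow> \<psi> x \<le> v n x" using v(4) by (simp add: AE_all_countable)
  ultimately have "AE x in m. x \<in> (\<Union>n. U n) \<longrightarrow> \<psi> x \<le> u x"
    by eventually_elim (auto intro: order_trans)
  moreover have "sqrt (E1 u u) \<le> suminf e"
  proof (rule LIMSEQ_le_const2[OF tendsto_real_sqrt[OF E1.tendsto_self[OF PF u]]])
    have "sqrt (E1 (?P N) (?P N)) \<le> suminf e" for N
      using E1.norm_sum_le[of "{..<N}" v e, OF _ v(1,2)] sum_le_suminf[OF sum, of "{..<N}"] e0 by fastforce
    then show "\<exists>N. \<forall>n\<ge>N. sqrt (E1 (?P n) (?P n)) \<le> suminf e" by blast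
  qed
  ultimately show ?thesis using u(1) small_open[OF O] unfolding small_def by blast
qed

lemma small_UN_geometric:
  assumes "\<And>n. small (C * (1/2) ^ n) (U n)"
  shows "small (2 * C * (1/2) ^ k) (\<Union>n\<in>{k..}. U n)"
proof -
  have s: "(\<lambda>n. C * (1/2::real) ^ (n + k)) sums (2 * C * (1/2) ^ k)"
    using sums_mult[OF geometric_sums[of "1/2::real"], of "C * (1/2) ^ k"] by (simp add: power_add mult_ac)
  have "small (\<Sum>n. C * (1/2) ^ (n + k)) (\<Union>n. U (n + k))"
    by (rule small_UN[OF assms sums_summable[OF s]])
  moreover have "(\<Union>n. U (n + k)) = (\<Union>n\<in>{k..}. U n)"
  proof (intro equalityI subsetI)
    fix x assume "x \<in> (\<Union>n\<in>{k..}. U n)"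
    then obtain n where "n \<ge> k" "x \<in> U n" by blast
    then have "x \<in> U ((n - k) + k)" by simp
    then show "x \<in> (\<Union>n. U (n + k))" by blast
  qed auto
  ultimately show ?thesis using sums_unique[OF s] by simp
qed

text \<open>The positive part is not Lipschitz for the energy. Its energy is at most that of
  \<open>?z k\<close>, which tends to the energy of \<open>g\<close>; with convergence in L2 this
  gives strong convergence through \<open>F_strong\<close>.\<close>

lemma cut_off:
  assumes g: "g \<in> F" "\<And>x. 0 \<le> g x" and w: "\<And>k. w k \<in> F" and w0: "(\<lambda>k. E1 (w k) (w k)) \<longlonglongrightarrow> 0" and C: "C \<ge> 0"
  defines "v \<equiv> \<lambda>k x. max 0 (g x - C * \<bar>w k x\<bar>)"
  shows "v k \<in> F" "(\<lambda>k. form_dist2 E1 (v k) g) \<longlonglongrightarrow> 0"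
proof -
  let ?z = "\<lambda>k x. g x - C * \<bar>w k x\<bar>"
  have z: "?z k \<in> F" for k using g w by (intro E.diff_in E.scale_in E.abs_in)
  have v: "v k \<in> F" for k unfolding v_def using z by (rule E.pos_in)
  then show "v k \<in> F" .
  have sc: "form_dist2 E1 (?z k) g = C\<^sup>2 * E1 (\<lambda>x. \<bar>w k x\<bar>) (\<lambda>x. \<bar>w k x\<bar>)" for k
  proof -
    have "form_dist2 E1 (?z k) g = E1 (\<lambda>x. (- C) * \<bar>w k x\<bar>) (\<lambda>x. (- C) * \<bar>w k x\<bar>)" by (simp add: form_dist2_def)
    then show ?thesis using E1.expand_scale[OF E.abs_in[OF w], of "-C" k] by simp
  qed
  have lim: "(\<lambda>k. C\<^sup>2 * E1 (w k) (w k)) \<longlonglongrightarrow> 0" using tendsto_mult_left[OF w0, of "C\<^sup>2"] by simp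
  have z_lim: "(\<lambda>k. form_dist2 E1 (?z k) g) \<longlonglongrightarrow> 0"
  proof (rule Lim_null_comparison[OF _ lim], rule always_eventually, rule allI)
    fix k
    have "C\<^sup>2 * E1 (\<lambda>x. \<bar>w k x\<bar>) (\<lambda>x. \<bar>w k x\<bar>) \<le> C\<^sup>2 * E1 (w k) (w k)"
      using E1.abs_contr[OF w] by (intro mult_left_mono) auto
    then show "norm (form_dist2 E1 (?z k) g) \<le> C\<^sup>2 * E1 (w k) (w k)"
      unfolding sc using E1.nonneg[OF E.abs_in[OF w]] by simp
  qed
  have zE: "(\<lambda>k. E (?z k) (?z k)) \<longlonglongrightarrow> E g g"
    using z_lim by (intro E.tendsto_self z g) (simp add: dist2_E1_tendsto_iff[OF z g(1)])
  have vz: "E (v k) (v k) \<le> E (?z k) (?z k)" for k unfolding v_def using z by (rule E.pos_contr)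
  obtain D where D: "\<And>k. E (?z k) (?z k) \<le> D" using LIMSEQ_bounded_above[OF zE] by blast
  have L2: "(\<lambda>k. L2_dist2 M (v k) g) \<longlonglongrightarrow> 0"
  proof (rule Lim_null_comparison)
    show "(\<lambda>k. L2_dist2 M (?z k) g) \<longlonglongrightarrow> 0" using z_lim by (simp add: dist2_E1_tendsto_iff[OF z g(1)])
    have "L2_dist2 M (v k) g \<le> L2_dist2 M (?z k) g" for k
      unfolding L2_dist2_def
    proof (rule integral_mono)
      show "integrable M (\<lambda>x. (v k x - g x)\<^sup>2)" "integrable M (\<lambda>x. (?z k x - g x)\<^sup>2)"
        using L2_sq_integrable[OF F_L2[OF E.diff_in[OF v g(1)]]] L2_sq_integrable[OF F_L2[OF E.diff_in[OF z g(1)]]] by auto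
      fix x
      have "\<bar>v k x - g x\<bar> \<le> \<bar>?z k x - g x\<bar>" using g(2)[of x] C by (auto simp: v_def max_def abs_if)
      then show "(v k x - g x)\<^sup>2 \<le> (?z k x - g x)\<^sup>2" by (simp add: abs_le_square_iff)
    qed
    then show "\<forall>\<^sub>F k in sequentially. norm (L2_dist2 M (v k) g) \<le> L2_dist2 M (?z k) g"
      by (intro always_eventually allI) (simp add: L2_dist2_def)
  qed
  show "(\<lambda>k. form_dist2 E1 (v k) g) \<longlonglongrightarrow> 0"
  proof (rule F_strong[OF v _ g(1) L2])
    show "E (v k) (v k) \<le> D" for k using vz[of k] D[of k] by linarith
    fix e :: real assume "e > 0"
    then have "\<forall>\<^sub>F k in sequentially. E (?z k) (?z k) < E g g + e" by (intro order_tendstoD[OF zE]) simp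
    then show "\<forall>\<^sub>F k in sequentially. E (v k) (v k) \<le> E g g + e"
      by eventually_elim (use vz in \<open>meson less_imp_le order_trans\<close>)
  qed
qed

text \<open>On the removed set \<open>C * \<psi>\<close> is at most \<open>C\<close> times the
  dominating function, so subtracting the latter kills a compactly supported function there and
  barely changes it in \<open>E1\<close>.\<close>

lemma nest_of_small:
  assumes O: "\<And>j. small ((1/2) ^ j) (U j)"
  shows "nest m E F (\<lambda>k. - (\<Union>j\<in>{k..}. U j))"
  unfolding nest_def
proof (intro conjI allI ballI impI)
  let ?K = "\<lambda>k. - (\<Union>j\<in>{k..}. U j)"
  have sm: "small (2 * 1 * (1/2) ^ k) (\<Union>j\<in>{k..}. U j)" for k by (rule small_UN_geometric) (use O in simp)
  show "closed (?K k)" for k using small_open[OF sm] by (simp add: closed_def)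
  show "?K k \<subseteq> ?K (Suc k)" for k by auto
  fix u and e :: real assume u: "u \<in> F" and e: "e > 0"
  obtain f where f: "f \<in> F" "f \<in> Cc" "form_dist2 E1 u f < e / 4" using Cc_dense[OF u, of "e/4"] e by auto
  obtain C where C: "C \<ge> 0" "\<And>x. \<bar>f x\<bar> \<le> C * \<psi> x" using Cc_le_ref[OF f(2)] by blast
  have "\<forall>k. \<exists>v. v \<in> F \<and> sqrt (E1 v v) \<le> 2 * (1/2) ^ k \<and> (AE x in m. x \<in> (\<Union>j\<in>{k..}. U j) \<longrightarrow> \<psi> x \<le> v x)"
    by (intro allI, rule smallE[OF sm]) auto
  from choice[OF this] obtain w where "\<forall>k. w k \<in> F \<and> sqrt (E1 (w k) (w k)) \<le> 2 * (1/2) ^ k \<and> (AE x in m. x \<in> (\<Union>j\<in>{k..}. U j) \<longrightarrow> \<psi> x \<le> w k x)" by blast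
  then have w: "\<And>k. w k \<in> F" "\<And>k. sqrt (E1 (w k) (w k)) \<le> 2 * (1/2) ^ k"
    "\<And>k. AE x in m. x \<in> (\<Union>j\<in>{k..}. U j) \<longrightarrow> \<psi> x \<le> w k x" by auto
  have "(\<lambda>k. sqrt (E1 (w k) (w k))) \<longlonglongrightarrow> 0"
    by (rule Lim_null_comparison[OF _ geometric_null[of 2]])
      (use w(2) E1.nonneg[OF w(1)] in \<open>auto intro!: always_eventually\<close>)
  from tendsto_power[OF this, of 2] have w0: "(\<lambda>k. E1 (w k) (w k)) \<longlonglongrightarrow> 0" using E1.nonneg[OF w(1)] by simp
  define p where "p = (\<lambda>x. max 0 (f x))"
  define q where "q = (\<lambda>x. max 0 (- f x))"
  have pq: "p \<in> F" "\<And>x. 0 \<le> p x" "q \<in> F" "\<And>x. 0 \<le> q x"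
    unfolding p_def q_def using E.pos_in[OF f(1)] E.neg_in[OF f(1)] by auto
  define v1 where "v1 = (\<lambda>k x. max 0 (p x - C * \<bar>w k x\<bar>))"
  define v2 where "v2 = (\<lambda>k x. max 0 (q x - C * \<bar>w k x\<bar>))"
  have v1: "v1 k \<in> F" "(\<lambda>k. form_dist2 E1 (v1 k) p) \<longlonglongrightarrow> 0" for k
    unfolding v1_def using cut_off[OF pq(1,2) w(1) w0 C(1)] by auto
  have v2: "v2 k \<in> F" "(\<lambda>k. form_dist2 E1 (v2 k) q) \<longlonglongrightarrow> 0" for k
    unfolding v2_def using cut_off[OF pq(3,4) w(1) w0 C(1)] by auto
  let ?v = "\<lambda>k x. v1 k x - v2 k x"
  have vF: "?v k \<in> F" for k using v1 v2 by (intro E.diff_in)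
  have "form_dist2 E1 f (?v k) \<le> 2 * form_dist2 E1 (v1 k) p + 2 * form_dist2 E1 (v2 k) q" for k
  proof -
    have "f = (\<lambda>x. p x - q x)" by (auto simp: p_def q_def)
    then have "form_dist2 E1 f (?v k) = E1 (\<lambda>x. (v2 k x - q x) - (v1 k x - p x)) (\<lambda>x. (v2 k x - q x) - (v1 k x - p x))"
      by (simp add: form_dist2_def algebra_simps)
    also have "\<dots> \<le> 2 * form_dist2 E1 (v2 k) q + 2 * form_dist2 E1 (v1 k) p"
      unfolding form_dist2_def by (intro E1.sq_diff_le E.diff_in v1 v2 pq)
    finally show ?thesis by simp
  qed
  moreover have "(\<lambda>k. 2 * form_dist2 E1 (v1 k) p + 2 * form_dist2 E1 (v2 k) q) \<longlonglongrightarrow> 2 * 0 + 2 * 0"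
    by (intro tendsto_intros v1 v2)
  then have "\<forall>\<^sub>F k in sequentially. 2 * form_dist2 E1 (v1 k) p + 2 * form_dist2 E1 (v2 k) q < e / 4"
    using e by (intro order_tendstoD) auto
  ultimately obtain k where k: "form_dist2 E1 f (?v k) < e / 4"
    using eventually_happens' order_le_less_trans by (metis (mono_tags, lifting) sequentially_bot)
  have "form_dist2 E1 u (?v k) < e"
    using E1.dist2_triangle[OF u f(1) vF, of k] f(3) k by simp
  moreover have "AE x in m. x \<notin> ?K k \<longrightarrow> ?v k x = 0"
    using w(3)[of k]
  proof eventually_elim
    case (elim x)
    show ?case
    proof
      assume "x \<notin> ?K k"
      then have "\<psi> x \<le> w k x" using elim by simp
      then have "C * \<psi> x \<le> C * \<bar>w k x\<bar>" using C(1) by (intro mult_left_mono) auto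
      then have "\<bar>f x\<bar> \<le> C * \<bar>w k x\<bar>" using C(2)[of x] by linarith
      then show "?v k x = 0" by (auto simp: v1_def v2_def p_def q_def)
    qed
  qed
  ultimately show "\<exists>k. \<exists>v\<in>F. (AE x in m. x \<notin> ?K k \<longrightarrow> v x = 0) \<and> form_dist2 E1 u v < e"
    by (intro exI[of _ k] bexI[OF _ vF[of k]] conjI)
qed

lemma small_of_nest:
  assumes K: "nest m E F K" and e: "e > 0"
  shows "\<exists>k. small e (- K k)"
proof -
  have "e\<^sup>2 > 0" using e by simp
  then obtain k v where v: "v \<in> F" "AE x in m. x \<notin> K k \<longrightarrow> v x = 0" "form_dist2 E1 \<psi> v < e\<^sup>2"
    using K \<psi>(1) unfolding nest_def by meson
  let ?d = "\<lambda>x. \<psi> x - v x"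
  have "sqrt (E1 ?d ?d) \<le> e" using v(3) e by (intro real_le_lsqrt) (auto simp: form_dist2_def)
  moreover have "AE x in m. x \<in> - K k \<longrightarrow> \<psi> x \<le> ?d x" using v(2) by eventually_elim simp
  moreover have "open (- K k)" using K by (simp add: nest_def closed_def)
  ultimately show ?thesis unfolding small_def using E.diff_in[OF \<psi>(1) v(1)] by blast
qed

section \<open>Polar sets and quasi-continuity in terms of small open sets\<close>

lemma polar_iff: "polar m E F N \<longleftrightarrow> (\<forall>e>0. \<exists>U. small e U \<and> N \<subseteq> U)"
proof
  assume "polar m E F N"
  then obtain K where K: "nest m E F K" "N \<subseteq> (\<Inter>k. - K k)" unfolding polar_def by blast
  then show "\<forall>e>0. \<exists>U. small e U \<and> N \<subseteq> U" using small_of_nest[OF K(1)] by blast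
next
  assume *: "\<forall>e>0. \<exists>U. small e U \<and> N \<subseteq> U"
  have "\<exists>U. small ((1/2) ^ j) U \<and> N \<subseteq> U" for j :: nat using * by simp
  then obtain U where U: "\<And>j. small ((1/2) ^ j) (U j)" "\<And>j. N \<subseteq> U j" by metis
  show "polar m E F N"
    unfolding polar_def using nest_of_small[OF U(1)] U(2) by (intro exI[of _ "\<lambda>k. - (\<Union>j\<in>{k..}. U j)"]) auto
qed

abbreviation "qc \<equiv> quasi_continuous m E F"
abbreviation "QE \<equiv> qe m E F"

lemma qc_iff: "qc u \<longleftrightarrow> (\<forall>e>0. \<exists>U. small e U \<and> continuous_on (- U) u)"
proof
  assume "qc u"
  then obtain K where K: "nest m E F K" "\<And>k. continuous_on (K k) u" unfolding quasi_continuous_def by blast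
  show "\<forall>e>0. \<exists>U. small e U \<and> continuous_on (- U) u"
  proof (intro allI impI)
    fix e :: real assume "e > 0"
    then obtain k where "small e (- K k)" using small_of_nest[OF K(1)] by blast
    then show "\<exists>U. small e U \<and> continuous_on (- U) u" using K(2)[of k] by (intro exI[of _ "- K k"]) simp
  qed
next
  assume *: "\<forall>e>0. \<exists>U. small e U \<and> continuous_on (- U) u"
  have "\<exists>U. small ((1/2) ^ j) U \<and> continuous_on (- U) u" for j :: nat using * by simp
  then obtain U where U: "\<And>j. small ((1/2) ^ j) (U j)" "\<And>j. continuous_on (- U j) u" by metis
  have "continuous_on (- (\<Union>j\<in>{k..}. U j)) u" for k
    by (rule continuous_on_subset[OF U(2)[of k]]) auto
  then show "qc u"
    unfolding quasi_continuous_def using nest_of_small[OF U(1)] by blast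
qed

lemma qe_iff: "QE P \<longleftrightarrow> (\<forall>e>0. \<exists>U. small e U \<and> (\<forall>x. x \<notin> U \<longrightarrow> P x))"
  unfolding qe_def polar_iff by (intro all_cong ex_cong) auto

lemma qe_all_countable:
  assumes "\<And>n::nat. QE (P n)"
  shows "QE (\<lambda>x. \<forall>n. P n x)"
  unfolding qe_iff
proof (intro allI impI)
  fix e :: real assume e: "e > 0"
  have "\<exists>U. small (e/2 * (1/2) ^ n) U \<and> (\<forall>x. x \<notin> U \<longrightarrow> P n x)" for n
    using assms[of n] e unfolding qe_iff by simp
  then obtain U where U: "\<And>n. small (e/2 * (1/2) ^ n) (U n)" "\<And>n x. x \<notin> U n \<Longrightarrow> P n x" by metis
  have "small e (\<Union>n\<in>{0..}. U n)" using small_UN_geometric[OF U(1), of 0] by simp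
  then show "\<exists>V. small e V \<and> (\<forall>x. x \<notin> V \<longrightarrow> (\<forall>n. P n x))" using U(2) by blast
qed

lemma qe_mono: "QE P \<Longrightarrow> (\<And>x. P x \<Longrightarrow> Q x) \<Longrightarrow> QE Q"
  unfolding qe_iff by meson

lemma qe_AE:
  assumes s: "sets \<nu> = sets borel" and c: "charges_no_polar m E F \<nu>" and P: "QE P"
  shows "AE x in \<nu>. P x"
proof -
  obtain K where K: "nest m E F K" "{x. \<not> P x} \<subseteq> (\<Inter>k. - K k)" using P unfolding qe_def polar_def by blast
  have "open (- K k)" for k using K(1) by (simp add: nest_def closed_def)
  then have b: "(\<Inter>k. - K k) \<in> sets borel" by (intro sets.countable_INT) (auto intro: borel_open)
  have "polar m E F (\<Inter>k. - K k)" unfolding polar_def using K(1) by blast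
  then have "(\<Inter>k. - K k) \<in> null_sets \<nu>"
    using c b s unfolding charges_no_polar_def null_sets_def by simp
  then show ?thesis by (rule AE_I') (use K(2) in auto)
qed

lemma E1_null_subseq:
  assumes v: "\<And>n. v n \<in> F" and lim: "(\<lambda>n. E1 (v n) (v n)) \<longlonglongrightarrow> 0"
  obtains r :: "nat \<Rightarrow> nat" where "strict_mono r" "AE x in m. (\<lambda>n. v (r n) x) \<longlonglongrightarrow> 0"
proof -
  have "(\<lambda>n. form_dist2 E1 (v n) (\<lambda>x. 0)) \<longlonglongrightarrow> 0" using lim by (simp add: form_dist2_def)
  then have "(\<lambda>n. L2_dist2 M (v n) (\<lambda>x. 0)) \<longlonglongrightarrow> 0" by (simp add: dist2_E1_tendsto_iff v E.zero_in)
  then obtain r :: "nat \<Rightarrow> nat" where "strict_mono r" "AE x in M. (\<lambda>n. v (r n) x) \<longlonglongrightarrow> 0"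
    using L2_AE_subseq[of v, OF F_L2[OF v] F_L2[OF E.zero_in]] by blast
  then show ?thesis using that by (simp add: AE_completion_iff)
qed

text \<open>On the exceptional set all dominating functions are at least \<open>\<psi>\<close>, yet
  a subsequence tends to 0 a.e.\<close>

lemma qe_AE_m:
  assumes P: "QE P" shows "AE x in m. P x"
proof -
  have "\<exists>U. small ((1/2) ^ j) U \<and> (\<forall>x. x \<notin> U \<longrightarrow> P x)" for j :: nat using P unfolding qe_iff by simp
  then obtain U where U: "\<And>j. small ((1/2) ^ j) (U j)" "\<And>j x. x \<notin> U j \<Longrightarrow> P x" by metis
  have "\<forall>j. \<exists>v. v \<in> F \<and> sqrt (E1 v v) \<le> (1/2) ^ j \<and> (AE x in m. x \<in> U j \<longrightarrow> \<psi> x \<le> v x)"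
    by (intro allI, rule smallE[OF U(1)]) blast
  from choice[OF this] obtain v where "\<forall>j. v j \<in> F \<and> sqrt (E1 (v j) (v j)) \<le> (1/2) ^ j \<and> (AE x in m. x \<in> U j \<longrightarrow> \<psi> x \<le> v j x)" by blast
  then have v: "\<And>j. v j \<in> F" "\<And>j. sqrt (E1 (v j) (v j)) \<le> (1/2) ^ j" "\<And>j. AE x in m. x \<in> U j \<longrightarrow> \<psi> x \<le> v j x"
    by auto
  have "(\<lambda>k. sqrt (E1 (v k) (v k))) \<longlonglongrightarrow> 0"
    by (rule Lim_null_comparison[OF _ LIMSEQ_power_zero[of "1/2::real"]])
      (use v(2) E1.nonneg[OF v(1)] in \<open>auto intro!: always_eventually\<close>)
  from tendsto_power[OF this, of 2] have "(\<lambda>k. E1 (v k) (v k)) \<longlonglongrightarrow> 0" using E1.nonneg[OF v(1)] by simp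
  then obtain r :: "nat \<Rightarrow> nat" where r: "AE x in m. (\<lambda>n. v (r n) x) \<longlonglongrightarrow> 0" using E1_null_subseq[of v, OF v(1)] by blast
  have "AE x in m. \<forall>j. x \<in> U j \<longrightarrow> \<psi> x \<le> v j x" using v(3) by (simp add: AE_all_countable)
  with r show ?thesis
  proof eventually_elim
    case (elim x)
    show ?case
    proof (rule ccontr)
      assume "\<not> P x"
      then have "\<psi> x \<le> v j x" for j using U(2) elim(2) by blast
      then have "\<psi> x \<le> 0" by (intro LIMSEQ_le_const[OF elim(1)]) blast
      then show False using \<psi>(3)[of x] by simp
    qed
  qed
qed

lemma qc_comp2:
  assumes "qc u" "qc v"
    and "\<And>S. continuous_on S u \<Longrightarrow> continuous_on S v \<Longrightarrow> continuous_on S w"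
  shows "qc w"
  unfolding qc_iff
proof (intro allI impI)
  fix e :: real assume e: "e > 0"
  obtain U where U: "small (e/2) U" "continuous_on (- U) u" using assms(1) e unfolding qc_iff by (meson half_gt_zero)
  obtain V where V: "small (e/2) V" "continuous_on (- V) v" using assms(2) e unfolding qc_iff by (meson half_gt_zero)
  have "small e (U \<union> V)" using small_Un[OF U(1) V(1)] by simp
  moreover have "continuous_on (- (U \<union> V)) w"
    using U(2) V(2) by (intro assms(3)) (auto elim: continuous_on_subset)
  ultimately show "\<exists>U. small e U \<and> continuous_on (- U) w" by blast
qed

lemma small_empty: "e > 0 \<Longrightarrow> small e {}"
  unfolding small_def using E.zero_in E1.zero_left[OF E.zero_in] by force

lemma qc_continuous: "continuous_on UNIV u \<Longrightarrow> qc u"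
  unfolding qc_iff using small_empty by (intro allI impI exI[of _ "{}"]) simp

text \<open>On the union of the nest \<open>u\<close> is a limit of Borel functions; the rest is
  polar, hence null for the measures considered, which explains the completion.\<close>

lemma qc_measurable:
  assumes s: "sets \<nu> = sets borel" and c: "\<And>P. QE P \<Longrightarrow> AE x in \<nu>. P x" and u: "qc u"
  shows "u \<in> borel_measurable (completion \<nu>)"
proof -
  obtain K where K: "nest m E F K" "\<And>k. continuous_on (K k) u" using u unfolding quasi_continuous_def by blast
  have cl: "closed (K k)" and inc: "K k \<subseteq> K (Suc k)" for k using K(1) by (auto simp: nest_def)
  have mono: "K i \<subseteq> K j" if "i \<le> j" for i j using lift_Suc_mono_le[of K i j, OF inc that] .
  define g where "g x = indicator (\<Union>k. K k) x * u x" for x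
  have "(\<lambda>k. indicator (K k) x * u x) \<longlonglongrightarrow> g x" for x
  proof (rule tendsto_eventually)
    show "\<forall>\<^sub>F k in sequentially. indicator (K k) x * u x = g x"
    proof (cases "x \<in> (\<Union>k. K k)")
      case True
      then obtain i where "x \<in> K i" by blast
      then have "indicator (K k) x * u x = g x" if "k \<ge> i" for k
        using mono[OF that] True by (auto simp: g_def indicator_def)
      then show ?thesis by (auto simp: eventually_sequentially)
    qed (auto simp: g_def indicator_def)
  qed
  moreover have "(\<lambda>x. indicator (K k) x * u x) \<in> borel_measurable borel" for k
    using borel_measurable_continuous_on_indicator[OF borel_closed[OF cl] K(2), of k] by simp
  ultimately have "g \<in> borel_measurable borel" by (rule borel_measurable_LIMSEQ_real)
  then have g: "g \<in> borel_measurable \<nu>" using measurable_cong_sets[OF s refl] by blast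
  have "QE (\<lambda>x. g x = u x)"
    unfolding qe_def polar_def using K(1) by (intro exI[of _ K]) (auto simp: g_def indicator_def)
  then show ?thesis by (intro borel_measurable_completion_AE[OF g] c)
qed

lemma qc_measurable_m: "qc u \<Longrightarrow> u \<in> borel_measurable M"
  by (rule qc_measurable[OF sets_m qe_AE_m])

text \<open>Chebyshev's inequality for the weighted capacity: the absolute value of \<open>w\<close>
  divided by \<open>l\<close> dominates \<open>\<psi>\<close> where the bound fails.\<close>

lemma qc_bound:
  assumes w: "w \<in> F" and q: "qc w" and l: "l > 0" and e: "e > 0"
  shows "\<exists>U. small (sqrt (E1 w w) / l + e) U \<and> continuous_on (- U) w \<and> (\<forall>x. x \<notin> U \<longrightarrow> \<bar>w x\<bar> \<le> l * \<psi> x)"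
proof -
  obtain V where V: "small e V" "continuous_on (- V) w" using q e unfolding qc_iff by blast
  obtain v where v: "v \<in> F" "sqrt (E1 v v) \<le> e" "\<And>x. 0 \<le> v x" "AE x in m. x \<in> V \<longrightarrow> \<psi> x \<le> v x"
    using smallE[OF V(1)] by blast
  \<comment> \<open>The set \<open>V\<close> is included because \<open>w\<close> is continuous only
    off \<open>V\<close>; without it the exceedance set need not be open.\<close>
  define U where "U = - ((- V) \<inter> {x \<in> - V. \<bar>w x\<bar> - l * \<psi> x \<in> {..0}})"
  have "closed ((- V) \<inter> (\<lambda>x. \<bar>w x\<bar> - l * \<psi> x) -` {..0})"
    using V(2) small_open[OF V(1)] by (intro continuous_closed_preimage continuous_intros \<psi>) auto
  moreover have "(- V) \<inter> (\<lambda>x. \<bar>w x\<bar> - l * \<psi> x) -` {..0} = - U" by (auto simp: U_def)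
  ultimately have oU: "open U" by (simp add: closed_def)
  have U_iff: "x \<in> U \<longleftrightarrow> x \<in> V \<or> l * \<psi> x < \<bar>w x\<bar>" for x by (auto simp: U_def)
  let ?z = "\<lambda>x. (1/l) * \<bar>w x\<bar> + v x"
  have aw: "(\<lambda>x. \<bar>w x\<bar>) \<in> F" using w by (rule E.abs_in)
  have z: "?z \<in> F" using aw v(1) by (intro E.add_in E.scale_in)
  have "sqrt (E1 ?z ?z) \<le> sqrt (E1 (\<lambda>x. (1/l) * \<bar>w x\<bar>) (\<lambda>x. (1/l) * \<bar>w x\<bar>)) + sqrt (E1 v v)"
    using aw v(1) by (intro E1.triangle E.scale_in)
  also have "sqrt (E1 (\<lambda>x. (1/l) * \<bar>w x\<bar>) (\<lambda>x. (1/l) * \<bar>w x\<bar>)) = (1/l) * sqrt (E1 (\<lambda>x. \<bar>w x\<bar>) (\<lambda>x. \<bar>w x\<bar>))"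
    unfolding E1.expand_scale[OF aw] using l by (simp add: real_sqrt_mult real_sqrt_divide)
  also have "\<dots> \<le> (1/l) * sqrt (E1 w w)" using E1_abs_le[OF w] l by (intro mult_left_mono) auto
  finally have "sqrt (E1 ?z ?z) \<le> sqrt (E1 w w) / l + e" using v(2) by simp
  moreover have "AE x in m. x \<in> U \<longrightarrow> \<psi> x \<le> ?z x"
    using v(4)
  proof eventually_elim
    case (elim x)
    show ?case
    proof
      assume "x \<in> U"
      then consider "x \<in> V" | "l * \<psi> x < \<bar>w x\<bar>" unfolding U_iff by blast
      then show "\<psi> x \<le> ?z x"
      proof cases
        case 1
        moreover have "0 \<le> (1/l) * \<bar>w x\<bar>" using l by simp
        ultimately show ?thesis using elim by linarith
      next
        case 2
        then have "\<psi> x < (1/l) * \<bar>w x\<bar>" using l by (simp add: field_simps)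
        then show ?thesis using v(3)[of x] by simp
      qed
    qed
  qed
  ultimately have "small (sqrt (E1 w w) / l + e) U" unfolding small_def using oU z by blast
  moreover have "continuous_on (- U) w" using V(2) by (rule continuous_on_subset) (auto simp: U_iff)
  moreover have "\<forall>x. x \<notin> U \<longrightarrow> \<bar>w x\<bar> \<le> l * \<psi> x" by (auto simp: U_iff)
  ultimately show ?thesis by blast
qed

text \<open>Borel-Cantelli for capacity: off a small set the increments are geometric from some
  index on, and the convergence is uniform.\<close>

lemma qc_limit:
  assumes u: "\<And>n. qc (u n)" and C: "C \<ge> 0"
    and step: "\<And>n. \<exists>U. small (C * (1/2) ^ n) U \<and> (\<forall>x. x \<notin> U \<longrightarrow> \<bar>u (Suc n) x - u n x\<bar> \<le> (1/2) ^ n)"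
  obtains v where "qc v" "QE (\<lambda>x. (\<lambda>n. u n x) \<longlonglongrightarrow> v x)"
proof -
  obtain U where U: "\<And>n. small (C * (1/2) ^ n) (U n)" "\<And>n x. x \<notin> U n \<Longrightarrow> \<bar>u (Suc n) x - u n x\<bar> \<le> (1/2) ^ n"
    using step by metis
  define v where "v x = lim (\<lambda>n. u n x)" for x
  have main: "\<exists>W. small e W \<and> continuous_on (- W) v \<and> (\<forall>x. x \<notin> W \<longrightarrow> (\<lambda>n. u n x) \<longlonglongrightarrow> v x)" if e: "e > 0" for e
  proof -
    have "\<forall>\<^sub>F k in sequentially. 2 * C * (1/2) ^ k < e / 2" using e by (intro order_tendstoD[OF geometric_null]) simp
    then obtain k where k: "2 * C * (1/2) ^ k < e / 2" using eventually_happens' sequentially_bot by blast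
    have "\<exists>V. small (e/4 * (1/2) ^ n) V \<and> continuous_on (- V) (u n)" for n
      using u[of n] e unfolding qc_iff by simp
    then obtain V where V: "\<And>n. small (e/4 * (1/2) ^ n) (V n)" "\<And>n. continuous_on (- V n) (u n)" by metis
    \<comment> \<open>The tail of the sets \<open>U n\<close> gives the rate, the whole family
      \<open>V n\<close> makes all approximants continuous off \<open>W\<close>.\<close>
    define W where "W = (\<Union>n\<in>{k..}. U n) \<union> (\<Union>n\<in>{0..}. V n)"
    have "small (2 * C * (1/2) ^ k + 2 * (e/4) * (1/2) ^ 0) W"
      unfolding W_def by (intro small_Un small_UN_geometric U V)
    then have sW: "small e W" by (rule small_mono) (use k in simp)
    have step': "\<bar>u (Suc n) x - u n x\<bar> \<le> (1/2) ^ n" if "x \<notin> W" "n \<ge> k" for n x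
      using U(2)[of x n] that by (auto simp: W_def)
    \<comment> \<open>The difference of two powers is the exact geometric sum, so the induction on
      \<open>j\<close> closes without loss.\<close>
    have tail: "\<bar>u j x - u i x\<bar> \<le> 2 * (1/2) ^ i - 2 * (1/2) ^ j" if x: "x \<notin> W" and i: "i \<ge> k" and j: "i \<le> j" for x i j
      using j
    proof (induction j rule: dec_induct)
      case (step n)
      then show ?case using step'[OF x, of n] i by (simp add: abs_le_iff)
    qed simp
    have conv: "(\<lambda>n. u n x) \<longlonglongrightarrow> v x" if x: "x \<notin> W" for x
    proof -
      have "Cauchy (\<lambda>n. u n x)"
      proof (rule CauchyI')
        fix d :: real assume d: "d > 0"
        have "\<forall>\<^sub>F n in sequentially. 2 * (1/2) ^ n < d \<and> n \<ge> k"
          using order_tendstoD(2)[OF geometric_null d, of 2] eventually_ge_at_top[of k] by (auto intro: eventually_conj)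
        then obtain N where N: "\<And>n. n \<ge> N \<Longrightarrow> 2 * (1/2) ^ n < d \<and> n \<ge> k" unfolding eventually_sequentially by blast
        have "dist (u i x) (u j x) < d" if "i \<ge> N" "j > i" for i j
        proof -
          have "\<bar>u j x - u i x\<bar> \<le> 2 * (1/2) ^ i - 2 * (1/2) ^ j" using N[OF that(1)] that(2) by (intro tail x) auto
          moreover have "2 * (1/2::real) ^ j > 0" by simp
          ultimately show ?thesis using N[OF that(1)] unfolding dist_real_def by linarith
        qed
        then show "\<exists>M. \<forall>m\<ge>M. \<forall>n>m. dist (u m x) (u n x) < d" by blast
      qed
      then show ?thesis unfolding v_def by (simp add: Cauchy_convergent_iff convergent_LIMSEQ_iff)
    qed
    have rate: "\<bar>v x - u i x\<bar> \<le> 2 * (1/2) ^ i" if x: "x \<notin> W" and i: "i \<ge> k" for x i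
    proof (rule LIMSEQ_le_const2)
      show "(\<lambda>n. \<bar>u n x - u i x\<bar>) \<longlonglongrightarrow> \<bar>v x - u i x\<bar>" by (intro tendsto_intros conv x)
      have "\<bar>u n x - u i x\<bar> \<le> 2 * (1/2) ^ i" if n: "n \<ge> i" for n
      proof -
        have "2 * (1/2::real) ^ n > 0" by simp
        then show ?thesis using tail[OF x i n] by linarith
      qed
      then show "\<exists>N. \<forall>n\<ge>N. \<bar>u n x - u i x\<bar> \<le> 2 * (1/2) ^ i" by blast
    qed
    have "continuous_on (- W) v"
    proof (rule uniform_limit_theorem)
      show "\<forall>\<^sub>F n in sequentially. continuous_on (- W) (u n)"
        by (intro always_eventually allI continuous_on_subset[OF V(2)]) (auto simp: W_def)
      show "uniform_limit (- W) u v sequentially"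
      proof (rule uniform_limitI)
        fix d :: real assume d: "d > 0"
        have "\<forall>\<^sub>F n in sequentially. 2 * (1/2) ^ n < d" using geometric_null d by (rule order_tendstoD)
        then show "\<forall>\<^sub>F n in sequentially. \<forall>x\<in>- W. dist (u n x) (v x) < d"
          using eventually_ge_at_top[of k]
        proof eventually_elim
          case (elim n)
          then show ?case using rate[of _ n] by (fastforce simp: dist_real_def abs_minus_commute)
        qed
      qed
    qed simp
    with sW conv show ?thesis by blast
  qed
  have "qc v" unfolding qc_iff using main by blast
  moreover have "QE (\<lambda>x. (\<lambda>n. u n x) \<longlonglongrightarrow> v x)" unfolding qe_iff using main by blast
  ultimately show ?thesis using that by blast
qed

lemma fast_subseq:
  assumes lim: "a \<longlonglongrightarrow> (0::real)" and pos: "\<And>n. d n > 0"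
  obtains r :: "nat \<Rightarrow> nat" where "strict_mono r" "\<And>n. a (r n) < d n"
proof -
  have ev: "\<exists>N. \<forall>k\<ge>N. a k < d n" for n
    using order_tendstoD(2)[OF lim pos, of n] by (simp add: eventually_sequentially)
  have "\<exists>r. \<forall>n. a (r n) < d n \<and> r n < r (Suc n)"
  proof (rule dependent_nat_choice)
    show "\<exists>x. a x < d 0" using ev[of 0] by blast
    fix x n
    obtain N where "\<And>k. k \<ge> N \<Longrightarrow> a k < d (Suc n)" using ev by blast
    then show "\<exists>y. a y < d (Suc n) \<and> x < y" by (intro exI[of _ "max N (Suc x)"]) auto
  qed
  then show ?thesis using that by (auto simp: strict_mono_Suc_iff)
qed

lemma qc_null_subseq:
  assumes w: "\<And>n. w n \<in> F" "\<And>n. qc (w n)" and lim: "(\<lambda>n. E1 (w n) (w n)) \<longlonglongrightarrow> 0"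
  obtains r :: "nat \<Rightarrow> nat" where "strict_mono r" "QE (\<lambda>x. (\<lambda>n. w (r n) x) \<longlonglongrightarrow> 0)"
proof -
  \<comment> \<open>One factor \<open>(1/2) ^ n\<close> is spent on the threshold in
    \<open>qc_bound\<close>, the other remains as capacity.\<close>
  obtain r :: "nat \<Rightarrow> nat" where r: "strict_mono r" "\<And>n. E1 (w (r n)) (w (r n)) < ((1/2) ^ n * (1/2) ^ n)\<^sup>2"
    using fast_subseq[OF lim, of "\<lambda>n. ((1/2) ^ n * (1/2) ^ n)\<^sup>2"] by auto
  have "\<exists>U. small (2 * (1/2) ^ n) U \<and> (\<forall>x. x \<notin> U \<longrightarrow> \<bar>w (r n) x\<bar> \<le> (1/2) ^ n)" for n
  proof -
    obtain U where U: "small (sqrt (E1 (w (r n)) (w (r n))) / (1/2) ^ n + (1/2) ^ n) U"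
      "\<And>x. x \<notin> U \<Longrightarrow> \<bar>w (r n) x\<bar> \<le> (1/2) ^ n * \<psi> x"
      using qc_bound[OF w, of "(1/2) ^ n" "(1/2) ^ n" "r n"] by auto
    have "sqrt (E1 (w (r n)) (w (r n))) \<le> (1/2) ^ n * (1/2) ^ n"
      using r(2)[of n] by (intro real_le_lsqrt) auto
    then have "sqrt (E1 (w (r n)) (w (r n))) / (1/2) ^ n \<le> (1/2) ^ n" by (simp add: field_simps)
    then have "small (2 * (1/2) ^ n) U" by (intro small_mono[OF U(1)]) simp
    moreover have "\<bar>w (r n) x\<bar> \<le> (1/2) ^ n" if "x \<notin> U" for x
      by (rule order_trans[OF U(2)[OF that]]) (simp add: mult_left_le \<psi>(4))
    ultimately show ?thesis by blast
  qed
  then obtain U where U: "\<And>n. small (2 * (1/2) ^ n) (U n)" "\<And>n x. x \<notin> U n \<Longrightarrow> \<bar>w (r n) x\<bar> \<le> (1/2) ^ n" by metis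
  have "QE (\<lambda>x. (\<lambda>n. w (r n) x) \<longlonglongrightarrow> 0)"
    unfolding qe_iff
  proof (intro allI impI)
    fix e :: real assume e: "e > 0"
    have "\<forall>\<^sub>F k in sequentially. 2 * 2 * (1/2) ^ k < e" using geometric_null e by (rule order_tendstoD)
    then obtain k where k: "2 * 2 * (1/2) ^ k < e" using eventually_happens' sequentially_bot by blast
    have "small e (\<Union>n\<in>{k..}. U n)" by (rule small_mono[OF small_UN_geometric[OF U(1)]]) (use k in simp)
    moreover have "(\<lambda>n. w (r n) x) \<longlonglongrightarrow> 0" if "x \<notin> (\<Union>n\<in>{k..}. U n)" for x
    proof (rule Lim_null_comparison[OF _ LIMSEQ_power_zero[of "1/2::real"]])
      show "\<forall>\<^sub>F n in sequentially. norm (w (r n) x) \<le> (1/2) ^ n"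
        using eventually_ge_at_top[of k] by eventually_elim (use that U(2) in auto)
    qed simp
    ultimately show "\<exists>U. small e U \<and> (\<forall>x. x \<notin> U \<longrightarrow> (\<lambda>n. w (r n) x) \<longlonglongrightarrow> 0)" by blast
  qed
  with r(1) that show ?thesis by blast
qed

text \<open>Continuous approximants with a geometric rate converge q.e. to a quasi-continuous
  function; L2 convergence along a subsequence identifies it with \<open>f\<close>.\<close>

lemma qc_version:
  assumes f: "f \<in> F"
  obtains u where "u \<in> F" "qc u" "AE x in m. u x = f x"
proof -
  have "\<exists>g\<in>F \<inter> Cc. form_dist2 E1 f g < ((1/2) ^ n * (1/2) ^ n)\<^sup>2" for n :: nat
    by (rule Cc_dense[OF f]) simp
  then obtain g where g: "\<And>n. g n \<in> F" "\<And>n. g n \<in> Cc" "\<And>n. form_dist2 E1 f (g n) < ((1/2) ^ n * (1/2) ^ n)\<^sup>2"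
    by (metis IntD1 IntD2)
  have qcg: "qc (g n)" for n by (intro qc_continuous CcD g)
  have nrm: "sqrt (form_dist2 E1 f (g n)) \<le> (1/2) ^ n * (1/2) ^ n" for n
    using g(3)[of n] by (intro real_le_lsqrt) auto
  have "\<exists>U. small (3 * (1/2) ^ n) U \<and> (\<forall>x. x \<notin> U \<longrightarrow> \<bar>g (Suc n) x - g n x\<bar> \<le> (1/2) ^ n)" for n
  proof -
    let ?w = "\<lambda>x. g (Suc n) x - g n x"
    have wF: "?w \<in> F" using g by (intro E.diff_in)
    have wq: "qc ?w" by (rule qc_comp2[OF qcg qcg]) (intro continuous_intros)
    obtain U where U: "small (sqrt (E1 ?w ?w) / (1/2) ^ n + (1/2) ^ n) U" "\<And>x. x \<notin> U \<Longrightarrow> \<bar>?w x\<bar> \<le> (1/2) ^ n * \<psi> x"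
      using qc_bound[OF wF wq, of "(1/2) ^ n" "(1/2) ^ n"] by auto
    have "sqrt (E1 (\<lambda>x. (f x - g n x) - (f x - g (Suc n) x)) (\<lambda>x. (f x - g n x) - (f x - g (Suc n) x)))
        \<le> sqrt (form_dist2 E1 f (g n)) + sqrt (form_dist2 E1 f (g (Suc n)))"
      unfolding form_dist2_def by (intro E1.triangle_diff E.diff_in f g)
    also have "\<dots> \<le> (1/2) ^ n * (1/2) ^ n + (1/2) ^ Suc n * (1/2) ^ Suc n" by (intro add_mono nrm)
    also have "\<dots> \<le> 2 * (1/2) ^ n * (1/2) ^ n" by simp
    finally have "sqrt (E1 ?w ?w) \<le> 2 * (1/2) ^ n * (1/2) ^ n" by (simp add: algebra_simps)
    then have "sqrt (E1 ?w ?w) / (1/2) ^ n \<le> 2 * (1/2) ^ n" by (simp add: field_simps)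
    then have "small (3 * (1/2) ^ n) U" by (intro small_mono[OF U(1)]) simp
    moreover have "\<bar>?w x\<bar> \<le> (1/2) ^ n" if "x \<notin> U" for x
      by (rule order_trans[OF U(2)[OF that]]) (simp add: mult_left_le \<psi>(4))
    ultimately show ?thesis by blast
  qed
  then obtain u where u: "qc u" "QE (\<lambda>x. (\<lambda>n. g n x) \<longlonglongrightarrow> u x)" using qc_limit[of g 3, OF qcg] by auto
  have "(\<lambda>n. L2_dist2 M (g n) f) \<longlonglongrightarrow> 0"
  proof -
    have "(\<lambda>n. sqrt (form_dist2 E1 (g n) f)) \<longlonglongrightarrow> 0"
    proof (rule Lim_null_comparison[OF _ LIMSEQ_power_zero[of "1/2 * 1/2::real"]])
      show "\<forall>\<^sub>F n in sequentially. norm (sqrt (form_dist2 E1 (g n) f)) \<le> (1/2 * 1/2) ^ n"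
        using nrm E1.dist2_nonneg[OF g(1) f] E1.dist2_sym[OF g(1) f]
        by (intro always_eventually) (simp add: power_mult_distrib[symmetric])
    qed simp
    from tendsto_power[OF this, of 2] have "(\<lambda>n. form_dist2 E1 (g n) f) \<longlonglongrightarrow> 0"
      using E1.dist2_nonneg[OF g(1) f] by simp
    then show ?thesis using dist2_E1_tendsto_iff[of g f] g(1) f by blast
  qed
  then obtain r :: "nat \<Rightarrow> nat" where r: "strict_mono r" "AE x in M. (\<lambda>n. g (r n) x) \<longlonglongrightarrow> f x"
    using L2_AE_subseq[of g M f] F_L2 g(1) f by blast
  have eq: "AE x in m. f x = u x"
    using r(2) qe_AE_m[OF u(2)] unfolding AE_completion_iff
  proof eventually_elim
    case (elim x)
    from LIMSEQ_unique[OF elim(1) LIMSEQ_comp_mono[OF elim(2) r(1)]] show ?case .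
  qed
  have "u \<in> F" by (rule F_AE_eq[OF f qc_measurable_m[OF u(1)] eq])
  moreover have "AE x in m. u x = f x" using eq by eventually_elim simp
  ultimately show ?thesis using that u(1) by blast
qed

text \<open>The negativity set is open relative to the complement of \<open>V\<close>, and it is
  null. Adding it to \<open>V\<close> costs no capacity, since the dominating function only has to
  work a.e.\<close>

lemma qc_nonneg_on_open:
  assumes w: "qc w" and G: "open G" and nn: "AE x in m. x \<in> G \<longrightarrow> 0 \<le> w x"
  shows "QE (\<lambda>x. x \<in> G \<longrightarrow> 0 \<le> w x)"
  unfolding qe_iff
proof (intro allI impI)
  fix e :: real assume e: "e > 0"
  obtain V where V: "small e V" "continuous_on (- V) w" using w e unfolding qc_iff by blast
  define U where "U = V \<union> {x \<in> G. w x < 0}"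
  have "closed ((- V) \<inter> w -` {0..})"
    using V(2) small_open[OF V(1)] by (intro continuous_closed_preimage) auto
  then have "closed ((- V) \<inter> w -` {0..} \<union> (- V) \<inter> (- G))"
    using small_open[OF V(1)] G by (intro closed_Un closed_Int[of "- V" "- G"]) auto
  moreover have "(- V) \<inter> w -` {0..} \<union> (- V) \<inter> (- G) = - U" by (auto simp: U_def)
  ultimately have oU: "open U" by (simp add: closed_def)
  obtain v where v: "v \<in> F" "sqrt (E1 v v) \<le> e" "AE x in m. x \<in> V \<longrightarrow> \<psi> x \<le> v x"
    using V(1) by (auto simp: small_def)
  have "AE x in m. x \<in> U \<longrightarrow> \<psi> x \<le> v x"
    using v(3) nn by eventually_elim (auto simp: U_def)
  then have "small e U" unfolding small_def using oU v by blast
  then show "\<exists>U. small e U \<and> (\<forall>x. x \<notin> U \<longrightarrow> x \<in> G \<longrightarrow> 0 \<le> w x)" by (intro exI[of _ U]) (auto simp: U_def)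
qed

end

section \<open>Convergence quasi-everywhere\<close>

text \<open>Lets the weight be divided out again after Mazur has been applied to weighted
  functions.\<close>

lemma tail_hull_mult:
  assumes "w \<in> tail_hull (\<lambda>n x. U n x * c x) N"
  shows "\<exists>h\<in>tail_hull U N. w = (\<lambda>x. h x * c x)"
  using assms
proof (induction rule: tail_hull.induct)
  case (base i)
  then show ?case by (intro bexI[of _ "U i"] tail_hull.base) auto
next
  case (step u v t)
  then obtain f g where "f \<in> tail_hull U N" "u = (\<lambda>x. f x * c x)" "g \<in> tail_hull U N" "v = (\<lambda>x. g x * c x)" by blast
  with step show ?case
    by (intro bexI[of _ "\<lambda>x. (1 - t) * f x + t * g x"] tail_hull.step) (auto simp: algebra_simps)
qed

context regular_dirichlet begin

abbreviation "Y \<equiv> ext_space m E F"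

lemma Y_iff: "u \<in> Y \<longleftrightarrow> u \<in> X \<and> qc u"
  by (auto simp: ext_space_def X_def)

lemma Y_X: "u \<in> Y \<Longrightarrow> u \<in> X" and Y_qc: "u \<in> Y \<Longrightarrow> qc u"
  by (auto simp: Y_iff)

lemma Y_lin: "u \<in> Y \<Longrightarrow> v \<in> Y \<Longrightarrow> (\<lambda>x. a * u x + b * v x) \<in> Y"
  unfolding Y_iff by (auto intro: ext.lin intro!: qc_comp2[of u v] continuous_intros)

sublocale Y: semi_inner Y ext
proof (rule ext.semi_subspace)
  have "(\<lambda>x. 0) \<in> Y" using ext.zero_in qc_continuous[of "\<lambda>x. 0"] by (simp add: Y_iff)
  then show "Y \<noteq> {}" by blast
qed (use Y_X Y_lin in auto)

lemma Y_abs: "u \<in> Y \<Longrightarrow> (\<lambda>x. \<bar>u x\<bar>) \<in> Y"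
  unfolding Y_iff by (auto intro: ext.abs_in intro!: qc_comp2[of u u] continuous_intros)

lemma Y_clip: "u \<in> Y \<Longrightarrow> c > 0 \<Longrightarrow> (\<lambda>x. min (max 0 (u x)) c) \<in> Y"
  unfolding Y_iff by (auto intro: X_clip intro!: qc_comp2[of u u] continuous_intros)

lemma \<psi>_Y: "\<psi> \<in> Y"
  using F_subset_X[OF \<psi>(1)] qc_continuous[OF \<psi>(2)] by (simp add: Y_iff)

lemma Y_min: "u \<in> Y \<Longrightarrow> v \<in> Y \<Longrightarrow> (\<lambda>x. min (u x) (v x)) \<in> Y"
  unfolding Y_iff by (auto intro: ext.min_in intro!: qc_comp2[of u v] continuous_intros)

text \<open>The excess inequality bounds the energy of the cut-off by a pairing with
  \<open>g n\<close>, small by Cauchy-Schwarz, plus its pairing with \<open>\<psi>\<close>, small by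
  weak convergence.\<close>

lemma min_ref_null:
  assumes g: "\<And>n. g n \<in> X" and g0: "\<And>n x. 0 \<le> g n x" and lim: "(\<lambda>n. ext (g n) (g n)) \<longlonglongrightarrow> 0"
    and ae: "AE x in m. (\<lambda>n. g n x) \<longlonglongrightarrow> 0"
  shows "(\<lambda>n. E1 (\<lambda>x. min (g n x) (\<psi> x)) (\<lambda>x. min (g n x) (\<psi> x))) \<longlonglongrightarrow> 0"
proof -
  define v where "v n = (\<lambda>x. min (g n x) (\<psi> x))" for n
  have \<psi>X: "\<psi> \<in> X" using \<psi>(1) by (rule F_subset_X)
  have \<psi>0: "0 \<le> \<psi> x" for x using \<psi>(3)[of x] by simp
  have vX: "v n \<in> X" for n unfolding v_def using g \<psi>X by (rule ext.min_in)
  have vF: "v n \<in> F" for n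
    by (rule X_dominated_in_F[OF vX \<psi>(1)]) (use g0 \<psi>0 in \<open>auto simp: v_def\<close>)
  have L2: "(\<lambda>n. L2_dist2 M (v n) (\<lambda>x. 0)) \<longlonglongrightarrow> 0"
  proof (rule L2_null_dominated[OF vF \<psi>(1)])
    show "\<bar>v n x\<bar> \<le> \<psi> x" for n x using g0[of n x] \<psi>0[of x] by (simp add: v_def)
    show "AE x in m. (\<lambda>n. v n x) \<longlonglongrightarrow> 0"
      using ae
    proof eventually_elim
      case (elim x)
      have "(\<lambda>n. v n x) \<longlonglongrightarrow> min 0 (\<psi> x)" unfolding v_def by (intro tendsto_intros elim)
      then show ?case using \<psi>0[of x] by simp
    qed
  qed
  obtain D where D: "\<And>n. ext (g n) (g n) \<le> D" using LIMSEQ_bounded_above[OF lim] by blast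
  have bd: "E (v n) (v n) \<le> D + E \<psi> \<psi>" for n
    using ext.min_contr[OF g \<psi>X, of n] D[of n] by (simp add: v_def[symmetric] ext_eq_E vF \<psi>(1))
  have wk: "(\<lambda>n. E (v n) \<psi>) \<longlonglongrightarrow> 0"
    using F_weak_tendsto[OF vF bd E.zero_in L2 \<psi>(1)] by (simp add: E.zero_left \<psi>(1))
  have up: "E (v n) (v n) \<le> sqrt (ext (g n) (g n)) * (sqrt (D + E \<psi> \<psi>) + sqrt (E \<psi> \<psi>)) + E (v n) \<psi>" for n
  proof -
    have "ext (\<lambda>x. g n x - v n x) (\<lambda>x. \<psi> x - v n x) \<le> 0"
      using ext.excess_le[OF g \<psi>X, of n] by (simp add: v_def)
    then have "ext (g n) \<psi> - ext (g n) (v n) - ext (v n) \<psi> + ext (v n) (v n) \<le> 0"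
      using g vX \<psi>X by (simp add: ext.diff_left ext.diff_right ext.diff_in)
    then have 1: "E (v n) (v n) \<le> ext (g n) (v n) - ext (g n) \<psi> + E (v n) \<psi>"
      by (simp add: ext_eq_E vF \<psi>(1))
    have "ext (g n) (v n) \<le> sqrt (ext (g n) (g n)) * sqrt (D + E \<psi> \<psi>)"
    proof -
      have "ext (g n) (v n) \<le> sqrt (ext (g n) (g n)) * sqrt (ext (v n) (v n))"
        using ext.abs_le[OF g vX, of n n] by simp
      also have "\<dots> \<le> sqrt (ext (g n) (g n)) * sqrt (D + E \<psi> \<psi>)"
        using bd[of n] ext.nonneg[OF g] by (intro mult_left_mono) (auto simp: ext_eq_E vF)
      finally show ?thesis .
    qed
    moreover have "- ext (g n) \<psi> \<le> sqrt (ext (g n) (g n)) * sqrt (E \<psi> \<psi>)"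
      using ext.abs_le[OF g \<psi>X, of n] by (simp add: ext_eq_E \<psi>(1))
    ultimately show ?thesis using 1 by (simp add: algebra_simps)
  qed
  have "(\<lambda>n. sqrt (ext (g n) (g n)) * (sqrt (D + E \<psi> \<psi>) + sqrt (E \<psi> \<psi>)) + E (v n) \<psi>)
      \<longlonglongrightarrow> sqrt 0 * (sqrt (D + E \<psi> \<psi>) + sqrt (E \<psi> \<psi>)) + 0"
    by (intro tendsto_intros lim wk)
  then have "(\<lambda>n. sqrt (ext (g n) (g n)) * (sqrt (D + E \<psi> \<psi>) + sqrt (E \<psi> \<psi>)) + E (v n) \<psi>) \<longlonglongrightarrow> 0" by simp
  then have "(\<lambda>n. E (v n) (v n)) \<longlonglongrightarrow> 0"
    by (rule Lim_null_comparison[rotated]) (use up E.nonneg[OF vF] in \<open>auto intro!: always_eventually\<close>)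
  moreover have "(\<lambda>n. L2_inner M (v n) (v n)) \<longlonglongrightarrow> 0"
    using L2 by (simp add: L2_dist2_form_dist2 form_dist2_def)
  ultimately show ?thesis unfolding v_def[symmetric] E1_eq using tendsto_add[of _ 0 _ _ 0] by force
qed

text \<open>
  The measure \<open>\<rho>\<close> plays the role of a killing measure that makes the irreducible form transient.
\<close>

context
  fixes \<rho> :: "'a measure"
  assumes irr: "irreducible_form m E F"
    and \<rho>_qe: "\<And>P. QE P \<Longrightarrow> AE x in \<rho>. P x"
    and \<rho>_nonzero: "\<not> (AE x in \<rho>. False)"
begin

text \<open>The limiting positive constant need not lie in \<open>F\<close>, so it is compared with
  \<open>c * \<psi>\<close>: cutting this at the combinations converges strongly, hence q.e. along a
  subsequence, which transfers the positive limit from \<open>m\<close> to \<open>\<rho>\<close>,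
  where the combinations vanish.\<close>

lemma weighted_mean_null:
  assumes t: "\<And>n. t n \<in> Y" and t01: "\<And>n x. 0 \<le> t n x \<and> t n x \<le> 1"
    and lim: "(\<lambda>n. ext (t n) (t n)) \<longlonglongrightarrow> 0"
    and tL: "\<And>n. t n \<in> L2 \<rho>" and lim\<rho>: "(\<lambda>n. L2_inner \<rho> (t n) (t n)) \<longlonglongrightarrow> 0"
    and e: "e > 0" and ge: "\<And>n. e \<le> L2_inner M (\<lambda>x. t n x * \<psi> x) \<psi>"
  shows False
proof -
  \<comment> \<open>The \<open>t n\<close> are bounded but need not be square integrable for
    \<open>m\<close>; the weight makes them so.\<close>
  let ?U = "\<lambda>n x. t n x * \<psi> x"
  have \<psi>L: "\<psi> \<in> L2 M" using F_L2 \<psi>(1) by blast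
  have \<psi>0: "0 \<le> \<psi> x" for x using \<psi>(3)[of x] by simp
  have multL: "(\<lambda>x. h x * \<psi> x) \<in> L2 M" if "h \<in> borel_measurable M" "\<And>x. 0 \<le> h x \<and> h x \<le> 1" for h
    by (rule L2_bound[OF _ \<psi>L])
      (use that L2_meas[OF \<psi>L] \<psi>0 in \<open>auto intro!: borel_measurable_times mult_left_le_one_le simp: abs_mult\<close>)
  have UL: "?U n \<in> L2 M" for n using t01 X_meas[OF Y_X[OF t]] by (intro multL) auto
  have Ubd: "L2_inner M (?U n) (?U n) \<le> L2_inner M \<psi> \<psi>" for n
    unfolding L2_inner_self
  proof (rule integral_mono[OF L2_sq_integrable[OF UL] L2_sq_integrable[OF \<psi>L]])
    fix x
    have "\<bar>?U n x\<bar> \<le> \<bar>\<psi> x\<bar>" using t01[of n x] \<psi>0[of x] by (simp add: abs_mult mult_left_le_one_le)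
    then show "(?U n x)\<^sup>2 \<le> (\<psi> x)\<^sup>2" by (simp add: abs_le_square_iff)
  qed
  obtain P where P: "\<And>N. P N \<in> tail_hull ?U N" "form_cauchy (L2_inner M) P"
    using L2.mazur[of ?U M, OF UL Ubd] by blast
  have "\<forall>N. \<exists>h\<in>tail_hull t N. P N = (\<lambda>x. h x * \<psi> x)" using tail_hull_mult[OF P(1)] by blast
  then have "\<forall>N. \<exists>h. h \<in> tail_hull t N \<and> P N = (\<lambda>x. h x * \<psi> x)" by blast
  from choice[OF this] obtain h where h: "\<And>N. h N \<in> tail_hull t N" "\<And>N. P N = (\<lambda>x. h N x * \<psi> x)"
    by blast
  have hY: "h N \<in> Y" for N by (rule Y.tail_hull_in[OF h(1) t])
  have h01: "0 \<le> h N x" "h N x \<le> 1" for N x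
    using tail_hull_ge[OF h(1), of N 0 x] tail_hull_le[OF h(1), of N x 1] t01 by auto
  have PL: "P N \<in> L2 M" for N unfolding h(2) using h01 X_meas[OF Y_X[OF hY]] by (intro multL) auto
  have int: "integrable M (\<lambda>x. P n x * \<psi> x)" for n by (rule L2_mult_integrable[OF PL \<psi>L])
  \<comment> \<open>A second factor \<open>\<psi>\<close> turns the L2 Cauchy property into an L1
    one, from which pointwise Cauchy subsequences are drawn.\<close>
  obtain r :: "nat \<Rightarrow> nat" where r: "strict_mono r" "AE x in M. Cauchy (\<lambda>i. P (r i) x * \<psi> x)"
  proof (rule cauchy_L1_AE_cauchy_subseq[of M "\<lambda>n x. P n x * \<psi> x", OF int])
    fix d :: real assume d: "d > 0"
    define C where "C = L2_inner M \<psi> \<psi> + 1"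
    have C: "C > 0" using L2.nonneg[OF \<psi>L] by (simp add: C_def add_nonneg_pos)
    have "d\<^sup>2 / C > 0" using d C by simp
    then obtain N where N: "\<And>i j. i \<ge> N \<Longrightarrow> j \<ge> N \<Longrightarrow> form_dist2 (L2_inner M) (P i) (P j) < d\<^sup>2 / C"
      using P(2) unfolding form_cauchy_def by blast
    have "(LINT x|M. norm (P i x * \<psi> x - P j x * \<psi> x)) < d" if ij: "i \<ge> N" "j \<ge> N" for i j
    proof -
      let ?d = "\<lambda>x. P i x - P j x"
      have dL: "?d \<in> L2 M" using PL by (intro L2.diff_in)
      have adL: "(\<lambda>x. \<bar>?d x\<bar>) \<in> L2 M" by (rule L2_bound[OF _ dL]) (use L2_meas[OF dL] in auto)
      have eq: "(LINT x|M. norm (P i x * \<psi> x - P j x * \<psi> x)) = L2_inner M (\<lambda>x. \<bar>?d x\<bar>) \<psi>"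
        unfolding L2_inner_def using \<psi>0 by (intro Bochner_Integration.integral_cong) (auto simp: abs_mult left_diff_distrib[symmetric])
      have "(L2_inner M (\<lambda>x. \<bar>?d x\<bar>) \<psi>)\<^sup>2 \<le> L2_inner M (\<lambda>x. \<bar>?d x\<bar>) (\<lambda>x. \<bar>?d x\<bar>) * L2_inner M \<psi> \<psi>"
        by (rule L2.Cauchy_Schwarz[OF adL \<psi>L])
      also have "L2_inner M (\<lambda>x. \<bar>?d x\<bar>) (\<lambda>x. \<bar>?d x\<bar>) = form_dist2 (L2_inner M) (P i) (P j)"
        by (simp add: form_dist2_def L2_inner_def)
      also have "\<dots> * L2_inner M \<psi> \<psi> \<le> d\<^sup>2 / C * L2_inner M \<psi> \<psi>"
        using N[OF ij] L2.nonneg[OF \<psi>L] by (intro mult_right_mono) auto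
      also have "\<dots> < d\<^sup>2 / C * C" using d C by (intro mult_strict_left_mono) (auto simp: C_def)
      also have "\<dots> = d\<^sup>2" using C by simp
      finally show ?thesis unfolding eq using d by (intro power2_less_imp_less[of _ d]) auto
    qed
    then show "\<exists>N. \<forall>i\<ge>N. \<forall>j\<ge>N. (LINT x|M. norm (P i x * \<psi> x - P j x * \<psi> x)) < d" by blast
  qed
  \<comment> \<open>The clamp matters only where the limit is missing: the bounds by 0 and 1 are
    required at every point.\<close>
  define k where "k x = max 0 (min 1 (lim (\<lambda>i. h (r i) x)))" for x
  have k01: "0 \<le> k x" "k x \<le> 1" for x by (auto simp: k_def)
  have km: "k \<in> borel_measurable M"
    unfolding k_def using X_meas[OF Y_X[OF hY]] by (intro borel_measurable_max borel_measurable_min borel_measurable_lim_metric) auto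
  have k_lim: "AE x in m. (\<lambda>i. h (r i) x) \<longlonglongrightarrow> k x"
    using r(2) unfolding AE_completion_iff
  proof eventually_elim
    case (elim x)
    then obtain l where "(\<lambda>i. P (r i) x * \<psi> x) \<longlonglongrightarrow> l" by (auto simp: Cauchy_convergent_iff convergent_def)
    then have "(\<lambda>i. P (r i) x * \<psi> x / (\<psi> x * \<psi> x)) \<longlonglongrightarrow> l / (\<psi> x * \<psi> x)"
      using \<psi>(3)[of x] by (intro tendsto_intros) auto
    then have l: "(\<lambda>i. h (r i) x) \<longlonglongrightarrow> l / (\<psi> x * \<psi> x)" using \<psi>(3)[of x] by (simp add: h(2))
    have "0 \<le> l / (\<psi> x * \<psi> x)" "l / (\<psi> x * \<psi> x) \<le> 1"
      using LIMSEQ_le_const[OF l] LIMSEQ_le_const2[OF l] h01 by blast+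
    then have "k x = l / (\<psi> x * \<psi> x)" using limI[OF l] by (simp add: k_def)
    with l show ?case by simp
  qed
  have ext_small: "\<exists>N. \<forall>n\<ge>N. ext (h n) (h n) \<le> d" if d: "d > 0" for d
  proof -
    obtain N where N: "\<And>n. n \<ge> N \<Longrightarrow> ext (t n) (t n) < d"
      using order_tendstoD(2)[OF lim d] by (auto simp: eventually_sequentially)
    have "ext (h n) (h n) \<le> d" if "n \<ge> N" for n
      by (rule Y.tail_hull_norm_le[OF h(1) t]) (use N that in \<open>meson less_imp_le order_trans\<close>)
    then show ?thesis by blast
  qed
  have k_le: "k \<in> X \<and> ext k k \<le> d" if d: "d > 0" for d
  proof -
    obtain N where N: "\<And>n. n \<ge> N \<Longrightarrow> ext (h n) (h n) \<le> d" using ext_small[OF d] by blast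
    have "AE x in m. (\<lambda>i. h (r (i + N)) x) \<longlonglongrightarrow> k x"
      using k_lim by eventually_elim (rule LIMSEQ_ignore_initial_segment)
    moreover have "ext (h (r (i + N))) (h (r (i + N))) \<le> d" for i
      using N seq_suble[OF r(1), of "i + N"] by simp
    ultimately show ?thesis using X_weak_closed[of "\<lambda>i. h (r (i + N))", OF Y_X[OF hY] _ _ km] by blast
  qed
  have kX: "k \<in> X" using k_le[of 1] by simp
  have "ext k k \<le> 0" by (rule field_le_epsilon) (use k_le in simp)
  then have "ext k k = 0" using ext.nonneg[OF kX] by simp
  from null_energy_constant[OF irr kX k01 this] obtain c where c: "AE x in m. k x = c" by blast
  have lim_int: "(\<lambda>i. L2_inner M (P (r i)) \<psi>) \<longlonglongrightarrow> L2_inner M (\<lambda>x. k x * \<psi> x) \<psi>"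
    unfolding L2_inner_def
  proof (rule integral_dominated_convergence)
    show "integrable M (\<lambda>x. (\<psi> x)\<^sup>2)" using \<psi>L by (rule L2_sq_integrable)
    show "AE x in M. (\<lambda>i. P (r i) x * \<psi> x) \<longlonglongrightarrow> k x * \<psi> x * \<psi> x"
      unfolding AE_completion_iff h(2) using k_lim by eventually_elim (intro tendsto_intros)
    show "AE x in M. norm (P (r i) x * \<psi> x) \<le> (\<psi> x)\<^sup>2" for i
      using h01[of "r i"] \<psi>0 by (auto simp: h(2) abs_mult power2_eq_square intro!: mult_right_mono mult_left_le_one_le)
  qed (use km L2_meas[OF \<psi>L] L2_meas[OF PL] in auto)
  have "e \<le> L2_inner M (P (r i)) \<psi>" for i
    by (rule L2.tail_hull_ge_left[OF P(1) UL \<psi>L ge])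
  then have e_le: "e \<le> L2_inner M (\<lambda>x. k x * \<psi> x) \<psi>" by (intro LIMSEQ_le_const[OF lim_int]) blast
  have c_pos: "c > 0"
  proof (rule ccontr)
    assume "\<not> c > 0"
    have "AE x in M. k x * \<psi> x * \<psi> x = 0"
      unfolding AE_completion_iff using c by eventually_elim (use k01 \<open>\<not> c > 0\<close> in \<open>metis mult_zero_left not_less order_antisym\<close>)
    then have "L2_inner M (\<lambda>x. k x * \<psi> x) \<psi> = 0" unfolding L2_inner_def by (rule integral_eq_zero_AE)
    with e_le e show False by simp
  qed
  define \<phi> where "\<phi> = (\<lambda>x. c * \<psi> x)"
  have \<phi>F: "\<phi> \<in> F" unfolding \<phi>_def using \<psi>(1) by (rule E.scale_in)
  have \<phi>Y: "\<phi> \<in> Y" unfolding \<phi>_def using \<psi>_Y by (rule Y.scale_in)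
  have \<phi>b: "0 < \<phi> x" "\<phi> x \<le> c" for x using c_pos \<psi>(3,4)[of x] by (auto simp: \<phi>_def mult_left_le)
  define V where "V i = (\<lambda>x. min (\<phi> x) (h (r i) x))" for i
  have VY: "V i \<in> Y" for i unfolding V_def using \<phi>Y hY by (rule Y_min)
  have VF: "V i \<in> F" for i
    by (rule X_dominated_in_F[OF Y_X[OF VY] \<phi>F]) (use h01 \<phi>b in \<open>auto simp: V_def less_imp_le\<close>)
  have V_le: "E (V i) (V i) \<le> E \<phi> \<phi> + ext (h (r i)) (h (r i))" for i
    using ext.min_contr[OF F_subset_X[OF \<phi>F] Y_X[OF hY], of "r i"] by (simp add: V_def[symmetric] ext_eq_E VF \<phi>F)
  have V_up: "\<forall>\<^sub>F i in sequentially. E (V i) (V i) \<le> E \<phi> \<phi> + d" if d: "d > 0" for d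
  proof -
    obtain N where N: "\<And>n. n \<ge> N \<Longrightarrow> ext (h n) (h n) \<le> d" using ext_small[OF d] by blast
    show ?thesis
      using eventually_ge_at_top[of N]
    proof eventually_elim
      case (elim i)
      then have "ext (h (r i)) (h (r i)) \<le> d" using N seq_suble[OF r(1), of i] by simp
      then show ?case using V_le[of i] by simp
    qed
  qed
  obtain D where D: "\<And>n. ext (t n) (t n) \<le> D" using LIMSEQ_bounded_above[OF lim] by blast
  have V_bd: "E (V i) (V i) \<le> E \<phi> \<phi> + D" for i
    using V_le[of i] Y.tail_hull_norm_le[OF h(1) t D, of "r i"] by simp
  have VL2: "(\<lambda>i. L2_dist2 M (V i) \<phi>) \<longlonglongrightarrow> 0"
  proof (rule L2_dominated(2)[OF F_meas[OF VF] F_meas[OF \<phi>F] F_L2[OF \<phi>F]])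
    show "AE x in M. \<bar>V i x\<bar> \<le> \<phi> x" for i using h01 \<phi>b by (auto simp: V_def less_imp_le)
    show "AE x in M. (\<lambda>i. V i x) \<longlonglongrightarrow> \<phi> x"
      unfolding AE_completion_iff using k_lim c
    proof eventually_elim
      case (elim x)
      have "(\<lambda>i. V i x) \<longlonglongrightarrow> min (\<phi> x) (k x)" unfolding V_def by (intro tendsto_intros elim)
      then show ?case using elim(2) \<phi>b(2)[of x] by simp
    qed
  qed
  have strong: "(\<lambda>i. form_dist2 E1 (V i) \<phi>) \<longlonglongrightarrow> 0" by (rule F_strong[OF VF V_bd \<phi>F VL2 V_up])
  let ?w = "\<lambda>i x. V i x - \<phi> x"
  have "?w i \<in> F" "qc (?w i)" for i
    using E.diff_in[OF VF \<phi>F] Y_qc[OF Y.diff_in[OF VY \<phi>Y]] by auto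
  moreover have "(\<lambda>i. E1 (?w i) (?w i)) \<longlonglongrightarrow> 0" using strong by (simp add: form_dist2_def)
  ultimately obtain s :: "nat \<Rightarrow> nat" where s: "strict_mono s" "QE (\<lambda>x. (\<lambda>n. ?w (s n) x) \<longlonglongrightarrow> 0)"
    using qc_null_subseq[of ?w] by blast
  have hL: "h N \<in> L2 \<rho>" for N by (rule L2.tail_hull_in[OF h(1) tL])
  have h\<rho>: "(\<lambda>n. L2_inner \<rho> (h n) (h n)) \<longlonglongrightarrow> 0"
  proof (rule LIMSEQ_I)
    fix d :: real assume d: "d > 0"
    then obtain N where N: "\<And>n. n \<ge> N \<Longrightarrow> L2_inner \<rho> (t n) (t n) < d / 2"
      using order_tendstoD(2)[OF lim\<rho>, of "d / 2"] by (auto simp: eventually_sequentially)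
    have "norm (L2_inner \<rho> (h n) (h n) - 0) < d" if "n \<ge> N" for n
    proof -
      have "L2_inner \<rho> (h n) (h n) \<le> d / 2"
        by (rule L2.tail_hull_norm_le[OF h(1) tL]) (use N that in \<open>meson less_imp_le order_trans\<close>)
      then show ?thesis using L2.nonneg[OF hL, of n] d by simp
    qed
    then show "\<exists>no. \<forall>n\<ge>no. norm (L2_inner \<rho> (h n) (h n) - 0) < d" by blast
  qed
  have "(\<lambda>n. L2_dist2 \<rho> (h (r (s n))) (\<lambda>x. 0)) \<longlonglongrightarrow> 0"
    using LIMSEQ_comp_mono[OF LIMSEQ_comp_mono[OF h\<rho> r(1)] s(1)] by (simp add: L2_dist2_form_dist2 form_dist2_def)
  then obtain q :: "nat \<Rightarrow> nat" where q: "strict_mono q" "AE x in \<rho>. (\<lambda>n. h (r (s (q n))) x) \<longlonglongrightarrow> 0"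
    using L2_AE_subseq[of "\<lambda>n. h (r (s n))" \<rho> "\<lambda>x. 0", OF hL L2.zero_in] by blast
  \<comment> \<open>At almost every point the truncations tend to
    \<open>min (\<phi> x) 0 = 0\<close> and also to the positive value
    \<open>\<phi> x\<close>.\<close>
  have "AE x in \<rho>. False"
    using q(2) \<rho>_qe[OF s(2)]
  proof eventually_elim
    case (elim x)
    have "(\<lambda>n. V (s (q n)) x) \<longlonglongrightarrow> min (\<phi> x) 0" unfolding V_def by (intro tendsto_intros elim)
    moreover have "(\<lambda>n. ?w (s (q n)) x + \<phi> x) \<longlonglongrightarrow> 0 + \<phi> x"
      by (intro tendsto_intros LIMSEQ_comp_mono[OF elim(2) q(1)])
    ultimately have "min (\<phi> x) 0 = \<phi> x" using LIMSEQ_unique by simp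
    with \<phi>b(1)[of x] show ?case by simp
  qed
  with \<rho>_nonzero show False by simp
qed

text \<open>A sequential counterexample is clipped at height 1. Its weighted means vanish by
  \<open>weighted_mean_null\<close>, so a subsequence tends to 0 a.e. and
  \<open>min_ref_null\<close> applies.\<close>

lemma min_ref_small:
  assumes e: "e > 0"
  shows "\<exists>d>0. \<forall>g\<in>Y \<inter> L2 \<rho>. ext g g < d \<and> L2_inner \<rho> g g < d \<longrightarrow>
    E1 (\<lambda>x. min \<bar>g x\<bar> (\<psi> x)) (\<lambda>x. min \<bar>g x\<bar> (\<psi> x)) < e"
proof (rule ccontr)
  assume neg: "\<not> ?thesis"
  have "\<forall>n. \<exists>g. g \<in> Y \<and> g \<in> L2 \<rho> \<and> ext g g < inverse (real (Suc n)) \<and> L2_inner \<rho> g g < inverse (real (Suc n)) \<and>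
      e \<le> E1 (\<lambda>x. min \<bar>g x\<bar> (\<psi> x)) (\<lambda>x. min \<bar>g x\<bar> (\<psi> x))"
  proof
    fix n
    have "inverse (real (Suc n)) > 0" by simp
    with neg show "\<exists>g. g \<in> Y \<and> g \<in> L2 \<rho> \<and> ext g g < inverse (real (Suc n)) \<and> L2_inner \<rho> g g < inverse (real (Suc n)) \<and>
      e \<le> E1 (\<lambda>x. min \<bar>g x\<bar> (\<psi> x)) (\<lambda>x. min \<bar>g x\<bar> (\<psi> x))" by (meson IntD1 IntD2 not_less)
  qed
  from choice[OF this] obtain g where "\<forall>n. g n \<in> Y \<and> g n \<in> L2 \<rho> \<and> ext (g n) (g n) < inverse (real (Suc n)) \<and>
      L2_inner \<rho> (g n) (g n) < inverse (real (Suc n)) \<and>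
      e \<le> E1 (\<lambda>x. min \<bar>g n x\<bar> (\<psi> x)) (\<lambda>x. min \<bar>g n x\<bar> (\<psi> x))" by blast
  then have g: "\<And>n. g n \<in> Y" "\<And>n. g n \<in> L2 \<rho>" "\<And>n. ext (g n) (g n) < inverse (real (Suc n))"
    "\<And>n. L2_inner \<rho> (g n) (g n) < inverse (real (Suc n))"
    "\<And>n. e \<le> E1 (\<lambda>x. min \<bar>g n x\<bar> (\<psi> x)) (\<lambda>x. min \<bar>g n x\<bar> (\<psi> x))" by auto
  define a where "a n = (\<lambda>x. \<bar>g n x\<bar>)" for n
  define t where "t n = (\<lambda>x. min (max 0 (a n x)) 1)" for n
  have aY: "a n \<in> Y" for n unfolding a_def using g(1) by (rule Y_abs)
  have a_lim: "(\<lambda>n. ext (a n) (a n)) \<longlonglongrightarrow> 0"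
  proof (rule Lim_null_comparison[OF _ LIMSEQ_inverse_real_of_nat], rule always_eventually, rule allI)
    fix n
    have "ext (a n) (a n) \<le> ext (g n) (g n)" unfolding a_def using Y_X[OF g(1)] by (rule ext.abs_contr)
    then show "norm (ext (a n) (a n)) \<le> inverse (real (Suc n))" using g(3)[of n] Y.nonneg[OF aY, of n] by simp
  qed
  have tY: "t n \<in> Y" for n unfolding t_def using aY by (rule Y_clip) simp
  have t01: "0 \<le> t n x \<and> t n x \<le> 1" for n x by (simp add: t_def)
  have t_lim: "(\<lambda>n. ext (t n) (t n)) \<longlonglongrightarrow> 0"
  proof (rule Lim_null_comparison[OF _ a_lim], rule always_eventually, rule allI)
    fix n
    show "norm (ext (t n) (t n)) \<le> ext (a n) (a n)"
      using X_clip(2)[OF Y_X[OF aY], of 1 n] Y.nonneg[OF tY, of n] by (simp add: t_def[symmetric])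
  qed
  have t_le: "\<bar>t n x\<bar> \<le> \<bar>g n x\<bar>" for n x by (simp add: t_def a_def)
  have tL: "t n \<in> L2 \<rho>" for n
    by (rule L2_bound[OF _ g(2)[of n]]) (use t_le L2_meas[OF g(2)[of n]] in \<open>auto simp: t_def a_def intro!: borel_measurable_min borel_measurable_max borel_measurable_abs\<close>)
  have t\<rho>: "(\<lambda>n. L2_inner \<rho> (t n) (t n)) \<longlonglongrightarrow> 0"
  proof (rule Lim_null_comparison[OF _ LIMSEQ_inverse_real_of_nat], rule always_eventually, rule allI)
    fix n
    have "L2_inner \<rho> (t n) (t n) \<le> L2_inner \<rho> (g n) (g n)"
      unfolding L2_inner_self
      by (rule integral_mono[OF L2_sq_integrable[OF tL] L2_sq_integrable[OF g(2)]]) (use t_le in \<open>simp add: abs_le_square_iff\<close>)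
    then show "norm (L2_inner \<rho> (t n) (t n)) \<le> inverse (real (Suc n))" using g(4)[of n] L2.nonneg[OF tL, of n] by simp
  qed
  let ?J = "\<lambda>n. L2_inner M (\<lambda>x. t n x * \<psi> x) \<psi>"
  have \<psi>0: "0 \<le> \<psi> x" for x using \<psi>(3)[of x] by simp
  have \<psi>L: "\<psi> \<in> L2 M" using F_L2 \<psi>(1) by blast
  have UL: "(\<lambda>x. t n x * \<psi> x) \<in> L2 M" for n
    by (rule L2_bound[OF _ \<psi>L])
      (use t01[of n] X_meas[OF Y_X[OF tY]] L2_meas[OF \<psi>L] \<psi>0 in \<open>auto intro!: borel_measurable_times mult_left_le_one_le simp: abs_mult\<close>)
  have J0: "0 \<le> ?J n" for n
    unfolding L2_inner_def using t01 \<psi>0 by (intro Bochner_Integration.integral_nonneg mult_nonneg_nonneg) auto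
  have "?J \<longlonglongrightarrow> 0"
  proof (rule LIMSEQ_I)
    fix d :: real assume d: "d > 0"
    have "\<forall>\<^sub>F n in sequentially. ?J n < d"
    proof (rule ccontr)
      assume "\<not> ?thesis"
      then obtain r :: "nat \<Rightarrow> nat" where r: "strict_mono r" "\<And>n. \<not> ?J (r n) < d"
        by (rule subseq_of_frequently) blast
      have ge: "d \<le> L2_inner M (\<lambda>x. t (r n) x * \<psi> x) \<psi>" for n using r(2)[of n] by simp
      show False
        by (rule weighted_mean_null[of "\<lambda>n. t (r n)", OF tY t01 LIMSEQ_comp_mono[OF t_lim r(1)] tL LIMSEQ_comp_mono[OF t\<rho> r(1)] d ge])
    qed
    then show "\<exists>no. \<forall>n\<ge>no. norm (?J n - 0) < d" using J0 by (simp add: eventually_sequentially)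
  qed
  moreover have "(\<integral>x. norm (t n x * \<psi> x * \<psi> x) \<partial>M) = ?J n" for n
    unfolding L2_inner_def using t01 \<psi>0 by (intro Bochner_Integration.integral_cong) (auto simp: abs_mult)
  ultimately have "(\<lambda>n. \<integral>x. norm (t n x * \<psi> x * \<psi> x) \<partial>M) \<longlonglongrightarrow> 0" by simp
  then have "\<exists>r::nat\<Rightarrow>nat. strict_mono r \<and> (AE x in M. (\<lambda>n. t (r n) x * \<psi> x * \<psi> x) \<longlonglongrightarrow> 0)"
    by (intro tendsto_L1_AE_subseq[of M "\<lambda>n x. t n x * \<psi> x * \<psi> x"] L2_mult_integrable[OF UL \<psi>L]) 
  then obtain r :: "nat \<Rightarrow> nat" where r: "strict_mono r" "AE x in M. (\<lambda>n. t (r n) x * \<psi> x * \<psi> x) \<longlonglongrightarrow> 0" by blast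
  have "AE x in m. (\<lambda>n. a (r n) x) \<longlonglongrightarrow> 0"
    using r(2) unfolding AE_completion_iff
  proof eventually_elim
    case (elim x)
    then have "(\<lambda>n. t (r n) x * \<psi> x * \<psi> x / (\<psi> x * \<psi> x)) \<longlonglongrightarrow> 0 / (\<psi> x * \<psi> x)"
      using \<psi>(3)[of x] by (intro tendsto_intros) auto
    then have t: "(\<lambda>n. t (r n) x) \<longlonglongrightarrow> 0" using \<psi>(3)[of x] by simp
    \<comment> \<open>Values below 1 are unaffected by the clip, so the unclipped functions tend to
      0 as well.\<close>
    have "\<forall>\<^sub>F n in sequentially. t (r n) x < 1" using order_tendstoD(2)[OF t, of 1] by simp
    then have "\<forall>\<^sub>F n in sequentially. t (r n) x = a (r n) x"
      by eventually_elim (auto simp: t_def a_def min_def split: if_splits)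
    then show ?case using t by (rule Lim_transform_eventually[rotated])
  qed
  then have "(\<lambda>n. E1 (\<lambda>x. min (a (r n) x) (\<psi> x)) (\<lambda>x. min (a (r n) x) (\<psi> x))) \<longlonglongrightarrow> 0"
    by (intro min_ref_null Y_X[OF aY] LIMSEQ_comp_mono[OF a_lim r(1)]) (simp_all add: a_def)
  then have "e \<le> 0" using g(5) by (intro LIMSEQ_le_const) (auto simp: a_def)
  with e show False by simp
qed

text \<open>Increments of a fast subsequence are inflated by \<open>2 ^ n\<close>. Capacity controls
  only their truncations by \<open>\<psi>\<close>, but a bound by \<open>\<psi> / 2\<close> shows
  that the truncation was inactive.\<close>

theorem Y_complete:
  assumes u: "\<And>n. u n \<in> Y" and uL: "\<And>n. u n \<in> L2 \<rho>"
    and c: "form_cauchy ext u" "form_cauchy (L2_inner \<rho>) u"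
  obtains r :: "nat \<Rightarrow> nat" and v where "strict_mono r" "v \<in> Y" "QE (\<lambda>x. (\<lambda>n. u (r n) x) \<longlonglongrightarrow> v x)"
    "(\<lambda>n. form_dist2 ext (u n) v) \<longlonglongrightarrow> 0"
proof -
  have "\<forall>n::nat. \<exists>d>0. \<forall>g\<in>Y \<inter> L2 \<rho>. ext g g < d \<and> L2_inner \<rho> g g < d \<longrightarrow>
    E1 (\<lambda>x. min \<bar>g x\<bar> (\<psi> x)) (\<lambda>x. min \<bar>g x\<bar> (\<psi> x)) < ((1/2) ^ n)\<^sup>2"
    by (intro allI min_ref_small) simp
  from choice[OF this] obtain d where d: "\<And>n. d n > 0"
    "\<And>n g. g \<in> Y \<Longrightarrow> g \<in> L2 \<rho> \<Longrightarrow> ext g g < d n \<Longrightarrow> L2_inner \<rho> g g < d n \<Longrightarrow>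
      E1 (\<lambda>x. min \<bar>g x\<bar> (\<psi> x)) (\<lambda>x. min \<bar>g x\<bar> (\<psi> x)) < ((1/2) ^ n)\<^sup>2" by blast
  \<comment> \<open>The divisor offsets the later scaling, since the forms are quadratic.\<close>
  have Nex: "\<exists>N. \<forall>i\<ge>N. \<forall>j\<ge>N. form_dist2 ext (u i) (u j) < d n / (2 ^ n)\<^sup>2 \<and>
      form_dist2 (L2_inner \<rho>) (u i) (u j) < d n / (2 ^ n)\<^sup>2" for n
  proof -
    have pos: "d n / (2 ^ n)\<^sup>2 > 0" using d(1) by simp
    obtain N where N: "\<And>i j. i \<ge> N \<Longrightarrow> j \<ge> N \<Longrightarrow> form_dist2 ext (u i) (u j) < d n / (2 ^ n)\<^sup>2"
      using c(1) pos unfolding form_cauchy_def by blast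
    obtain N' where N': "\<And>i j. i \<ge> N' \<Longrightarrow> j \<ge> N' \<Longrightarrow> form_dist2 (L2_inner \<rho>) (u i) (u j) < d n / (2 ^ n)\<^sup>2"
      using c(2) pos unfolding form_cauchy_def by blast
    show ?thesis using N N' by (intro exI[of _ "max N N'"]) auto
  qed
  have "\<exists>r. \<forall>n. (\<forall>i\<ge>r n. \<forall>j\<ge>r n. form_dist2 ext (u i) (u j) < d n / (2 ^ n)\<^sup>2 \<and>
      form_dist2 (L2_inner \<rho>) (u i) (u j) < d n / (2 ^ n)\<^sup>2) \<and> r n < r (Suc n)"
  proof (rule dependent_nat_choice)
    show "\<exists>x. \<forall>i\<ge>x. \<forall>j\<ge>x. form_dist2 ext (u i) (u j) < d 0 / (2 ^ 0)\<^sup>2 \<and>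
      form_dist2 (L2_inner \<rho>) (u i) (u j) < d 0 / (2 ^ 0)\<^sup>2" by (rule Nex)
    fix x n
    obtain N where "\<forall>i\<ge>N. \<forall>j\<ge>N. form_dist2 ext (u i) (u j) < d (Suc n) / (2 ^ Suc n)\<^sup>2 \<and>
      form_dist2 (L2_inner \<rho>) (u i) (u j) < d (Suc n) / (2 ^ Suc n)\<^sup>2" using Nex by blast
    then show "\<exists>y. (\<forall>i\<ge>y. \<forall>j\<ge>y. form_dist2 ext (u i) (u j) < d (Suc n) / (2 ^ Suc n)\<^sup>2 \<and>
      form_dist2 (L2_inner \<rho>) (u i) (u j) < d (Suc n) / (2 ^ Suc n)\<^sup>2) \<and> x < y"
      by (intro exI[of _ "max N (Suc x)"]) auto
  qed
  then obtain r where r: "\<And>n i j. i \<ge> r n \<Longrightarrow> j \<ge> r n \<Longrightarrow> form_dist2 ext (u i) (u j) < d n / (2 ^ n)\<^sup>2 \<and>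
      form_dist2 (L2_inner \<rho>) (u i) (u j) < d n / (2 ^ n)\<^sup>2" "\<And>n. r n < r (Suc n)" by blast
  have rm: "strict_mono r" using r(2) by (simp add: strict_mono_Suc_iff)
  have step: "\<exists>U. small (3 * (1/2) ^ n) U \<and> (\<forall>x. x \<notin> U \<longrightarrow> \<bar>u (r (Suc n)) x - u (r n) x\<bar> \<le> (1/2) ^ n)" for n
  proof -
    let ?D = "\<lambda>x. u (r (Suc n)) x - u (r n) x"
    define g where "g = (\<lambda>x. 2 ^ n * ?D x)"
    have DY: "?D \<in> Y" using u by (intro Y.diff_in)
    have DL: "?D \<in> L2 \<rho>" using uL by (intro L2.diff_in)
    have gY: "g \<in> Y" unfolding g_def using DY by (rule Y.scale_in)
    have gL: "g \<in> L2 \<rho>" unfolding g_def using DL by (rule L2.scale_in)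
    have lt: "form_dist2 ext (u (r (Suc n))) (u (r n)) < d n / (2 ^ n)\<^sup>2"
      "form_dist2 (L2_inner \<rho>) (u (r (Suc n))) (u (r n)) < d n / (2 ^ n)\<^sup>2"
      using r(1)[of n "r (Suc n)" "r n"] r(2)[of n] by auto
    have "ext g g = (2 ^ n)\<^sup>2 * form_dist2 ext (u (r (Suc n))) (u (r n))"
      unfolding g_def Y.expand_scale[OF DY] form_dist2_def ..
    also have "\<dots> < d n" using lt(1) by (simp add: field_simps)
    finally have 1: "ext g g < d n" .
    have "L2_inner \<rho> g g = (2 ^ n)\<^sup>2 * form_dist2 (L2_inner \<rho>) (u (r (Suc n))) (u (r n))"
      unfolding g_def L2.expand_scale[OF DL] form_dist2_def ..
    also have "\<dots> < d n" using lt(2) by (simp add: field_simps)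
    finally have 2: "L2_inner \<rho> g g < d n" .
    let ?z = "\<lambda>x. min \<bar>g x\<bar> (\<psi> x)"
    have zY: "?z \<in> Y" by (intro Y_min Y_abs gY \<psi>_Y)
    have zF: "?z \<in> F" by (rule X_dominated_in_F[OF Y_X[OF zY] \<psi>(1)]) (use \<psi>(3) in \<open>auto intro: less_imp_le\<close>)
    have "sqrt (E1 ?z ?z) \<le> (1/2) ^ n" using d(2)[OF gY gL 1 2] by (intro real_le_lsqrt) auto
    \<comment> \<open>The threshold 1/2 lies strictly below 1 and so excludes that the minimum is
      attained by \<open>\<psi>\<close>.\<close>
    moreover obtain U where U: "small (sqrt (E1 ?z ?z) / (1/2) + (1/2) ^ n) U" "\<And>x. x \<notin> U \<Longrightarrow> \<bar>?z x\<bar> \<le> 1/2 * \<psi> x"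
      using qc_bound[OF zF Y_qc[OF zY], of "1/2" "(1/2) ^ n"] by auto
    ultimately have "small (3 * (1/2) ^ n) U" by (intro small_mono[OF U(1)]) simp
    moreover have "\<bar>?D x\<bar> \<le> (1/2) ^ n" if "x \<notin> U" for x
    proof -
      have "\<bar>g x\<bar> \<le> 1" using U(2)[OF that] \<psi>(3,4)[of x] by (simp add: min_def split: if_splits)
      then have "2 ^ n * \<bar>?D x\<bar> \<le> 1" by (simp add: g_def abs_mult)
      then show ?thesis by (simp add: field_simps power_one_over)
    qed
    ultimately show ?thesis by blast
  qed
  obtain v where v: "qc v" "QE (\<lambda>x. (\<lambda>n. u (r n) x) \<longlonglongrightarrow> v x)"
    using qc_limit[of "\<lambda>n. u (r n)" 3, OF Y_qc[OF u] _ step] by auto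
  note lim = X_cauchy_limit[OF Y_X[OF u] c(1) rm qe_AE_m[OF v(2)] qc_measurable_m[OF v(1)]]
  have "v \<in> Y" using lim(1) v(1) by (simp add: Y_iff)
  with rm v(2) lim(2) that show ?thesis by blast
qed

end
end

section \<open>Density of the traces\<close>

lemma sum_measure_simps [simp]: "space (sum_measure N N') = space N" "sets (sum_measure N N') = sets N"
  by (simp_all add: sum_measure_def)

lemma nn_integral_sum_measure:
  assumes s: "sets N = sets N'" and f: "f \<in> borel_measurable N"
  shows "(\<integral>\<^sup>+x. f x \<partial>sum_measure N N') = (\<integral>\<^sup>+x. f x \<partial>N) + (\<integral>\<^sup>+x. f x \<partial>N')"
proof -
  have mm: "g \<in> borel_measurable N \<Longrightarrow> g \<in> borel_measurable N'" "g \<in> borel_measurable N \<Longrightarrow> g \<in> borel_measurable (sum_measure N N')"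
    for g :: "_ \<Rightarrow> ennreal"
    using measurable_cong_sets[OF s refl] measurable_cong_sets[of "sum_measure N N'" N borel borel] by auto
  have sp: "space N = space N'" using s by (rule sets_eq_imp_space_eq)
  show ?thesis
    using f
  proof (induction rule: borel_measurable_induct)
    case (cong f g)
    note fg = cong(3)
    have "(\<integral>\<^sup>+x. f x \<partial>sum_measure N N') = (\<integral>\<^sup>+x. g x \<partial>sum_measure N N')" by (intro nn_integral_cong fg) simp
    moreover have "(\<integral>\<^sup>+x. f x \<partial>N) = (\<integral>\<^sup>+x. g x \<partial>N)" by (intro nn_integral_cong fg)
    moreover have "(\<integral>\<^sup>+x. f x \<partial>N') = (\<integral>\<^sup>+x. g x \<partial>N')" by (intro nn_integral_cong fg) (simp add: sp)
    ultimately show ?case using cong(4) by simp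
  next
    case (set A)
    then show ?case using s by (simp add: emeasure_sum_measure)
  next
    case (mult u c)
    note u = mult(2)
    show ?case
      by (simp only: nn_integral_cmult[OF u] nn_integral_cmult[OF mm(1)[OF u]] nn_integral_cmult[OF mm(2)[OF u]]
          mult.IH distrib_left)
  next
    case (add u v)
    then have u: "u \<in> borel_measurable N" and v: "v \<in> borel_measurable N" by auto
    show ?case
      by (simp only: nn_integral_add[OF v u] nn_integral_add[OF mm(1)[OF v] mm(1)[OF u]]
          nn_integral_add[OF mm(2)[OF v] mm(2)[OF u]] add.IH) (simp only: ac_simps)
  next
    case (seq U)
    have Um: "\<And>i. U i \<in> borel_measurable N" and inc: "incseq U" by fact+
    have gen: "(\<integral>\<^sup>+x. (SUP i. U i) x \<partial>K) = (SUP i. \<integral>\<^sup>+x. U i x \<partial>K)"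
      if "\<And>i. U i \<in> borel_measurable K" for K
      using nn_integral_monotone_convergence_SUP[OF inc that] by (simp add: SUP_apply image_comp)
    have "(\<integral>\<^sup>+x. (SUP i. U i) x \<partial>sum_measure N N') = (SUP i. (\<integral>\<^sup>+x. U i x \<partial>N) + (\<integral>\<^sup>+x. U i x \<partial>N'))"
      unfolding gen[OF mm(2)[OF Um]] seq.IH ..
    also have "\<dots> = (SUP i. \<integral>\<^sup>+x. U i x \<partial>N) + (SUP i. \<integral>\<^sup>+x. U i x \<partial>N')"
      using inc by (intro ennreal_SUP_add) (auto simp: incseq_def le_fun_def intro!: nn_integral_mono)
    finally show ?case unfolding gen[OF Um] gen[OF mm(1)[OF Um]] .
  qed
qed

lemma L2_iff_nn:
  assumes "u \<in> borel_measurable N"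
  shows "u \<in> L2 N \<longleftrightarrow> (\<integral>\<^sup>+x. ennreal ((u x)\<^sup>2) \<partial>N) < \<infinity>"
  using assms by (auto simp: L2_def integrable_iff_bounded)

lemma nn_integral_L2: "u \<in> L2 N \<Longrightarrow> (\<integral>\<^sup>+x. ennreal ((u x)\<^sup>2) \<partial>N) = ennreal (L2_inner N u u)"
  unfolding L2_inner_self by (intro nn_integral_eq_integral L2_sq_integrable) auto

text \<open>The three completions have different measurable sets; a version measurable before
  completion links their integrals.\<close>

lemma L2_sum_measure_iff:
  assumes s: "sets N = sets N'" and u: "u \<in> borel_measurable (completion (sum_measure N N'))"
    "u \<in> borel_measurable (completion N)" "u \<in> borel_measurable (completion N')"
  shows "u \<in> L2 (completion (sum_measure N N')) \<longleftrightarrow> u \<in> L2 (completion N) \<and> u \<in> L2 (completion N')"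
proof -
  obtain u' where u': "u' \<in> borel_measurable (sum_measure N N')" "AE x in sum_measure N N'. u x = u' x"
    using completion_ex_borel_measurable_real[OF u(1)] by blast
  have u'N: "u' \<in> borel_measurable N" using u'(1) measurable_cong_sets[of "sum_measure N N'" N "borel :: real measure" borel] by simp
  obtain B where "{x \<in> space (sum_measure N N'). \<not> u x = u' x} \<subseteq> B" "B \<in> sets (sum_measure N N')"
    and B0: "emeasure (sum_measure N N') B = 0" using AE_E[OF u'(2)] by blast
  then have B: "{x \<in> space N. \<not> u x = u' x} \<subseteq> B" "B \<in> sets N" "emeasure (sum_measure N N') B = 0" by simp_all
  then have "B \<in> null_sets N" "B \<in> null_sets N'" using s by (auto simp: emeasure_sum_measure null_sets_def)
  then have ae: "AE x in N. u x = u' x" "AE x in N'. u x = u' x"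
    using B(1) sets_eq_imp_space_eq[OF s] by (auto intro!: AE_I'[of B])
  have "(\<integral>\<^sup>+x. ennreal ((u x)\<^sup>2) \<partial>sum_measure N N') = (\<integral>\<^sup>+x. ennreal ((u' x)\<^sup>2) \<partial>sum_measure N N')"
    using u'(2) by (intro nn_integral_cong_AE) auto
  also have "\<dots> = (\<integral>\<^sup>+x. ennreal ((u' x)\<^sup>2) \<partial>N) + (\<integral>\<^sup>+x. ennreal ((u' x)\<^sup>2) \<partial>N')"
    using u'N by (intro nn_integral_sum_measure s) simp
  also have "(\<integral>\<^sup>+x. ennreal ((u' x)\<^sup>2) \<partial>N) = (\<integral>\<^sup>+x. ennreal ((u x)\<^sup>2) \<partial>N)"
    using ae(1) by (intro nn_integral_cong_AE) auto
  also have "(\<integral>\<^sup>+x. ennreal ((u' x)\<^sup>2) \<partial>N') = (\<integral>\<^sup>+x. ennreal ((u x)\<^sup>2) \<partial>N')"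
    using ae(2) by (intro nn_integral_cong_AE) auto
  finally show ?thesis using u by (simp add: L2_iff_nn nn_integral_completion)
qed

section \<open>L2 closures of subspaces\<close>

definition L2_closure :: "'a measure \<Rightarrow> ('a \<Rightarrow> real) set \<Rightarrow> ('a \<Rightarrow> real) set" where
  "L2_closure N D = {f \<in> L2 N. \<forall>e>0. \<exists>g\<in>D. L2_dist2 N f g < e}"

locale L2_subspace =
  fixes N :: "'a measure" and D :: "('a \<Rightarrow> real) set"
  assumes D_L2: "D \<subseteq> L2 N" and D_lin: "\<And>u v a b. u \<in> D \<Longrightarrow> v \<in> D \<Longrightarrow> (\<lambda>x. a * u x + b * v x) \<in> D"
    and D_ne: "D \<noteq> {}"
begin

lemma closure_L2: "f \<in> L2_closure N D \<Longrightarrow> f \<in> L2 N"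
  by (simp add: L2_closure_def)

lemma closure_limit:
  assumes f: "\<And>e. e > 0 \<Longrightarrow> \<exists>g\<in>L2_closure N D. L2_dist2 N f g < e" and fL: "f \<in> L2 N"
  shows "f \<in> L2_closure N D"
  unfolding L2_closure_def
proof (intro CollectI conjI allI impI fL)
  fix e :: real assume e: "e > 0"
  obtain g where g: "g \<in> L2_closure N D" "L2_dist2 N f g < e / 4" using f[of "e/4"] e by auto
  then obtain v where v: "v \<in> D" "L2_dist2 N g v < e / 4" using e unfolding L2_closure_def by (auto dest!: spec[of _ "e/4"])
  have "L2_dist2 N f v \<le> 2 * L2_dist2 N f g + 2 * L2_dist2 N g v"
    unfolding L2_dist2_form_dist2 using v(1) D_L2 by (intro L2.dist2_triangle fL closure_L2[OF g(1)]) auto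
  also have "\<dots> < e" using g v by simp
  finally show "\<exists>g\<in>D. L2_dist2 N f g < e" using v(1) by blast
qed

lemma closure_tendsto:
  assumes f: "\<And>n. f n \<in> L2_closure N D" and gL: "g \<in> L2 N" and lim: "(\<lambda>n. L2_dist2 N (f n) g) \<longlonglongrightarrow> 0"
  shows "g \<in> L2_closure N D"
proof (rule closure_limit[OF _ gL])
  fix e :: real assume "e > 0"
  then obtain n where "L2_dist2 N (f n) g < e"
    using order_tendstoD(2)[OF lim, of e] eventually_happens' sequentially_bot by blast
  moreover have "L2_dist2 N g (f n) = L2_dist2 N (f n) g" by (simp add: L2_dist2_def power2_commute)
  ultimately show "\<exists>h\<in>L2_closure N D. L2_dist2 N g h < e" using f by (intro bexI[of _ "f n"]) simp_all
qed

lemma closure_dominated: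
  assumes f: "\<And>n. f n \<in> L2_closure N D" and g: "g \<in> borel_measurable N" and k: "k \<in> L2 N"
    and bd: "\<And>n. AE x in N. \<bar>f n x\<bar> \<le> k x" and lim: "AE x in N. (\<lambda>n. f n x) \<longlonglongrightarrow> g x"
  shows "g \<in> L2_closure N D"
  using L2_dominated[OF L2_meas[OF closure_L2[OF f]] g k bd lim] by (intro closure_tendsto[OF f])

lemma closure_lin:
  assumes f: "f \<in> L2_closure N D" and g: "g \<in> L2_closure N D"
  shows "(\<lambda>x. a * f x + b * g x) \<in> L2_closure N D"
  unfolding L2_closure_def
proof (intro CollectI conjI allI impI L2_lin closure_L2 f g)
  fix e :: real assume e: "e > 0"
  define d where "d = e / (2 * a\<^sup>2 + 2 * b\<^sup>2 + 1)"
  have pos: "2 * a\<^sup>2 + 2 * b\<^sup>2 + 1 > 0"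
    using zero_le_power2[of a] zero_le_power2[of b] by linarith
  have d: "d > 0" using e pos by (simp add: d_def)
  obtain u where u: "u \<in> D" "L2_dist2 N f u < d" using f d unfolding L2_closure_def by blast
  obtain v where v: "v \<in> D" "L2_dist2 N g v < d" using g d unfolding L2_closure_def by blast
  let ?p = "\<lambda>x. f x - u x" and ?q = "\<lambda>x. g x - v x"
  have p: "?p \<in> L2 N" "?q \<in> L2 N" using u v D_L2 closure_L2 f g by (auto intro: L2.diff_in)
  have "L2_dist2 N (\<lambda>x. a * f x + b * g x) (\<lambda>x. a * u x + b * v x) = L2_inner N (\<lambda>x. a * ?p x + b * ?q x) (\<lambda>x. a * ?p x + b * ?q x)"
    by (simp add: L2_dist2_def L2_inner_self algebra_simps)
  also have "\<dots> \<le> 2 * L2_inner N (\<lambda>x. a * ?p x) (\<lambda>x. a * ?p x) + 2 * L2_inner N (\<lambda>x. b * ?q x) (\<lambda>x. b * ?q x)"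
    by (rule L2.sq_add_le) (intro L2.scale_in p)+
  also have "\<dots> = 2 * (a\<^sup>2 * L2_dist2 N f u) + 2 * (b\<^sup>2 * L2_dist2 N g v)"
    unfolding L2.expand_scale[OF p(1)] L2.expand_scale[OF p(2)] by (simp add: L2_dist2_def L2_inner_self)
  also have "\<dots> \<le> 2 * (a\<^sup>2 * d) + 2 * (b\<^sup>2 * d)"
    using u v by (intro add_mono mult_left_mono) auto
  also have "\<dots> = d * (2 * a\<^sup>2 + 2 * b\<^sup>2 + 1) - d" by (simp add: algebra_simps)
  also have "\<dots> = e - d" using pos by (simp add: d_def)
  finally have "L2_dist2 N (\<lambda>x. a * f x + b * g x) (\<lambda>x. a * u x + b * v x) < e" using d by simp
  then show "\<exists>h\<in>D. L2_dist2 N (\<lambda>x. a * f x + b * g x) h < e" using D_lin[OF u(1) v(1)] by blast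
qed

lemma closure_zero: "(\<lambda>x. 0) \<in> L2_closure N D"
proof -
  obtain u where "u \<in> D" using D_ne by blast
  then have "(\<lambda>x. 0) \<in> D" using D_lin[of u u 0 0] by simp
  moreover have "L2_dist2 N (\<lambda>x. 0) (\<lambda>x. 0) = 0" by (simp add: L2_dist2_def)
  ultimately show ?thesis unfolding L2_closure_def using L2.zero_in by force
qed

lemma closure_sum: "(\<And>i. i \<in> J \<Longrightarrow> f i \<in> L2_closure N D) \<Longrightarrow> (\<lambda>x. \<Sum>i\<in>J. f i x) \<in> L2_closure N D"
proof (induction J rule: infinite_finite_induct)
  case (insert i J)
  then show ?case using closure_lin[of "f i" "\<lambda>x. \<Sum>i\<in>J. f i x" 1 1] by simp
qed (auto simp: closure_zero)

lemma closure_AE: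
  assumes f: "f \<in> L2_closure N D" and g: "g \<in> borel_measurable N" and eq: "AE x in N. f x = g x"
  shows "g \<in> L2_closure N D"
proof (rule closure_limit)
  show gL: "g \<in> L2 N" using closure_L2[OF f] g eq by (rule L2_AE_eq)
  fix e :: real assume "e > 0"
  moreover have "L2_dist2 N g f = (\<integral>x. 0 \<partial>N)" unfolding L2_dist2_def
    by (rule integral_cong_AE) (use L2_meas[OF closure_L2[OF f]] g eq in auto)
  ultimately show "\<exists>h\<in>L2_closure N D. L2_dist2 N g h < e" using f by (intro bexI[of _ f]) auto
qed

end

section \<open>The perturbed setting and density of its traces\<close>

locale perturbed_dirichlet = regular_dirichlet m E F
  for m :: "'a::{metric_space, second_countable_topology} measure" and E F +
  fixes kp km \<mu> :: "'a::{metric_space, second_countable_topology} measure" and Q :: "'a set"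
  assumes irreducible: "irreducible_form m E F"
    and kp: "smooth_measure m E F kp" and km: "smooth_measure m E F km"
    and \<mu>: "radon_measure \<mu>" and \<mu>_nonzero: "emeasure \<mu> UNIV \<noteq> 0" and \<mu>_polar: "charges_no_polar m E F \<mu>"
    and Q_conull: "- Q \<in> null_sets (completion \<mu>)"
begin

abbreviation "P \<equiv> pert_space m E F kp km"
abbreviation "P0 \<equiv> pert_space_part m E F kp km Q"
abbreviation "H \<equiv> harmonic_space m E F kp km Q"
abbreviation "a \<equiv> pert_form m E F kp km"
abbreviation "a_plus \<equiv> pert_form_plus m E F kp"
abbreviation "\<nu> \<equiv> measure_on \<mu> Q"
abbreviation "V \<equiv> P \<inter> L2 \<nu>"

lemma sets_k: "sets kp = sets borel" "sets km = sets borel" "sets \<mu> = sets borel"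
  using kp km \<mu> by (auto simp: smooth_measure_def radon_measure_def)

lemma space_k: "space kp = UNIV" "space km = UNIV" "space \<mu> = UNIV"
  using sets_k[THEN sets_eq_imp_space_eq] by simp_all

lemma qe_AE_kp: "QE R \<Longrightarrow> AE x in kp. R x" and qe_AE_km: "QE R \<Longrightarrow> AE x in km. R x"
  and qe_AE_\<mu>: "QE R \<Longrightarrow> AE x in \<mu>. R x"
  using qe_AE kp km \<mu>_polar sets_k by (auto simp: smooth_measure_def)

lemma qe_AE_sum: "QE R \<Longrightarrow> AE x in sum_measure kp km. R x"
proof (rule qe_AE)
  show "sets (sum_measure kp km) = sets borel" by (simp add: sets_k)
  show "charges_no_polar m E F (sum_measure kp km)"
    using kp km unfolding charges_no_polar_def smooth_measure_def
    by (auto simp: emeasure_sum_measure sets_k)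
qed

lemma qc_meas: "qc u \<Longrightarrow> u \<in> borel_measurable (completion kp)" "qc u \<Longrightarrow> u \<in> borel_measurable (completion km)"
    "qc u \<Longrightarrow> u \<in> borel_measurable (completion \<mu>)" "qc u \<Longrightarrow> u \<in> borel_measurable (completion (sum_measure kp km))"
  using qc_measurable[OF sets_k(1) qe_AE_kp] qc_measurable[OF sets_k(2) qe_AE_km]
    qc_measurable[OF sets_k(3) qe_AE_\<mu>] qc_measurable[OF _ qe_AE_sum] by (auto simp: sets_k)

lemma Q_sets: "Q \<inter> space (completion \<mu>) \<in> sets (completion \<mu>)"
proof -
  have cQ: "- Q \<in> sets (completion \<mu>)" using Q_conull by blast
  have "UNIV - (- Q) \<in> sets (completion \<mu>)"
    using sets.Diff[OF sets.top[of "completion \<mu>"] cQ] by (simp only: space_completion space_k)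
  moreover have "UNIV - (- Q) = Q" by blast
  ultimately show ?thesis by (simp only: space_completion space_k Int_UNIV_right)
qed

lemma AE_Q: "AE x in \<mu>. x \<in> Q"
proof -
  have "AE x in completion \<mu>. x \<notin> - Q" using Q_conull by (rule AE_not_in)
  then show ?thesis unfolding AE_completion_iff by simp
qed

lemma AE_\<nu>_iff: "(AE x in \<nu>. R x) \<longleftrightarrow> (AE x in \<mu>. R x)"
  unfolding measure_on_def AE_restrict_space_iff[OF Q_sets] AE_completion_iff
  using AE_Q by (auto elim: eventually_elim2)

lemma \<nu>_meas: "u \<in> borel_measurable (completion \<mu>) \<Longrightarrow> u \<in> borel_measurable \<nu>"
  unfolding measure_on_def by (rule measurable_restrict_space1)

lemma L2_\<nu>: 
  assumes "u \<in> L2 (completion \<mu>)" shows "u \<in> L2 \<nu>"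
proof -
  have "integrable (completion \<mu>) (\<lambda>x. indicator Q x *\<^sub>R (u x)\<^sup>2)"
    using Q_sets by (intro integrable_mult_indicator L2_sq_integrable[OF assms]) (simp add: space_k)
  then show ?thesis using \<nu>_meas[OF L2_meas[OF assms]]
    unfolding L2_def measure_on_def integrable_restrict_space[OF Q_sets] by simp
qed

lemma L2_completion:
  assumes "u \<in> L2 N" shows "u \<in> L2 (completion N)"
proof -
  have "(\<lambda>x. (u x)\<^sup>2) \<in> borel_measurable N" using L2_meas[OF assms] by simp
  from integrable_completion[OF this] show ?thesis
    using assms by (simp add: L2_def measurable_completion)
qed

lemma qe_AE_\<nu>: "QE R \<Longrightarrow> AE x in \<nu>. R x"
  unfolding AE_\<nu>_iff by (rule qe_AE_\<mu>)

lemma \<nu>_nonzero: "\<not> (AE x in \<nu>. False)"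
proof
  assume "AE x in \<nu>. False"
  then have "AE x in \<mu>. False" unfolding AE_\<nu>_iff .
  then have "emeasure \<mu> (space \<mu>) = 0" by (subst (asm) AE_iff_measurable[of "space \<mu>"]) auto
  with \<mu>_nonzero show False by (simp add: space_k)
qed

lemma P_iff: "u \<in> P \<longleftrightarrow> u \<in> Y \<and> u \<in> L2 (completion kp) \<and> u \<in> L2 (completion km)"
proof (cases "u \<in> Y")
  case True
  then show ?thesis
    using L2_sum_measure_iff[of kp km u] qc_meas[OF Y_qc[OF True]] by (simp add: pert_space_def sets_k)
qed (simp add: pert_space_def)

lemma P_lin: "u \<in> P \<Longrightarrow> v \<in> P \<Longrightarrow> (\<lambda>x. b * u x + c * v x) \<in> P"
  unfolding P_iff by (auto intro: Y_lin L2_lin)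

lemma P_ne: "P \<noteq> {}"
  using Y.zero_in L2.zero_in P_iff by blast

lemma V_lin: "u \<in> V \<Longrightarrow> v \<in> V \<Longrightarrow> (\<lambda>x. b * u x + c * v x) \<in> V"
  using P_lin L2_lin by blast

lemma V_ne: "V \<noteq> {}"
  using Y.zero_in L2.zero_in P_iff by blast

sublocale V: L2_subspace \<nu> V
  by unfold_locales (use V_lin V_ne in auto)

lemma indicator_L2:
  assumes B: "B \<in> sets borel" and fin: "emeasure \<mu> B < \<infinity>"
  shows "(indicator B :: 'a \<Rightarrow> real) \<in> L2 \<mu>"
proof -
  have "integrable \<mu> (indicator B :: 'a \<Rightarrow> real)" using B fin by (simp add: sets_k)
  moreover have "(\<lambda>x. (indicator B x :: real)\<^sup>2) = indicator B" by (auto simp: indicator_def)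
  ultimately show ?thesis using B by (simp add: L2_def sets_k)
qed

lemma Cc_L2:
  assumes f: "f \<in> Cc" shows "f \<in> L2 \<mu>"
proof -
  obtain K where K: "compact K" "\<And>x. x \<notin> K \<Longrightarrow> f x = 0" using f by (auto simp: Cc_def)
  have "compact (f ` K)" using K(1) CcD[OF f] by (intro compact_continuous_image)
  then obtain b where b: "\<And>x. x \<in> K \<Longrightarrow> \<bar>f x\<bar> \<le> b"
    using compact_imp_bounded by (fastforce simp: bounded_iff)
  have "emeasure \<mu> K < \<infinity>" using \<mu> K(1) by (simp add: radon_measure_def)
  then have "(indicator K :: 'a \<Rightarrow> real) \<in> L2 \<mu>" using K(1) by (intro indicator_L2) (auto intro: borel_closed compact_imp_closed)
  then have g: "(\<lambda>x. b * indicator K x) \<in> L2 \<mu>" by (rule L2.scale_in)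
  have "f \<in> borel_measurable \<mu>"
    using borel_measurable_continuous_onI[OF CcD[OF f]] measurable_cong_sets[OF sets_k(3) refl] by blast
  then show ?thesis
  proof (rule L2_bound[OF _ g], intro always_eventually allI)
    fix x
    show "\<bar>f x\<bar> \<le> \<bar>b * indicator K x\<bar>" using K(2)[of x] b[of x] by (cases "x \<in> K") auto
  qed
qed

text \<open>
  Functions of \<open>F \<inter> Cc\<close> need not be square integrable for the smooth measures, so they are cut off
  outside nests on which these measures are finite.
\<close>

lemma Cc_in_closure:
  assumes f: "f \<in> F" "f \<in> Cc" and f0: "\<And>x. 0 \<le> f x"
  shows "f \<in> L2_closure \<nu> V"
proof -
  obtain Kp where Kp: "nest m E F Kp" "\<And>k. emeasure kp (Kp k) < \<infinity>" using kp by (auto simp: smooth_measure_def)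
  obtain Km where Km: "nest m E F Km" "\<And>k. emeasure km (Km k) < \<infinity>" using km by (auto simp: smooth_measure_def)
  obtain C where C: "C \<ge> 0" "\<And>x. \<bar>f x\<bar> \<le> C * \<psi> x" using Cc_le_ref[OF f(2)] by blast
  have fb: "f x \<le> C" for x using C(2)[of x] mult_left_le[OF \<psi>(4)[of x] C(1)] f0[of x] by linarith
  have fL: "f \<in> L2 \<nu>" using Cc_L2[OF f(2)] by (intro L2_\<nu> L2_completion)
  have "\<forall>n::nat. \<exists>Bp Bm w. w \<in> F \<and> qc w \<and> E1 w w \<le> (2 * (1/2) ^ n)\<^sup>2 \<and> QE (\<lambda>x. x \<in> - Bp \<union> - Bm \<longrightarrow> \<psi> x \<le> w x) \<and>
      closed Bp \<and> closed Bm \<and> emeasure kp Bp < \<infinity> \<and> emeasure km Bm < \<infinity>"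
  proof
    fix n :: nat
    obtain i where i: "small ((1/2) ^ n) (- Kp i)" using small_of_nest[OF Kp(1), of "(1/2) ^ n"] by auto
    obtain j where j: "small ((1/2) ^ n) (- Km j)" using small_of_nest[OF Km(1), of "(1/2) ^ n"] by auto
    have sm: "small ((1/2) ^ n + (1/2) ^ n) (- Kp i \<union> - Km j)" using small_Un[OF i j] .
    obtain v where v: "v \<in> F" "sqrt (E1 v v) \<le> (1/2) ^ n + (1/2) ^ n" "AE x in m. x \<in> - Kp i \<union> - Km j \<longrightarrow> \<psi> x \<le> v x"
      using smallE[OF sm] by blast
    \<comment> \<open>A quasi-continuous version turns a bound a.e. for \<open>m\<close> into a
      bound q.e., which the smooth measures respect.\<close>
    obtain w where w: "w \<in> F" "qc w" "AE x in m. w x = v x" using qc_version[OF v(1)] .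
    have "E1 w w = E1 v v"
      unfolding E1_eq using E_cong(2)[OF w(1) v(1) w(3)]
        L2_inner_cong_AE[OF F_meas[OF w(1)] F_meas[OF v(1)] F_meas[OF w(1)] F_meas[OF v(1)]] w(3)
      by (simp add: AE_completion_iff)
    also have "\<dots> \<le> (2 * (1/2) ^ n)\<^sup>2"
      using power_mono[OF v(2), of 2] E1.nonneg[OF v(1)] by simp
    finally have "E1 w w \<le> (2 * (1/2) ^ n)\<^sup>2" .
    moreover have "QE (\<lambda>x. x \<in> - Kp i \<union> - Km j \<longrightarrow> 0 \<le> w x - \<psi> x)"
    proof (rule qc_nonneg_on_open)
      show "qc (\<lambda>x. w x - \<psi> x)" by (rule qc_comp2[OF w(2) qc_continuous[OF \<psi>(2)]]) (intro continuous_intros)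
      show "open (- Kp i \<union> - Km j)" using small_open[OF sm] .
      show "AE x in m. x \<in> - Kp i \<union> - Km j \<longrightarrow> 0 \<le> w x - \<psi> x" using v(3) w(3) by eventually_elim auto
    qed
    then have "QE (\<lambda>x. x \<in> - Kp i \<union> - Km j \<longrightarrow> \<psi> x \<le> w x)" by (rule qe_mono) auto
    moreover have "closed (Kp i)" "closed (Km j)" using Kp(1) Km(1) by (auto simp: nest_def)
    ultimately show "\<exists>Bp Bm w. w \<in> F \<and> qc w \<and> E1 w w \<le> (2 * (1/2) ^ n)\<^sup>2 \<and> QE (\<lambda>x. x \<in> - Bp \<union> - Bm \<longrightarrow> \<psi> x \<le> w x) \<and>
      closed Bp \<and> closed Bm \<and> emeasure kp Bp < \<infinity> \<and> emeasure km Bm < \<infinity>"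
      using w Kp(2) Km(2) by blast
  qed
  then obtain Bp Bm w where B: "\<forall>n::nat. w n \<in> F \<and> qc (w n) \<and> E1 (w n) (w n) \<le> (2 * (1/2) ^ n)\<^sup>2 \<and>
      QE (\<lambda>x. x \<in> - Bp n \<union> - Bm n \<longrightarrow> \<psi> x \<le> w n x) \<and>
      closed (Bp n) \<and> closed (Bm n) \<and> emeasure kp (Bp n) < \<infinity> \<and> emeasure km (Bm n) < \<infinity>"
    unfolding choice_iff by blast
  then have w: "\<And>n. w n \<in> F" "\<And>n. qc (w n)" by auto
  have "(\<lambda>n. E1 (w n) (w n)) \<longlonglongrightarrow> 0"
  proof (rule Lim_null_comparison)
    show "\<forall>\<^sub>F n in sequentially. norm (E1 (w n) (w n)) \<le> (2 * (1/2) ^ n)\<^sup>2"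
      using B E1.nonneg[OF w(1)] by (intro always_eventually) auto
    have "(\<lambda>n. (2 * (1/2::real) ^ n)\<^sup>2) \<longlonglongrightarrow> (2 * 0)\<^sup>2" by (intro tendsto_intros LIMSEQ_power_zero) simp
    then show "(\<lambda>n. (2 * (1/2::real) ^ n)\<^sup>2) \<longlonglongrightarrow> 0" by simp
  qed
  then obtain r :: "nat \<Rightarrow> nat" where r: "strict_mono r" "QE (\<lambda>x. (\<lambda>n. w (r n) x) \<longlonglongrightarrow> 0)"
    using qc_null_subseq[of w, OF w] by blast
  \<comment> \<open>Vanishes q.e. outside each of the two sets of finite measure and is bounded by
    \<open>C\<close>, hence is square integrable for both smooth measures.\<close>
  define v where "v n = (\<lambda>x. max 0 (f x - C * \<bar>w (r n) x\<bar>))" for n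
  have vb: "0 \<le> v n x" "v n x \<le> f x" for n x using C(1) f0[of x] by (auto simp: v_def)
  have vF: "v n \<in> F" for n unfolding v_def using f w by (intro E.pos_in E.diff_in E.scale_in E.abs_in)
  have vq: "qc (v n)" for n
    unfolding v_def by (rule qc_comp2[OF qc_continuous[OF CcD[OF f(2)]] w(2)[of "r n"]]) (intro continuous_intros)
  have vY: "v n \<in> Y" for n using F_subset_X[OF vF] vq by (simp add: Y_iff)
  have v0: "QE (\<lambda>x. x \<in> - Bp (r n) \<union> - Bm (r n) \<longrightarrow> v n x = 0)" for n
  proof -
    have "QE (\<lambda>x. x \<in> - Bp (r n) \<union> - Bm (r n) \<longrightarrow> \<psi> x \<le> w (r n) x)" using B by blast
    then show ?thesis
    proof (rule qe_mono, intro impI)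
      fix x assume "x \<in> - Bp (r n) \<union> - Bm (r n) \<longrightarrow> \<psi> x \<le> w (r n) x" "x \<in> - Bp (r n) \<union> - Bm (r n)"
      then have "\<psi> x \<le> \<bar>w (r n) x\<bar>" by auto
      then have "C * \<psi> x \<le> C * \<bar>w (r n) x\<bar>" using C(1) by (rule mult_left_mono)
      then show "v n x = 0" using C(2)[of x] by (auto simp: v_def)
    qed
  qed
  have L2k: "v n \<in> L2 (completion k)"
    if k: "sets k = sets borel" and q: "\<And>R. QE R \<Longrightarrow> AE x in k. R x" and vm: "v n \<in> borel_measurable (completion k)"
      and D: "closed D" "emeasure k D < \<infinity>" and z: "QE (\<lambda>x. x \<notin> D \<longrightarrow> v n x = 0)" for k D n
  proof (rule L2_bound[OF vm])
    have "integrable k (indicator D :: 'a \<Rightarrow> real)" using D k by (simp add: borel_closed)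
    moreover have "(\<lambda>x. (indicator D x :: real)\<^sup>2) = indicator D" by (auto simp: indicator_def)
    moreover have "(indicator D :: 'a \<Rightarrow> real) \<in> borel_measurable k" using D k by (intro borel_measurable_indicator) (simp add: borel_closed)
    ultimately have "(indicator D :: 'a \<Rightarrow> real) \<in> L2 k" by (simp add: L2_def)
    then show "(\<lambda>x. C * indicator D x) \<in> L2 (completion k)" by (intro L2.scale_in L2_completion)
    show "AE x in completion k. \<bar>v n x\<bar> \<le> \<bar>C * indicator D x\<bar>"
      unfolding AE_completion_iff using q[OF z]
    proof eventually_elim
      case (elim x)
      then show ?case using vb[where n=n and x=x] fb[of x] C(1) by (cases "x \<in> D") auto
    qed
  qed
  have "v n \<in> P" for n
    unfolding P_iff
  proof (intro conjI vY)
    show "v n \<in> L2 (completion kp)"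
      by (rule L2k[OF sets_k(1) qe_AE_kp qc_meas(1)[OF vq], of "Bp (r n)"]) (use B qe_mono[OF v0[of n]] in auto)
    show "v n \<in> L2 (completion km)"
      by (rule L2k[OF sets_k(2) qe_AE_km qc_meas(2)[OF vq], of "Bm (r n)"]) (use B qe_mono[OF v0[of n]] in auto)
  qed
  moreover have vm: "v n \<in> borel_measurable \<nu>" for n using \<nu>_meas[OF qc_meas(3)[OF vq]] .
  have vL: "v n \<in> L2 \<nu>" for n by (rule L2_bound[OF vm fL]) (use vb f0 in auto)
  ultimately have vV: "v n \<in> V" for n by blast
  have cl: "v n \<in> L2_closure \<nu> V" for n
    using vV[of n] vL[of n] unfolding L2_closure_def by (auto intro!: bexI[of _ "v n"] simp: L2_dist2_def)
  show ?thesis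
  proof (rule V.closure_dominated[OF cl L2_meas[OF fL] fL])
    show "AE x in \<nu>. \<bar>v n x\<bar> \<le> f x" for n using vb by auto
    show "AE x in \<nu>. (\<lambda>n. v n x) \<longlonglongrightarrow> f x"
      using qe_AE_\<nu>[OF r(2)]
    proof eventually_elim
      case (elim x)
      have "(\<lambda>n. v n x) \<longlonglongrightarrow> max 0 (f x - C * \<bar>0\<bar>)" unfolding v_def by (intro tendsto_intros elim)
      then show ?case using f0[of x] by simp
    qed
  qed
qed

lemma indicator_\<nu>:
  assumes "B \<in> sets borel" "emeasure \<mu> B < \<infinity>"
  shows "(indicator B :: 'a \<Rightarrow> real) \<in> L2 \<nu>"
  by (intro L2_\<nu> L2_completion indicator_L2 assms)

lemma finite_in_compact:
  assumes "open U" "U \<subseteq> K" "compact K" shows "emeasure \<mu> U < \<infinity>"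
proof -
  have "emeasure \<mu> U \<le> emeasure \<mu> K"
    using assms sets_k by (intro emeasure_mono) (auto intro: borel_closed compact_imp_closed)
  also have "\<dots> < \<infinity>" using \<mu> assms(3) by (simp add: radon_measure_def)
  finally show ?thesis .
qed

lemma disjoint_UN_in_closure:
  assumes dis: "disjoint_family A" and A: "\<And>i::nat. (indicator (A i) :: 'a \<Rightarrow> real) \<in> L2_closure \<nu> V"
    and BL: "(indicator (\<Union>i. A i) :: 'a \<Rightarrow> real) \<in> L2 \<nu>"
  shows "(indicator (\<Union>i. A i) :: 'a \<Rightarrow> real) \<in> L2_closure \<nu> V"
proof -
  have part: "(\<Sum>i<n. indicator (A i) x) = (indicator (\<Union>i<n. A i) x :: real)" for n x
    using dis by (intro indicator_UN_disjoint[symmetric]) (auto intro: disjoint_family_on_mono)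
  show ?thesis
  proof (rule V.closure_dominated[OF _ L2_meas[OF BL] BL])
    show "(\<lambda>x. \<Sum>i<n. indicator (A i) x) \<in> L2_closure \<nu> V" for n using A by (intro V.closure_sum)
    show "AE x in \<nu>. \<bar>\<Sum>i<n. indicator (A i) x\<bar> \<le> (indicator (\<Union>i. A i) x :: real)" for n
    proof (intro always_eventually allI)
      fix x show "\<bar>\<Sum>i<n. indicator (A i) x\<bar> \<le> (indicator (\<Union>i. A i) x :: real)"
        unfolding part by (auto simp: indicator_def)
    qed
    show "AE x in \<nu>. (\<lambda>n. \<Sum>i<n. indicator (A i) x) \<longlonglongrightarrow> (indicator (\<Union>i. A i) x :: real)"
      unfolding part by (intro always_eventually allI LIMSEQ_indicator_UN)
  qed
qed

text \<open>Uniform approximation of a bump from \<open>F\<close> may leak out of \<open>U\<close>;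
  lowering the approximant by the error and taking the positive part restores the support.\<close>

lemma open_in_closure:
  assumes U: "open U" "U \<subseteq> K" "compact K"
  shows "(indicator U :: 'a \<Rightarrow> real) \<in> L2_closure \<nu> V"
proof -
  \<comment> \<open>The distance to the empty set is 0 by convention, so the whole space is treated
    apart.\<close>
  define g where "g n x = (if U = UNIV then 1 else min 1 (real n * infdist x (- U)))" for n :: nat and x
  have g0: "0 \<le> g n x" "g n x \<le> indicator U x" for n x
    by (auto simp: g_def infdist_nonneg indicator_def)
  have gC: "g n \<in> Cc" for n
  proof -
    have "continuous_on UNIV (g n)" unfolding g_def by (cases "U = UNIV") (auto intro!: continuous_intros)
    moreover have "g n x = 0" if "x \<notin> K" for x
    proof -
      have "x \<notin> U" using that U(2) by blast
      then show ?thesis using g0[of n x] by simp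
    qed
    ultimately show ?thesis using U(3) unfolding Cc_def by blast
  qed
  have g_lim: "(\<lambda>n. g n x) \<longlonglongrightarrow> indicator U x" for x
  proof (cases "U = UNIV \<or> x \<notin> U")
    case True
    then have "g n x = indicator U x" for n using g0[of n x] by (auto simp: g_def indicator_def)
    then show ?thesis by simp
  next
    case False
    then have "infdist x (- U) > 0"
      using U(1) by (subst infdist_pos_not_in_closed) auto
    then obtain N where N: "1 < real N * infdist x (- U)" using ex_less_of_nat_mult by blast
    have "\<forall>\<^sub>F n in sequentially. g n x = indicator U x"
      using eventually_ge_at_top[of N]
    proof eventually_elim
      case (elim n)
      have "real N * infdist x (- U) \<le> real n * infdist x (- U)" using elim infdist_nonneg by (intro mult_right_mono) auto
      then show ?case using N False by (simp add: g_def)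
    qed
    then show ?thesis by (rule tendsto_eventually)
  qed
  have "\<forall>n. \<exists>f. f \<in> F \<inter> Cc \<and> (\<forall>x. \<bar>g n x - f x\<bar> < inverse (real (Suc n)))"
    using Cc_uniform[OF gC] by (meson inverse_positive_iff_positive of_nat_0_less_iff zero_less_Suc)
  from choice[OF this] obtain f where f: "\<And>n. f n \<in> F" "\<And>n. f n \<in> Cc" "\<And>n x. \<bar>g n x - f n x\<bar> < inverse (real (Suc n))" by blast
  \<comment> \<open>Written as a difference with a clipped function, so that membership in
    \<open>F\<close> follows from the contractions.\<close>
  define p where "p n = (\<lambda>x. max 0 (f n x) - min (max 0 (f n x)) (inverse (real (Suc n))))" for n
  have p_eq: "p n x = max 0 (f n x - inverse (real (Suc n)))" for n x
  proof -
    have "max 0 b - min (max 0 b) d = max 0 (b - d)" if "d > 0" for b d :: real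
      using that by (auto simp: max_def min_def)
    then show ?thesis unfolding p_def by simp
  qed
  have pF: "p n \<in> F" for n unfolding p_def using f(1) by (intro E.diff_in E.pos_in F_clip) auto
  have pg: "0 \<le> p n x" "p n x \<le> g n x" for n x
    using f(3)[of n x] g0[of n x] by (auto simp: p_eq)
  have pC: "p n \<in> Cc" for n
  proof -
    have "continuous_on UNIV (p n)" unfolding p_def by (intro continuous_intros CcD[OF f(2)])
    moreover obtain K' where "compact K'" "\<And>x. x \<notin> K' \<Longrightarrow> g n x = 0" using gC[of n] by (auto simp: Cc_def)
    moreover have "p n x = 0" if "g n x = 0" for x using pg[of n x] that by simp
    ultimately show ?thesis unfolding Cc_def by blast
  qed
  have iL: "(indicator U :: 'a \<Rightarrow> real) \<in> L2 \<nu>" using U(1) finite_in_compact[OF U] by (intro indicator_\<nu>) auto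
  show ?thesis
  proof (rule V.closure_dominated[OF Cc_in_closure[OF pF pC pg(1)] L2_meas[OF iL] iL])
    show "AE x in \<nu>. \<bar>p n x\<bar> \<le> indicator U x" for n
    proof (intro always_eventually allI)
      fix x show "\<bar>p n x\<bar> \<le> indicator U x" using pg[of n x] g0(2)[of n x] by simp
    qed
    have "(\<lambda>n. p n x) \<longlonglongrightarrow> indicator U x" for x
    proof (rule tendsto_sandwich)
      show "\<forall>\<^sub>F n in sequentially. g n x - 2 * inverse (real (Suc n)) \<le> p n x"
      proof (intro always_eventually allI)
        fix n show "g n x - 2 * inverse (real (Suc n)) \<le> p n x" using f(3)[of n x] unfolding p_eq by linarith
      qed
      show "\<forall>\<^sub>F n in sequentially. p n x \<le> g n x" using pg by simp
      have "(\<lambda>n. g n x - 2 * inverse (real (Suc n))) \<longlonglongrightarrow> indicator U x - 2 * 0"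
        by (intro tendsto_intros g_lim LIMSEQ_inverse_real_of_nat)
      then show "(\<lambda>n. g n x - 2 * inverse (real (Suc n))) \<longlonglongrightarrow> indicator U x" by simp
    qed (rule g_lim)
    then show "AE x in \<nu>. (\<lambda>n. p n x) \<longlonglongrightarrow> indicator U x" by simp
  qed
qed

text \<open>Dynkin's argument inside a relatively compact open set, where complements stay square
  integrable.\<close>

lemma borel_in_closure_local:
  assumes B: "B \<in> sets borel" and G: "open G" "G \<subseteq> K" "compact K"
  shows "(indicator (B \<inter> G) :: 'a \<Rightarrow> real) \<in> L2_closure \<nu> V"
proof -
  have GL: "(indicator G :: 'a \<Rightarrow> real) \<in> L2 \<nu>" using G(1) finite_in_compact[OF G] by (intro indicator_\<nu>) auto
  have Bs: "B \<in> sigma_sets UNIV {S :: 'a set. open S}" using B by (simp add: borel_def)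
  show ?thesis
  proof (rule sigma_sets_induct_disjoint[OF _ _ Bs, of "\<lambda>B. (indicator (B \<inter> G) :: 'a \<Rightarrow> real) \<in> L2_closure \<nu> V"])
    show "Int_stable {S :: 'a set. open S}" by (auto simp: Int_stable_def)
    show "(indicator (A \<inter> G) :: 'a \<Rightarrow> real) \<in> L2_closure \<nu> V" if "A \<in> {S. open S}" for A
      using that G by (intro open_in_closure[of _ K]) auto
    show "(indicator ({} \<inter> G) :: 'a \<Rightarrow> real) \<in> L2_closure \<nu> V" using V.closure_zero by (simp add: indicator_def[abs_def])
    show "(indicator ((UNIV - A) \<inter> G) :: 'a \<Rightarrow> real) \<in> L2_closure \<nu> V"
      if "(indicator (A \<inter> G) :: 'a \<Rightarrow> real) \<in> L2_closure \<nu> V" for A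
    proof -
      have "(indicator ((UNIV - A) \<inter> G) :: 'a \<Rightarrow> real) = (\<lambda>x. 1 * indicator G x + (- 1) * indicator (A \<inter> G) x)"
        by (auto simp: indicator_def)
      then show ?thesis using V.closure_lin[OF open_in_closure[OF G] that, of 1 "-1"] by simp
    qed
    fix A :: "nat \<Rightarrow> 'a set"
    assume dis: "disjoint_family A" and rng: "range A \<subseteq> sigma_sets UNIV {S. open S}"
      and A: "\<And>i. (indicator (A i \<inter> G) :: 'a \<Rightarrow> real) \<in> L2_closure \<nu> V"
    have Ab: "A i \<in> sets borel" for i using rng by (auto simp: borel_def)
    have dis': "disjoint_family (\<lambda>i. A i \<inter> G)" using dis by (auto simp: disjoint_family_on_def)
    have un: "(\<Union>i. A i) \<inter> G = (\<Union>i. A i \<inter> G)" by blast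
    have "(indicator (\<Union>i. A i \<inter> G) :: 'a \<Rightarrow> real) \<in> L2 \<nu>"
    proof (rule L2_bound[OF _ GL])
      show "(indicator (\<Union>i. A i \<inter> G) :: 'a \<Rightarrow> real) \<in> borel_measurable \<nu>"
        using Ab G(1) sets_k by (intro \<nu>_meas measurable_completion borel_measurable_indicator) auto
    qed (auto simp: indicator_def)
    then show "(indicator ((\<Union>i. A i) \<inter> G) :: 'a \<Rightarrow> real) \<in> L2_closure \<nu> V"
      unfolding un using dis' A by (intro disjoint_UN_in_closure)
  qed auto
qed

lemma borel_in_closure:
  assumes B: "B \<in> sets borel" and fin: "emeasure \<mu> B < \<infinity>"
  shows "(indicator B :: 'a \<Rightarrow> real) \<in> L2_closure \<nu> V"
proof -
  obtain c :: "nat \<Rightarrow> 'a" and r where "(\<forall>n. r n > 0 \<and> compact (cball (c n) (r n))) \<and> (\<Union>n. ball (c n) (r n / 2)) = UNIV"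
    using compact_ball_cover[OF loc_compact] by blast
  then have cr: "\<And>n. r n > 0" "\<And>n. compact (cball (c n) (r n))" "(\<Union>n. ball (c n) (r n / 2)) = UNIV"
    by auto
  let ?G = "\<lambda>n. ball (c n) (r n / 2)"
  \<comment> \<open>Disjoint pieces, each inside a relatively compact ball, to which the local
    version applies.\<close>
  define A where "A n = (B - (\<Union>i<n. ?G i)) \<inter> ?G n" for n
  have A: "(indicator (A n) :: 'a \<Rightarrow> real) \<in> L2_closure \<nu> V" for n
    unfolding A_def
  proof (rule borel_in_closure_local[of _ _ "cball (c n) (r n)"])
    show "?G n \<subseteq> cball (c n) (r n)" using cr(1)[of n] by auto
    show "B - (\<Union>i<n. ?G i) \<in> sets borel" using B by (intro sets.Diff sets.finite_UN) auto
  qed (use cr(2) in auto)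
  have dis: "disjoint_family A"
    unfolding disjoint_family_on_def
  proof (intro ballI impI)
    fix i j :: nat assume "i \<noteq> j"
    then show "A i \<inter> A j = {}" by (cases "i < j") (auto simp: A_def)
  qed
  have un: "(\<Union>n. A n) = B"
  proof (intro equalityI subsetI)
    fix x assume x: "x \<in> B"
    have ex: "\<exists>n. x \<in> ?G n" using cr(3) by blast
    have "x \<in> A (LEAST n. x \<in> ?G n)"
      unfolding A_def using x LeastI_ex[OF ex] not_less_Least by blast
    then show "x \<in> (\<Union>n. A n)" by blast
  qed (auto simp: A_def)
  have BL: "(indicator B :: 'a \<Rightarrow> real) \<in> L2 \<nu>" using B fin by (rule indicator_\<nu>)
  show ?thesis using disjoint_UN_in_closure[OF dis A] BL unfolding un by blast
qed

lemma L2_in_closure: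
  assumes g: "g \<in> L2 \<mu>"
  shows "g \<in> L2_closure \<nu> V"
proof -
  obtain s where s: "\<And>i. simple_function \<mu> (s i)" "\<And>x. (\<lambda>i. s i x) \<longlonglongrightarrow> g x" "\<And>i x. dist (s i x) 0 \<le> 2 * dist (g x) 0"
    using borel_measurable_implies_sequence_metric[OF L2_meas[OF g], of 0] by (auto simp: space_k)
  have gL: "g \<in> L2 \<nu>" using g by (intro L2_\<nu> L2_completion)
  have s_le: "\<bar>s i x\<bar> \<le> \<bar>2 * g x\<bar>" for i x using s(3)[of i x] by simp
  have sL: "s i \<in> L2 \<mu>" for i
    by (rule L2_bound[OF borel_measurable_simple_function[OF s(1)] L2.scale_in[OF g, of 2]]) (use s_le in simp)
  have s_cl: "s i \<in> L2_closure \<nu> V" for i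
  proof -
    \<comment> \<open>The value 0 is omitted because its level set may have infinite
      measure.\<close>
    let ?R = "s i ` UNIV - {0}"
    let ?S = "\<lambda>y. s i -` {y}"
    have fin: "finite (s i ` UNIV)" using simple_functionD(1)[OF s(1), of i] by (simp add: space_k)
    have S: "?S y \<in> sets borel" for y using simple_functionD(2)[OF s(1), of i "{y}"] by (simp add: space_k sets_k)
    have "(\<lambda>x. \<Sum>y\<in>?R. y * indicator (?S y) x) \<in> L2_closure \<nu> V"
    proof (rule V.closure_sum)
      fix y assume y: "y \<in> ?R"
      have "emeasure \<mu> (?S y) < \<infinity>"
      proof -
        have "integrable \<mu> (\<lambda>x. indicator (?S y) x *\<^sub>R (s i x)\<^sup>2)"
          using S[of y] by (intro integrable_mult_indicator L2_sq_integrable[OF sL]) (simp add: sets_k)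
        also have "(\<lambda>x. indicator (?S y) x *\<^sub>R (s i x)\<^sup>2) = (\<lambda>x. y\<^sup>2 * indicator (?S y) x)"
          by (auto simp: indicator_def)
        finally have "integrable \<mu> (\<lambda>x. inverse (y\<^sup>2) * (y\<^sup>2 * indicator (?S y) x))" by (rule integrable_mult_right)
        then have "integrable \<mu> (indicator (?S y) :: 'a \<Rightarrow> real)" using y by (simp add: mult.assoc[symmetric])
        then show ?thesis using S[of y] by (simp add: integrable_indicator_iff sets_k)
      qed
      from V.closure_lin[OF borel_in_closure[OF S this] V.closure_zero, of y 0]
      show "(\<lambda>x. y * indicator (?S y) x) \<in> L2_closure \<nu> V" by simp
    qed
    moreover have "(\<Sum>y\<in>?R. y * indicator (?S y) x) = s i x" for x
    proof (cases "s i x = 0")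
      case True
      then have "(\<Sum>y\<in>?R. y * indicator (?S y) x) = 0" by (intro sum.neutral) (auto simp: indicator_def)
      with True show ?thesis by simp
    next
      case False
      then have "(\<Sum>y\<in>?R. y * indicator (?S y) x) = (\<Sum>y\<in>{s i x}. y * indicator (?S y) x)"
        using fin by (intro sum.mono_neutral_right) (auto simp: indicator_def)
      then show ?thesis by simp
    qed
    ultimately show ?thesis by simp
  qed
  have agL: "(\<lambda>x. \<bar>2 * g x\<bar>) \<in> L2 \<nu>" by (rule L2_bound[OF _ L2.scale_in[OF gL, of 2]]) (use L2_meas[OF gL] in auto)
  show ?thesis
    by (rule V.closure_dominated[of s, OF s_cl L2_meas[OF gL] agL]) (use s_le s(2) in auto)
qed

theorem V_dense: "L2_dense \<nu> V"
  unfolding L2_dense_def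
proof (intro ballI allI impI)
  fix f and e :: real assume f: "f \<in> L2 \<nu>" and e: "e > 0"
  have int: "integrable (completion \<mu>) (\<lambda>x. indicator Q x *\<^sub>R (f x)\<^sup>2)"
    using L2_sq_integrable[OF f] unfolding measure_on_def integrable_restrict_space[OF Q_sets] .
  have "(\<lambda>x. indicator Q x *\<^sub>R f x) \<in> borel_measurable (completion \<mu>)"
    using L2_meas[OF f] unfolding measure_on_def borel_measurable_restrict_space_iff[OF Q_sets] .
  \<comment> \<open>A trace is measurable for the completion only; a Borel version brings it within
    reach of the approximation.\<close>
  then obtain g where g: "g \<in> borel_measurable \<mu>" "AE x in \<mu>. indicator Q x *\<^sub>R f x = g x"
    using completion_ex_borel_measurable_real by blast
  have eq: "AE x in \<mu>. f x = g x" using g(2) AE_Q by eventually_elim simp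
  have "AE x in completion \<mu>. indicator Q x *\<^sub>R (f x)\<^sup>2 = (g x)\<^sup>2"
    unfolding AE_completion_iff using g(2) AE_Q by eventually_elim simp
  then have "integrable (completion \<mu>) (\<lambda>x. (g x)\<^sup>2)"
    using int borel_measurable_integrable[OF int] measurable_completion[of "\<lambda>x. (g x)\<^sup>2" \<mu> borel] g(1)
    by (subst (asm) integrable_cong_AE) auto
  then have "integrable \<mu> (\<lambda>x. (g x)\<^sup>2)" using g(1) by (subst (asm) integrable_completion) auto
  then have "g \<in> L2 \<mu>" using g(1) by (simp add: L2_def)
  then have "g \<in> L2_closure \<nu> V" by (rule L2_in_closure)
  then have "f \<in> L2_closure \<nu> V" 
  proof (rule V.closure_AE[OF _ L2_meas[OF f]])
    show "AE x in \<nu>. g x = f x" unfolding AE_\<nu>_iff using eq by eventually_elim simp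
  qed
  then show "\<exists>g\<in>V. L2_dist2 \<nu> f g < e" using e unfolding L2_closure_def by blast
qed

end

section \<open>The Dirichlet-to-Neumann operator\<close>

context perturbed_dirichlet begin

abbreviation "Jp \<equiv> L2_inner (completion kp)"
abbreviation "Jm \<equiv> L2_inner (completion km)"
abbreviation "I\<nu> \<equiv> L2_inner \<nu>"

lemma a_eq: "a u v = ext u v + Jp u v - Jm u v"
  by (simp add: pert_form_def L2_inner_def)

lemma a_plus_eq: "a_plus u v = ext u v + Jp u v"
  by (simp add: pert_form_plus_def L2_inner_def)

lemma a_a_plus: "a u v = a_plus u v - Jm u v"
  by (simp add: a_eq a_plus_eq)

lemma P_parts: "u \<in> P \<Longrightarrow> u \<in> Y" "u \<in> P \<Longrightarrow> u \<in> X" "u \<in> P \<Longrightarrow> qc u"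
  "u \<in> P \<Longrightarrow> u \<in> L2 (completion kp)" "u \<in> P \<Longrightarrow> u \<in> L2 (completion km)"
  "u \<in> P \<Longrightarrow> u \<in> borel_measurable \<nu>"
  using \<nu>_meas qc_meas(3) by (auto simp: P_iff Y_iff)

lemma semi_inner_P: "semi_inner P ext" "semi_inner P Jp" "semi_inner P Jm"
proof -
  show "semi_inner P ext" by (rule Y.semi_subspace) (use P_parts P_ne P_lin in auto)
  show "semi_inner P Jp" by (rule L2.semi_subspace) (use P_parts P_ne P_lin in auto)
  show "semi_inner P Jm" by (rule L2.semi_subspace) (use P_parts P_ne P_lin in auto)
qed

sublocale Pe: semi_inner P ext by (rule semi_inner_P)

sublocale Pp: semi_inner P a_plus
proof -
  interpret p: semi_inner P Jp by (rule semi_inner_P)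
  interpret b: bilinear_on P a_plus
    using bilinear_on_combine[OF Pe.bilinear_on_axioms p.bilinear_on_axioms, of 1]
    by (simp add: a_plus_eq[abs_def])
  show "semi_inner P a_plus" by unfold_locales (simp add: a_plus_eq Pe.nonneg p.nonneg)
qed

sublocale Pa: bilinear_on P a
proof -
  interpret q: semi_inner P Jm by (rule semi_inner_P)
  show "bilinear_on P a"
    using bilinear_on_combine[OF Pp.bilinear_on_axioms q.bilinear_on_axioms, of "- 1"]
    by (simp add: a_a_plus[abs_def])
qed

lemma a_cong_qe:
  assumes u: "u \<in> P" and u': "u' \<in> P" and w: "w \<in> P" and eq: "QE (\<lambda>x. u x = u' x)"
  shows "a u w = a u' w"
proof -
  have "ext u w = ext u' w"
    by (rule X_AE_eq(2)[OF P_parts(2)[OF u] X_meas[OF P_parts(2)[OF u']] qe_AE_m[OF eq] P_parts(2)[OF w]])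
  moreover have "Jp u w = Jp u' w"
    by (rule L2_inner_cong_AE) (use P_parts(4) u u' w L2_meas qe_AE_kp[OF eq] in \<open>auto simp: AE_completion_iff\<close>)
  moreover have "Jm u w = Jm u' w"
    by (rule L2_inner_cong_AE) (use P_parts(5) u u' w L2_meas qe_AE_km[OF eq] in \<open>auto simp: AE_completion_iff\<close>)
  ultimately show ?thesis by (simp add: a_eq)
qed

lemma P0_AE: "v \<in> P0 \<Longrightarrow> AE x in \<nu>. v x = 0"
proof -
  assume "v \<in> P0"
  then have "QE (\<lambda>x. x \<in> Q \<longrightarrow> v x = 0)" by (simp add: pert_space_part_def)
  then have "AE x in \<mu>. x \<in> Q \<longrightarrow> v x = 0" by (rule qe_AE_\<mu>)
  with AE_Q show ?thesis unfolding AE_\<nu>_iff by eventually_elim simp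
qed

lemma P0_P: "v \<in> P0 \<Longrightarrow> v \<in> P" and H_P: "u \<in> H \<Longrightarrow> u \<in> P"
  and H_P0: "u \<in> H \<Longrightarrow> v \<in> P0 \<Longrightarrow> a u v = 0"
  by (auto simp: pert_space_part_def harmonic_space_def)

abbreviation "W \<equiv> H \<inter> L2 \<nu>"

lemma H_lin: "u \<in> H \<Longrightarrow> v \<in> H \<Longrightarrow> (\<lambda>x. b * u x + c * v x) \<in> H"
  unfolding harmonic_space_def using P_lin P0_P by (auto simp: Pa.left)

lemma W_lin: "u \<in> W \<Longrightarrow> v \<in> W \<Longrightarrow> (\<lambda>x. b * u x + c * v x) \<in> W"
  using H_lin L2_lin by blast

lemma W_V: "u \<in> W \<Longrightarrow> u \<in> V"
  using H_P by blast

lemma W_ne: "W \<noteq> {}"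
proof -
  have "(\<lambda>x. 0) \<in> H" unfolding harmonic_space_def using Pa.zero_in P0_P by (auto simp: Pa.zero_left)
  then show ?thesis using L2.zero_in by blast
qed

definition A :: "(('a \<Rightarrow> real) \<times> ('a \<Rightarrow> real)) set" where
  "A = DN_operator m E F kp km \<mu> Q"

text \<open>The harmonic representative equals \<open>\<phi>\<close> a.e. for \<open>\<nu>\<close>,
  so its trace is square integrable and it ranges over \<open>W\<close>.\<close>

lemma A_iff: "(\<phi>, f) \<in> A \<longleftrightarrow> \<phi> \<in> L2 \<nu> \<and> f \<in> L2 \<nu> \<and> (\<exists>u\<in>W. (AE x in \<nu>. u x = \<phi> x) \<and> (\<forall>v\<in>V. a u v = I\<nu> f v))"
proof -
  have "u \<in> L2 \<nu>" if "\<phi> \<in> L2 \<nu>" "u \<in> H" "AE x in \<nu>. u x = \<phi> x" for u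
  proof -
    have "AE x in \<nu>. \<phi> x = u x" using that(3) by eventually_elim simp
    then show ?thesis by (rule L2_AE_eq[OF that(1) P_parts(6)[OF H_P[OF that(2)]]])
  qed
  then show ?thesis unfolding A_def DN_operator_def L2_inner_def by blast
qed

lemma A_I: "\<phi> \<in> L2 \<nu> \<Longrightarrow> f \<in> L2 \<nu> \<Longrightarrow> u \<in> W \<Longrightarrow> AE x in \<nu>. u x = \<phi> x \<Longrightarrow>
    (\<And>v. v \<in> V \<Longrightarrow> a u v = I\<nu> f v) \<Longrightarrow> (\<phi>, f) \<in> A"
  unfolding A_iff by blast

lemma A_symmetric:
  assumes "(u, f) \<in> A" "(v, g) \<in> A"
  shows "I\<nu> f v = I\<nu> u g"
proof -
  obtain u' where u: "u \<in> L2 \<nu>" "f \<in> L2 \<nu>" "u' \<in> W" "AE x in \<nu>. u' x = u x" "\<And>w. w \<in> V \<Longrightarrow> a u' w = I\<nu> f w"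
    using assms(1) unfolding A_iff by blast
  obtain v' where v: "v \<in> L2 \<nu>" "g \<in> L2 \<nu>" "v' \<in> W" "AE x in \<nu>. v' x = v x" "\<And>w. w \<in> V \<Longrightarrow> a v' w = I\<nu> g w"
    using assms(2) unfolding A_iff by blast
  have "I\<nu> f v = I\<nu> f v'"
    by (rule L2_inner_cong_AE) (use u v L2_meas in \<open>auto elim: eventually_mono\<close>)
  also have "\<dots> = a u' v'" using u(5)[OF W_V[OF v(3)]] by simp
  also have "\<dots> = a v' u'" using u(3) v(3) W_V by (intro Pa.sym) auto
  also have "\<dots> = I\<nu> g u'" by (rule v(5)[OF W_V[OF u(3)]])
  also have "\<dots> = I\<nu> g u"
    by (rule L2_inner_cong_AE) (use u v L2_meas in auto)
  also have "\<dots> = I\<nu> u g" using v(2) u(1) by (rule L2.sym)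
  finally show ?thesis .
qed

lemma A_lin:
  assumes "(u, f) \<in> A" "(v, g) \<in> A"
  shows "(\<lambda>x. b * u x + c * v x, \<lambda>x. b * f x + c * g x) \<in> A"
proof -
  obtain u' where u: "u \<in> L2 \<nu>" "f \<in> L2 \<nu>" "u' \<in> W" "AE x in \<nu>. u' x = u x" "\<And>w. w \<in> V \<Longrightarrow> a u' w = I\<nu> f w"
    using assms(1) unfolding A_iff by blast
  obtain v' where v: "v \<in> L2 \<nu>" "g \<in> L2 \<nu>" "v' \<in> W" "AE x in \<nu>. v' x = v x" "\<And>w. w \<in> V \<Longrightarrow> a v' w = I\<nu> g w"
    using assms(2) unfolding A_iff by blast
  have "AE x in \<nu>. b * u' x + c * v' x = b * u x + c * v x" using u(4) v(4) by eventually_elim simp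
  moreover have "a (\<lambda>x. b * u' x + c * v' x) w = I\<nu> (\<lambda>x. b * f x + c * g x) w" if w: "w \<in> V" for w
    using Pa.left[of u' v' w b c] L2.left[OF u(2) v(2), of w b c] u(3,5) v(3,5) w W_V by auto
  ultimately show ?thesis
    by (intro A_I[OF L2_lin[OF u(1) v(1)] L2_lin[OF u(2) v(2)] W_lin[OF u(3) v(3)]])
qed

lemma A_AE_eq:
  assumes "(u, f) \<in> A" and v: "v \<in> L2 \<nu>" "AE x in \<nu>. u x = v x" and g: "g \<in> L2 \<nu>" "AE x in \<nu>. f x = g x"
  shows "(v, g) \<in> A"
proof -
  obtain u' where u: "u \<in> L2 \<nu>" "f \<in> L2 \<nu>" "u' \<in> W" "AE x in \<nu>. u' x = u x" "\<And>w. w \<in> V \<Longrightarrow> a u' w = I\<nu> f w"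
    using assms(1) unfolding A_iff by blast
  have "AE x in \<nu>. u' x = v x" using u(4) v(2) by eventually_elim simp
  moreover have "I\<nu> f w = I\<nu> g w" if "w \<in> V" for w
    by (rule L2_inner_cong_AE) (use u g that L2_meas in auto)
  ultimately show ?thesis unfolding A_iff using u v(1) g(1) by auto
qed

lemma L2_limit:
  assumes U: "\<And>n. U n \<in> L2 N" and c: "form_cauchy (L2_inner N) U" and r: "strict_mono (r :: nat \<Rightarrow> nat)"
    and u: "u \<in> borel_measurable N" and lim: "AE x in N. (\<lambda>n. U (r n) x) \<longlonglongrightarrow> u x"
  shows "u \<in> L2 N" "(\<lambda>n. form_dist2 (L2_inner N) (U n) u) \<longlonglongrightarrow> 0"
  using L2_cauchy_limit[OF U c r u lim] by (auto simp: L2_dist2_form_dist2)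

section \<open>The closed shifted form, its resolvent and self-adjointness\<close>

context
  fixes \<delta> C :: real
  assumes decomposition: "unique_decomposition m E F kp km Q"
    and \<delta>: "0 < \<delta>" "\<delta> < 1" and C: "0 < C"
    and form_bound: "\<And>u. u \<in> H \<Longrightarrow> (\<integral>\<^sup>+x. ennreal ((u x)\<^sup>2) \<partial>completion km)
             \<le> ennreal (\<delta> * a_plus u u) + ennreal C * (\<integral>\<^sup>+x. ennreal ((u x)\<^sup>2) \<partial>\<nu>)"
begin

lemma Im_le:
  assumes u: "u \<in> W" shows "Jm u u \<le> \<delta> * a_plus u u + C * I\<nu> u u"
proof -
  have uP: "u \<in> P" and uH: "u \<in> H" and uL: "u \<in> L2 \<nu>" using u H_P by auto
  have nn: "0 \<le> \<delta> * a_plus u u" "0 \<le> C * I\<nu> u u" using \<delta> C Pp.nonneg[OF uP] L2.nonneg[OF uL] by auto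
  have "ennreal (Jm u u) \<le> ennreal (\<delta> * a_plus u u) + ennreal C * ennreal (I\<nu> u u)"
    using form_bound[OF uH] unfolding nn_integral_L2[OF P_parts(5)[OF uP]] nn_integral_L2[OF uL] .
  also have "\<dots> = ennreal (\<delta> * a_plus u u + C * I\<nu> u u)"
    using nn C L2.nonneg[OF uL] by (simp add: ennreal_mult ennreal_plus)
  finally show ?thesis using nn by (subst (asm) ennreal_le_iff) auto
qed

lemma a_lower:
  assumes u: "u \<in> W" shows "(1 - \<delta>) * a_plus u u - C * I\<nu> u u \<le> a u u"
  using Im_le[OF u] unfolding a_a_plus by (simp add: algebra_simps)

text \<open>The part vanishing on \<open>Q\<close> is invisible both to the trace and, by
  harmonicity, to pairings with \<open>H\<close>. This extends equations tested on \<open>W\<close>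
  to all of \<open>V\<close>.\<close>

lemma V_decomposition:
  assumes v: "v \<in> V"
  obtains w where "w \<in> W" "AE x in \<nu>. v x = w x" "\<And>u. u \<in> H \<Longrightarrow> a u v = a u w"
proof -
  obtain v1 v2 where *: "v1 \<in> P0" "v2 \<in> H" "QE (\<lambda>x. v x = v1 x + v2 x)"
    using decomposition v unfolding unique_decomposition_def by blast
  have ae: "AE x in \<nu>. v x = v2 x" using qe_AE_\<nu>[OF *(3)] P0_AE[OF *(1)] by eventually_elim simp
  have v2P: "v2 \<in> P" and v1P: "v1 \<in> P" using * H_P P0_P by auto
  have "v2 \<in> L2 \<nu>" by (rule L2_AE_eq[OF _ P_parts(6)[OF v2P] ae]) (use v in blast)
  moreover have "a u v = a u v2" if u: "u \<in> H" for u
  proof -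
    have uP: "u \<in> P" using u by (rule H_P)
    have "a v u = a (\<lambda>x. v1 x + v2 x) u"
      using v by (intro a_cong_qe[OF _ Pa.add_in[OF v1P v2P] uP *(3)]) auto
    also have "\<dots> = a u v1 + a u v2" using Pa.add_left[OF v1P v2P uP] Pa.sym[OF v1P uP] Pa.sym[OF v2P uP] by simp
    also have "\<dots> = a u v2" using H_P0[OF u *(1)] by simp
    finally show ?thesis using Pa.sym[OF _ uP, of v] v by simp
  qed
  ultimately show ?thesis using that *(2) ae by blast
qed

definition "shifted \<Lambda> u v = a u v + \<Lambda> * I\<nu> u v" for \<Lambda> :: real

lemma semi_inner_shifted:
  assumes L: "\<Lambda> \<ge> C" shows "semi_inner W (shifted \<Lambda>)"
proof -
  interpret x: bilinear_on W a by (rule Pa.subspace) (use H_P W_ne W_lin in auto)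
  interpret y: semi_inner W I\<nu> by (rule L2.semi_subspace) (use W_ne W_lin in auto)
  interpret z: bilinear_on W "shifted \<Lambda>"
    unfolding shifted_def by (rule bilinear_on_combine) unfold_locales
  show ?thesis
  proof unfold_locales
    fix u assume u: "u \<in> W"
    have "0 \<le> (1 - \<delta>) * a_plus u u" using \<delta> Pp.nonneg[of u] u H_P by auto
    moreover have "C * I\<nu> u u \<le> \<Lambda> * I\<nu> u u" using L y.nonneg[OF u] by (rule mult_right_mono)
    ultimately show "0 \<le> shifted \<Lambda> u u" unfolding shifted_def using a_lower[OF u] by simp
  qed
qed

lemma shifted_lower:
  assumes u: "u \<in> W"
  shows "(1 - \<delta>) * a_plus u u + (\<Lambda> - C) * I\<nu> u u \<le> shifted \<Lambda> u u"
  unfolding shifted_def using a_lower[OF u] by (simp add: algebra_simps)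

text \<open>The gaps \<open>1 - \<delta>\<close> and \<open>\<Lambda> - C\<close> let the shifted
  form dominate its nonnegative constituents, and the form bound then controls the negative part.
  All the limits are identified through one limit q.e.\<close>

lemma shifted_complete:
  assumes L: "\<Lambda> > C" and U: "\<And>n. U n \<in> W" and c: "form_cauchy (shifted \<Lambda>) U"
  shows "\<exists>u\<in>W. (\<lambda>n. form_dist2 (shifted \<Lambda>) (U n) u) \<longlonglongrightarrow> 0"
proof -
  interpret s: semi_inner W "shifted \<Lambda>" using L by (intro semi_inner_shifted) simp
  have UP: "U n \<in> P" for n using U H_P by blast
  have UL: "U n \<in> L2 \<nu>" for n using U by blast
  have cauchyI: "form_cauchy G U"
    if K: "K \<ge> 0" and G: "\<And>w. w \<in> W \<Longrightarrow> G w w \<le> K * shifted \<Lambda> w w" for G K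
    unfolding form_cauchy_def
  proof (intro allI impI)
    fix e :: real assume e: "e > 0"
    have "e / (K + 1) > 0" using e K by simp
    then obtain N where N: "\<And>i j. i \<ge> N \<Longrightarrow> j \<ge> N \<Longrightarrow> form_dist2 (shifted \<Lambda>) (U i) (U j) < e / (K + 1)"
      using c unfolding form_cauchy_def by blast
    have "form_dist2 G (U i) (U j) < e" if ij: "i \<ge> N" "j \<ge> N" for i j
    proof -
      have "form_dist2 G (U i) (U j) \<le> K * form_dist2 (shifted \<Lambda>) (U i) (U j)"
        unfolding form_dist2_def by (intro G s.diff_in U)
      also have "\<dots> \<le> K * (e / (K + 1))" using N[OF ij] K by (intro mult_left_mono) auto
      also have "\<dots> < e" using e K by (simp add: field_simps)
      finally show ?thesis .
    qed
    then show "\<exists>N. \<forall>i\<ge>N. \<forall>j\<ge>N. form_dist2 G (U i) (U j) < e" by blast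
  qed
  have parts: "0 \<le> ext w w" "0 \<le> Jp w w" "0 \<le> I\<nu> w w" if "w \<in> W" for w
    using that H_P Pe.nonneg L2.nonneg L2.nonneg[OF P_parts(4)] by auto
  have low: "(1 - \<delta>) * (ext w w + Jp w w) + (\<Lambda> - C) * I\<nu> w w \<le> shifted \<Lambda> w w" if "w \<in> W" for w
    using shifted_lower[OF that] by (simp add: a_plus_eq)
  have b1: "ext w w + Jp w w \<le> (1 / (1 - \<delta>)) * shifted \<Lambda> w w" if w: "w \<in> W" for w
  proof -
    have "0 \<le> (\<Lambda> - C) * I\<nu> w w" using L parts[OF w] by simp
    then have "(1 - \<delta>) * (ext w w + Jp w w) \<le> shifted \<Lambda> w w" using low[OF w] by linarith
    then show ?thesis using \<delta> by (simp add: field_simps)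
  qed
  have b2: "I\<nu> w w \<le> (1 / (\<Lambda> - C)) * shifted \<Lambda> w w" if w: "w \<in> W" for w
  proof -
    have "0 \<le> (1 - \<delta>) * (ext w w + Jp w w)" using \<delta> parts[OF w] by simp
    then have "(\<Lambda> - C) * I\<nu> w w \<le> shifted \<Lambda> w w" using low[OF w] by linarith
    then show ?thesis using L by (simp add: field_simps)
  qed
  \<comment> \<open>The negative part enters with the wrong sign, so its Cauchy property comes only
    from the form bound.\<close>
  have b3: "Jm w w \<le> (\<delta> * (1 / (1 - \<delta>)) + C * (1 / (\<Lambda> - C))) * shifted \<Lambda> w w" if w: "w \<in> W" for w
  proof -
    have "Jm w w \<le> \<delta> * (ext w w + Jp w w) + C * I\<nu> w w" using Im_le[OF w] by (simp add: a_plus_eq)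
    also have "\<dots> \<le> \<delta> * ((1 / (1 - \<delta>)) * shifted \<Lambda> w w) + C * ((1 / (\<Lambda> - C)) * shifted \<Lambda> w w)"
      using b1[OF w] b2[OF w] \<delta> C by (intro add_mono mult_left_mono) auto
    finally show ?thesis by (simp add: algebra_simps)
  qed
  have ce: "form_cauchy ext U" and cp: "form_cauchy Jp U" and c\<nu>: "form_cauchy I\<nu> U" and cm: "form_cauchy Jm U"
  proof -
    have K: "0 \<le> 1 / (1 - \<delta>)" using \<delta> by simp
    have "ext w w \<le> (1 / (1 - \<delta>)) * shifted \<Lambda> w w" "Jp w w \<le> (1 / (1 - \<delta>)) * shifted \<Lambda> w w" if "w \<in> W" for w
      using b1[OF that] parts[OF that] by linarith+
    then show "form_cauchy ext U" "form_cauchy Jp U" by (auto intro: cauchyI[where K="1 / (1 - \<delta>)", OF K])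
    show "form_cauchy I\<nu> U" by (rule cauchyI[where K="1 / (\<Lambda> - C)"]) (use L b2 in auto)
    show "form_cauchy Jm U" by (rule cauchyI[where K="\<delta> * (1 / (1 - \<delta>)) + C * (1 / (\<Lambda> - C))"]) (use L \<delta> C b3 in auto)
  qed
  obtain r :: "nat \<Rightarrow> nat" and u where r: "strict_mono r" and uY: "u \<in> Y"
    and q: "QE (\<lambda>x. (\<lambda>n. U (r n) x) \<longlonglongrightarrow> u x)" and le: "(\<lambda>n. form_dist2 ext (U n) u) \<longlonglongrightarrow> 0"
    using Y_complete[OF irreducible qe_AE_\<nu> \<nu>_nonzero P_parts(1)[OF UP] UL ce c\<nu>] by blast
  have uq: "qc u" using uY by (rule Y_qc)
  have lp: "u \<in> L2 (completion kp)" "(\<lambda>n. form_dist2 Jp (U n) u) \<longlonglongrightarrow> 0"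
    using L2_limit[OF P_parts(4)[OF UP] cp r qc_meas(1)[OF uq]] qe_AE_kp[OF q] by (auto simp: AE_completion_iff)
  have lm: "u \<in> L2 (completion km)" "(\<lambda>n. form_dist2 Jm (U n) u) \<longlonglongrightarrow> 0"
    using L2_limit[OF P_parts(5)[OF UP] cm r qc_meas(2)[OF uq]] qe_AE_km[OF q] by (auto simp: AE_completion_iff)
  have l\<nu>: "u \<in> L2 \<nu>" "(\<lambda>n. form_dist2 I\<nu> (U n) u) \<longlonglongrightarrow> 0"
    using L2_limit[OF UL c\<nu> r \<nu>_meas[OF qc_meas(3)[OF uq]]] qe_AE_\<nu>[OF q] by auto
  have uP: "u \<in> P" using uY lp lm by (simp add: P_iff)
  \<comment> \<open>Harmonicity is closed because pairing with \<open>v\<close> is continuous in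
    each of the three constituents of \<open>a\<close>.\<close>
  have "a u v = 0" if v: "v \<in> P0" for v
  proof -
    have vP: "v \<in> P" using v by (rule P0_P)
    have "(\<lambda>n. ext (U n) v + Jp (U n) v - Jm (U n) v) \<longlonglongrightarrow> ext u v + Jp u v - Jm u v"
      by (intro tendsto_diff tendsto_add Pe.tendsto_left[OF UP uP le vP]
          L2.tendsto_left[OF P_parts(4)[OF UP] lp P_parts(4)[OF vP]] L2.tendsto_left[OF P_parts(5)[OF UP] lm P_parts(5)[OF vP]])
    moreover have "ext (U n) v + Jp (U n) v - Jm (U n) v = 0" for n
      using H_P0[OF _ v, of "U n"] U by (auto simp: a_eq)
    ultimately have "(\<lambda>n::nat. 0) \<longlonglongrightarrow> a u v" by (simp only: a_eq)
    from LIMSEQ_unique[OF this tendsto_const] show ?thesis .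
  qed
  then have uW: "u \<in> W" using uP l\<nu> by (simp add: harmonic_space_def)
  have "(\<lambda>n. form_dist2 ext (U n) u + form_dist2 Jp (U n) u - form_dist2 Jm (U n) u + \<Lambda> * form_dist2 I\<nu> (U n) u)
      \<longlonglongrightarrow> 0 + 0 - 0 + \<Lambda> * 0"
    by (intro tendsto_intros le lp lm l\<nu>)
  then have "(\<lambda>n. form_dist2 (shifted \<Lambda>) (U n) u) \<longlonglongrightarrow> 0"
    by (simp add: form_dist2_def shifted_def a_eq)
  with uW show ?thesis by blast
qed

text \<open>Riesz gives the equation for harmonic test functions; the decomposition extends it,
  since both sides depend only on the harmonic part.\<close>

lemma resolvent:
  assumes L: "\<Lambda> > C" and h: "h \<in> L2 \<nu>"
  obtains u where "u \<in> W" "\<And>v. v \<in> V \<Longrightarrow> a u v + \<Lambda> * I\<nu> u v = I\<nu> h v"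
proof -
  interpret s: semi_inner W "shifted \<Lambda>" using L by (intro semi_inner_shifted) simp
  obtain u where u: "u \<in> W" "\<And>v. v \<in> W \<Longrightarrow> shifted \<Lambda> u v = I\<nu> h v"
  \<comment> \<open>The constant combines Cauchy-Schwarz for \<open>\<nu>\<close> with
    \<open>\<Lambda> - C\<close> times the trace norm being below the shifted form.\<close>
  proof (rule s.riesz[where l="I\<nu> h" and K="sqrt (I\<nu> h h) * sqrt (1 / (\<Lambda> - C))"])
    show "\<exists>u\<in>W. (\<lambda>n. form_dist2 (shifted \<Lambda>) (U n) u) \<longlonglongrightarrow> 0" if "\<And>n. U n \<in> W" "form_cauchy (shifted \<Lambda>) U" for U
      using shifted_complete[OF L that] .
    show "I\<nu> h (\<lambda>x. b * u x + c * v x) = b * I\<nu> h u + c * I\<nu> h v" if "u \<in> W" "v \<in> W" for u v b c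
      using L2.left[of u \<nu> v h b c] L2.sym[OF h, of u] L2.sym[OF h, of v] L2.sym[OF h L2_lin, of u v b c] that h by auto
    show "\<bar>I\<nu> h v\<bar> \<le> sqrt (I\<nu> h h) * sqrt (1 / (\<Lambda> - C)) * sqrt (shifted \<Lambda> v v)" if v: "v \<in> W" for v
    proof -
      have "0 \<le> (1 - \<delta>) * a_plus v v" using \<delta> v H_P Pp.nonneg by auto
      then have "(\<Lambda> - C) * I\<nu> v v \<le> shifted \<Lambda> v v" using shifted_lower[OF v, of \<Lambda>] by linarith
      then have "I\<nu> v v \<le> 1 / (\<Lambda> - C) * shifted \<Lambda> v v" using L by (simp add: field_simps)
      then have "sqrt (I\<nu> v v) \<le> sqrt (1 / (\<Lambda> - C) * shifted \<Lambda> v v)" by (rule real_sqrt_le_mono)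
      then have "sqrt (I\<nu> v v) \<le> sqrt (1 / (\<Lambda> - C)) * sqrt (shifted \<Lambda> v v)" by (simp only: real_sqrt_mult)
      then have "sqrt (I\<nu> h h) * sqrt (I\<nu> v v) \<le> sqrt (I\<nu> h h) * (sqrt (1 / (\<Lambda> - C)) * sqrt (shifted \<Lambda> v v))"
        using L2.nonneg[OF h] by (intro mult_left_mono) auto
      then show ?thesis using L2.abs_le[OF h, of v] v by (simp add: mult.assoc)
    qed
  qed blast
  show ?thesis
  proof (rule that[OF u(1)])
    fix v assume v: "v \<in> V"
    obtain w where w: "w \<in> W" "AE x in \<nu>. v x = w x" "\<And>u. u \<in> H \<Longrightarrow> a u v = a u w"
      using V_decomposition[OF v] by blast
    have "I\<nu> z v = I\<nu> z w" if "z \<in> L2 \<nu>" for z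
      by (rule L2_inner_cong_AE) (use that v w L2_meas in auto)
    then show "a u v + \<Lambda> * I\<nu> u v = I\<nu> h v" using u(2)[OF w(1)] u(1) w(3) h by (auto simp: shifted_def)
  qed
qed

lemma resolvent_A:
  assumes L: "\<Lambda> > C" and h: "h \<in> L2 \<nu>"
  obtains u where "u \<in> W" "(u, \<lambda>x. h x - \<Lambda> * u x) \<in> A" "\<And>v. v \<in> V \<Longrightarrow> a u v + \<Lambda> * I\<nu> u v = I\<nu> h v"
proof -
  obtain u where u: "u \<in> W" "\<And>v. v \<in> V \<Longrightarrow> a u v + \<Lambda> * I\<nu> u v = I\<nu> h v" using resolvent[OF L h] by blast
  have uL: "u \<in> L2 \<nu>" using u(1) by blast
  have "a u v = I\<nu> (\<lambda>x. h x - \<Lambda> * u x) v" if v: "v \<in> V" for v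
    using u(2)[OF v] L2.diff_left[OF h L2.scale_in[OF uL, of \<Lambda>], of v] L2.scale_left[OF uL, of v \<Lambda>] v by simp
  then have "(u, \<lambda>x. h x - \<Lambda> * u x) \<in> A"
    unfolding A_iff using u(1) uL h by (auto intro: L2.diff_in L2.scale_in)
  with u that show ?thesis by blast
qed

lemma A_L2: "A \<subseteq> L2 \<nu> \<times> L2 \<nu>"
  using A_iff by auto

lemma A_zero: "(\<lambda>x. 0, \<lambda>x. 0) \<in> A"
proof -
  have "(\<lambda>x. 0) \<in> W" using W_ne W_lin[of _ _ 0 0] by fastforce
  moreover have "a (\<lambda>x. 0) v = I\<nu> (\<lambda>x. 0) v" if "v \<in> V" for v
    using that Pa.zero_left[of v] L2.zero_left[of v \<nu>] by auto
  ultimately show ?thesis by (intro A_I[OF L2.zero_in L2.zero_in]) auto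
qed

lemma V_L2: "V \<subseteq> L2 \<nu>"
  by blast

text \<open>A harmonic representative with zero trace and Neumann data \<open>f - g\<close> has zero
  shifted energy, so it pairs to zero with everything; \<open>f - g\<close> is then orthogonal to
  the dense traces.\<close>

lemma A_single_valued:
  assumes "(u, f) \<in> A" "(v, g) \<in> A" and eq: "AE x in \<nu>. u x = v x"
  shows "AE x in \<nu>. f x = g x"
proof -
  interpret s: semi_inner W "shifted (C + 1)" by (intro semi_inner_shifted) simp
  obtain w where w: "w \<in> W" "AE x in \<nu>. w x = u x - v x" "\<And>z. z \<in> V \<Longrightarrow> a w z = I\<nu> (\<lambda>x. f x - g x) z"
    using A_lin[OF assms(1,2), of 1 "-1"] unfolding A_iff by auto
  have fg: "f \<in> L2 \<nu>" "g \<in> L2 \<nu>" using assms A_iff by blast+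
  then have dL: "(\<lambda>x. f x - g x) \<in> L2 \<nu>" by (rule L2.diff_in)
  have wL: "w \<in> L2 \<nu>" using w(1) by blast
  have w0: "AE x in \<nu>. w x = 0" using w(2) eq by eventually_elim simp
  have wz: "I\<nu> z w = 0" if "z \<in> L2 \<nu>" for z
  proof -
    have "I\<nu> z w = I\<nu> z (\<lambda>x. 0)" by (rule L2_inner_cong_AE) (use that wL w0 L2_meas in auto)
    then show ?thesis using L2.zero_right[OF that] by simp
  qed
  have "shifted (C + 1) w w = 0"
    unfolding shifted_def using w(3)[OF W_V[OF w(1)]] wz[OF dL] wz[OF wL] by simp
  then have z: "shifted (C + 1) w z = 0" if "z \<in> W" for z using s.null_left[OF w(1) that] by simp
  have "I\<nu> (\<lambda>x. f x - g x) z = 0" if v: "z \<in> V" for z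
  proof -
    obtain z' where z': "z' \<in> W" "\<And>u. u \<in> H \<Longrightarrow> a u z = a u z'" using V_decomposition[OF v] by blast
    have "I\<nu> (\<lambda>x. f x - g x) z = a w z" using w(3)[OF v] by simp
    also have "\<dots> = a w z'" using z'(2) w(1) by blast
    also have "\<dots> = - (C + 1) * I\<nu> w z'" using z[OF z'(1)] by (simp add: shifted_def algebra_simps)
    also have "I\<nu> w z' = 0" using wz[of z'] L2.sym[OF wL, of z'] z'(1) by auto
    finally show ?thesis by simp
  qed
  then have "AE x in \<nu>. f x - g x = 0" by (rule L2_dense_orthogonal[OF V_dense V_L2 dL])
  then show ?thesis by eventually_elim simp
qed

text \<open>With n as shift parameter, the elements \<open>u\<close> given by n times the resolvent
  of \<open>w\<close> approximate \<open>w\<close>. Testing their equation against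
  \<open>u - w\<close> bounds the squared distance by the form of \<open>w\<close> divided by
  4n.\<close>

lemma A_dense: "L2_dense \<nu> (fst ` A)"
  unfolding L2_dense_def
proof (intro ballI allI impI)
  fix f and e :: real assume f: "f \<in> L2 \<nu>" and e: "e > 0"
  interpret s: semi_inner W "shifted C" by (intro semi_inner_shifted) simp
  obtain v where v: "v \<in> V" "L2_dist2 \<nu> f v < e / 4" using V_dense f e unfolding L2_dense_def by (meson divide_pos_pos zero_less_numeral)
  obtain w where w: "w \<in> W" "AE x in \<nu>. v x = w x" using V_decomposition[OF v(1)] by blast
  have wL: "w \<in> L2 \<nu>" using w(1) by blast
  \<comment> \<open>Makes this bound smaller than \<open>e / 4\<close>.\<close>
  obtain n :: nat where n: "shifted C w w / e < real n" using reals_Archimedean2 by blast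
  have n0: "real n > 0" using n s.nonneg[OF w(1)] e by (meson divide_nonneg_pos le_less_trans)
  obtain u where u: "u \<in> W" "(u, \<lambda>x. real n * w x - (C + real n) * u x) \<in> A"
    "\<And>v. v \<in> V \<Longrightarrow> a u v + (C + real n) * I\<nu> u v = I\<nu> (\<lambda>x. real n * w x) v"
    using resolvent_A[of "C + real n" "\<lambda>x. real n * w x"] n0 L2.scale_in[OF wL] by auto
  have uL: "u \<in> L2 \<nu>" using u(1) by blast
  let ?d = "\<lambda>x. u x - w x"
  have dW: "?d \<in> W" using u(1) w(1) by (rule s.diff_in)
  have dL: "?d \<in> L2 \<nu>" using dW by blast
  have "a u ?d + (C + real n) * I\<nu> u ?d = real n * I\<nu> w ?d"
    using u(3)[OF W_V[OF dW]] L2.scale_left[OF wL dL] by simp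
  then have "shifted C u ?d + real n * (I\<nu> u ?d - I\<nu> w ?d) = 0" by (simp add: shifted_def algebra_simps)
  moreover have "I\<nu> u ?d - I\<nu> w ?d = I\<nu> ?d ?d" using L2.diff_left[OF uL wL dL] by simp
  moreover have "shifted C u ?d = shifted C u u - shifted C u w" using u(1) w(1) by (simp add: s.diff_right)
  ultimately have 1: "real n * I\<nu> ?d ?d = shifted C u w - shifted C u u" by simp
  \<comment> \<open>The square of \<open>u - w / 2\<close> provides the quarter.\<close>
  have "0 \<le> shifted C (\<lambda>x. u x + (- 1/2) * w x) (\<lambda>x. u x + (- 1/2) * w x)"
    by (intro s.nonneg s.add_in s.scale_in u w)
  then have "shifted C u w - shifted C u u \<le> shifted C w w / 4"
    unfolding s.expand_comb[OF u(1) w(1)] by (simp add: power2_eq_square)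
  also have "\<dots> < real n * e / 4" using n e by (simp add: field_simps)
  finally have "real n * I\<nu> ?d ?d < real n * (e / 4)" using 1 by simp
  then have d: "I\<nu> ?d ?d < e / 4" using n0 by simp
  have "L2_dist2 \<nu> v u = I\<nu> (\<lambda>x. v x - u x) (\<lambda>x. v x - u x)" by (simp add: L2_dist2_form_dist2 form_dist2_def)
  also have "\<dots> = I\<nu> (\<lambda>x. - ?d x) (\<lambda>x. - ?d x)"
  proof -
    have 1: "(\<lambda>x. v x - u x) \<in> L2 \<nu>" "(\<lambda>x. - ?d x) \<in> L2 \<nu>" using L2.diff_in[of v \<nu> u] L2.minus_in[OF dL] v(1) uL by blast+
    have "AE x in \<nu>. v x - u x = - ?d x" using w(2) by eventually_elim simp
    then show ?thesis by (intro L2_inner_cong_AE L2_meas 1)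
  qed
  also have "\<dots> = I\<nu> ?d ?d" using L2.minus_left[OF dL L2.minus_in[OF dL]] L2.minus_right[OF dL dL] by simp
  finally have vu: "L2_dist2 \<nu> v u < e / 4" using d by simp
  have "L2_dist2 \<nu> f u \<le> 2 * L2_dist2 \<nu> f v + 2 * L2_dist2 \<nu> v u"
    unfolding L2_dist2_form_dist2 using v(1) by (intro L2.dist2_triangle f uL) auto
  also have "\<dots> < e" using v(2) vu by simp
  finally show "\<exists>g\<in>fst ` A. L2_dist2 \<nu> f g < e" using u(2) by (force intro: bexI[of _ u] image_eqI[of _ fst])
qed

text \<open>For (v, g) in the adjoint, solve the equation shifted by \<open>C + 1\<close> with
  right-hand side \<open>g + (C + 1) * v\<close>. The solution \<open>u\<close> differs from
  \<open>v\<close> by something orthogonal to the range of the shifted operator, which is all of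
  L2.\<close>

lemma A_adjoint: "A = adjoint_graph \<nu> A"
proof (intro equalityI subsetI)
  fix p assume p: "p \<in> A"
  then obtain v g where vg: "p = (v, g)" "(v, g) \<in> A" by (cases p) auto
  then show "p \<in> adjoint_graph \<nu> A"
    unfolding adjoint_graph_def using A_L2 A_symmetric[OF _ vg(2)] by auto
next
  fix p assume p: "p \<in> adjoint_graph \<nu> A"
  then obtain v g where pv: "p = (v, g)" and v: "v \<in> L2 \<nu>" and g: "g \<in> L2 \<nu>"
    unfolding adjoint_graph_def by auto
  have adj: "I\<nu> f v = I\<nu> u g" if "(u, f) \<in> A" for u f
    using p that unfolding adjoint_graph_def pv by auto
  let ?L = "C + 1"
  have hL: "(\<lambda>x. g x + ?L * v x) \<in> L2 \<nu>" using g v by (intro L2.add_in L2.scale_in)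
  obtain u where u: "u \<in> W" "(u, \<lambda>x. (g x + ?L * v x) - ?L * u x) \<in> A"
    using resolvent_A[OF _ hL, of ?L] by auto
  have uL: "u \<in> L2 \<nu>" using u(1) by blast
  let ?f = "\<lambda>x. (g x + ?L * v x) - ?L * u x"
  have fL: "?f \<in> L2 \<nu>" using u(2) A_L2 by auto
  have dL: "(\<lambda>x. v x - u x) \<in> L2 \<nu>" using v uL by (rule L2.diff_in)
  have "I\<nu> (\<lambda>x. v x - u x) h = 0" if h: "h \<in> L2 \<nu>" for h
  proof -
    obtain w where w: "w \<in> W" "(w, \<lambda>x. h x - ?L * w x) \<in> A" using resolvent_A[OF _ h, of ?L] by auto
    have wL: "w \<in> L2 \<nu>" using w(1) by blast
    have hw: "I\<nu> (\<lambda>x. h x - ?L * w x) z = I\<nu> h z - ?L * I\<nu> w z" if "z \<in> L2 \<nu>" for z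
      using L2.diff_left[OF h L2.scale_in[OF wL] that, of ?L] L2.scale_left[OF wL that, of ?L] by simp
    have "I\<nu> h v - ?L * I\<nu> w v = I\<nu> w g" using adj[OF w(2)] hw[OF v] by simp
    moreover have "I\<nu> h u - ?L * I\<nu> w u = I\<nu> w ?f" using A_symmetric[OF w(2) u(2)] hw[OF uL] by simp
    moreover have "I\<nu> w ?f = I\<nu> w g + ?L * I\<nu> w v - ?L * I\<nu> w u"
      using L2.diff_right[OF hL L2.scale_in[OF uL] wL, of ?L] L2.add_right[OF g L2.scale_in[OF v] wL, of ?L]
        L2.scale_right[OF v wL, of ?L] L2.scale_right[OF uL wL, of ?L] by simp
    ultimately have "I\<nu> h v = I\<nu> h u" by simp
    then show ?thesis using L2.diff_right[OF v uL h] L2.sym[OF dL h] by simp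
  qed
  from this[OF dL] have "AE x in \<nu>. v x - u x = 0" by (intro L2_null[OF dL]) simp
  then have ae: "AE x in \<nu>. u x = v x" by eventually_elim simp
  then have "AE x in \<nu>. ?f x = g x" by eventually_elim simp
  from A_AE_eq[OF u(2) v ae g this] show "p \<in> A" unfolding pv .
qed

theorem A_self_adjoint: "lower_semibounded \<nu> A \<and> self_adjoint \<nu> A"
proof
  show "lower_semibounded \<nu> A"
    unfolding lower_semibounded_def
  proof (intro exI[of _ "- C"] ballI, clarify)
    fix \<phi> f assume "(\<phi>, f) \<in> A"
    then obtain u where u: "\<phi> \<in> L2 \<nu>" "f \<in> L2 \<nu>" "u \<in> W" "AE x in \<nu>. u x = \<phi> x" "\<And>w. w \<in> V \<Longrightarrow> a u w = I\<nu> f w"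
      unfolding A_iff by blast
    have uL: "u \<in> L2 \<nu>" using u(3) by blast
    have "I\<nu> \<phi> \<phi> = I\<nu> u u" by (rule L2_inner_cong_AE) (use u(1,4) uL L2_meas in \<open>auto elim: eventually_mono\<close>)
    moreover have "I\<nu> f \<phi> = I\<nu> f u" by (rule L2_inner_cong_AE) (use u(1,2,4) uL L2_meas in \<open>auto elim: eventually_mono\<close>)
    moreover have "I\<nu> f u = a u u" using u(5)[OF W_V[OF u(3)]] by simp
    moreover have "0 \<le> (1 - \<delta>) * a_plus u u" using \<delta> Pp.nonneg[of u] u(3) H_P by auto
    ultimately show "- C * I\<nu> \<phi> \<phi> \<le> I\<nu> f \<phi>" using a_lower[OF u(3)] by simp
  qed
  have "L2_operator \<nu> A"
    unfolding L2_operator_def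
  proof (intro conjI A_L2 A_zero)
    show "\<forall>(u, f)\<in>A. \<forall>(v, g)\<in>A. \<forall>a b. (\<lambda>x. a * u x + b * v x, \<lambda>x. a * f x + b * g x) \<in> A"
      by clarify (rule A_lin)
    show "\<forall>(u, f)\<in>A. \<forall>(v, g)\<in>A. (AE x in \<nu>. u x = v x) \<longrightarrow> (AE x in \<nu>. f x = g x)"
      unfolding case_prod_beta
    proof (intro ballI impI)
      fix p q assume "p \<in> A" "q \<in> A" "AE x in \<nu>. fst p x = fst q x"
      then show "AE x in \<nu>. snd p x = snd q x"
        using A_single_valued[of "fst p" "snd p" "fst q" "snd q"] by simp
    qed
  qed
  then show "self_adjoint \<nu> A"
    unfolding self_adjoint_def using A_dense A_adjoint by blast
qed

end
end

theorem theorem3p4: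
  fixes m \<mu> \<kappa>p \<kappa>m :: "'a::{metric_space, second_countable_topology} measure"
    and \<E> :: "('a \<Rightarrow> real) \<Rightarrow> ('a \<Rightarrow> real) \<Rightarrow> real"
    and \<F> :: "('a \<Rightarrow> real) set"
    and F :: "'a set"
  assumes "locally compact (UNIV :: 'a set)"
    and "radon_measure m" and "full_support m"
    and "dirichlet_form m \<E> \<F>" and "regular_form m \<E> \<F>" and "irreducible_form m \<E> \<F>"
    and "radon_measure \<mu>" and "emeasure \<mu> UNIV \<noteq> 0" and "charges_no_polar m \<E> \<F> \<mu>"
    and "is_qsupp m \<E> \<F> \<mu> F"
    and "smooth_measure m \<E> \<F> \<kappa>p" and "smooth_measure m \<E> \<F> \<kappa>m"
    and "mutually_singular \<kappa>p \<kappa>m" and "emeasure \<kappa>m UNIV \<noteq> 0"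
    and "unique_decomposition m \<E> \<F> \<kappa>p \<kappa>m F"
    and "form_bounded_on_trace m \<E> \<F> \<kappa>p \<kappa>m \<mu> F"
  shows "lower_semibounded (measure_on \<mu> F) (DN_operator m \<E> \<F> \<kappa>p \<kappa>m \<mu> F) \<and>
         self_adjoint (measure_on \<mu> F) (DN_operator m \<E> \<F> \<kappa>p \<kappa>m \<mu> F)"
proof -
  have "sigma_finite_measure m" by (rule radon_sigma_finite) fact+
  moreover have "space m = UNIV"
    using \<open>radon_measure m\<close> sets_eq_imp_space_eq[of m borel] by (simp add: radon_measure_def)
  moreover have "- F \<in> null_sets (completion \<mu>)" using \<open>is_qsupp m \<E> \<F> \<mu> F\<close> by (simp add: is_qsupp_def)
  ultimately interpret perturbed_dirichlet m \<E> \<F> \<kappa>p \<kappa>m \<mu> F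
    using assms by (simp add: perturbed_dirichlet_def perturbed_dirichlet_axioms_def regular_dirichlet_def
        regular_dirichlet_axioms_def dirichlet_def)
  obtain \<delta> C :: real where "0 < \<delta>" "\<delta> < 1" "0 < C" "\<And>u. u \<in> H \<Longrightarrow>
      (\<integral>\<^sup>+x. ennreal ((u x)\<^sup>2) \<partial>completion \<kappa>m)
        \<le> ennreal (\<delta> * a_plus u u) + ennreal C * (\<integral>\<^sup>+x. ennreal ((u x)\<^sup>2) \<partial>\<nu>)"
    using \<open>form_bounded_on_trace m \<E> \<F> \<kappa>p \<kappa>m \<mu> F\<close> unfolding form_bounded_on_trace_def by blast
  from A_self_adjoint[OF \<open>unique_decomposition m \<E> \<F> \<kappa>p \<kappa>m F\<close> this] show ?thesis
    unfolding A_def .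
qed


end
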